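(* Let $\mathcal{C}$ be a category of Brauer type with parity sign $\epsilon$ whose parameters satisfy $f=f'=0$, $\lambda'=\lambda$ and $\varsigma\neq0$. Then $e^2=\epsilon$ and $$\lambda'=\lambda,\ a=\lambda^2,\ b=0,\ c=0,\ \varsigma'=\epsilon\varsigma,\ \rho=\epsilon\varsigma e\lambda,\ e'=\epsilon e,\ d=d'=f=f'=0,\ D=E=D'=E'=0,\ F=\epsilon e\lambda^2,\ F'=e\lambda^2 .$$ Conversely, for all $\lambda,\varsigma\in\mathbb{K}\setminus\{0\}$, $\delta\in\mathbb{K}$ and $e\in\mathbb{K}$ with $e^2=\epsilon$ (so $\lambda,\varsigma,\delta$ are independent), the monoidal supercategory presented by the defining relations with these parameter values is a category of Brauer type, denoted $\mathcal{C}^{0,0}_{\lambda,\varsigma}(\epsilon,e,\epsilon e)$.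
   Context: $\mathbb{K}$ is a field of characteristic different from 2; everything is $\mathbb{K}$-linear. A strict monoidal supercategory is a strict monoidal category enriched over $\mathbb{Z}/2$-graded vector spaces, with interchange law $(f\otimes g)\circ(h\otimes k)=(-1)^{|g||h|}(f\circ h)\otimes(g\circ k)$. A category of Brauer type is a strict monoidal supercategory whose objects are generated by one object $\bullet$ ($m\in\mathbb{N}$ denotes $\bullet^{\otimes m}$, $1_m$ its identity, $I=1_1$), whose morphisms are generated by an even $H\in\mathrm{Hom}(2,2)$ and $A\in\mathrm{Hom}(2,0)$, $U\in\mathrm{Hom}(0,2)$ which are both even ($\epsilon=1$) or both odd ($\epsilon=-1$), such that $H$ is an isomorphism satisfying the braid relation $(H\otimes I)(I\otimes H)(H\otimes I)=(I\otimes H)(H\otimes I)(I\otimes H)$, and such that for all $m,n$ the standard expressions of $(m,n)$-Brauer diagrams form a basis of $\mathrm{Hom}(m,n)$. Parameters. In a category of Brauer type there are unique scalars with (the defining relations, together with the braid relation): $HU=\lambda U$, $AH=\lambda'A$; $AU=\delta$; $(A\otimes I)(I\otimes U)=\varsigma I$, $(I\otimes A)(U\otimes I)=\varsigma' I$; $(A\otimes I)(I\otimes H)(U\otimes I)=\rho I$; $H^2=a1_2+bH+cUA$; $(H\otimes I)(I\otimes U)=d(U\otimes I)+e(I\otimes H)(U\otimes I)+f(I\otimes U)$; $(H\otimes I)(I\otimes H)(U\otimes I)=D(U\otimes I)+E(I\otimes H)(U\otimes I)+F(I\otimes U)$; $(I\otimes A)(H\otimes I)=d'(A\otimes I)+e'(A\otimes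 I)(I\otimes H)+f'(I\otimes A)$; $(A\otimes I)(I\otimes H)(H\otimes I)=D'(A\otimes I)+E'(A\otimes I)(I\otimes H)+F'(I\otimes A)$. Standard expressions: $s_i^n=1_{i-1}\otimes H\otimes 1_{n-i-1}$, $u_i^n=1_{i-1}\otimes U\otimes 1_{n-i+1}$, $\mathsf{a}_i^n=1_{i-1}\otimes A\otimes 1_{n-i+1}$; for $p\ge1$, $s\ge0$, $p+s\le n+1$ put $I_s^{n,p}=s_{p+s}^{n+2}\cdots s_{p+1}^{n+2}u_p^n$ and $J_s^{n,p}=\mathsf{a}_p^ns_{p+1}^{n+2}\cdots s_{p+s}^{n+2}$. For $n-r=2k\ge0$, $I(r,n)$ is the set of products $I_{s_1}^{n-2,p_1}\cdots I_{s_k}^{r,p_k}$ with $p_1>\dots>p_k$, $J(n,r)$ the set of products $J_{s_1}^{r,p_1}\cdots J_{s_k}^{n-2,p_k}$ with $p_1<\dots<p_k$, and $H(r)$ a fixed set of words in the $s_i^r$ with exactly one reduced expression for each element of $S_r$, none containing a consecutive subword $s_is_{i+1}s_i$. The standard expressions are the products $UXA$ with $U\in I(r,n)$, $X\in H(r)$, $A\in J(m,r)$, $r\ge0$. *)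

theory Defs
  imports
    "Jordan_Normal_Form.VS_Connect"
    "HOL-Library.Z2"
    "HOL-Combinatorics.Permutations"
begin

section \<open>Strict monoidal supercategories with object monoid the natural numbers\<close>

text \<open>
  The objects are the tensor powers of a single object, and the power with exponent \<open>m\<close> is
  written \<open>m\<close>, so that the tensor product of objects is addition and the unit object is \<open>0\<close>.
  Vector spaces are those of the locale \<open>vectorspace\<close>, over the field \<open>class_ring\<close> attached to
  the type \<open>'k\<close>; the fields \<open>mult\<close> and \<open>one\<close> of the records \<open>Hom C m n\<close> are never used.
  \<open>Hdeg C p m n\<close> is the homogeneous part of degree \<open>p\<close> of \<open>Hom C m n\<close>, and \<open>g \<cdot> f\<close> means
  "first \<open>f\<close>, then \<open>g\<close>".
\<close>

record ('k, 'f) supercat =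
  Hom :: "nat \<Rightarrow> nat \<Rightarrow> ('k, 'f) module"
  Hdeg :: "bit \<Rightarrow> nat \<Rightarrow> nat \<Rightarrow> 'f set"
  idm :: "nat \<Rightarrow> 'f"
  cmp :: "'f \<Rightarrow> 'f \<Rightarrow> 'f"  (infixl \<open>\<cdot>\<index>\<close> 70)
  tns :: "'f \<Rightarrow> 'f \<Rightarrow> 'f"  (infixl \<open>\<boxtimes>\<index>\<close> 75)

abbreviation linear_maps ::
    "('k::field, 'f) module \<Rightarrow> ('k, 'f) module \<Rightarrow> ('f \<Rightarrow> 'f) set" where
  "linear_maps V W \<equiv> LinearCombinations.module_hom (class_ring :: 'k ring) V W"

definition koszul_sign :: "bit \<Rightarrow> bit \<Rightarrow> 'k::ring_1" where
  "koszul_sign p q = (if p = 1 \<and> q = 1 then - 1 else 1)"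

locale strict_monoidal_supercategory =
  fixes C :: "('k::field, 'f) supercat" (structure)
  assumes hom_space: "vectorspace (class_ring :: 'k ring) (Hom C m n)"
    and hom_disjoint: "(m, n) \<noteq> (m', n') \<Longrightarrow> carrier (Hom C m n) \<inter> carrier (Hom C m' n') = {}"
    and deg_subspace: "VectorSpace.subspace (class_ring :: 'k ring) (Hdeg C p m n) (Hom C m n)"
    and deg_decomp: "f \<in> carrier (Hom C m n) \<Longrightarrow>
      \<exists>!x. fst x \<in> Hdeg C 0 m n \<and> snd x \<in> Hdeg C 1 m n \<and> f = fst x \<oplus>\<^bsub>Hom C m n\<^esub> snd x"
    and id_even: "idm C m \<in> Hdeg C 0 m m"
    and comp_deg: "\<lbrakk>g \<in> Hdeg C q n l; f \<in> Hdeg C p m n\<rbrakk> \<Longrightarrow> g \<cdot> f \<in> Hdeg C (q + p) m l"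
    and comp_linear_left: "f \<in> carrier (Hom C m n) \<Longrightarrow>
      (\<lambda>g. g \<cdot> f) \<in> linear_maps (Hom C n l) (Hom C m l)"
    and comp_linear_right: "g \<in> carrier (Hom C n l) \<Longrightarrow>
      (\<lambda>f. g \<cdot> f) \<in> linear_maps (Hom C m n) (Hom C m l)"
    and comp_assoc: "\<lbrakk>h \<in> carrier (Hom C l j); g \<in> carrier (Hom C n l); f \<in> carrier (Hom C m n)\<rbrakk>
      \<Longrightarrow> (h \<cdot> g) \<cdot> f = h \<cdot> (g \<cdot> f)"
    and comp_id_left: "f \<in> carrier (Hom C m n) \<Longrightarrow> idm C n \<cdot> f = f"
    and comp_id_right: "f \<in> carrier (Hom C m n) \<Longrightarrow> f \<cdot> idm C m = f"
    and tens_deg: "\<lbrakk>f \<in> Hdeg C p m n; g \<in> Hdeg C q m' n'\<rbrakk>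
      \<Longrightarrow> f \<boxtimes> g \<in> Hdeg C (p + q) (m + m') (n + n')"
    and tens_linear_left: "g \<in> carrier (Hom C m' n') \<Longrightarrow>
      (\<lambda>f. f \<boxtimes> g) \<in> linear_maps (Hom C m n) (Hom C (m + m') (n + n'))"
    and tens_linear_right: "f \<in> carrier (Hom C m n) \<Longrightarrow>
      (\<lambda>g. f \<boxtimes> g) \<in> linear_maps (Hom C m' n') (Hom C (m + m') (n + n'))"
    and tens_assoc: "\<lbrakk>f \<in> carrier (Hom C m n); g \<in> carrier (Hom C m' n');
      h \<in> carrier (Hom C m'' n'')\<rbrakk> \<Longrightarrow> (f \<boxtimes> g) \<boxtimes> h = f \<boxtimes> (g \<boxtimes> h)"
    and tens_unit_left: "f \<in> carrier (Hom C m n) \<Longrightarrow> idm C 0 \<boxtimes> f = f"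
    and tens_unit_right: "f \<in> carrier (Hom C m n) \<Longrightarrow> f \<boxtimes> idm C 0 = f"
    and tens_id: "idm C m \<boxtimes> idm C n = idm C (m + n)"
    and interchange: "\<lbrakk>f \<in> carrier (Hom C n l); g \<in> Hdeg C q n' l';
      h \<in> Hdeg C p m n; k \<in> carrier (Hom C m' n')\<rbrakk> \<Longrightarrow>
      (f \<boxtimes> g) \<cdot> (h \<boxtimes> k) =
        koszul_sign q p \<odot>\<^bsub>Hom C (m + m') (l + l')\<^esub> ((f \<cdot> h) \<boxtimes> (g \<cdot> k))"

section \<open>Formal expressions in the generators\<close>

datatype 'k expr =
    EH | EA | EU
  | EId nat
  | ECmp "'k expr" "'k expr"  (infixl \<open>\<^bold>\<cdot>\<close> 70)
  | ETns "'k expr" "'k expr"  (infixl \<open>\<^bold>\<otimes>\<close> 75)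
  | EZero nat nat
  | ESum "'k expr" "'k expr"  (infixl \<open>\<^bold>+\<close> 65)
  | EScl 'k "'k expr"  (infixr \<open>\<^bold>*\<close> 68)

primrec edom :: "'k expr \<Rightarrow> nat" where
  "edom EH = 2"
| "edom EA = 2"
| "edom EU = 0"
| "edom (EId n) = n"
| "edom (t \<^bold>\<cdot> u) = edom u"
| "edom (t \<^bold>\<otimes> u) = edom t + edom u"
| "edom (EZero m n) = m"
| "edom (t \<^bold>+ u) = edom t"
| "edom (c \<^bold>* t) = edom t"

primrec ecod :: "'k expr \<Rightarrow> nat" where
  "ecod EH = 2"
| "ecod EA = 0"
| "ecod EU = 2"
| "ecod (EId n) = n"
| "ecod (t \<^bold>\<cdot> u) = ecod t"
| "ecod (t \<^bold>\<otimes> u) = ecod t + ecod u"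
| "ecod (EZero m n) = n"
| "ecod (t \<^bold>+ u) = ecod t"
| "ecod (c \<^bold>* t) = ecod t"

definition parallel :: "'k expr \<Rightarrow> 'k expr \<Rightarrow> bool" where
  "parallel t u \<longleftrightarrow> edom t = edom u \<and> ecod t = ecod u"

primrec well_typed :: "'k expr \<Rightarrow> bool" where
  "well_typed EH = True"
| "well_typed EA = True"
| "well_typed EU = True"
| "well_typed (EId n) = True"
| "well_typed (t \<^bold>\<cdot> u) = (well_typed t \<and> well_typed u \<and> edom t = ecod u)"
| "well_typed (t \<^bold>\<otimes> u) = (well_typed t \<and> well_typed u)"
| "well_typed (EZero m n) = True"
| "well_typed (t \<^bold>+ u) = (well_typed t \<and> well_typed u \<and> parallel t u)"
| "well_typed (c \<^bold>* t) = well_typed t"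

text \<open>\<open>homogeneous \<pi> t p\<close>: \<open>t\<close> has degree \<open>p\<close> when \<open>A\<close> and \<open>U\<close> are given the degree \<open>\<pi>\<close>.\<close>

inductive homogeneous :: "bit \<Rightarrow> 'k expr \<Rightarrow> bit \<Rightarrow> bool" for \<pi> :: bit where
  "homogeneous \<pi> EH 0"
| "homogeneous \<pi> EA \<pi>"
| "homogeneous \<pi> EU \<pi>"
| "homogeneous \<pi> (EId n) 0"
| "\<lbrakk>homogeneous \<pi> t p; homogeneous \<pi> u q\<rbrakk> \<Longrightarrow> homogeneous \<pi> (t \<^bold>\<cdot> u) (p + q)"
| "\<lbrakk>homogeneous \<pi> t p; homogeneous \<pi> u q\<rbrakk> \<Longrightarrow> homogeneous \<pi> (t \<^bold>\<otimes> u) (p + q)"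
| "homogeneous \<pi> (EZero m n) p"
| "\<lbrakk>homogeneous \<pi> t p; homogeneous \<pi> u p\<rbrakk> \<Longrightarrow> homogeneous \<pi> (t \<^bold>+ u) p"
| "homogeneous \<pi> t p \<Longrightarrow> homogeneous \<pi> (c \<^bold>* t) p"

primrec interp :: "('k, 'f) supercat \<Rightarrow> 'f \<Rightarrow> 'f \<Rightarrow> 'f \<Rightarrow> 'k expr \<Rightarrow> 'f" where
  "interp C H A U EH = H"
| "interp C H A U EA = A"
| "interp C H A U EU = U"
| "interp C H A U (EId n) = idm C n"
| "interp C H A U (t \<^bold>\<cdot> u) = interp C H A U t \<cdot>\<^bsub>C\<^esub> interp C H A U u"
| "interp C H A U (t \<^bold>\<otimes> u) = interp C H A U t \<boxtimes>\<^bsub>C\<^esub> interp C H A U u"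
| "interp C H A U (EZero m n) = \<zero>\<^bsub>Hom C m n\<^esub>"
| "interp C H A U (t \<^bold>+ u) =
     interp C H A U t \<oplus>\<^bsub>Hom C (edom t) (ecod t)\<^esub> interp C H A U u"
| "interp C H A U (c \<^bold>* t) = c \<odot>\<^bsub>Hom C (edom t) (ecod t)\<^esub> interp C H A U t"

definition satisfies ::
    "('k, 'f) supercat \<Rightarrow> 'f \<Rightarrow> 'f \<Rightarrow> 'f \<Rightarrow> ('k expr \<times> 'k expr) set \<Rightarrow> bool" where
  "satisfies C H A U R \<longleftrightarrow> (\<forall>(t, u) \<in> R. interp C H A U t = interp C H A U u)"

section \<open>The strict monoidal supercategory presented by generators and relations\<close>

text \<open>
  The least congruence on well-typed expressions that contains the relations \<open>R\<close> and validates
  the axioms of a strict monoidal supercategory.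
\<close>

inductive pres_eq :: "bit \<Rightarrow> ('k::field expr \<times> 'k expr) set \<Rightarrow> 'k expr \<Rightarrow> 'k expr \<Rightarrow> bool"
  for \<pi> :: bit and R :: "('k expr \<times> 'k expr) set"
where
  rel: "\<lbrakk>(t, u) \<in> R; well_typed t; well_typed u; parallel t u\<rbrakk> \<Longrightarrow> pres_eq \<pi> R t u"
| refl: "well_typed t \<Longrightarrow> pres_eq \<pi> R t t"
| sym: "pres_eq \<pi> R t u \<Longrightarrow> pres_eq \<pi> R u t"
| trans: "\<lbrakk>pres_eq \<pi> R t u; pres_eq \<pi> R u v\<rbrakk> \<Longrightarrow> pres_eq \<pi> R t v"
| cong_comp: "\<lbrakk>pres_eq \<pi> R t t'; pres_eq \<pi> R u u'; edom t = ecod u\<rbrakk>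
    \<Longrightarrow> pres_eq \<pi> R (t \<^bold>\<cdot> u) (t' \<^bold>\<cdot> u')"
| cong_tens: "\<lbrakk>pres_eq \<pi> R t t'; pres_eq \<pi> R u u'\<rbrakk>
    \<Longrightarrow> pres_eq \<pi> R (t \<^bold>\<otimes> u) (t' \<^bold>\<otimes> u')"
| cong_sum: "\<lbrakk>pres_eq \<pi> R t t'; pres_eq \<pi> R u u'; parallel t u\<rbrakk>
    \<Longrightarrow> pres_eq \<pi> R (t \<^bold>+ u) (t' \<^bold>+ u')"
| cong_scale: "pres_eq \<pi> R t t' \<Longrightarrow> pres_eq \<pi> R (c \<^bold>* t) (c \<^bold>* t')"
| sum_assoc: "well_typed (t \<^bold>+ u \<^bold>+ v) \<Longrightarrow>
    pres_eq \<pi> R (t \<^bold>+ u \<^bold>+ v) (t \<^bold>+ (u \<^bold>+ v))"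
| sum_comm: "well_typed (t \<^bold>+ u) \<Longrightarrow> pres_eq \<pi> R (t \<^bold>+ u) (u \<^bold>+ t)"
| sum_zero: "well_typed t \<Longrightarrow> pres_eq \<pi> R (t \<^bold>+ EZero (edom t) (ecod t)) t"
| sum_neg: "well_typed t \<Longrightarrow>
    pres_eq \<pi> R (t \<^bold>+ (- 1) \<^bold>* t) (EZero (edom t) (ecod t))"
| scale_sum: "well_typed (t \<^bold>+ u) \<Longrightarrow>
    pres_eq \<pi> R (c \<^bold>* (t \<^bold>+ u)) (c \<^bold>* t \<^bold>+ c \<^bold>* u)"
| scale_add: "well_typed t \<Longrightarrow> pres_eq \<pi> R ((c + d) \<^bold>* t) (c \<^bold>* t \<^bold>+ d \<^bold>* t)"
| scale_scale: "well_typed t \<Longrightarrow> pres_eq \<pi> R ((c * d) \<^bold>* t) (c \<^bold>* d \<^bold>* t)"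
| scale_one: "well_typed t \<Longrightarrow> pres_eq \<pi> R (1 \<^bold>* t) t"
| comp_sum_left: "well_typed ((t \<^bold>+ u) \<^bold>\<cdot> v) \<Longrightarrow>
    pres_eq \<pi> R ((t \<^bold>+ u) \<^bold>\<cdot> v) (t \<^bold>\<cdot> v \<^bold>+ u \<^bold>\<cdot> v)"
| comp_sum_right: "well_typed (t \<^bold>\<cdot> (u \<^bold>+ v)) \<Longrightarrow>
    pres_eq \<pi> R (t \<^bold>\<cdot> (u \<^bold>+ v)) (t \<^bold>\<cdot> u \<^bold>+ t \<^bold>\<cdot> v)"
| comp_scale_left: "well_typed (t \<^bold>\<cdot> u) \<Longrightarrow>
    pres_eq \<pi> R ((c \<^bold>* t) \<^bold>\<cdot> u) (c \<^bold>* (t \<^bold>\<cdot> u))"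
| comp_scale_right: "well_typed (t \<^bold>\<cdot> u) \<Longrightarrow>
    pres_eq \<pi> R (t \<^bold>\<cdot> (c \<^bold>* u)) (c \<^bold>* (t \<^bold>\<cdot> u))"
| comp_assoc: "well_typed (t \<^bold>\<cdot> u \<^bold>\<cdot> v) \<Longrightarrow>
    pres_eq \<pi> R (t \<^bold>\<cdot> u \<^bold>\<cdot> v) (t \<^bold>\<cdot> (u \<^bold>\<cdot> v))"
| comp_id_left: "well_typed t \<Longrightarrow> pres_eq \<pi> R (EId (ecod t) \<^bold>\<cdot> t) t"
| comp_id_right: "well_typed t \<Longrightarrow> pres_eq \<pi> R (t \<^bold>\<cdot> EId (edom t)) t"
| tens_sum_left: "\<lbrakk>well_typed (t \<^bold>+ u); well_typed v\<rbrakk> \<Longrightarrow>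
    pres_eq \<pi> R ((t \<^bold>+ u) \<^bold>\<otimes> v) (t \<^bold>\<otimes> v \<^bold>+ u \<^bold>\<otimes> v)"
| tens_sum_right: "\<lbrakk>well_typed t; well_typed (u \<^bold>+ v)\<rbrakk> \<Longrightarrow>
    pres_eq \<pi> R (t \<^bold>\<otimes> (u \<^bold>+ v)) (t \<^bold>\<otimes> u \<^bold>+ t \<^bold>\<otimes> v)"
| tens_scale_left: "\<lbrakk>well_typed t; well_typed u\<rbrakk> \<Longrightarrow>
    pres_eq \<pi> R ((c \<^bold>* t) \<^bold>\<otimes> u) (c \<^bold>* (t \<^bold>\<otimes> u))"
| tens_scale_right: "\<lbrakk>well_typed t; well_typed u\<rbrakk> \<Longrightarrow>
    pres_eq \<pi> R (t \<^bold>\<otimes> (c \<^bold>* u)) (c \<^bold>* (t \<^bold>\<otimes> u))"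
| tens_assoc: "\<lbrakk>well_typed t; well_typed u; well_typed v\<rbrakk> \<Longrightarrow>
    pres_eq \<pi> R (t \<^bold>\<otimes> u \<^bold>\<otimes> v) (t \<^bold>\<otimes> (u \<^bold>\<otimes> v))"
| tens_unit_left: "well_typed t \<Longrightarrow> pres_eq \<pi> R (EId 0 \<^bold>\<otimes> t) t"
| tens_unit_right: "well_typed t \<Longrightarrow> pres_eq \<pi> R (t \<^bold>\<otimes> EId 0) t"
| tens_id: "pres_eq \<pi> R (EId m \<^bold>\<otimes> EId n) (EId (m + n))"
| interchange: "\<lbrakk>well_typed (t \<^bold>\<cdot> v); well_typed (u \<^bold>\<cdot> w);
      homogeneous \<pi> u q; homogeneous \<pi> v p\<rbrakk> \<Longrightarrow>
    pres_eq \<pi> R ((t \<^bold>\<otimes> u) \<^bold>\<cdot> (v \<^bold>\<otimes> w))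
      (koszul_sign q p \<^bold>* ((t \<^bold>\<cdot> v) \<^bold>\<otimes> (u \<^bold>\<cdot> w)))"

definition pres_class ::
    "bit \<Rightarrow> ('k::field expr \<times> 'k expr) set \<Rightarrow> 'k expr \<Rightarrow> 'k expr set" where
  "pres_class \<pi> R t = {u. pres_eq \<pi> R t u}"

definition presented ::
    "bit \<Rightarrow> ('k::field expr \<times> 'k expr) set \<Rightarrow> ('k, 'k expr set) supercat" where
  "presented \<pi> R = \<lparr>
     Hom = (\<lambda>m n. \<lparr>
       carrier = pres_class \<pi> R ` {t. well_typed t \<and> edom t = m \<and> ecod t = n},
       mult = undefined, one = undefined,
       zero = pres_class \<pi> R (EZero m n),
       add = (\<lambda>X Y. \<Union>t\<in>X. \<Union>u\<in>Y. pres_class \<pi> R (t \<^bold>+ u)),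
       smult = (\<lambda>c X. \<Union>t\<in>X. pres_class \<pi> R (c \<^bold>* t))\<rparr>),
     Hdeg = (\<lambda>p m n. pres_class \<pi> R `
       {t. well_typed t \<and> edom t = m \<and> ecod t = n \<and> homogeneous \<pi> t p}),
     idm = (\<lambda>n. pres_class \<pi> R (EId n)),
     cmp = (\<lambda>X Y. \<Union>t\<in>X. \<Union>u\<in>Y. pres_class \<pi> R (t \<^bold>\<cdot> u)),
     tns = (\<lambda>X Y. \<Union>t\<in>X. \<Union>u\<in>Y. pres_class \<pi> R (t \<^bold>\<otimes> u))\<rparr>"

section \<open>Standard expressions of Brauer diagrams\<close>

definition gen_s :: "('k, 'f) supercat \<Rightarrow> 'f \<Rightarrow> nat \<Rightarrow> nat \<Rightarrow> 'f" where
  "gen_s C H n i = idm C (i - 1) \<boxtimes>\<^bsub>C\<^esub> H \<boxtimes>\<^bsub>C\<^esub> idm C (n - i - 1)"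

definition gen_u :: "('k, 'f) supercat \<Rightarrow> 'f \<Rightarrow> nat \<Rightarrow> nat \<Rightarrow> 'f" where
  "gen_u C U n i = idm C (i - 1) \<boxtimes>\<^bsub>C\<^esub> U \<boxtimes>\<^bsub>C\<^esub> idm C (n + 1 - i)"

definition gen_a :: "('k, 'f) supercat \<Rightarrow> 'f \<Rightarrow> nat \<Rightarrow> nat \<Rightarrow> 'f" where
  "gen_a C A n i = idm C (i - 1) \<boxtimes>\<^bsub>C\<^esub> A \<boxtimes>\<^bsub>C\<^esub> idm C (n + 1 - i)"

text \<open>\<open>cup_I C H U n p s\<close> is $I_s^{n,p} : n \to n+2$ and \<open>cap_J C H A n p s\<close> is
  $J_s^{n,p} : n+2 \to n$.\<close>

primrec cup_I :: "('k, 'f) supercat \<Rightarrow> 'f \<Rightarrow> 'f \<Rightarrow> nat \<Rightarrow> nat \<Rightarrow> nat \<Rightarrow> 'f" where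
  "cup_I C H U n p 0 = gen_u C U n p"
| "cup_I C H U n p (Suc s) = gen_s C H (n + 2) (p + Suc s) \<cdot>\<^bsub>C\<^esub> cup_I C H U n p s"

primrec cap_J :: "('k, 'f) supercat \<Rightarrow> 'f \<Rightarrow> 'f \<Rightarrow> nat \<Rightarrow> nat \<Rightarrow> nat \<Rightarrow> 'f" where
  "cap_J C H A n p 0 = gen_a C A n p"
| "cap_J C H A n p (Suc s) = cap_J C H A n p s \<cdot>\<^bsub>C\<^esub> gen_s C H (n + 2) (p + Suc s)"

text \<open>
  The list $[(p_1,s_1),\dots,(p_k,s_k)]$ with $p_1 > \dots > p_k$ encodes both the product
  $I_{s_1}^{n-2,p_1} \cdots I_{s_k}^{r,p_k}$ in $I(r,n)$ and its mirror image
  $J_{s_k}^{r,p_k} \cdots J_{s_1}^{n-2,p_1}$ in $J(n,r)$, where $n = r + 2k$.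
\<close>

fun arc_word :: "nat \<Rightarrow> (nat \<times> nat) list \<Rightarrow> bool" where
  "arc_word r [] = True"
| "arc_word r ((p, s) # xs) =
    (1 \<le> p \<and> p + s \<le> r + 2 * length xs + 1 \<and> (\<forall>(p', s') \<in> set xs. p' < p) \<and> arc_word r xs)"

fun eval_I :: "('k, 'f) supercat \<Rightarrow> 'f \<Rightarrow> 'f \<Rightarrow> nat \<Rightarrow> (nat \<times> nat) list \<Rightarrow> 'f" where
  "eval_I C H U r [] = idm C r"
| "eval_I C H U r ((p, s) # xs) =
    cup_I C H U (r + 2 * length xs) p s \<cdot>\<^bsub>C\<^esub> eval_I C H U r xs"

fun eval_J :: "('k, 'f) supercat \<Rightarrow> 'f \<Rightarrow> 'f \<Rightarrow> nat \<Rightarrow> (nat \<times> nat) list \<Rightarrow> 'f" where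
  "eval_J C H A r [] = idm C r"
| "eval_J C H A r ((p, s) # ys) =
    eval_J C H A r ys \<cdot>\<^bsub>C\<^esub> cap_J C H A (r + 2 * length ys) p s"

primrec eval_H :: "('k, 'f) supercat \<Rightarrow> 'f \<Rightarrow> nat \<Rightarrow> nat list \<Rightarrow> 'f" where
  "eval_H C H r [] = idm C r"
| "eval_H C H r (i # w) = gen_s C H r i \<cdot>\<^bsub>C\<^esub> eval_H C H r w"

primrec word_perm :: "nat list \<Rightarrow> nat \<Rightarrow> nat" where
  "word_perm [] = id"
| "word_perm (i # w) = Transposition.transpose i (i + 1) \<circ> word_perm w"

definition reduced_word :: "nat \<Rightarrow> nat list \<Rightarrow> bool" where
  "reduced_word r w \<longleftrightarrow> set w \<subseteq> {1..<r} \<and>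
     (\<forall>v. set v \<subseteq> {1..<r} \<and> word_perm v = word_perm w \<longrightarrow> length w \<le> length v)"

text \<open>\<open>W r\<close> plays the role of the fixed set $H(r)$; a word \<open>w\<close> lists the indices of its letters $s_i^r$.\<close>

definition word_choice :: "(nat \<Rightarrow> nat list set) \<Rightarrow> bool" where
  "word_choice W \<longleftrightarrow> (\<forall>r.
     (\<forall>w \<in> W r. reduced_word r w \<and> (\<nexists>x y i. w = x @ [i, i + 1, i] @ y)) \<and>
     (\<forall>\<sigma>. \<sigma> permutes {1..r} \<longrightarrow> (\<exists>!w. w \<in> W r \<and> word_perm w = \<sigma>)))"

definition standard_expressions :: "(nat \<Rightarrow> nat list set) \<Rightarrow> nat \<Rightarrow> nat \<Rightarrow>
    (nat \<times> (nat \<times> nat) list \<times> nat list \<times> (nat \<times> nat) list) set" where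
  "standard_expressions W m n = {(r, xs, w, ys).
     arc_word r xs \<and> n = r + 2 * length xs \<and> w \<in> W r \<and> arc_word r ys \<and> m = r + 2 * length ys}"

fun eval_standard :: "('k, 'f) supercat \<Rightarrow> 'f \<Rightarrow> 'f \<Rightarrow> 'f \<Rightarrow>
    nat \<times> (nat \<times> nat) list \<times> nat list \<times> (nat \<times> nat) list \<Rightarrow> 'f" where
  "eval_standard C H A U (r, xs, w, ys) =
     eval_I C H U r xs \<cdot>\<^bsub>C\<^esub> eval_H C H r w \<cdot>\<^bsub>C\<^esub> eval_J C H A r ys"

section \<open>Categories of Brauer type and their parameters\<close>

inductive generated :: "('k, 'f) supercat \<Rightarrow> 'f \<Rightarrow> 'f \<Rightarrow> 'f \<Rightarrow> nat \<Rightarrow> nat \<Rightarrow> 'f \<Rightarrow> bool"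
  for C :: "('k, 'f) supercat" and H A U :: 'f
where
  "generated C H A U 2 2 H"
| "generated C H A U 2 0 A"
| "generated C H A U 0 2 U"
| "generated C H A U n n (idm C n)"
| "\<lbrakk>generated C H A U n l g; generated C H A U m n f\<rbrakk> \<Longrightarrow> generated C H A U m l (g \<cdot>\<^bsub>C\<^esub> f)"
| "\<lbrakk>generated C H A U m n f; generated C H A U m' n' g\<rbrakk>
    \<Longrightarrow> generated C H A U (m + m') (n + n') (f \<boxtimes>\<^bsub>C\<^esub> g)"
| "generated C H A U m n \<zero>\<^bsub>Hom C m n\<^esub>"
| "\<lbrakk>generated C H A U m n f; generated C H A U m n g\<rbrakk>
    \<Longrightarrow> generated C H A U m n (f \<oplus>\<^bsub>Hom C m n\<^esub> g)"
| "generated C H A U m n f \<Longrightarrow> generated C H A U m n (c \<odot>\<^bsub>Hom C m n\<^esub> f)"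

abbreviation EI :: "'k expr" where
  "EI \<equiv> EId 1"

definition braid_relation :: "('k expr \<times> 'k expr) set" where
  "braid_relation =
     {((EH \<^bold>\<otimes> EI) \<^bold>\<cdot> (EI \<^bold>\<otimes> EH) \<^bold>\<cdot> (EH \<^bold>\<otimes> EI),
       (EI \<^bold>\<otimes> EH) \<^bold>\<cdot> (EH \<^bold>\<otimes> EI) \<^bold>\<cdot> (EI \<^bold>\<otimes> EH))}"

definition parity :: "'k::field \<Rightarrow> bit" where
  "parity \<epsilon> = (if \<epsilon> = 1 then 0 else 1)"

definition brauer_type :: "(nat \<Rightarrow> nat list set) \<Rightarrow> 'k::field \<Rightarrow>
    ('k, 'f) supercat \<Rightarrow> 'f \<Rightarrow> 'f \<Rightarrow> 'f \<Rightarrow> bool" where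
  "brauer_type W \<epsilon> C H A U \<longleftrightarrow>
     strict_monoidal_supercategory C \<and>
     (\<epsilon> = 1 \<or> \<epsilon> = - 1) \<and>
     H \<in> Hdeg C 0 2 2 \<and> A \<in> Hdeg C (parity \<epsilon>) 2 0 \<and> U \<in> Hdeg C (parity \<epsilon>) 0 2 \<and>
     (\<forall>m n. \<forall>f \<in> carrier (Hom C m n). generated C H A U m n f) \<and>
     (\<exists>G \<in> carrier (Hom C 2 2). G \<cdot>\<^bsub>C\<^esub> H = idm C 2 \<and> H \<cdot>\<^bsub>C\<^esub> G = idm C 2) \<and>
     satisfies C H A U braid_relation \<and>
     (\<forall>m n. inj_on (eval_standard C H A U) (standard_expressions W m n) \<and>
       vectorspace.basis (class_ring :: 'k ring) (Hom C m n)
         (eval_standard C H A U ` standard_expressions W m n))"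

record 'k params =
  par_lam :: 'k
  par_lam' :: 'k
  par_delta :: 'k
  par_sig :: 'k
  par_sig' :: 'k
  par_rho :: 'k
  par_a :: 'k
  par_b :: 'k
  par_c :: 'k
  par_d :: 'k
  par_e :: 'k
  par_f :: 'k
  par_D :: 'k
  par_E :: 'k
  par_F :: 'k
  par_d' :: 'k
  par_e' :: 'k
  par_f' :: 'k
  par_D' :: 'k
  par_E' :: 'k
  par_F' :: 'k

definition parameter_relations :: "'k params \<Rightarrow> ('k expr \<times> 'k expr) set" where
  "parameter_relations P = {
     (EH \<^bold>\<cdot> EU, par_lam P \<^bold>* EU),
     (EA \<^bold>\<cdot> EH, par_lam' P \<^bold>* EA),
     (EA \<^bold>\<cdot> EU, par_delta P \<^bold>* EId 0),
     ((EA \<^bold>\<otimes> EI) \<^bold>\<cdot> (EI \<^bold>\<otimes> EU), par_sig P \<^bold>* EI),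
     ((EI \<^bold>\<otimes> EA) \<^bold>\<cdot> (EU \<^bold>\<otimes> EI), par_sig' P \<^bold>* EI),
     ((EA \<^bold>\<otimes> EI) \<^bold>\<cdot> (EI \<^bold>\<otimes> EH) \<^bold>\<cdot> (EU \<^bold>\<otimes> EI), par_rho P \<^bold>* EI),
     (EH \<^bold>\<cdot> EH, par_a P \<^bold>* EId 2 \<^bold>+ par_b P \<^bold>* EH \<^bold>+ par_c P \<^bold>* (EU \<^bold>\<cdot> EA)),
     ((EH \<^bold>\<otimes> EI) \<^bold>\<cdot> (EI \<^bold>\<otimes> EU),
        par_d P \<^bold>* (EU \<^bold>\<otimes> EI) \<^bold>+ par_e P \<^bold>* ((EI \<^bold>\<otimes> EH) \<^bold>\<cdot> (EU \<^bold>\<otimes> EI))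
          \<^bold>+ par_f P \<^bold>* (EI \<^bold>\<otimes> EU)),
     ((EH \<^bold>\<otimes> EI) \<^bold>\<cdot> (EI \<^bold>\<otimes> EH) \<^bold>\<cdot> (EU \<^bold>\<otimes> EI),
        par_D P \<^bold>* (EU \<^bold>\<otimes> EI) \<^bold>+ par_E P \<^bold>* ((EI \<^bold>\<otimes> EH) \<^bold>\<cdot> (EU \<^bold>\<otimes> EI))
          \<^bold>+ par_F P \<^bold>* (EI \<^bold>\<otimes> EU)),
     ((EI \<^bold>\<otimes> EA) \<^bold>\<cdot> (EH \<^bold>\<otimes> EI),
        par_d' P \<^bold>* (EA \<^bold>\<otimes> EI) \<^bold>+ par_e' P \<^bold>* ((EA \<^bold>\<otimes> EI) \<^bold>\<cdot> (EI \<^bold>\<otimes> EH))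
          \<^bold>+ par_f' P \<^bold>* (EI \<^bold>\<otimes> EA)),
     ((EA \<^bold>\<otimes> EI) \<^bold>\<cdot> (EI \<^bold>\<otimes> EH) \<^bold>\<cdot> (EH \<^bold>\<otimes> EI),
        par_D' P \<^bold>* (EA \<^bold>\<otimes> EI) \<^bold>+ par_E' P \<^bold>* ((EA \<^bold>\<otimes> EI) \<^bold>\<cdot> (EI \<^bold>\<otimes> EH))
          \<^bold>+ par_F' P \<^bold>* (EI \<^bold>\<otimes> EA))}"

definition has_parameters ::
    "('k, 'f) supercat \<Rightarrow> 'f \<Rightarrow> 'f \<Rightarrow> 'f \<Rightarrow> 'k params \<Rightarrow> bool" where
  "has_parameters C H A U P \<longleftrightarrow> satisfies C H A U (parameter_relations P)"

definition defining_relations :: "'k params \<Rightarrow> ('k expr \<times> 'k expr) set" where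
  "defining_relations P = parameter_relations P \<union> braid_relation"

lemma defining_relations_typed:
  "(t, u) \<in> defining_relations P \<Longrightarrow> well_typed t \<and> well_typed u \<and> parallel t u"
  by (auto simp: defining_relations_def parameter_relations_def braid_relation_def parallel_def)

definition params_00 :: "'k::field \<Rightarrow> 'k \<Rightarrow> 'k \<Rightarrow> 'k \<Rightarrow> 'k \<Rightarrow> 'k params" where
  "params_00 \<epsilon> l \<sigma> \<delta> e = \<lparr>
     par_lam = l, par_lam' = l, par_delta = \<delta>,
     par_sig = \<sigma>, par_sig' = \<epsilon> * \<sigma>, par_rho = \<epsilon> * \<sigma> * e * l,
     par_a = l\<^sup>2, par_b = 0, par_c = 0,
     par_d = 0, par_e = e, par_f = 0,
     par_D = 0, par_E = 0, par_F = \<epsilon> * e * l\<^sup>2,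
     par_d' = 0, par_e' = \<epsilon> * e, par_f' = 0,
     par_D' = 0, par_E' = 0, par_F' = e * l\<^sup>2\<rparr>"

end

theory Submission
  imports Defs
begin

text \<open>
  In a category of Brauer type the coordinate functionals of the standard basis turn equalities of
  words into equations between the parameters; evaluating short words in two ways gives the listed
  values.

  Conversely, when \<open>d = f = D = E = b = c = 0\<close> every defining relation rewrites a word to a
  nonzero scalar multiple of a word, apart from closed loops. Such rewriting carries every word to a
  multiple of a standard one, by pushing cups to the left, caps to the right and sorting each of
  them, so the standard expressions span. They are independent because the presented category acts
  on functions on the matchings of the integers: up to the scalars \<open>l\<close>, \<open>e\<close>, \<open>\<epsilon> e\<close> and \<open>\<sigma> \<epsilon> e\<close> the
  generators act by composing with ordinary Brauer diagrams, where a cup or cap at position \<open>a\<close>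
  carries the twist \<open>e\<^sup>a\<close> or \<open>(\<epsilon> e)\<^sup>a\<close>. Since \<open>e\<^sup>2 = \<epsilon>\<close>, these twists produce the signs
  of the interchange law. A standard expression sends the straight matching to a nonzero multiple of
  its own diagram, and the diagram determines the expression: the rightmost left end point of an arc
  on either side belongs to the first factor.
\<close>

section \<open>Calculus in a presented supercategory\<close>

text \<open>Multiplying linear combinations of diagrams directly would require associativity in the
  presence of signs and loops. Acting on scalar functions of one infinite set avoids this:
  nonnegative integers are outgoing points numbered from the left, negative ones are incoming
  points, and the strands to the right of a generator are simply the remaining integers. Only the
  number of strands to the left enters. Moving a generator past a cup or cap changes that number by
  two, hence a twist by \<open>e^2 = \<epsilon>\<close>, which is the sign wanted for two cups or
  caps. Spanning is directed rewriting and not an equivalence of words: the loop value may be zero,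
  and a shortened word may fit on fewer strands than the original. Only the existence of some scalar
  is recorded, so that cups and caps, whose scalars differ, obey one common calculus up to
  reflection. For the parameters, the decisive word is a cap, a crossing and a cup on two strands;
  it yields \<open>e * e' = 1\<close> and \<open>d = d' = 0\<close>. The last alternative, a nonzero
  \<open>b\<close>, would make \<open>H\<close> a scalar.\<close>

locale presentation =
  fixes \<pi> :: bit and R :: "('k::field expr \<times> 'k expr) set"
begin

abbreviation peq (infix "\<simeq>" 50) where "t \<simeq> u \<equiv> pres_eq \<pi> R t u"

declare pres_eq.trans [trans]

lemma peq_typed:
  "t \<simeq> u \<Longrightarrow> well_typed t \<and> well_typed u \<and> edom u = edom t \<and> ecod u = ecod t"
  by (induction rule: pres_eq.induct) (auto simp: parallel_def)

lemma peq_sum_left: "t \<simeq> t' \<Longrightarrow> well_typed (t \<^bold>+ u) \<Longrightarrow> t \<^bold>+ u \<simeq> t' \<^bold>+ u"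
  by (auto intro: pres_eq.cong_sum pres_eq.refl)

lemma peq_sum_right: "u \<simeq> u' \<Longrightarrow> well_typed (t \<^bold>+ u) \<Longrightarrow> t \<^bold>+ u \<simeq> t \<^bold>+ u'"
  by (auto intro: pres_eq.cong_sum pres_eq.refl)

lemma peq_comp_left: "t \<simeq> t' \<Longrightarrow> well_typed (t \<^bold>\<cdot> u) \<Longrightarrow> t \<^bold>\<cdot> u \<simeq> t' \<^bold>\<cdot> u"
  by (auto intro: pres_eq.cong_comp pres_eq.cong_tens pres_eq.refl)

lemma peq_comp_right: "u \<simeq> u' \<Longrightarrow> well_typed (t \<^bold>\<cdot> u) \<Longrightarrow> t \<^bold>\<cdot> u \<simeq> t \<^bold>\<cdot> u'"
  by (auto intro: pres_eq.cong_comp pres_eq.cong_tens pres_eq.refl)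

lemma peq_tens_left: "t \<simeq> t' \<Longrightarrow> well_typed u \<Longrightarrow> t \<^bold>\<otimes> u \<simeq> t' \<^bold>\<otimes> u"
  by (auto intro: pres_eq.cong_comp pres_eq.cong_tens pres_eq.refl)

lemma peq_tens_right: "u \<simeq> u' \<Longrightarrow> well_typed t \<Longrightarrow> t \<^bold>\<otimes> u \<simeq> t \<^bold>\<otimes> u'"
  by (auto intro: pres_eq.cong_comp pres_eq.cong_tens pres_eq.refl)

lemma zero_sum: "well_typed t \<Longrightarrow> edom t = m \<Longrightarrow> ecod t = n \<Longrightarrow> EZero m n \<^bold>+ t \<simeq> t"
  by (rule pres_eq.trans[OF pres_eq.sum_comm]) (auto simp: parallel_def intro: pres_eq.sum_zero)

text \<open>The congruence has no rule for composing, tensoring or scaling \<open>EZero\<close>.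
  Each such law below is obtained by writing the zero as its own double, distributing, and
  cancelling with this lemma.\<close>

lemma idempotent_zero:
  assumes "t \<simeq> t \<^bold>+ t"
  shows "t \<simeq> EZero (edom t) (ecod t)"
proof -
  have t: "well_typed t" using peq_typed[OF assms] by simp
  let ?n = "(- 1) \<^bold>* t" and ?z = "EZero (edom t) (ecod t)"
  have "t \<simeq> t \<^bold>+ ?z" by (intro pres_eq.sym[OF pres_eq.sum_zero] t)
  also have "\<dots> \<simeq> t \<^bold>+ (t \<^bold>+ ?n)"
    by (rule peq_sum_right[OF pres_eq.sym[OF pres_eq.sum_neg]]) (use t in \<open>auto simp: parallel_def\<close>)
  also have "\<dots> \<simeq> t \<^bold>+ t \<^bold>+ ?n"
    by (rule pres_eq.sym[OF pres_eq.sum_assoc]) (use t in \<open>auto simp: parallel_def\<close>)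
  also have "\<dots> \<simeq> t \<^bold>+ ?n"
    by (rule peq_sum_left[OF pres_eq.sym[OF assms]]) (use t in \<open>auto simp: parallel_def\<close>)
  also have "\<dots> \<simeq> ?z" by (rule pres_eq.sum_neg[OF t])
  finally show ?thesis .
qed

lemma zero_zero: "EZero m n \<simeq> EZero m n \<^bold>+ EZero m n"
  using pres_eq.sym[OF pres_eq.sum_zero[of "EZero m n" \<pi> R]] by simp

lemma zero_comp:
  assumes "well_typed u" "ecod u = m"
  shows "EZero m n \<^bold>\<cdot> u \<simeq> EZero (edom u) n"
proof -
  have "EZero m n \<^bold>\<cdot> u \<simeq> (EZero m n \<^bold>+ EZero m n) \<^bold>\<cdot> u"
    by (rule peq_comp_left[OF zero_zero]) (use assms in auto)
  also have "\<dots> \<simeq> EZero m n \<^bold>\<cdot> u \<^bold>+ EZero m n \<^bold>\<cdot> u"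
    by (rule pres_eq.comp_sum_left) (use assms in \<open>auto simp: parallel_def\<close>)
  finally show ?thesis using idempotent_zero by fastforce
qed

lemma comp_zero:
  assumes "well_typed t" "edom t = n"
  shows "t \<^bold>\<cdot> EZero m n \<simeq> EZero m (ecod t)"
proof -
  have "t \<^bold>\<cdot> EZero m n \<simeq> t \<^bold>\<cdot> (EZero m n \<^bold>+ EZero m n)"
    by (rule peq_comp_right[OF zero_zero]) (use assms in auto)
  also have "\<dots> \<simeq> t \<^bold>\<cdot> EZero m n \<^bold>+ t \<^bold>\<cdot> EZero m n"
    by (rule pres_eq.comp_sum_right) (use assms in \<open>auto simp: parallel_def\<close>)
  finally show ?thesis using idempotent_zero by fastforce
qed

lemma zero_tens:
  assumes "well_typed u"
  shows "EZero m n \<^bold>\<otimes> u \<simeq> EZero (m + edom u) (n + ecod u)"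
proof -
  have "EZero m n \<^bold>\<otimes> u \<simeq> (EZero m n \<^bold>+ EZero m n) \<^bold>\<otimes> u"
    by (rule peq_tens_left[OF zero_zero]) (use assms in auto)
  also have "\<dots> \<simeq> EZero m n \<^bold>\<otimes> u \<^bold>+ EZero m n \<^bold>\<otimes> u"
    by (rule pres_eq.tens_sum_left) (use assms in \<open>auto simp: parallel_def\<close>)
  finally show ?thesis using idempotent_zero by fastforce
qed

lemma tens_zero:
  assumes "well_typed t"
  shows "t \<^bold>\<otimes> EZero m n \<simeq> EZero (edom t + m) (ecod t + n)"
proof -
  have "t \<^bold>\<otimes> EZero m n \<simeq> t \<^bold>\<otimes> (EZero m n \<^bold>+ EZero m n)"
    by (rule peq_tens_right[OF zero_zero]) (use assms in auto)
  also have "\<dots> \<simeq> t \<^bold>\<otimes> EZero m n \<^bold>+ t \<^bold>\<otimes> EZero m n"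
    by (rule pres_eq.tens_sum_right) (use assms in \<open>auto simp: parallel_def\<close>)
  finally show ?thesis using idempotent_zero by fastforce
qed

lemma scale_zero: "c \<^bold>* EZero m n \<simeq> EZero m n"
proof -
  have "c \<^bold>* EZero m n \<simeq> c \<^bold>* (EZero m n \<^bold>+ EZero m n)"
    by (rule pres_eq.cong_scale[OF zero_zero])
  also have "\<dots> \<simeq> c \<^bold>* EZero m n \<^bold>+ c \<^bold>* EZero m n"
    by (rule pres_eq.scale_sum) (auto simp: parallel_def)
  finally show ?thesis using idempotent_zero by fastforce
qed

lemma zero_scale: "well_typed t \<Longrightarrow> 0 \<^bold>* t \<simeq> EZero (edom t) (ecod t)"
  using idempotent_zero[of "0 \<^bold>* t"] pres_eq.scale_add[of t \<pi> R 0 0] by simp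

lemma scale_to_zero: "t \<simeq> EZero m n \<Longrightarrow> c \<^bold>* t \<simeq> EZero m n"
  by (rule pres_eq.trans[OF pres_eq.cong_scale scale_zero])

text \<open>A morphism \<open>m \<rightarrow> n\<close> built from the generators has degree \<open>\<pi> (n - m) / 2\<close>, or it vanishes.\<close>

lemma homogeneous_degree:
  assumes "homogeneous \<pi> t p" "well_typed t"
  shows "t \<simeq> EZero (edom t) (ecod t) \<or>
    (\<exists>k::int. int (ecod t) = int (edom t) + 2 * k \<and> p = \<pi> * of_int k)"
  using assms
proof (induction rule: homogeneous.induct)
  case 1
  show ?case by (intro disjI2 exI[of _ 0]) simp
next
  case 2
  show ?case by (intro disjI2 exI[of _ "- 1"]) simp
next
  case 3
  show ?case by (intro disjI2 exI[of _ 1]) simp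
next
  case 4
  show ?case by (intro disjI2 exI[of _ 0]) simp
next
  case (5 t p u q)
  then have ty: "well_typed t" "well_typed u" "edom t = ecod u" by auto
  consider "t \<simeq> EZero (edom t) (ecod t)" | "u \<simeq> EZero (edom u) (ecod u)"
    | k l where "int (ecod t) = int (edom t) + 2 * k" "p = \<pi> * of_int k"
        "int (ecod u) = int (edom u) + 2 * l" "q = \<pi> * of_int l"
    using 5(3)[OF ty(1)] 5(4)[OF ty(2)] by metis
  then show ?case
  proof cases
    case 1
    then have "t \<^bold>\<cdot> u \<simeq> EZero (edom u) (ecod t)"
      using pres_eq.trans[OF peq_comp_left[OF 1] zero_comp] ty by auto
    then show ?thesis by simp
  next
    case 2
    then have "t \<^bold>\<cdot> u \<simeq> EZero (edom u) (ecod t)"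
      using pres_eq.trans[OF peq_comp_right[OF 2] comp_zero] ty by auto
    then show ?thesis by simp
  next
    case 3
    then show ?thesis using ty by (intro disjI2 exI[of _ "k + l"]) (simp add: distrib_left)
  qed
next
  case (6 t p u q)
  then have ty: "well_typed t" "well_typed u" by auto
  consider "t \<simeq> EZero (edom t) (ecod t)" | "u \<simeq> EZero (edom u) (ecod u)"
    | k l where "int (ecod t) = int (edom t) + 2 * k" "p = \<pi> * of_int k"
        "int (ecod u) = int (edom u) + 2 * l" "q = \<pi> * of_int l"
    using 6(3)[OF ty(1)] 6(4)[OF ty(2)] by metis
  then show ?case
  proof cases
    case 1
    then have "t \<^bold>\<otimes> u \<simeq> EZero (edom t + edom u) (ecod t + ecod u)"
      using pres_eq.trans[OF peq_tens_left[OF 1] zero_tens] ty by auto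
    then show ?thesis by simp
  next
    case 2
    then have "t \<^bold>\<otimes> u \<simeq> EZero (edom t + edom u) (ecod t + ecod u)"
      using pres_eq.trans[OF peq_tens_right[OF 2] tens_zero] ty by auto
    then show ?thesis by simp
  next
    case 3
    then show ?thesis using ty by (intro disjI2 exI[of _ "k + l"]) (simp add: distrib_left)
  qed
next
  case (7 m n p)
  then show ?case by (simp add: pres_eq.refl)
next
  case (8 t p u)
  then have ty: "well_typed t" "well_typed u" "edom u = edom t" "ecod u = ecod t"
    by (auto simp: parallel_def)
  show ?case
  proof (cases "t \<simeq> EZero (edom t) (ecod t) \<and> u \<simeq> EZero (edom u) (ecod u)")
    case True
    then have "t \<^bold>+ u \<simeq> EZero (edom t) (ecod t) \<^bold>+ EZero (edom t) (ecod t)"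
      using pres_eq.cong_sum[of \<pi> _ t "EZero (edom t) (ecod t)" u "EZero (edom t) (ecod t)"] ty
      by (simp add: parallel_def)
    then have "t \<^bold>+ u \<simeq> EZero (edom t) (ecod t)"
      by (rule pres_eq.trans[OF _ pres_eq.sym[OF zero_zero]])
    then show ?thesis by simp
  next
    case False
    then have "\<exists>k. int (ecod t) = int (edom t) + 2 * k \<and> p = \<pi> * of_int k"
      using 8(3)[OF ty(1)] 8(4)[OF ty(2)] unfolding ty by blast
    then show ?thesis by simp
  qed
next
  case (9 t p c)
  then have "well_typed t" by simp
  from 9(2)[OF this] show ?case
    using scale_to_zero[of t "edom t" "ecod t" c] by auto
qed

lemma homogeneous_rep:
  assumes "well_typed t"
  shows "\<exists>t' p. t \<simeq> t' \<and> homogeneous \<pi> t' p"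
  using assms
proof (induction t)
  case (ECmp t u)
  then obtain t' p u' q where "t \<simeq> t'" "homogeneous \<pi> t' p" "u \<simeq> u'" "homogeneous \<pi> u' q"
    by auto
  then show ?case using ECmp.prems
    by (intro exI[of _ "t' \<^bold>\<cdot> u'"] exI[of _ "p + q"] conjI pres_eq.cong_comp homogeneous.intros) auto
next
  case (ETns t u)
  then obtain t' p u' q where "t \<simeq> t'" "homogeneous \<pi> t' p" "u \<simeq> u'" "homogeneous \<pi> u' q"
    by auto
  then show ?case using ETns.prems
    by (intro exI[of _ "t' \<^bold>\<otimes> u'"] exI[of _ "p + q"] conjI pres_eq.cong_tens homogeneous.intros) auto
next
  case (ESum t u)
  then obtain t' p u' q where t': "t \<simeq> t'" "homogeneous \<pi> t' p" and u': "u \<simeq> u'" "homogeneous \<pi> u' q"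
    by auto
  have ty: "well_typed t'" "well_typed u'" "parallel t' u'" "parallel t u"
    using peq_typed[OF t'(1)] peq_typed[OF u'(1)] ESum.prems by (auto simp: parallel_def)
  have sum: "t \<^bold>+ u \<simeq> t' \<^bold>+ u'" using t' u' ty by (auto intro: pres_eq.cong_sum)
  show ?case
  proof (cases "p = q")
    case True
    then show ?thesis using sum t' u' homogeneous.intros(8) by blast
  next
    case False
    have "t' \<simeq> EZero (edom t') (ecod t') \<or> u' \<simeq> EZero (edom u') (ecod u')"
      using homogeneous_degree[OF t'(2) ty(1)] homogeneous_degree[OF u'(2) ty(2)] False ty(3)
      by (auto simp: parallel_def)
    then show ?thesis
    proof
      assume z: "t' \<simeq> EZero (edom t') (ecod t')"
      have "t' \<^bold>+ u' \<simeq> EZero (edom t') (ecod t') \<^bold>+ u'"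
        using peq_sum_left[OF z] ty by simp
      also have "\<dots> \<simeq> u'" using zero_sum ty by (auto simp: parallel_def)
      finally show ?thesis using pres_eq.trans[OF sum] u' by blast
    next
      assume z: "u' \<simeq> EZero (edom u') (ecod u')"
      have "t' \<^bold>+ u' \<simeq> t' \<^bold>+ EZero (edom t') (ecod t')"
        using peq_sum_right[OF z] ty by (simp add: parallel_def)
      also have "\<dots> \<simeq> t'" using pres_eq.sum_zero ty by auto
      finally show ?thesis using pres_eq.trans[OF sum] t' by blast
    qed
  qed
next
  case (EScl c t)
  then obtain t' p where "t \<simeq> t'" "homogeneous \<pi> t' p" by auto
  then show ?case by (intro exI[of _ "c \<^bold>* t'"] exI[of _ p]) (auto intro: pres_eq.cong_scale homogeneous.intros)
qed ((intro exI conjI, rule pres_eq.refl, assumption, rule homogeneous.intros)+)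

lemma scale_one_peq: "t \<simeq> u \<Longrightarrow> c = 1 \<Longrightarrow> t \<simeq> c \<^bold>* u"
  using pres_eq.trans[OF _ pres_eq.sym[OF pres_eq.scale_one[of u \<pi> R]], of t] peq_typed[of t u] by simp

lemma koszul_sign_zero [simp]: "koszul_sign 0 p = 1" "koszul_sign p 0 = 1"
  by (auto simp: koszul_sign_def)

text \<open>The interchange rule asks for both crossing factors to be homogeneous, while here one of
  them is arbitrary. It is replaced by a homogeneous representative; the evenness of the other
  factor makes the sign trivial whatever degree results.\<close>

lemma interchange_even:
  assumes "well_typed (t \<^bold>\<cdot> v)" "well_typed (u \<^bold>\<cdot> w)" "homogeneous \<pi> u 0 \<or> homogeneous \<pi> v 0"
  shows "(t \<^bold>\<otimes> u) \<^bold>\<cdot> (v \<^bold>\<otimes> w) \<simeq> (t \<^bold>\<cdot> v) \<^bold>\<otimes> (u \<^bold>\<cdot> w)"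
proof -
  have wt: "well_typed v" "well_typed u" using assms by auto
  obtain v' p where v': "v \<simeq> v'" "homogeneous \<pi> v' p" "homogeneous \<pi> v 0 \<longrightarrow> p = 0"
    using homogeneous_rep[OF wt(1)] pres_eq.refl[OF wt(1)] by (cases "homogeneous \<pi> v 0") auto
  obtain u' q where u': "u \<simeq> u'" "homogeneous \<pi> u' q" "homogeneous \<pi> u 0 \<longrightarrow> q = 0"
    using homogeneous_rep[OF wt(2)] pres_eq.refl[OF wt(2)] by (cases "homogeneous \<pi> u 0") auto
  have pq: "q = 0 \<or> p = 0" using assms(3) v'(3) u'(3) by auto
  note ty = peq_typed[OF v'(1)] peq_typed[OF u'(1)]
  have "(t \<^bold>\<otimes> u) \<^bold>\<cdot> (v \<^bold>\<otimes> w) \<simeq> (t \<^bold>\<otimes> u') \<^bold>\<cdot> (v' \<^bold>\<otimes> w)"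
    using assms ty v' u' by (auto intro!: pres_eq.cong_comp pres_eq.cong_tens intro: pres_eq.refl)
  also have "\<dots> \<simeq> koszul_sign q p \<^bold>* ((t \<^bold>\<cdot> v') \<^bold>\<otimes> (u' \<^bold>\<cdot> w))"
    using assms ty v' u' by (intro pres_eq.interchange) auto
  also have "koszul_sign q p = (1::'k)" using pq by auto
  also have "1 \<^bold>* ((t \<^bold>\<cdot> v') \<^bold>\<otimes> (u' \<^bold>\<cdot> w)) \<simeq> (t \<^bold>\<cdot> v') \<^bold>\<otimes> (u' \<^bold>\<cdot> w)"
    using assms ty by (intro pres_eq.scale_one) auto
  also have "\<dots> \<simeq> (t \<^bold>\<cdot> v) \<^bold>\<otimes> (u \<^bold>\<cdot> w)"
    using assms ty v' u' by (intro pres_eq.cong_comp pres_eq.cong_tens) (auto intro: pres_eq.refl pres_eq.sym)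
  finally show ?thesis .
qed

lemma tens_as_comp:
  assumes "well_typed t" "well_typed u"
  shows "t \<^bold>\<otimes> u \<simeq> (t \<^bold>\<otimes> EId (ecod u)) \<^bold>\<cdot> (EId (edom t) \<^bold>\<otimes> u)"
proof -
  have "(t \<^bold>\<otimes> EId (ecod u)) \<^bold>\<cdot> (EId (edom t) \<^bold>\<otimes> u) \<simeq> (t \<^bold>\<cdot> EId (edom t)) \<^bold>\<otimes> (EId (ecod u) \<^bold>\<cdot> u)"
    using assms by (intro interchange_even) (auto intro: homogeneous.intros)
  also have "\<dots> \<simeq> t \<^bold>\<otimes> u"
    using assms by (intro pres_eq.cong_tens pres_eq.comp_id_right pres_eq.comp_id_left) auto
  finally show ?thesis by (rule pres_eq.sym)
qed

text \<open>Both composites equal \<open>t \<otimes> u\<close> up to sign. The sign arises only when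
  \<open>u\<close> is applied after \<open>t\<close>, since there \<open>u\<close> and
  \<open>t\<close> are the inner factors of the interchange law; in the other order identities stand
  there.\<close>

lemma far_commute:
  assumes "well_typed t" "well_typed u" "homogeneous \<pi> t p" "homogeneous \<pi> u q"
  shows "(EId (ecod t) \<^bold>\<otimes> u) \<^bold>\<cdot> (t \<^bold>\<otimes> EId (edom u)) \<simeq>
    koszul_sign q p \<^bold>* ((t \<^bold>\<otimes> EId (ecod u)) \<^bold>\<cdot> (EId (edom t) \<^bold>\<otimes> u))"
proof -
  have "(EId (ecod t) \<^bold>\<otimes> u) \<^bold>\<cdot> (t \<^bold>\<otimes> EId (edom u)) \<simeq>
      koszul_sign q p \<^bold>* ((EId (ecod t) \<^bold>\<cdot> t) \<^bold>\<otimes> (u \<^bold>\<cdot> EId (edom u)))"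
    using assms by (intro pres_eq.interchange) auto
  also have "\<dots> \<simeq> koszul_sign q p \<^bold>* (t \<^bold>\<otimes> u)"
    using assms by (intro pres_eq.cong_scale pres_eq.cong_tens pres_eq.comp_id_right pres_eq.comp_id_left) auto
  also have "\<dots> \<simeq> koszul_sign q p \<^bold>* ((t \<^bold>\<otimes> EId (ecod u)) \<^bold>\<cdot> (EId (edom t) \<^bold>\<otimes> u))"
    using assms by (intro pres_eq.cong_scale tens_as_comp) auto
  finally show ?thesis .
qed

section \<open>Whiskering by identities on both sides\<close>

definition pad :: "nat \<Rightarrow> nat \<Rightarrow> 'k expr \<Rightarrow> 'k expr" where
  "pad a b t = EId a \<^bold>\<otimes> t \<^bold>\<otimes> EId b"

lemma pad_typed [simp]:
  "well_typed (pad a b t) = well_typed t" "edom (pad a b t) = a + edom t + b"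
  "ecod (pad a b t) = a + ecod t + b"
  by (auto simp: pad_def)

lemma pad_cong: "t \<simeq> u \<Longrightarrow> pad a b t \<simeq> pad a b u"
  unfolding pad_def using peq_typed by (auto intro!: pres_eq.cong_tens intro: pres_eq.refl)

lemma pad_comp:
  assumes "well_typed (t \<^bold>\<cdot> u)"
  shows "pad a b (t \<^bold>\<cdot> u) \<simeq> pad a b t \<^bold>\<cdot> pad a b u"
proof -
  have "pad a b t \<^bold>\<cdot> pad a b u \<simeq> ((EId a \<^bold>\<otimes> t) \<^bold>\<cdot> (EId a \<^bold>\<otimes> u)) \<^bold>\<otimes> (EId b \<^bold>\<cdot> EId b)"
    unfolding pad_def using assms by (intro interchange_even) (auto intro: homogeneous.intros)
  also have "\<dots> \<simeq> (EId a \<^bold>\<cdot> EId a) \<^bold>\<otimes> (t \<^bold>\<cdot> u) \<^bold>\<otimes> EId b"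
    using assms by (intro pres_eq.cong_tens interchange_even)
      (auto intro: homogeneous.intros pres_eq.comp_id_left[of "EId b" \<pi> R, simplified])
  also have "\<dots> \<simeq> pad a b (t \<^bold>\<cdot> u)"
    unfolding pad_def using assms
    by (intro pres_eq.cong_tens) (auto intro: pres_eq.refl pres_eq.comp_id_left[of "EId a" \<pi> R, simplified])
  finally show ?thesis by (rule pres_eq.sym)
qed

lemma pad_id: "pad a b (EId n) \<simeq> EId (a + n + b)"
  unfolding pad_def
  by (rule pres_eq.trans[OF peq_tens_left[OF pres_eq.tens_id]]) (auto intro: pres_eq.tens_id)

lemma pad_pad:
  assumes "well_typed t"
  shows "pad a b (pad c d t) \<simeq> pad (a + c) (d + b) t"
proof -
  have "pad a b (pad c d t) \<simeq> EId a \<^bold>\<otimes> (EId c \<^bold>\<otimes> t) \<^bold>\<otimes> EId d \<^bold>\<otimes> EId b"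
    unfolding pad_def using assms
    by (intro pres_eq.cong_tens pres_eq.sym[OF pres_eq.tens_assoc]) (auto intro: pres_eq.refl)
  also have "\<dots> \<simeq> (EId a \<^bold>\<otimes> EId c) \<^bold>\<otimes> t \<^bold>\<otimes> EId d \<^bold>\<otimes> EId b"
    using assms
    by (intro pres_eq.cong_tens pres_eq.sym[OF pres_eq.tens_assoc]) (auto intro: pres_eq.refl)
  also have "\<dots> \<simeq> (EId a \<^bold>\<otimes> EId c) \<^bold>\<otimes> t \<^bold>\<otimes> (EId d \<^bold>\<otimes> EId b)"
    using assms by (intro pres_eq.tens_assoc) auto
  also have "\<dots> \<simeq> pad (a + c) (d + b) t"
    unfolding pad_def using assms
    by (intro pres_eq.cong_tens) (auto intro: pres_eq.refl pres_eq.tens_id)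
  finally show ?thesis .
qed

lemma pad_zero: "pad a b (EZero m n) \<simeq> EZero (a + m + b) (a + n + b)"
  using pres_eq.trans[OF peq_tens_left[OF tens_zero[of "EId a" m n]] zero_tens[of "EId b"]]
  by (simp add: pad_def)

lemma pad_sum:
  assumes "well_typed (t \<^bold>+ u)"
  shows "pad a b (t \<^bold>+ u) \<simeq> pad a b t \<^bold>+ pad a b u"
  unfolding pad_def using assms
  by (intro pres_eq.trans[OF peq_tens_left[OF pres_eq.tens_sum_right] pres_eq.tens_sum_left])
    (auto simp: parallel_def)

lemma pad_scale:
  assumes "well_typed t"
  shows "pad a b (c \<^bold>* t) \<simeq> c \<^bold>* pad a b t"
  unfolding pad_def using assms
  by (intro pres_eq.trans[OF peq_tens_left[OF pres_eq.tens_scale_right] pres_eq.tens_scale_left]) auto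

end

section \<open>Words in the generators\<close>

text \<open>Positions are counted from \<open>0\<close>, and the last letter of a word is applied first.\<close>

datatype letter = LS nat | LU nat | LA nat

primrec lpos :: "letter \<Rightarrow> nat" where
  "lpos (LS i) = i" | "lpos (LU i) = i" | "lpos (LA i) = i"
primrec ldom :: "letter \<Rightarrow> nat" where
  "ldom (LS i) = 2" | "ldom (LU i) = 0" | "ldom (LA i) = 2"
primrec lcod :: "letter \<Rightarrow> nat" where
  "lcod (LS i) = 2" | "lcod (LU i) = 2" | "lcod (LA i) = 0"
primrec lgen :: "letter \<Rightarrow> 'k expr" where
  "lgen (LS i) = EH" | "lgen (LU i) = EU" | "lgen (LA i) = EA"
primrec ldeg :: "bit \<Rightarrow> letter \<Rightarrow> bit" where
  "ldeg p (LS i) = 0" | "ldeg p (LU i) = p" | "ldeg p (LA i) = p"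
primrec shl :: "nat \<Rightarrow> letter \<Rightarrow> letter" where
  "shl a (LS i) = LS (a + i)" | "shl a (LU i) = LU (a + i)" | "shl a (LA i) = LA (a + i)"

lemma letter_simps [simp]:
  "lpos (shl a x) = a + lpos x" "ldom (shl a x) = ldom x" "lcod (shl a x) = lcod x"
  "lgen (shl a x) = lgen x" "ldeg p (shl a x) = ldeg p x"
  "well_typed (lgen x)" "edom (lgen x) = ldom x" "ecod (lgen x) = lcod x"
  by (cases x; simp)+

lemma homogeneous_lgen: "homogeneous p (lgen x) (ldeg p x)"
  by (cases x) (auto intro: homogeneous.intros)

lemma shl_0 [simp]: "shl 0 x = x"
  by (cases x) auto

lemma shl_shl [simp]: "shl a (shl b x) = shl (a + b) x"
  by (cases x) auto

text \<open>Here \<open>n\<close> is the number of incoming strands. The bracketing is that of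
  \<open>gen_s\<close>, \<open>gen_u\<close> and \<open>gen_a\<close>, so that letters interpret to
  those morphisms literally.\<close>

definition lev :: "letter \<Rightarrow> nat \<Rightarrow> 'k expr" where
  "lev x n = EId (lpos x) \<^bold>\<otimes> lgen x \<^bold>\<otimes> EId (n - lpos x - ldom x)"

primrec cd :: "nat \<Rightarrow> letter list \<Rightarrow> nat" where
  "cd m [] = m"
| "cd m (x # w) = cd m w - ldom x + lcod x"

text \<open>Each letter must fit into the strands present when it acts. The subtraction in
  \<open>cd\<close> is truncated, so the value of \<open>cd\<close> is a target only under this
  condition.\<close>

primrec vld :: "nat \<Rightarrow> letter list \<Rightarrow> bool" where
  "vld m [] = True"
| "vld m (x # w) = (vld m w \<and> lpos x + ldom x \<le> cd m w)"

primrec ev :: "nat \<Rightarrow> letter list \<Rightarrow> 'k expr" where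
  "ev m [] = EId m"
| "ev m (x # w) = lev x (cd m w) \<^bold>\<cdot> ev m w"

abbreviation sh :: "nat \<Rightarrow> letter list \<Rightarrow> letter list" where
  "sh a \<equiv> map (shl a)"

text \<open>A list keeps the terms of a relation, also those whose coefficient may be zero. Every
  defining relation then reads word = list, and one lemma transports all of them into larger
  words.\<close>

primrec comb :: "nat \<Rightarrow> nat \<Rightarrow> ('k \<times> letter list) list \<Rightarrow> 'k expr" where
  "comb m n [] = EZero m n"
| "comb m n (cw # cs) = fst cw \<^bold>* ev m (snd cw) \<^bold>+ comb m n cs"

definition vlds :: "nat \<Rightarrow> nat \<Rightarrow> ('k \<times> letter list) list \<Rightarrow> bool" where
  "vlds m n cs \<longleftrightarrow> (\<forall>cw\<in>set cs. vld m (snd cw) \<and> cd m (snd cw) = n)"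

lemma vlds_simps [simp]:
  "vlds m n []"
  "vlds m n (cw # cs) \<longleftrightarrow> vld m (snd cw) \<and> cd m (snd cw) = n \<and> vlds m n cs"
  by (auto simp: vlds_def)

lemma cd_append [simp]: "cd m (x @ y) = cd (cd m y) x"
  by (induction x) auto

lemma vld_append [simp]: "vld m (x @ y) \<longleftrightarrow> vld m y \<and> vld (cd m y) x"
  by (induction x) auto

lemma lev_typed [simp]:
  assumes "lpos x + ldom x \<le> n"
  shows "well_typed (lev x n)" "edom (lev x n) = n" "ecod (lev x n) = n - ldom x + lcod x"
  using assms by (auto simp: lev_def)

lemma ev_typed:
  "vld m w \<Longrightarrow> well_typed (ev m w :: 'k expr) \<and> edom (ev m w :: 'k expr) = m \<and> ecod (ev m w :: 'k expr) = cd m w"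
  by (induction w) auto

lemma ev_typed_simps [simp]:
  assumes "vld m w"
  shows "well_typed (ev m w)" "edom (ev m w) = m" "ecod (ev m w) = cd m w"
  using ev_typed[OF assms] by auto

lemma comb_typed:
  "vlds m n cs \<Longrightarrow> well_typed (comb m n cs) \<and> edom (comb m n cs) = m \<and> ecod (comb m n cs) = n"
  by (induction cs) (auto simp: parallel_def)

lemma comb_typed_simps [simp]:
  assumes "vlds m n cs"
  shows "well_typed (comb m n cs)" "edom (comb m n cs) = m" "ecod (comb m n cs) = n"
  using comb_typed[OF assms] by auto

lemma vld_sh: "vld m w \<Longrightarrow> vld (a + m + b) (sh a w) \<and> cd (a + m + b) (sh a w) = a + cd m w + b"
  by (induction w) auto

section \<open>Relations between short words inside long words\<close>

context presentation
begin

lemma lev_pad: "lev x n = pad (lpos x) (n - lpos x - ldom x) (lgen x)"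
  by (simp add: lev_def pad_def)

lemma pad_lev:
  assumes "lpos x + ldom x \<le> n"
  shows "pad a b (lev x n) \<simeq> lev (shl a x) (a + n + b)"
proof -
  have "pad a b (lev x n) \<simeq> pad (a + lpos x) (n - lpos x - ldom x + b) (lgen x)"
    unfolding lev_pad by (rule pad_pad) simp
  also have "\<dots> = lev (shl a x) (a + n + b)" using assms by (simp add: lev_pad)
  finally show ?thesis .
qed

lemma pad_ev:
  "vld m w \<Longrightarrow> pad a b (ev m w) \<simeq> ev (a + m + b) (sh a w)"
proof (induction w)
  case Nil
  then show ?case using pad_id by simp
next
  case (Cons x w)
  have "pad a b (ev m (x # w)) \<simeq> pad a b (lev x (cd m w)) \<^bold>\<cdot> pad a b (ev m w)"
    unfolding ev.simps using Cons by (intro pad_comp) auto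
  also have "\<dots> \<simeq> lev (shl a x) (a + cd m w + b) \<^bold>\<cdot> ev (a + m + b) (sh a w)"
    using Cons by (intro pres_eq.cong_comp pad_lev) auto
  also have "\<dots> = ev (a + m + b) (sh a (x # w))" using Cons vld_sh[of m w a b] by simp
  finally show ?case .
qed

lemma ev_append:
  "vld m (x @ y) \<Longrightarrow> ev m (x @ y) \<simeq> ev (cd m y) x \<^bold>\<cdot> ev m y"
proof (induction x)
  case Nil
  then show ?case using pres_eq.sym[OF pres_eq.comp_id_left[of "ev m y" \<pi> R]] by simp
next
  case (Cons a x)
  have "ev m ((a # x) @ y) \<simeq> lev a (cd m (x @ y)) \<^bold>\<cdot> (ev (cd m y) x \<^bold>\<cdot> ev m y)"
    unfolding append_Cons ev.simps using Cons by (intro peq_comp_right) auto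
  also have "\<dots> \<simeq> lev a (cd m (x @ y)) \<^bold>\<cdot> ev (cd m y) x \<^bold>\<cdot> ev m y"
    using Cons by (intro pres_eq.sym[OF pres_eq.comp_assoc]) auto
  finally show ?case by simp
qed

lemma vlds_append_right:
  "vld m y \<Longrightarrow> vlds (cd m y) n cs \<Longrightarrow> vlds m n (map (\<lambda>(c, w). (c, w @ y)) cs)"
  by (auto simp: vlds_def)

lemma vlds_append_left:
  "vld n x \<Longrightarrow> vlds m n cs \<Longrightarrow> vlds m (cd n x) (map (\<lambda>(c, w). (c, x @ w)) cs)"
  by (auto simp: vlds_def)

lemma vlds_sh:
  "vlds m n cs \<Longrightarrow> vlds (a + m + b) (a + n + b) (map (\<lambda>(c, w). (c, sh a w)) cs)"
  using vld_sh[of m _ a b] by (auto simp: vlds_def)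

lemma comb_comp:
  "vld m y \<Longrightarrow> vlds (cd m y) n cs \<Longrightarrow>
    comb (cd m y) n cs \<^bold>\<cdot> ev m y \<simeq> comb m n (map (\<lambda>(c, w). (c, w @ y)) cs)"
proof (induction cs)
  case Nil
  then show ?case using zero_comp[of "ev m y" "cd m y" n] by simp
next
  case (Cons cw cs)
  obtain c w where cw: "cw = (c, w)" by force
  let ?y = "ev m y"
  have "comb (cd m y) n (cw # cs) \<^bold>\<cdot> ?y \<simeq>
      (c \<^bold>* ev (cd m y) w) \<^bold>\<cdot> ?y \<^bold>+ comb (cd m y) n cs \<^bold>\<cdot> ?y"
    unfolding cw comb.simps fst_conv snd_conv using Cons.prems
    by (intro pres_eq.comp_sum_left) (auto simp: cw parallel_def)
  also have "\<dots> \<simeq> c \<^bold>* (ev (cd m y) w \<^bold>\<cdot> ?y) \<^bold>+ comb m n (map (\<lambda>(c, w). (c, w @ y)) cs)"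
    using Cons by (intro pres_eq.cong_sum pres_eq.comp_scale_left Cons.IH) (auto simp: cw parallel_def)
  also have "\<dots> \<simeq> c \<^bold>* ev m (w @ y) \<^bold>+ comb m n (map (\<lambda>(c, w). (c, w @ y)) cs)"
    using Cons vlds_append_right[of m y n cs]
    by (intro peq_sum_left pres_eq.cong_scale pres_eq.sym[OF ev_append]) (auto simp: cw parallel_def)
  finally show ?case by (simp add: cw)
qed

lemma comp_comb:
  "vld n x \<Longrightarrow> vlds m n cs \<Longrightarrow>
    ev n x \<^bold>\<cdot> comb m n cs \<simeq> comb m (cd n x) (map (\<lambda>(c, w). (c, x @ w)) cs)"
proof (induction cs)
  case Nil
  then show ?case using comp_zero[of "ev n x" n m] by simp
next
  case (Cons cw cs)
  obtain c w where cw: "cw = (c, w)" by force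
  let ?x = "ev n x"
  have "?x \<^bold>\<cdot> comb m n (cw # cs) \<simeq> ?x \<^bold>\<cdot> (c \<^bold>* ev m w) \<^bold>+ ?x \<^bold>\<cdot> comb m n cs"
    unfolding cw comb.simps fst_conv snd_conv using Cons.prems
    by (intro pres_eq.comp_sum_right) (auto simp: cw parallel_def)
  also have "\<dots> \<simeq> c \<^bold>* (?x \<^bold>\<cdot> ev m w) \<^bold>+ comb m (cd n x) (map (\<lambda>(c, w). (c, x @ w)) cs)"
    using Cons by (intro pres_eq.cong_sum pres_eq.comp_scale_right Cons.IH) (auto simp: cw parallel_def)
  also have "\<dots> \<simeq> c \<^bold>* ev m (x @ w) \<^bold>+ comb m (cd n x) (map (\<lambda>(c, w). (c, x @ w)) cs)"
    using Cons pres_eq.sym[OF ev_append[of m x w]] vlds_append_left[of n x m cs]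
    by (intro peq_sum_left pres_eq.cong_scale) (auto simp: cw parallel_def)
  finally show ?case by (simp add: cw)
qed

lemma pad_comb:
  "vlds m n cs \<Longrightarrow>
    pad a b (comb m n cs) \<simeq> comb (a + m + b) (a + n + b) (map (\<lambda>(c, w). (c, sh a w)) cs)"
proof (induction cs)
  case Nil
  then show ?case using pad_zero by simp
next
  case (Cons cw cs)
  obtain c w where cw: "cw = (c, w)" by force
  let ?cs = "comb (a + m + b) (a + n + b) (map (\<lambda>(c, w). (c, sh a w)) cs)"
  have "pad a b (comb m n (cw # cs)) \<simeq> pad a b (c \<^bold>* ev m w) \<^bold>+ pad a b (comb m n cs)"
    unfolding cw comb.simps fst_conv snd_conv using Cons.prems
    by (intro pad_sum) (auto simp: cw parallel_def)
  also have "\<dots> \<simeq> c \<^bold>* pad a b (ev m w) \<^bold>+ ?cs"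
    using Cons by (intro pres_eq.cong_sum pad_scale Cons.IH) (auto simp: cw parallel_def)
  also have "\<dots> \<simeq> c \<^bold>* ev (a + m + b) (sh a w) \<^bold>+ ?cs"
    using Cons vld_sh[of m w a b] vlds_sh[of m n cs a b]
    by (intro peq_sum_left pres_eq.cong_scale pad_ev) (auto simp: cw parallel_def)
  finally show ?case by (simp add: cw)
qed

text \<open>The short word sits \<open>a\<close> strands from the left, and the \<open>b\<close>
  strands left over on the right are padded as well. The bound on \<open>cd m y\<close> does not
  follow from validity: an empty \<open>w0\<close> demands no strands at all.\<close>

lemma lift_relation:
  assumes loc: "ev m0 w0 \<simeq> comb m0 n0 cs"
    and v0: "vld m0 w0" "cd m0 w0 = n0" "vlds m0 n0 cs"
    and v: "vld m (x @ sh a w0 @ y)" and cd: "a + m0 \<le> cd m y"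
  shows "ev m (x @ sh a w0 @ y) \<simeq>
    comb m (cd m (x @ sh a w0 @ y)) (map (\<lambda>(c, w). (c, x @ sh a w @ y)) cs)"
proof -
  obtain b where b: "cd m y = a + m0 + b" using cd le_iff_add by metis
  let ?cs = "map (\<lambda>(c, w). (c, sh a w)) cs"
  have vcs: "vlds (a + m0 + b) (a + n0 + b) ?cs"
    using v0(3) vld_sh[of m0 _ a b] by (auto simp: vlds_def)
  have w0: "vld (a + m0 + b) (sh a w0)" "cd (a + m0 + b) (sh a w0) = a + n0 + b"
    using v0 vld_sh[of m0 w0 a b] by auto
  have "ev (a + m0 + b) (sh a w0) \<simeq> comb (a + m0 + b) (a + n0 + b) ?cs"
    by (rule pres_eq.trans[OF pres_eq.sym[OF pad_ev[OF v0(1)]]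
        pres_eq.trans[OF pad_cong[OF loc] pad_comb[OF v0(3)]]])
  then have 1: "ev (a + m0 + b) (sh a w0) \<^bold>\<cdot> ev m y \<simeq> comb (a + m0 + b) (a + n0 + b) ?cs \<^bold>\<cdot> ev m y"
    using v w0 b by (intro peq_comp_left) auto
  have "ev m (sh a w0 @ y) \<simeq> comb m (a + n0 + b) (map (\<lambda>(c, w). (c, w @ y)) ?cs)"
    using pres_eq.trans[OF ev_append[of m "sh a w0" y] pres_eq.trans[OF _ comb_comp[of m y]],
        of "a + n0 + b" ?cs] 1 v w0 b vcs
    by simp
  then have 2: "ev (a + n0 + b) x \<^bold>\<cdot> ev m (sh a w0 @ y) \<simeq>
      ev (a + n0 + b) x \<^bold>\<cdot> comb m (a + n0 + b) (map (\<lambda>(c, w). (c, w @ y)) ?cs)"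
    using v w0 b by (intro peq_comp_right) auto
  let ?cy = "map (\<lambda>(c, w). (c, w @ y)) ?cs"
  have 3: "ev m (x @ sh a w0 @ y) \<simeq> ev (a + n0 + b) x \<^bold>\<cdot> ev m (sh a w0 @ y)"
    using ev_append[of m x "sh a w0 @ y"] v w0 b by simp
  have 4: "ev (a + n0 + b) x \<^bold>\<cdot> comb m (a + n0 + b) ?cy \<simeq>
      comb m (cd (a + n0 + b) x) (map (\<lambda>(c, w). (c, x @ w)) ?cy)"
    using vlds_append_right[of m y "a + n0 + b" ?cs] v w0 b vcs by (intro comp_comb) auto
  have "ev m (x @ sh a w0 @ y) \<simeq> comb m (cd (a + n0 + b) x) (map (\<lambda>(c, w). (c, x @ w)) ?cy)"
    by (rule pres_eq.trans[OF 3 pres_eq.trans[OF 2 4]])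
  then show ?thesis using w0 b by (simp add: comp_def case_prod_unfold)
qed

lemma ev_single: "lpos x + ldom x \<le> m \<Longrightarrow> ev m [x] \<simeq> lev x m"
  using pres_eq.comp_id_right[of "lev x m" \<pi> R] by simp

lemma ev_two: "vld m [x, y] \<Longrightarrow> ev m [x, y] \<simeq> lev x (m - ldom y + lcod y) \<^bold>\<cdot> lev y m"
  unfolding ev.simps(2)[of m x] cd.simps by (intro peq_comp_right ev_single) auto

lemma comb_single: "vld m w \<Longrightarrow> cd m w = n \<Longrightarrow> comb m n [(c, w)] \<simeq> c \<^bold>* ev m w"
  using pres_eq.sum_zero[of "c \<^bold>* ev m w" \<pi> R] by simp

text \<open>There are \<open>c\<close> strands between the two letters. The position of
  \<open>y\<close> counts the strands produced by \<open>x\<close> if \<open>y\<close> acts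
  afterwards and the strands consumed by \<open>x\<close> if \<open>y\<close> acts first; hence
  \<open>lcod x\<close> on one side and \<open>ldom x\<close> on the other.\<close>

lemma word_far_commute:
  fixes x y :: letter
  assumes "lpos x = 0" "lpos y = 0"
  shows "ev (ldom x + c + ldom y) [shl (lcod x + c) y, x] \<simeq>
    comb (ldom x + c + ldom y) (lcod x + c + lcod y)
      [(koszul_sign (ldeg \<pi> y) (ldeg \<pi> x), [x, shl (ldom x + c) y])]"
proof -
  let ?k = "koszul_sign (ldeg \<pi> y) (ldeg \<pi> x) :: 'k"
  let ?X = "lgen x :: 'k expr" and ?u = "EId c \<^bold>\<otimes> lgen y :: 'k expr"
  have y: "lev (shl (n + c) y) (n + c + ldom y) \<simeq> EId n \<^bold>\<otimes> ?u" for n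
  proof -
    have "lev (shl (n + c) y) (n + c + ldom y) \<simeq> EId (n + c) \<^bold>\<otimes> lgen y"
      using assms pres_eq.tens_unit_right[of "EId (n + c) \<^bold>\<otimes> lgen y" \<pi> R] by (simp add: lev_def)
    also have "\<dots> \<simeq> EId n \<^bold>\<otimes> EId c \<^bold>\<otimes> lgen y"
      by (intro peq_tens_left pres_eq.sym[OF pres_eq.tens_id]) simp
    also have "\<dots> \<simeq> EId n \<^bold>\<otimes> ?u" by (rule pres_eq.tens_assoc) auto
    finally show ?thesis .
  qed
  have x: "lev x (ldom x + n) \<simeq> ?X \<^bold>\<otimes> EId n" for n
    using assms peq_tens_left[OF pres_eq.tens_unit_left[of "?X" \<pi> R], of "EId n"]
    by (simp add: lev_def)
  let ?m = "ldom x + c + ldom y"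
  have m: "?m - ldom x + lcod x = lcod x + c + ldom y" "?m - ldom y + lcod y = ldom x + (c + lcod y)"
    "?m = ldom x + (c + ldom y)" by auto
  have v: "vld ?m [x, shl (ldom x + c) y]" "vld ?m [shl (lcod x + c) y, x]"
    "cd ?m [x, shl (ldom x + c) y] = lcod x + c + lcod y" using assms by auto
  have hu: "homogeneous \<pi> ?u (ldeg \<pi> y)"
    using homogeneous.intros(6)[OF homogeneous.intros(4) homogeneous_lgen, of \<pi> c y] unfolding add_0 .
  have "ev ?m [shl (lcod x + c) y, x] \<simeq> lev (shl (lcod x + c) y) (lcod x + c + ldom y) \<^bold>\<cdot> lev x ?m"
    using ev_two[OF v(2)] unfolding m(1) .
  also have "\<dots> \<simeq> (EId (lcod x) \<^bold>\<otimes> ?u) \<^bold>\<cdot> (?X \<^bold>\<otimes> EId (c + ldom y))"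
    unfolding m(3) using y[of "lcod x"] x[of "c + ldom y"] assms by (intro pres_eq.cong_comp) auto
  also have "\<dots> \<simeq> ?k \<^bold>* ((?X \<^bold>\<otimes> EId (c + lcod y)) \<^bold>\<cdot> (EId (ldom x) \<^bold>\<otimes> ?u))"
    using far_commute[OF _ _ homogeneous_lgen hu, of x] by simp
  also have "\<dots> \<simeq> ?k \<^bold>* (lev x (ldom x + (c + lcod y)) \<^bold>\<cdot> lev (shl (ldom x + c) y) ?m)"
    using pres_eq.sym[OF y[of "ldom x"]] pres_eq.sym[OF x[of "c + lcod y"]]
    by (intro pres_eq.cong_scale pres_eq.cong_comp) auto
  also have "\<dots> \<simeq> ?k \<^bold>* ev ?m [x, shl (ldom x + c) y]"
    using ev_two[OF v(1)] unfolding letter_simps m(2) by (rule pres_eq.cong_scale[OF pres_eq.sym])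
  also have "\<dots> \<simeq> comb ?m (lcod x + c + lcod y) [(?k, [x, shl (ldom x + c) y])]"
    by (rule pres_eq.sym[OF comb_single[OF v(1,3)]])
  finally show ?thesis .
qed

text \<open>The Koszul sign is its own inverse, so the same scalar serves in the reverse
  direction.\<close>

lemma word_far_commute':
  fixes x y :: letter
  assumes "lpos x = 0" "lpos y = 0"
  shows "ev (ldom x + c + ldom y) [x, shl (ldom x + c) y] \<simeq>
    comb (ldom x + c + ldom y) (lcod x + c + lcod y)
      [(koszul_sign (ldeg \<pi> y) (ldeg \<pi> x), [shl (lcod x + c) y, x])]"
proof -
  let ?k = "koszul_sign (ldeg \<pi> y) (ldeg \<pi> x) :: 'k" and ?m = "ldom x + c + ldom y"
  have kk: "?k * ?k = 1" by (simp add: koszul_sign_def)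
  have v: "vld ?m [x, shl (ldom x + c) y]" "vld ?m [shl (lcod x + c) y, x]"
    "cd ?m [x, shl (ldom x + c) y] = lcod x + c + lcod y"
    "cd ?m [shl (lcod x + c) y, x] = lcod x + c + lcod y" using assms by auto
  have swap: "ev ?m [shl (lcod x + c) y, x] \<simeq> ?k \<^bold>* ev ?m [x, shl (ldom x + c) y]"
    by (rule pres_eq.trans[OF word_far_commute[OF assms] comb_single]) (use v in auto)
  have "ev ?m [x, shl (ldom x + c) y] \<simeq> (?k * ?k) \<^bold>* ev ?m [x, shl (ldom x + c) y]"
    unfolding kk by (rule pres_eq.sym[OF pres_eq.scale_one]) (use v in simp)
  also have "\<dots> \<simeq> ?k \<^bold>* ?k \<^bold>* ev ?m [x, shl (ldom x + c) y]"
    by (rule pres_eq.scale_scale) (use v in simp)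
  also have "\<dots> \<simeq> ?k \<^bold>* ev ?m [shl (lcod x + c) y, x]"
    by (rule pres_eq.cong_scale[OF pres_eq.sym[OF swap]])
  also have "\<dots> \<simeq> comb ?m (lcod x + c + lcod y) [(?k, [shl (lcod x + c) y, x])]"
    by (rule pres_eq.sym[OF comb_single]) (use v in auto)
  finally show ?thesis .
qed

end

section \<open>The defining relations as identities between words\<close>

context presentation
begin

lemma lev_gen: "lpos x = 0 \<Longrightarrow> lev x (ldom x) \<simeq> lgen x"
  unfolding lev_def using pres_eq.tens_unit_right[of "EId 0 \<^bold>\<otimes> lgen x" \<pi> R]
    pres_eq.tens_unit_left[of "lgen x" \<pi> R] pres_eq.trans by fastforce

lemma lev_gen_left: "lpos x = 0 \<Longrightarrow> lev x (Suc (ldom x)) \<simeq> lgen x \<^bold>\<otimes> EI"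
  unfolding lev_def using peq_tens_left[OF pres_eq.tens_unit_left[of "lgen x" \<pi> R], of "EI"]
  by simp

lemma lev_gen_right: "lpos x = 1 \<Longrightarrow> lev x (Suc (ldom x)) \<simeq> EI \<^bold>\<otimes> lgen x"
  unfolding lev_def using pres_eq.tens_unit_right[of "EI \<^bold>\<otimes> lgen x" \<pi> R] by simp

lemma lev_gens:
  "lev (LS 0) 2 \<simeq> EH" "lev (LU 0) 0 \<simeq> EU" "lev (LA 0) 2 \<simeq> EA"
  "lev (LS 0) 3 \<simeq> EH \<^bold>\<otimes> EI" "lev (LU 0) 1 \<simeq> EU \<^bold>\<otimes> EI" "lev (LA 0) 3 \<simeq> EA \<^bold>\<otimes> EI"
  "lev (LS 1) 3 \<simeq> EI \<^bold>\<otimes> EH" "lev (LU 1) 1 \<simeq> EI \<^bold>\<otimes> EU" "lev (LA 1) 3 \<simeq> EI \<^bold>\<otimes> EA"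
  using lev_gen[of "LS 0"] lev_gen[of "LU 0"] lev_gen[of "LA 0"]
    lev_gen_left[of "LS 0"] lev_gen_left[of "LU 0"] lev_gen_left[of "LA 0"]
    lev_gen_right[of "LS 1"] lev_gen_right[of "LU 1"] lev_gen_right[of "LA 1"]
  by (simp_all add: eval_nat_numeral)

lemma ev_nil: "ev m [] \<simeq> EId m"
  by (simp add: pres_eq.refl)

lemma ev_one_gen: "lev x m \<simeq> t \<Longrightarrow> lpos x + ldom x \<le> m \<Longrightarrow> ev m [x] \<simeq> t"
  using ev_single pres_eq.trans by blast

lemma ev_two_gen:
  assumes "lev x (m - ldom y + lcod y) \<simeq> t" "lev y m \<simeq> u" "vld m [x, y]"
  shows "ev m [x, y] \<simeq> t \<^bold>\<cdot> u"
  using assms by (intro pres_eq.trans[OF ev_two pres_eq.cong_comp]) auto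

lemma ev_three_gen:
  assumes "lev x (m - ldom z + lcod z - ldom y + lcod y) \<simeq> t" "lev y (m - ldom z + lcod z) \<simeq> u"
    "lev z m \<simeq> v" "vld m [x, y, z]"
  shows "ev m [x, y, z] \<simeq> t \<^bold>\<cdot> u \<^bold>\<cdot> v"
proof -
  have "ev m [x, y, z] \<simeq> t \<^bold>\<cdot> (u \<^bold>\<cdot> v)"
    using assms ev_two_gen[of y m z u v] unfolding ev.simps(2)[of m x] by (intro pres_eq.cong_comp) auto
  also have "\<dots> \<simeq> t \<^bold>\<cdot> u \<^bold>\<cdot> v"
    using assms peq_typed[OF assms(1)] peq_typed[OF assms(2)] peq_typed[OF assms(3)]
    by (intro pres_eq.sym[OF pres_eq.comp_assoc]) auto
  finally show ?thesis .
qed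

lemma relation_one:
  assumes "t \<simeq> c1 \<^bold>* t1" "ev m w \<simeq> t" "ev m w1 \<simeq> t1" "vld m w1" "cd m w1 = n"
  shows "ev m w \<simeq> comb m n [(c1, w1)]"
proof -
  have "ev m w \<simeq> c1 \<^bold>* t1" using assms pres_eq.trans by blast
  also have "\<dots> \<simeq> c1 \<^bold>* ev m w1" by (intro pres_eq.cong_scale pres_eq.sym[OF assms(3)])
  also have "\<dots> \<simeq> comb m n [(c1, w1)]" by (rule pres_eq.sym[OF comb_single]) (use assms in auto)
  finally show ?thesis .
qed

lemma relation_three:
  assumes "t \<simeq> c1 \<^bold>* t1 \<^bold>+ c2 \<^bold>* t2 \<^bold>+ c3 \<^bold>* t3" "ev m w \<simeq> t"
    "ev m w1 \<simeq> t1" "ev m w2 \<simeq> t2" "ev m w3 \<simeq> t3" "vlds m n [(c1, w1), (c2, w2), (c3, w3)]"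
  shows "ev m w \<simeq> comb m n [(c1, w1), (c2, w2), (c3, w3)]"
proof -
  note ty = peq_typed[OF assms(3)] peq_typed[OF assms(4)] peq_typed[OF assms(5)]
  have "ev m w \<simeq> c1 \<^bold>* t1 \<^bold>+ c2 \<^bold>* t2 \<^bold>+ c3 \<^bold>* t3" using assms pres_eq.trans by blast
  also have "\<dots> \<simeq> c1 \<^bold>* t1 \<^bold>+ (c2 \<^bold>* t2 \<^bold>+ c3 \<^bold>* t3)"
    using assms(6) ty by (intro pres_eq.sum_assoc) (auto simp: parallel_def)
  also have "\<dots> \<simeq> c1 \<^bold>* ev m w1 \<^bold>+ (c2 \<^bold>* ev m w2 \<^bold>+ comb m n [(c3, w3)])"
    using assms(6) ty
    by (intro pres_eq.cong_sum pres_eq.cong_scale pres_eq.sym[OF assms(3)] pres_eq.sym[OF assms(4)]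
        pres_eq.trans[OF pres_eq.cong_scale[OF pres_eq.sym[OF assms(5)]] pres_eq.sym[OF comb_single]])
      (auto simp: parallel_def)
  finally show ?thesis by simp
qed

end

locale brauer_presentation = presentation \<pi> "defining_relations P"
  for \<pi> :: bit and P :: "'k::field params"
begin

abbreviation peq_params (infix "\<simeq>" 50) where
  "t \<simeq> u \<equiv> pres_eq \<pi> (defining_relations P) t u"

lemma defining_relation: "(t, u) \<in> defining_relations P \<Longrightarrow> t \<simeq> u"
  using defining_relations_typed by (intro pres_eq.rel) auto

lemma relations:
  "EH \<^bold>\<cdot> EU \<simeq> par_lam P \<^bold>* EU"
  "EA \<^bold>\<cdot> EH \<simeq> par_lam' P \<^bold>* EA"
  "EA \<^bold>\<cdot> EU \<simeq> par_delta P \<^bold>* EId 0"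
  "(EA \<^bold>\<otimes> EI) \<^bold>\<cdot> (EI \<^bold>\<otimes> EU) \<simeq> par_sig P \<^bold>* EI"
  "(EI \<^bold>\<otimes> EA) \<^bold>\<cdot> (EU \<^bold>\<otimes> EI) \<simeq> par_sig' P \<^bold>* EI"
  "(EA \<^bold>\<otimes> EI) \<^bold>\<cdot> (EI \<^bold>\<otimes> EH) \<^bold>\<cdot> (EU \<^bold>\<otimes> EI) \<simeq> par_rho P \<^bold>* EI"
  "EH \<^bold>\<cdot> EH \<simeq> par_a P \<^bold>* EId 2 \<^bold>+ par_b P \<^bold>* EH \<^bold>+ par_c P \<^bold>* (EU \<^bold>\<cdot> EA)"
  "(EH \<^bold>\<otimes> EI) \<^bold>\<cdot> (EI \<^bold>\<otimes> EU) \<simeq>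
    par_d P \<^bold>* (EU \<^bold>\<otimes> EI) \<^bold>+ par_e P \<^bold>* ((EI \<^bold>\<otimes> EH) \<^bold>\<cdot> (EU \<^bold>\<otimes> EI)) \<^bold>+ par_f P \<^bold>* (EI \<^bold>\<otimes> EU)"
  "(EH \<^bold>\<otimes> EI) \<^bold>\<cdot> (EI \<^bold>\<otimes> EH) \<^bold>\<cdot> (EU \<^bold>\<otimes> EI) \<simeq>
    par_D P \<^bold>* (EU \<^bold>\<otimes> EI) \<^bold>+ par_E P \<^bold>* ((EI \<^bold>\<otimes> EH) \<^bold>\<cdot> (EU \<^bold>\<otimes> EI)) \<^bold>+ par_F P \<^bold>* (EI \<^bold>\<otimes> EU)"
  "(EI \<^bold>\<otimes> EA) \<^bold>\<cdot> (EH \<^bold>\<otimes> EI) \<simeq>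
    par_d' P \<^bold>* (EA \<^bold>\<otimes> EI) \<^bold>+ par_e' P \<^bold>* ((EA \<^bold>\<otimes> EI) \<^bold>\<cdot> (EI \<^bold>\<otimes> EH)) \<^bold>+ par_f' P \<^bold>* (EI \<^bold>\<otimes> EA)"
  "(EA \<^bold>\<otimes> EI) \<^bold>\<cdot> (EI \<^bold>\<otimes> EH) \<^bold>\<cdot> (EH \<^bold>\<otimes> EI) \<simeq>
    par_D' P \<^bold>* (EA \<^bold>\<otimes> EI) \<^bold>+ par_E' P \<^bold>* ((EA \<^bold>\<otimes> EI) \<^bold>\<cdot> (EI \<^bold>\<otimes> EH)) \<^bold>+ par_F' P \<^bold>* (EI \<^bold>\<otimes> EA)"
  "(EH \<^bold>\<otimes> EI) \<^bold>\<cdot> (EI \<^bold>\<otimes> EH) \<^bold>\<cdot> (EH \<^bold>\<otimes> EI) \<simeq> (EI \<^bold>\<otimes> EH) \<^bold>\<cdot> (EH \<^bold>\<otimes> EI) \<^bold>\<cdot> (EI \<^bold>\<otimes> EH)"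
  by (rule defining_relation,
      simp add: defining_relations_def parameter_relations_def braid_relation_def del: One_nat_def)+

lemmas relation_simps = lev_gens lev_gens[unfolded numeral_3_eq_3 numeral_2_eq_2] ev_nil

lemma rel_HU: "ev 0 [LS 0, LU 0] \<simeq> comb 0 2 [(par_lam P, [LU 0])]"
  by (rule relation_one[OF relations(1) ev_two_gen ev_one_gen])
    (simp_all add: relation_simps del: One_nat_def)

lemma rel_AH: "ev 2 [LA 0, LS 0] \<simeq> comb 2 0 [(par_lam' P, [LA 0])]"
  by (rule relation_one[OF relations(2) ev_two_gen ev_one_gen])
    (simp_all add: relation_simps del: One_nat_def)

lemma rel_AU: "ev 0 [LA 0, LU 0] \<simeq> comb 0 0 [(par_delta P, [])]"
  by (rule relation_one[OF relations(3) ev_two_gen ev_nil])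
    (simp_all add: relation_simps del: One_nat_def)

lemma rel_sig: "ev 1 [LA 0, LU 1] \<simeq> comb 1 1 [(par_sig P, [])]"
  by (rule relation_one[OF relations(4) ev_two_gen ev_nil])
    (simp_all add: relation_simps del: One_nat_def)

lemma rel_sig': "ev 1 [LA 1, LU 0] \<simeq> comb 1 1 [(par_sig' P, [])]"
  by (rule relation_one[OF relations(5) ev_two_gen ev_nil])
    (simp_all add: relation_simps del: One_nat_def)

lemma rel_rho: "ev 1 [LA 0, LS 1, LU 0] \<simeq> comb 1 1 [(par_rho P, [])]"
  by (rule relation_one[OF relations(6) ev_three_gen ev_nil])
    (simp_all add: relation_simps del: One_nat_def)

lemma rel_HH:
  "ev 2 [LS 0, LS 0] \<simeq> comb 2 2 [(par_a P, []), (par_b P, [LS 0]), (par_c P, [LU 0, LA 0])]"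
  by (rule relation_three[OF relations(7) ev_two_gen _ ev_one_gen ev_two_gen])
    (simp_all add: relation_simps pres_eq.refl del: One_nat_def)

lemma rel_HU_slide:
  "ev 1 [LS 0, LU 1] \<simeq>
    comb 1 3 [(par_d P, [LU 0]), (par_e P, [LS 1, LU 0]), (par_f P, [LU 1])]"
  by (rule relation_three[OF relations(8) ev_two_gen ev_one_gen ev_two_gen ev_one_gen])
    (simp_all add: relation_simps del: One_nat_def)

lemma rel_HHU:
  "ev 1 [LS 0, LS 1, LU 0] \<simeq>
    comb 1 3 [(par_D P, [LU 0]), (par_E P, [LS 1, LU 0]), (par_F P, [LU 1])]"
  by (rule relation_three[OF relations(9) ev_three_gen ev_one_gen ev_two_gen ev_one_gen])
    (simp_all add: relation_simps del: One_nat_def)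

lemma rel_AH_slide:
  "ev 3 [LA 1, LS 0] \<simeq>
    comb 3 1 [(par_d' P, [LA 0]), (par_e' P, [LA 0, LS 1]), (par_f' P, [LA 1])]"
  by (rule relation_three[OF relations(10) ev_two_gen ev_one_gen ev_two_gen ev_one_gen])
    (simp_all add: relation_simps del: One_nat_def)

lemma rel_AHH:
  "ev 3 [LA 0, LS 1, LS 0] \<simeq>
    comb 3 1 [(par_D' P, [LA 0]), (par_E' P, [LA 0, LS 1]), (par_F' P, [LA 1])]"
  by (rule relation_three[OF relations(11) ev_three_gen ev_one_gen ev_two_gen ev_one_gen])
    (simp_all add: relation_simps del: One_nat_def)

lemma rel_braid: "ev 3 [LS 0, LS 1, LS 0] \<simeq> comb 3 3 [(1, [LS 1, LS 0, LS 1])]"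
proof -
  have 1: "ev 3 [LS 0, LS 1, LS 0] \<simeq> (EH \<^bold>\<otimes> EI) \<^bold>\<cdot> (EI \<^bold>\<otimes> EH) \<^bold>\<cdot> (EH \<^bold>\<otimes> EI)"
    by (rule ev_three_gen) (simp_all add: relation_simps del: One_nat_def)
  have 3: "ev 3 [LS 1, LS 0, LS 1] \<simeq> (EI \<^bold>\<otimes> EH) \<^bold>\<cdot> (EH \<^bold>\<otimes> EI) \<^bold>\<cdot> (EI \<^bold>\<otimes> EH)"
    by (rule ev_three_gen) (simp_all add: relation_simps del: One_nat_def)
  show ?thesis
    by (rule relation_one[OF scale_one_peq[OF relations(12)] 1 3]) auto
qed

end

section \<open>Interpretation in a supercategory\<close>

locale supercategory_generators = strict_monoidal_supercategory C
  for C :: "('k::field, 'f) supercat" (structure) +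
  fixes H A U :: 'f and \<pi> :: bit
  assumes H_deg: "H \<in> Hdeg C 0 2 2" and A_deg: "A \<in> Hdeg C \<pi> 2 0" and U_deg: "U \<in> Hdeg C \<pi> 0 2"
begin

sublocale V: vectorspace "class_ring :: 'k ring" "Hom C m n" for m n
  by (rule hom_space)

abbreviation I where "I \<equiv> interp C H A U"

lemma deg_carrier: "f \<in> Hdeg C p m n \<Longrightarrow> f \<in> carrier (Hom C m n)"
  using deg_subspace submodule.subset subspace.submod by blast

lemma comp_in [simp]: "g \<in> carrier (Hom C n l) \<Longrightarrow> f \<in> carrier (Hom C m n) \<Longrightarrow> g \<cdot> f \<in> carrier (Hom C m l)"
  using LinearCombinations.module_hom_closed[OF comp_linear_left] by blast

lemma tens_in [simp]: "f \<in> carrier (Hom C m n) \<Longrightarrow> g \<in> carrier (Hom C m' n') \<Longrightarrow>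
    f \<boxtimes> g \<in> carrier (Hom C (m + m') (n + n'))"
  using LinearCombinations.module_hom_closed[OF tens_linear_left] by blast

lemma interp_in: "well_typed t \<Longrightarrow> I t \<in> carrier (Hom C (edom t) (ecod t))"
proof (induction t)
  case (EId n)
  show ?case using id_even[of n] by (auto intro: deg_carrier)
next
  case (ESum t u)
  then show ?case using V.M.add.m_closed by (auto simp: parallel_def)
next
  case (EScl c t)
  then show ?case using V.smult_closed by auto
qed (auto simp: H_deg A_deg U_deg intro: deg_carrier H_deg[THEN deg_carrier] A_deg[THEN deg_carrier] U_deg[THEN deg_carrier])

lemma interp_in': "well_typed t \<Longrightarrow> edom t = m \<Longrightarrow> ecod t = n \<Longrightarrow> I t \<in> carrier (Hom C m n)"
  using interp_in by auto

lemma interp_deg: "homogeneous \<pi> t p \<Longrightarrow> well_typed t \<Longrightarrow> I t \<in> Hdeg C p (edom t) (ecod t)"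
proof (induction rule: homogeneous.induct)
  case (5 t p u q)
  then show ?case using comp_deg by auto
next
  case (6 t p u q)
  then show ?case using tens_deg by auto
next
  case (7 m n p)
  then show ?case using submodule.zero_closed[OF subspace.submod[OF deg_subspace]] by auto
next
  case (8 t p u)
  then show ?case using submodule.m_closed[OF subspace.submod[OF deg_subspace]] by (auto simp: parallel_def)
next
  case (9 t p c)
  then show ?case using submodule.smult_closed[OF subspace.submod[OF deg_subspace]] by auto
qed (auto simp: H_deg A_deg U_deg id_even)

lemmas hom_add = LinearCombinations.module_hom_add[OF comp_linear_left] LinearCombinations.module_hom_add[OF comp_linear_right]
  LinearCombinations.module_hom_add[OF tens_linear_left] LinearCombinations.module_hom_add[OF tens_linear_right]

lemmas hom_smult = LinearCombinations.module_hom_smult[OF comp_linear_left, simplified] LinearCombinations.module_hom_smult[OF comp_linear_right, simplified]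
  LinearCombinations.module_hom_smult[OF tens_linear_left, simplified] LinearCombinations.module_hom_smult[OF tens_linear_right, simplified]

text \<open>The universal property of the presentation: every rule of the congruence is an axiom of
  the target or one of the given relations. With \<open>R = {}\<close> it transfers purely formal
  identities, with the defining relations it transfers the rewriting of words.\<close>

lemma interp_sound:
  assumes "pres_eq \<pi> R t u" "satisfies C H A U R"
  shows "I t = I u"
  using assms(1)
proof (induction rule: pres_eq.induct)
  case (rel t u)
  then show ?case using assms(2) by (auto simp: satisfies_def)
next
  case (cong_sum t t' u u')
  then have "well_typed t" "well_typed t'" "edom t' = edom t" "ecod t' = ecod t"
    using presentation.peq_typed by blast+
  then show ?case using cong_sum by simp
next
  case (cong_scale t t' c)
  then have "well_typed t" "well_typed t'" "edom t' = edom t" "ecod t' = ecod t"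
    using presentation.peq_typed by blast+
  then show ?case using cong_scale by simp
next
  case (sum_assoc t u v)
  then show ?case by (auto simp: parallel_def intro!: V.M.add.m_assoc interp_in')
next
  case (sum_comm t u)
  then show ?case by (auto simp: parallel_def intro!: V.M.add.m_comm interp_in')
next
  case (sum_zero t)
  then show ?case using V.M.r_zero interp_in by auto
next
  case (sum_neg t)
  have "I t \<oplus>\<^bsub>Hom C (edom t) (ecod t)\<^esub> (- 1) \<odot>\<^bsub>Hom C (edom t) (ecod t)\<^esub> I t =
    (1 + - 1) \<odot>\<^bsub>Hom C (edom t) (ecod t)\<^esub> I t"
    using V.smult_l_distr[of 1 "- 1" "I t"] V.smult_one[of "I t"] interp_in[OF sum_neg] by simp
  also have "\<dots> = \<zero>\<^bsub>Hom C (edom t) (ecod t)\<^esub>"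
    using V.lmult_0[of "I t"] interp_in[OF sum_neg] by simp
  finally show ?case by simp
next
  case (scale_sum t u c)
  then show ?case by (auto simp: parallel_def intro!: V.smult_r_distr interp_in')
next
  case (scale_add t c d)
  then show ?case using V.smult_l_distr[of c d "I t"] interp_in by auto
next
  case (scale_scale t c d)
  then show ?case using V.smult_assoc1[of c d "I t"] interp_in by auto
next
  case (scale_one t)
  then show ?case using V.smult_one[of "I t"] interp_in by auto
next
  case (comp_sum_left t u v)
  then show ?case using hom_add(1)[of "I v" "edom v" "ecod v" "I t" "ecod t" "I u"] interp_in[of t] interp_in[of u] interp_in[of v]
    by (auto simp: parallel_def)
next
  case (comp_sum_right t u v)
  then show ?case using hom_add(2)[of "I t" "edom t" "ecod t" "I u" "edom u" "I v"] interp_in[of t] interp_in[of u] interp_in[of v]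
    by (auto simp: parallel_def)
next
  case (comp_scale_left t u c)
  then show ?case using hom_smult(1)[of "I u" "edom u" "ecod u" "I t" "ecod t" c] interp_in[of t] interp_in[of u] by auto
next
  case (comp_scale_right t u c)
  then show ?case using hom_smult(2)[of "I t" "edom t" "ecod t" "I u" "edom u" c] interp_in[of t] interp_in[of u] by auto
next
  case (comp_assoc t u v)
  then show ?case using strict_monoidal_supercategory_axioms
    by (auto intro!: strict_monoidal_supercategory.comp_assoc interp_in')
next
  case (comp_id_left t)
  then show ?case using strict_monoidal_supercategory.comp_id_left[OF strict_monoidal_supercategory_axioms] interp_in by auto
next
  case (comp_id_right t)
  then show ?case using strict_monoidal_supercategory.comp_id_right[OF strict_monoidal_supercategory_axioms] interp_in by auto
next
  case (tens_sum_left t u v)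
  then show ?case using hom_add(3)[of "I v" "edom v" "ecod v" "I t" "edom t" "ecod t" "I u"] interp_in[of t] interp_in[of u] interp_in[of v]
    by (auto simp: parallel_def)
next
  case (tens_sum_right t u v)
  then show ?case using hom_add(4)[of "I t" "edom t" "ecod t" "I u" "edom u" "ecod u" "I v"] interp_in[of t] interp_in[of u] interp_in[of v]
    by (auto simp: parallel_def)
next
  case (tens_scale_left t u c)
  then show ?case using hom_smult(3)[of "I u" "edom u" "ecod u" "I t" "edom t" "ecod t" c] interp_in[of t] interp_in[of u] by auto
next
  case (tens_scale_right t u c)
  then show ?case using hom_smult(4)[of "I t" "edom t" "ecod t" "I u" "edom u" "ecod u" c] interp_in[of t] interp_in[of u] by auto
next
  case (tens_assoc t u v)
  then show ?case using strict_monoidal_supercategory.tens_assoc[OF strict_monoidal_supercategory_axioms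
        interp_in[of t] interp_in[of u] interp_in[of v]] by auto
next
  case (tens_unit_left t)
  then show ?case using strict_monoidal_supercategory.tens_unit_left[OF strict_monoidal_supercategory_axioms] interp_in by auto
next
  case (tens_unit_right t)
  then show ?case using strict_monoidal_supercategory.tens_unit_right[OF strict_monoidal_supercategory_axioms] interp_in by auto
next
  case (tens_id m n)
  then show ?case using strict_monoidal_supercategory.tens_id[OF strict_monoidal_supercategory_axioms] by auto
next
  case (interchange t v u w q p)
  then show ?case
    using strict_monoidal_supercategory.interchange[OF strict_monoidal_supercategory_axioms,
        of "I t" "ecod v" "ecod t" "I u" q "ecod w" "ecod u" "I v" p "edom v" "I w" "edom w"]
      interp_in[of t] interp_in[of w] interp_deg[of u q] interp_deg[of v p] by auto
qed auto

lemma interp_sound_empty: "pres_eq \<pi> {} t u \<Longrightarrow> I t = I u"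
  using interp_sound by (auto simp: satisfies_def)

lemma interp_ev_append: "vld m (x @ y) \<Longrightarrow> I (ev m (x @ y)) = I (ev (cd m y) x) \<cdot> I (ev m y)"
  using interp_sound_empty[OF presentation.ev_append] by auto

lemma interp_ev_single: "lpos x + ldom x \<le> m \<Longrightarrow> I (ev m [x]) = I (lev x m)"
  using interp_sound_empty[OF presentation.ev_single] by auto

end

section \<open>The presented supercategory\<close>

context presentation
begin

abbreviation "cl t \<equiv> pres_class \<pi> R t"
abbreviation "PC \<equiv> presented \<pi> R"

lemma cl_cong: "t \<simeq> u \<Longrightarrow> cl t = cl u"
  unfolding pres_class_def using pres_eq.trans[of \<pi> R] pres_eq.sym[of \<pi> R] by blast

lemma cl_eqD: "cl t = cl u \<Longrightarrow> well_typed u \<Longrightarrow> t \<simeq> u"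
  unfolding pres_class_def using pres_eq.refl[of u] by auto

lemma mem_cl: "u \<in> cl t \<longleftrightarrow> t \<simeq> u"
  by (simp add: pres_class_def)

lemma carrier_PC: "carrier (Hom PC m n) = cl ` {t. well_typed t \<and> edom t = m \<and> ecod t = n}"
  by (simp add: presented_def)

lemma carrier_PC_I: "well_typed t \<Longrightarrow> edom t = m \<Longrightarrow> ecod t = n \<Longrightarrow> cl t \<in> carrier (Hom PC m n)"
  by (auto simp: carrier_PC)

lemma carrier_PC_E:
  assumes "f \<in> carrier (Hom PC m n)"
  obtains t where "f = cl t" "well_typed t" "edom t = m" "ecod t = n"
  using assms by (auto simp: carrier_PC)

lemma Hdeg_PC: "Hdeg PC p m n = cl ` {t. well_typed t \<and> edom t = m \<and> ecod t = n \<and> homogeneous \<pi> t p}"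
  by (simp add: presented_def)

lemma Hdeg_PC_I:
  "well_typed t \<Longrightarrow> homogeneous \<pi> t p \<Longrightarrow> edom t = m \<Longrightarrow> ecod t = n \<Longrightarrow> cl t \<in> Hdeg PC p m n"
  by (auto simp: Hdeg_PC)

lemma Hdeg_PC_E:
  assumes "f \<in> Hdeg PC p m n"
  obtains t where "f = cl t" "well_typed t" "edom t = m" "ecod t = n" "homogeneous \<pi> t p"
  using assms by (auto simp: Hdeg_PC)

lemma zero_PC: "\<zero>\<^bsub>Hom PC m n\<^esub> = cl (EZero m n)" and id_PC: "idm PC n = cl (EId n)"
  by (simp_all add: presented_def)

text \<open>The operations of \<open>presented\<close> are unions over all representatives. If the
  summands of the union are equal to one class, the union is that class, which is how independence
  of representatives enters.\<close>

lemma Union_cl: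
  assumes "\<And>t' u'. t \<simeq> t' \<Longrightarrow> u \<simeq> u' \<Longrightarrow> cl (F t' u') = cl v" "well_typed t" "well_typed u"
  shows "(\<Union>t'\<in>cl t. \<Union>u'\<in>cl u. cl (F t' u')) = cl v"
proof (rule UN_constant_eq[OF _ ballI])
  show "t \<in> cl t" using assms pres_eq.refl by (simp add: mem_cl)
  fix t' assume t': "t' \<in> cl t"
  show "(\<Union>u'\<in>cl u. cl (F t' u')) = cl v"
    by (rule UN_constant_eq[of u, OF _ ballI]) (use assms t' pres_eq.refl in \<open>auto simp: mem_cl del: equalityI\<close>)
qed

lemma add_PC: "well_typed (t \<^bold>+ u) \<Longrightarrow> cl t \<oplus>\<^bsub>Hom PC m n\<^esub> cl u = cl (t \<^bold>+ u)"
  unfolding presented_def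
  by (simp, rule Union_cl) (auto del: equalityI intro: cl_cong[OF pres_eq.sym[OF pres_eq.cong_sum]])

lemma cmp_PC: "well_typed (t \<^bold>\<cdot> u) \<Longrightarrow> cl t \<cdot>\<^bsub>PC\<^esub> cl u = cl (t \<^bold>\<cdot> u)"
  unfolding presented_def
  by (simp, rule Union_cl) (auto del: equalityI intro: cl_cong[OF pres_eq.sym[OF pres_eq.cong_comp]])

lemma tns_PC: "well_typed t \<Longrightarrow> well_typed u \<Longrightarrow> cl t \<boxtimes>\<^bsub>PC\<^esub> cl u = cl (t \<^bold>\<otimes> u)"
  unfolding presented_def
  by (simp, rule Union_cl) (auto del: equalityI intro: cl_cong[OF pres_eq.sym[OF pres_eq.cong_tens]])

lemma smult_PC: "well_typed t \<Longrightarrow> c \<odot>\<^bsub>Hom PC m n\<^esub> cl t = cl (c \<^bold>* t)"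
proof -
  assume "well_typed t"
  then have "(\<Union>t'\<in>cl t. cl (c \<^bold>* t')) = cl (c \<^bold>* t)"
    by (intro UN_constant_eq[of t])
      (auto simp: mem_cl del: equalityI intro: pres_eq.refl cl_cong[OF pres_eq.sym[OF pres_eq.cong_scale]])
  then show ?thesis by (simp add: presented_def)
qed

lemmas PC_simps = add_PC cmp_PC tns_PC smult_PC zero_PC id_PC

lemma vectorspace_PC: "vectorspace (class_ring :: 'k ring) (Hom PC m n)"
proof (rule vs_criteria)
  show "field (class_ring :: 'k ring)" by (rule class_field)
  show "\<zero>\<^bsub>Hom PC m n\<^esub> \<in> carrier (Hom PC m n)" by (auto simp: PC_simps intro: carrier_PC_I)
  show "\<forall>v w. v \<in> carrier (Hom PC m n) \<and> w \<in> carrier (Hom PC m n) \<longrightarrow>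
      v \<oplus>\<^bsub>Hom PC m n\<^esub> w \<in> carrier (Hom PC m n)"
    by (auto elim!: carrier_PC_E simp: PC_simps parallel_def intro!: carrier_PC_I)
  show "\<forall>v\<in>carrier (Hom PC m n). \<exists>neg_v\<in>carrier (Hom PC m n). v \<oplus>\<^bsub>Hom PC m n\<^esub> neg_v = \<zero>\<^bsub>Hom PC m n\<^esub>"
  proof
    fix v assume "v \<in> carrier (Hom PC m n)"
    then obtain t where "v = cl t" "well_typed t" "edom t = m" "ecod t = n" by (rule carrier_PC_E)
    then show "\<exists>neg_v\<in>carrier (Hom PC m n). v \<oplus>\<^bsub>Hom PC m n\<^esub> neg_v = \<zero>\<^bsub>Hom PC m n\<^esub>"
      using cl_cong[OF pres_eq.sum_neg[of t]]
      by (intro bexI[of _ "cl ((- 1) \<^bold>* t)"]) (auto simp: PC_simps parallel_def intro!: carrier_PC_I)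
  qed
  show "\<forall>c v. c \<in> carrier (class_ring :: 'k ring) \<and> v \<in> carrier (Hom PC m n) \<longrightarrow>
      c \<odot>\<^bsub>Hom PC m n\<^esub> v \<in> carrier (Hom PC m n)"
    by (auto elim!: carrier_PC_E simp: PC_simps intro!: carrier_PC_I)
  show "\<forall>v w. v \<in> carrier (Hom PC m n) \<and> w \<in> carrier (Hom PC m n) \<longrightarrow>
      v \<oplus>\<^bsub>Hom PC m n\<^esub> w = w \<oplus>\<^bsub>Hom PC m n\<^esub> v"
    by (auto elim!: carrier_PC_E simp: PC_simps parallel_def del: equalityI intro!: cl_cong pres_eq.sum_comm)
  show "\<forall>v w x. v \<in> carrier (Hom PC m n) \<and> w \<in> carrier (Hom PC m n) \<and> x \<in> carrier (Hom PC m n) \<longrightarrow>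
      v \<oplus>\<^bsub>Hom PC m n\<^esub> w \<oplus>\<^bsub>Hom PC m n\<^esub> x = v \<oplus>\<^bsub>Hom PC m n\<^esub> (w \<oplus>\<^bsub>Hom PC m n\<^esub> x)"
    by (auto elim!: carrier_PC_E simp: PC_simps parallel_def del: equalityI intro!: cl_cong pres_eq.sum_assoc)
  show "\<forall>v\<in>carrier (Hom PC m n). v \<oplus>\<^bsub>Hom PC m n\<^esub> \<zero>\<^bsub>Hom PC m n\<^esub> = v"
    by (auto elim!: carrier_PC_E simp: PC_simps parallel_def del: equalityI intro!: cl_cong pres_eq.sum_zero)
  show "\<forall>a b v. a \<in> carrier class_ring \<and> b \<in> carrier class_ring \<and> v \<in> carrier (Hom PC m n) \<longrightarrow>
      (a \<otimes>\<^bsub>class_ring\<^esub> b) \<odot>\<^bsub>Hom PC m n\<^esub> v = a \<odot>\<^bsub>Hom PC m n\<^esub> (b \<odot>\<^bsub>Hom PC m n\<^esub> v)"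
    by (auto elim!: carrier_PC_E simp: PC_simps del: equalityI intro!: cl_cong pres_eq.scale_scale)
  show "\<forall>v\<in>carrier (Hom PC m n). \<one>\<^bsub>class_ring\<^esub> \<odot>\<^bsub>Hom PC m n\<^esub> v = v"
    by (auto elim!: carrier_PC_E simp: PC_simps del: equalityI intro!: cl_cong pres_eq.scale_one)
  show "\<forall>a b v. a \<in> carrier class_ring \<and> b \<in> carrier class_ring \<and> v \<in> carrier (Hom PC m n) \<longrightarrow>
      (a \<oplus>\<^bsub>class_ring\<^esub> b) \<odot>\<^bsub>Hom PC m n\<^esub> v = a \<odot>\<^bsub>Hom PC m n\<^esub> v \<oplus>\<^bsub>Hom PC m n\<^esub> b \<odot>\<^bsub>Hom PC m n\<^esub> v"
    by (auto elim!: carrier_PC_E simp: PC_simps parallel_def del: equalityI intro!: cl_cong pres_eq.scale_add)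
  show "\<forall>a v w. a \<in> carrier class_ring \<and> v \<in> carrier (Hom PC m n) \<and> w \<in> carrier (Hom PC m n) \<longrightarrow>
      a \<odot>\<^bsub>Hom PC m n\<^esub> (v \<oplus>\<^bsub>Hom PC m n\<^esub> w) = a \<odot>\<^bsub>Hom PC m n\<^esub> v \<oplus>\<^bsub>Hom PC m n\<^esub> a \<odot>\<^bsub>Hom PC m n\<^esub> w"
    by (auto elim!: carrier_PC_E simp: PC_simps parallel_def del: equalityI intro!: cl_cong pres_eq.scale_sum)
qed

text \<open>If \<open>n - m = 2 * k\<close>, only the degree \<open>\<pi> * k\<close> can survive;
  if \<open>n - m\<close> is odd, every homogeneous expression vanishes and any \<open>p\<close>
  serves.\<close>

lemma one_degree_vanishes:
  "\<exists>p. \<forall>q. q \<noteq> p \<longrightarrow> (\<forall>f\<in>Hdeg PC q m n. f = \<zero>\<^bsub>Hom PC m n\<^esub>)"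
proof -
  obtain p where p: "\<And>k. int n = int m + 2 * k \<Longrightarrow> p = \<pi> * of_int k"
  proof (cases "\<exists>k. int n = int m + 2 * k")
    case True
    then obtain k where "int n = int m + 2 * k" by blast
    then show ?thesis using that[of "\<pi> * of_int k"] by auto
  qed (use that in blast)
  have "f = \<zero>\<^bsub>Hom PC m n\<^esub>" if "q \<noteq> p" and f: "f \<in> Hdeg PC q m n" for q f
  proof -
    obtain t where t: "f = cl t" "well_typed t" "edom t = m" "ecod t = n" "homogeneous \<pi> t q"
      using f by (rule Hdeg_PC_E)
    then have "t \<simeq> EZero m n" using homogeneous_degree[OF t(5,2)] p \<open>q \<noteq> p\<close> by auto
    then show ?thesis using t cl_cong by (simp add: zero_PC)
  qed
  then show ?thesis by blast
qed

text \<open>Existence comes from a homogeneous representative. Uniqueness is immediate because one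
  of the two homogeneous parts of each morphism space is zero.\<close>

lemma decomposition_PC:
  assumes "f \<in> carrier (Hom PC m n)"
  shows "\<exists>!x. fst x \<in> Hdeg PC 0 m n \<and> snd x \<in> Hdeg PC 1 m n \<and> f = fst x \<oplus>\<^bsub>Hom PC m n\<^esub> snd x"
proof -
  interpret V: vectorspace "class_ring :: 'k ring" "Hom PC m n" by (rule vectorspace_PC)
  have deg: "g \<in> carrier (Hom PC m n)" if "g \<in> Hdeg PC p m n" for g p
    using that by (auto simp: Hdeg_PC carrier_PC)
  have z: "\<zero>\<^bsub>Hom PC m n\<^esub> \<in> Hdeg PC p m n" for p
    by (auto simp: zero_PC intro!: Hdeg_PC_I homogeneous.intros)
  obtain t where t: "f = cl t" "well_typed t" "edom t = m" "ecod t = n"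
    using assms by (rule carrier_PC_E)
  obtain t' q where t': "t \<simeq> t'" "homogeneous \<pi> t' q" using homogeneous_rep[OF t(2)] by blast
  have f: "f \<in> Hdeg PC q m n" using t t' peq_typed[OF t'(1)] cl_cong[OF t'(1)] by (auto intro: Hdeg_PC_I)
  have "\<exists>x. fst x \<in> Hdeg PC 0 m n \<and> snd x \<in> Hdeg PC 1 m n \<and> f = fst x \<oplus>\<^bsub>Hom PC m n\<^esub> snd x"
  proof (cases q)
    case zero
    then show ?thesis using f z[of 1] V.M.r_zero[OF assms] by (intro exI[of _ "(f, \<zero>\<^bsub>Hom PC m n\<^esub>)"]) auto
  next
    case one
    then show ?thesis using f z[of 0] V.M.l_zero[OF assms] by (intro exI[of _ "(\<zero>\<^bsub>Hom PC m n\<^esub>, f)"]) auto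
  qed
  moreover have "x = y"
    if x: "fst x \<in> Hdeg PC 0 m n \<and> snd x \<in> Hdeg PC 1 m n \<and> f = fst x \<oplus>\<^bsub>Hom PC m n\<^esub> snd x"
      and y: "fst y \<in> Hdeg PC 0 m n \<and> snd y \<in> Hdeg PC 1 m n \<and> f = fst y \<oplus>\<^bsub>Hom PC m n\<^esub> snd y" for x y
  proof -
    obtain p where p: "\<And>q g. q \<noteq> p \<Longrightarrow> g \<in> Hdeg PC q m n \<Longrightarrow> g = \<zero>\<^bsub>Hom PC m n\<^esub>"
      using one_degree_vanishes[of m n] by metis
    show ?thesis
    proof (cases p)
      case zero
      then have "snd x = \<zero>\<^bsub>Hom PC m n\<^esub>" "snd y = \<zero>\<^bsub>Hom PC m n\<^esub>" using x y p[of 1] by auto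
      moreover have "fst z = f" if "fst z \<in> Hdeg PC 0 m n" "f = fst z \<oplus>\<^bsub>Hom PC m n\<^esub> snd z"
        "snd z = \<zero>\<^bsub>Hom PC m n\<^esub>" for z
        using V.M.r_zero[OF deg[OF that(1)]] that(2) unfolding that(3) by simp
      ultimately have "fst x = f" "fst y = f" using x y by blast+
      then show ?thesis using \<open>snd x = _\<close> \<open>snd y = _\<close> by (simp add: prod_eq_iff)
    next
      case one
      then have "fst x = \<zero>\<^bsub>Hom PC m n\<^esub>" "fst y = \<zero>\<^bsub>Hom PC m n\<^esub>" using x y p[of 0] by auto
      moreover have "snd z = f" if "snd z \<in> Hdeg PC 1 m n" "f = fst z \<oplus>\<^bsub>Hom PC m n\<^esub> snd z"
        "fst z = \<zero>\<^bsub>Hom PC m n\<^esub>" for z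
        using V.M.l_zero[OF deg[OF that(1)]] that(2) unfolding that(3) by simp
      ultimately have "snd x = f" "snd y = f" using x y by blast+
      then show ?thesis using \<open>fst x = _\<close> \<open>fst y = _\<close> by (simp add: prod_eq_iff)
    qed
  qed
  ultimately show ?thesis by blast
qed

lemma supercategory_PC: "strict_monoidal_supercategory PC"
proof (rule strict_monoidal_supercategory.intro)
  fix m n
  show "vectorspace (class_ring :: 'k ring) (Hom PC m n)" by (rule vectorspace_PC)
next
  fix m n m' n' :: nat
  assume "(m, n) \<noteq> (m', n')"
  moreover have "(m, n) = (m', n')" if f: "f \<in> carrier (Hom PC m n)" "f \<in> carrier (Hom PC m' n')" for f
  proof -
    obtain t where t: "f = cl t" "well_typed t" "edom t = m" "ecod t = n"
      using f(1) by (rule carrier_PC_E)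
    obtain u where u: "f = cl u" "well_typed u" "edom u = m'" "ecod u = n'"
      using f(2) by (rule carrier_PC_E)
    show ?thesis using peq_typed[OF cl_eqD[of t u]] t u by simp
  qed
  ultimately show "carrier (Hom PC m n) \<inter> carrier (Hom PC m' n') = {}" by blast
next
  fix p m n
  interpret V: vectorspace "class_ring :: 'k ring" "Hom PC m n" by (rule vectorspace_PC)
  show "VectorSpace.subspace (class_ring :: 'k ring) (Hdeg PC p m n) (Hom PC m n)"
  proof (intro subspace.intro submodule.intro vectorspace_PC V.module_axioms)
    show "Hdeg PC p m n \<subseteq> carrier (Hom PC m n)" by (auto simp: Hdeg_PC carrier_PC)
    show "\<zero>\<^bsub>Hom PC m n\<^esub> \<in> Hdeg PC p m n" by (auto simp: zero_PC intro!: Hdeg_PC_I homogeneous.intros)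
  next
    fix v w assume "v \<in> Hdeg PC p m n" "w \<in> Hdeg PC p m n"
    then show "v \<oplus>\<^bsub>Hom PC m n\<^esub> w \<in> Hdeg PC p m n"
      by (auto elim!: Hdeg_PC_E simp: PC_simps parallel_def intro!: Hdeg_PC_I homogeneous.intros)
  next
    fix c :: 'k and v assume "v \<in> Hdeg PC p m n"
    then show "c \<odot>\<^bsub>Hom PC m n\<^esub> v \<in> Hdeg PC p m n"
      by (auto elim!: Hdeg_PC_E simp: PC_simps intro!: Hdeg_PC_I homogeneous.intros)
  qed
next
  fix f m n assume "f \<in> carrier (Hom PC m n)"
  then show "\<exists>!x. fst x \<in> Hdeg PC 0 m n \<and> snd x \<in> Hdeg PC 1 m n \<and> f = fst x \<oplus>\<^bsub>Hom PC m n\<^esub> snd x"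
    by (rule decomposition_PC)
next
  fix m
  show "idm PC m \<in> Hdeg PC 0 m m" by (auto simp: id_PC intro!: Hdeg_PC_I homogeneous.intros)
next
  fix f g p q m n l assume "g \<in> Hdeg PC q n l" "f \<in> Hdeg PC p m n"
  then show "g \<cdot>\<^bsub>PC\<^esub> f \<in> Hdeg PC (q + p) m l"
  proof (elim Hdeg_PC_E)
    fix t u assume tu: "g = cl t" "f = cl u" "well_typed t" "well_typed u"
      "homogeneous \<pi> t q" "homogeneous \<pi> u p"
    assume "edom t = n" "ecod t = l" "edom u = m" "ecod u = n"
    then show ?thesis using tu Hdeg_PC_I[OF _ homogeneous.intros(5)[OF tu(5,6)]] by (simp add: cmp_PC)
  qed
next
  fix f m n l assume "f \<in> carrier (Hom PC m n)"
  then show "(\<lambda>g. g \<cdot>\<^bsub>PC\<^esub> f) \<in> linear_maps (Hom PC n l) (Hom PC m l)"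
    by (auto simp: LinearCombinations.module_hom_def PC_simps parallel_def elim!: carrier_PC_E
        del: equalityI intro!: carrier_PC_I cl_cong pres_eq.comp_sum_left pres_eq.comp_scale_left)
next
  fix g n l m assume "g \<in> carrier (Hom PC n l)"
  then show "(\<lambda>f. g \<cdot>\<^bsub>PC\<^esub> f) \<in> linear_maps (Hom PC m n) (Hom PC m l)"
    by (auto simp: LinearCombinations.module_hom_def PC_simps parallel_def elim!: carrier_PC_E
        del: equalityI intro!: carrier_PC_I cl_cong pres_eq.comp_sum_right pres_eq.comp_scale_right)
next
  fix h l j g n f m
  assume "h \<in> carrier (Hom PC l j)" "g \<in> carrier (Hom PC n l)" "f \<in> carrier (Hom PC m n)"
  then show "h \<cdot>\<^bsub>PC\<^esub> g \<cdot>\<^bsub>PC\<^esub> f = h \<cdot>\<^bsub>PC\<^esub> (g \<cdot>\<^bsub>PC\<^esub> f)"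
    by (auto elim!: carrier_PC_E simp: PC_simps del: equalityI intro!: cl_cong pres_eq.comp_assoc)
next
  fix f m n assume "f \<in> carrier (Hom PC m n)"
  then show "idm PC n \<cdot>\<^bsub>PC\<^esub> f = f" "f \<cdot>\<^bsub>PC\<^esub> idm PC m = f"
    by (auto elim!: carrier_PC_E simp: PC_simps del: equalityI intro!: cl_cong pres_eq.comp_id_left pres_eq.comp_id_right)
next
  fix f p m n g q m' n' assume "f \<in> Hdeg PC p m n" "g \<in> Hdeg PC q m' n'"
  then show "f \<boxtimes>\<^bsub>PC\<^esub> g \<in> Hdeg PC (p + q) (m + m') (n + n')"
  proof (elim Hdeg_PC_E)
    fix t u assume tu: "f = cl t" "g = cl u" "well_typed t" "well_typed u"
      "homogeneous \<pi> t p" "homogeneous \<pi> u q"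
    assume "edom t = m" "ecod t = n" "edom u = m'" "ecod u = n'"
    then show ?thesis using tu Hdeg_PC_I[OF _ homogeneous.intros(6)[OF tu(5,6)]] by (simp add: tns_PC)
  qed
next
  fix g m' n' m n assume "g \<in> carrier (Hom PC m' n')"
  then show "(\<lambda>f. f \<boxtimes>\<^bsub>PC\<^esub> g) \<in> linear_maps (Hom PC m n) (Hom PC (m + m') (n + n'))"
    by (auto simp: LinearCombinations.module_hom_def PC_simps parallel_def elim!: carrier_PC_E
        del: equalityI intro!: carrier_PC_I cl_cong pres_eq.tens_sum_left pres_eq.tens_scale_left)
next
  fix f m n m' n' assume "f \<in> carrier (Hom PC m n)"
  then show "(\<lambda>g. f \<boxtimes>\<^bsub>PC\<^esub> g) \<in> linear_maps (Hom PC m' n') (Hom PC (m + m') (n + n'))"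
    by (auto simp: LinearCombinations.module_hom_def PC_simps parallel_def elim!: carrier_PC_E
        del: equalityI intro!: carrier_PC_I cl_cong pres_eq.tens_sum_right pres_eq.tens_scale_right)
next
  fix f m n g m' n' h m'' n''
  assume "f \<in> carrier (Hom PC m n)" "g \<in> carrier (Hom PC m' n')" "h \<in> carrier (Hom PC m'' n'')"
  then show "f \<boxtimes>\<^bsub>PC\<^esub> g \<boxtimes>\<^bsub>PC\<^esub> h = f \<boxtimes>\<^bsub>PC\<^esub> (g \<boxtimes>\<^bsub>PC\<^esub> h)"
    by (auto elim!: carrier_PC_E simp: PC_simps del: equalityI intro!: cl_cong pres_eq.tens_assoc)
next
  fix f m n assume "f \<in> carrier (Hom PC m n)"
  then show "idm PC 0 \<boxtimes>\<^bsub>PC\<^esub> f = f" "f \<boxtimes>\<^bsub>PC\<^esub> idm PC 0 = f"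
    by (auto elim!: carrier_PC_E simp: PC_simps del: equalityI intro!: cl_cong pres_eq.tens_unit_left pres_eq.tens_unit_right)
next
  fix m n
  show "idm PC m \<boxtimes>\<^bsub>PC\<^esub> idm PC n = idm PC (m + n)"
    by (auto simp: PC_simps del: equalityI intro!: cl_cong pres_eq.tens_id)
next
  fix f n l g q n' l' h p m k m'
  assume "f \<in> carrier (Hom PC n l)" "g \<in> Hdeg PC q n' l'" "h \<in> Hdeg PC p m n" "k \<in> carrier (Hom PC m' n')"
  then show "(f \<boxtimes>\<^bsub>PC\<^esub> g) \<cdot>\<^bsub>PC\<^esub> (h \<boxtimes>\<^bsub>PC\<^esub> k) =
      koszul_sign q p \<odot>\<^bsub>Hom PC (m + m') (l + l')\<^esub> ((f \<cdot>\<^bsub>PC\<^esub> h) \<boxtimes>\<^bsub>PC\<^esub> (g \<cdot>\<^bsub>PC\<^esub> k))"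
    by (auto elim!: carrier_PC_E Hdeg_PC_E simp: PC_simps del: equalityI intro!: cl_cong pres_eq.interchange)
qed

lemma interp_PC: "well_typed t \<Longrightarrow> interp PC (cl EH) (cl EA) (cl EU) t = cl t"
  by (induction t) (auto simp: PC_simps)

lemma generators_PC: "supercategory_generators PC (cl EH) (cl EA) (cl EU) \<pi>"
  by (intro supercategory_generators.intro supercategory_generators_axioms.intro supercategory_PC)
    (auto intro!: Hdeg_PC_I homogeneous.intros)

lemma generated_cl:
  "well_typed t \<Longrightarrow> generated PC (cl EH) (cl EA) (cl EU) (edom t) (ecod t) (cl t)"
proof (induction t)
  case EH
  show ?case using generated.intros(1) by simp
next
  case EA
  show ?case using generated.intros(2) by simp
next
  case EU
  show ?case using generated.intros(3) by simp
next
  case (EId n)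
  show ?case using generated.intros(4)[of PC _ _ _ n] by (simp add: id_PC)
next
  case (ECmp t u)
  then show ?case
    using generated.intros(5)[of PC "cl EH" "cl EA" "cl EU" "edom t" "ecod t" "cl t" "edom u" "cl u"]
    by (simp add: PC_simps)
next
  case (ETns t u)
  then show ?case
    using generated.intros(6)[of PC "cl EH" "cl EA" "cl EU" "edom t" "ecod t" "cl t" "edom u" "ecod u" "cl u"]
    by (simp add: PC_simps)
next
  case (EZero m n)
  show ?case using generated.intros(7)[of PC _ _ _ m n] by (simp add: zero_PC)
next
  case (ESum t u)
  then show ?case
    using generated.intros(8)[of PC "cl EH" "cl EA" "cl EU" "edom t" "ecod t" "cl t" "cl u"]
    by (simp add: PC_simps parallel_def)
next
  case (EScl c t)
  then show ?case
    using generated.intros(9)[of PC "cl EH" "cl EA" "cl EU" "edom t" "ecod t" "cl t" c]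
    by (simp add: PC_simps)
qed

end

section \<open>Standard expressions as words\<close>

text \<open>The word of $I_s$ with positions counted from zero: a cup is created at \<open>p\<close>
  and \<open>p + 1\<close>, and its right end is then carried to \<open>p + s + 1\<close> by
  \<open>s\<close> crossings.\<close>

primrec arcw :: "nat \<Rightarrow> nat \<Rightarrow> letter list" where
  "arcw p 0 = [LU p]"
| "arcw p (Suc s) = LS (Suc (p + s)) # arcw p s"

primrec coarcw :: "nat \<Rightarrow> nat \<Rightarrow> letter list" where
  "coarcw p 0 = [LA p]"
| "coarcw p (Suc s) = coarcw p s @ [LS (Suc (p + s))]"

fun iword :: "(nat \<times> nat) list \<Rightarrow> letter list" where
  "iword [] = []"
| "iword ((p, s) # xs) = arcw (p - 1) s @ iword xs"

fun jword :: "(nat \<times> nat) list \<Rightarrow> letter list" where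
  "jword [] = []"
| "jword ((p, s) # ys) = jword ys @ coarcw (p - 1) s"

definition sword :: "nat list \<Rightarrow> letter list" where
  "sword w = map (\<lambda>i. LS (i - 1)) w"

lemma sword_simps [simp]:
  "sword [] = []" "sword (i # w) = LS (i - 1) # sword w" "sword (v @ w) = sword v @ sword w"
  by (simp_all add: sword_def)

fun stdword :: "nat \<times> (nat \<times> nat) list \<times> nat list \<times> (nat \<times> nat) list \<Rightarrow> letter list" where
  "stdword (r, xs, w, ys) = iword xs @ sword w @ jword ys"

lemma arcw_valid: "p + s \<le> n \<Longrightarrow> vld n (arcw p s) \<and> cd n (arcw p s) = n + 2"
  by (induction s) auto

lemma coarcw_valid: "p + s \<le> n \<Longrightarrow> vld (Suc (Suc n)) (coarcw p s) \<and> cd (Suc (Suc n)) (coarcw p s) = n"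
  by (induction s) auto

lemma iword_valid: "arc_word r xs \<Longrightarrow> vld r (iword xs) \<and> cd r (iword xs) = r + 2 * length xs"
proof (induction xs rule: iword.induct)
  case (2 p s xs)
  then show ?case using arcw_valid[of "p - 1" s "r + 2 * length xs"] by auto
qed auto

lemma jword_valid:
  "arc_word r ys \<Longrightarrow> vld (r + 2 * length ys) (jword ys) \<and> cd (r + 2 * length ys) (jword ys) = r"
proof (induction ys rule: jword.induct)
  case (2 p s ys)
  then show ?case using coarcw_valid[of "p - 1" s "r + 2 * length ys"] by auto
qed auto

lemma sword_valid: "set w \<subseteq> {1..<r} \<Longrightarrow> vld r (sword w) \<and> cd r (sword w) = r"
  by (induction w) auto

context supercategory_generators
begin

lemma gen_s_interp: "1 \<le> i \<Longrightarrow> gen_s C H n i = I (lev (LS (i - 1)) n)"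
  by (simp add: gen_s_def lev_def)

lemma gen_u_interp: "1 \<le> i \<Longrightarrow> i \<le> n + 1 \<Longrightarrow> gen_u C U n i = I (lev (LU (i - 1)) n)"
  by (cases i) (simp_all add: gen_u_def lev_def)

lemma gen_a_interp: "1 \<le> i \<Longrightarrow> i \<le> n + 1 \<Longrightarrow> gen_a C A n i = I (lev (LA (i - 1)) (n + 2))"
  by (cases i) (simp_all add: gen_a_def lev_def)

lemma cup_interp: "1 \<le> p \<Longrightarrow> p + s \<le> n + 1 \<Longrightarrow> cup_I C H U n p s = I (ev n (arcw (p - 1) s))"
proof (induction s)
  case 0
  then show ?case using interp_ev_single[of "LU (p - 1)" n] gen_u_interp[of p n] by simp
next
  case (Suc s)
  then have "cd n (arcw (p - 1) s) = n + 2" "p - 1 + s = p + s - 1" using arcw_valid[of "p - 1" s n] by auto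
  then show ?case using Suc gen_s_interp[of "p + Suc s" "n + 2"] by simp
qed

lemma cap_interp:
  "1 \<le> p \<Longrightarrow> p + s \<le> n + 1 \<Longrightarrow> cap_J C H A n p s = I (ev (Suc (Suc n)) (coarcw (p - 1) s))"
proof (induction s)
  case 0
  then show ?case using interp_ev_single[of "LA (p - 1)" "n + 2"] gen_a_interp[of p n] by simp
next
  case (Suc s)
  have 1: "gen_s C H (Suc (Suc n)) (Suc (p + s)) = I (ev (Suc (Suc n)) [LS (p + s)])"
    using Suc gen_s_interp[of "p + Suc s" "n + 2"] interp_ev_single[of "LS (p + s)" "n + 2"] by simp
  have 2: "Suc (p - 1 + s) = p + s" using Suc by simp
  show ?case
    using Suc coarcw_valid[of "p - 1" s n] interp_ev_append[of "Suc (Suc n)" "coarcw (p - 1) s" "[LS (p + s)]"]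
    by (simp add: 1 2 del: ev.simps)
qed

lemma eval_I_interp: "arc_word r xs \<Longrightarrow> eval_I C H U r xs = I (ev r (iword xs))"
proof (induction xs rule: iword.induct)
  case (2 p s xs)
  have v: "vld r (iword ((p, s) # xs))" using iword_valid[OF 2(2)] by simp
  show ?case
    using 2 iword_valid[of r xs] cup_interp[of p s "r + 2 * length xs"]
      interp_ev_append[of r "arcw (p - 1) s" "iword xs"] v
    by simp
qed simp

lemma eval_J_interp: "arc_word r ys \<Longrightarrow> eval_J C H A r ys = I (ev (r + 2 * length ys) (jword ys))"
proof (induction ys rule: jword.induct)
  case (2 p s ys)
  have v: "vld (Suc (Suc (r + 2 * length ys))) (jword ((p, s) # ys))" using jword_valid[OF 2(2)] by simp
  have "p - 1 + s \<le> r + 2 * length ys" using 2(2) by auto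
  then show ?case
    using 2 coarcw_valid[of "p - 1" s "r + 2 * length ys"] cap_interp[of p s "r + 2 * length ys"]
      interp_ev_append[of "Suc (Suc (r + 2 * length ys))" "jword ys" "coarcw (p - 1) s"] v
    by simp
qed simp

lemma eval_H_interp: "set w \<subseteq> {1..<r} \<Longrightarrow> eval_H C H r w = I (ev r (sword w))"
proof (induction w)
  case (Cons i w)
  then show ?case using sword_valid[of w r] gen_s_interp[of i r] by simp
qed simp

lemma eval_standard_interp:
  assumes "arc_word r xs" "set w \<subseteq> {1..<r}" "arc_word r ys"
  shows "eval_standard C H A U (r, xs, w, ys) = I (ev (r + 2 * length ys) (stdword (r, xs, w, ys)))"
proof -
  let ?m = "r + 2 * length ys"
  note v = iword_valid[OF assms(1)] sword_valid[OF assms(2)] jword_valid[OF assms(3)]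
  have in1: "I (ev r (iword xs)) \<in> carrier (Hom C r (r + 2 * length xs))"
    and in2: "I (ev r (sword w)) \<in> carrier (Hom C r r)"
    and in3: "I (ev ?m (jword ys)) \<in> carrier (Hom C ?m r)"
    using v by (auto intro!: interp_in')
  have "I (ev ?m (stdword (r, xs, w, ys))) = I (ev r (iword xs)) \<cdot> (I (ev r (sword w)) \<cdot> I (ev ?m (jword ys)))"
    using v interp_ev_append[of ?m "iword xs" "sword w @ jword ys"] interp_ev_append[of ?m "sword w" "jword ys"]
    by simp
  also have "\<dots> = I (ev r (iword xs)) \<cdot> I (ev r (sword w)) \<cdot> I (ev ?m (jword ys))"
    by (rule comp_assoc[OF in1 in2 in3, symmetric])
  finally show ?thesis
    using eval_I_interp eval_J_interp eval_H_interp assms by simp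
qed

end

lemma word_perm_permutes: "set w \<subseteq> {1..<r} \<Longrightarrow> word_perm w permutes {1..r}"
proof (induction w)
  case Nil
  then show ?case using permutes_id by (simp add: id_def)
next
  case (Cons i w)
  have "Transposition.transpose i (i + 1) permutes {1..r}" using Cons by (intro permutes_swap_id) auto
  then show ?case unfolding word_perm.simps using Cons by (intro permutes_compose) auto
qed

lemma word_choice_word:
  assumes "word_choice W" "\<sigma> permutes {1..r}"
  obtains w where "w \<in> W r" "word_perm w = \<sigma>" "set w \<subseteq> {1..<r}"
  using assms unfolding word_choice_def reduced_word_def by blast

lemma word_choice_subset: "word_choice W \<Longrightarrow> w \<in> W r \<Longrightarrow> set w \<subseteq> {1..<r}"
  unfolding word_choice_def reduced_word_def by blast

text \<open>Reducedness compares the chosen word with the empty one and forces length zero. Together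
  with the next lemma this names the small standard expressions without knowing
  \<open>W\<close>.\<close>

lemma word_choice_Nil:
  assumes "word_choice W"
  shows "[] \<in> W r"
proof -
  obtain w where w: "w \<in> W r" "word_perm w = id"
    by (rule word_choice_word[OF assms, of id r]) (auto simp: permutes_id)
  then have "length w \<le> length ([] :: nat list)"
    using assms unfolding word_choice_def reduced_word_def
    by (metis empty_subsetI list.set(1) word_perm.simps(1))
  then show ?thesis using w by simp
qed

text \<open>The chosen word has length at most one by comparison with \<open>[1]\<close>, is
  nonempty because its permutation moves 1, and has only the letter 1 at its disposal.\<close>

lemma word_choice_transposition:
  assumes "word_choice W"
  shows "[1] \<in> W 2"
proof -
  obtain w where w: "w \<in> W 2" "word_perm w = Transposition.transpose 1 2" "set w \<subseteq> {1..<2}"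
    by (rule word_choice_word[OF assms permutes_swap_id, of 1 2 2]) auto
  then have "length w \<le> length [1::nat]"
  proof -
    have "reduced_word 2 w" using assms w(1) unfolding word_choice_def by blast
    moreover have "word_perm [1] = word_perm w" using w(2) by (simp add: numeral_2_eq_2)
    ultimately show ?thesis
      unfolding reduced_word_def by (auto dest!: spec[of _ "[1]"] simp: numeral_2_eq_2)
  qed
  moreover have "w \<noteq> []" using fun_cong[OF w(2), of 1] by auto
  ultimately obtain a where "w = [a]" by (cases w) auto
  moreover from this have "a = 1" using w(3) by auto
  ultimately show ?thesis using w(1) by simp
qed

lemma standard_expressions_evaluation:
  assumes "word_choice W" "supercategory_generators C H A U \<pi>" "x \<in> standard_expressions W m n"
  shows "eval_standard C H A U x = interp C H A U (ev m (stdword x))"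
    and "vld m (stdword x)" "cd m (stdword x) = n"
proof -
  interpret supercategory_generators C H A U \<pi> by (rule assms(2))
  obtain r xs w ys where x: "x = (r, xs, w, ys)" "arc_word r xs" "n = r + 2 * length xs" "w \<in> W r"
    "arc_word r ys" "m = r + 2 * length ys"
    using assms(3) by (cases x) (auto simp: standard_expressions_def)
  then have w: "set w \<subseteq> {1..<r}" using word_choice_subset[OF assms(1)] by blast
  show "eval_standard C H A U x = interp C H A U (ev m (stdword x))"
    using eval_standard_interp[OF x(2) w x(5)] x by simp
  show "vld m (stdword x)" "cd m (stdword x) = n"
    using iword_valid[OF x(2)] sword_valid[OF w] jword_valid[OF x(5)] x by auto
qed

section \<open>The parameters of a category of Brauer type\<close>

text \<open>The value at \<open>x\<close> is the \<open>k\<close> in \<open>x = k b + w\<close> with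
  \<open>w\<close> in the span of \<open>B - {b}\<close>. Two such representations with different
  \<open>k\<close> would put \<open>b\<close> into that span; the vectors having a representation
  form a submodule containing \<open>B\<close>, hence are all vectors.\<close>

lemma coordinate_functional:
  fixes V :: "('k::field, 'f) module"
  assumes vs: "vectorspace (class_ring :: 'k ring) V"
    and basis: "vectorspace.basis (class_ring :: 'k ring) V B" and b: "b \<in> B"
  obtains \<psi> :: "'f \<Rightarrow> 'k" where
    "\<And>x y. x \<in> carrier V \<Longrightarrow> y \<in> carrier V \<Longrightarrow> \<psi> (x \<oplus>\<^bsub>V\<^esub> y) = \<psi> x + \<psi> y"
    "\<And>c x. x \<in> carrier V \<Longrightarrow> \<psi> (c \<odot>\<^bsub>V\<^esub> x) = c * \<psi> x"
    "\<psi> b = 1" "\<And>b'. b' \<in> B \<Longrightarrow> b' \<noteq> b \<Longrightarrow> \<psi> b' = 0"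
proof -
  interpret V: vectorspace "class_ring :: 'k ring" V by (rule vs)
  have indep: "V.lin_indpt B" and gen: "V.span B = carrier V" and B: "B \<subseteq> carrier V"
    using basis V.basis_def by auto
  let ?W = "V.span (B - {b})"
  have sub: "submodule (class_ring :: 'k ring) ?W V" using B by (intro V.span_is_submodule) auto
  interpret W: submodule "class_ring :: 'k ring" ?W V by (rule sub)
  have bV: "b \<in> carrier V" using B b by auto
  have bW: "b \<notin> ?W"
  proof
    assume "b \<in> ?W"
    moreover have "V.lin_indpt (B - {b})" using indep V.subset_li_is_li by blast
    ultimately have "V.lin_dep ((B - {b}) \<union> {b})"
      using V.lin_dep_iff_in_span[of "B - {b}" b] B bV by auto
    then show False using indep b by (simp add: insert_absorb)
  qed
  have WV: "w \<in> carrier V" if "w \<in> ?W" for w using W.subset that by auto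
  let ?rep = "\<lambda>x k. \<exists>w\<in>?W. x = k \<odot>\<^bsub>V\<^esub> b \<oplus>\<^bsub>V\<^esub> w"
  have uniq: "k = k'" if reps: "?rep x k" "?rep x k'" for x k k'
  proof (rule ccontr)
    assume "k \<noteq> k'"
    obtain w w' where w: "w \<in> ?W" "w' \<in> ?W"
      and eq: "k \<odot>\<^bsub>V\<^esub> b \<oplus>\<^bsub>V\<^esub> w = k' \<odot>\<^bsub>V\<^esub> b \<oplus>\<^bsub>V\<^esub> w'"
      using reps by auto
    let ?d = "k - k'" and ?kb = "k \<odot>\<^bsub>V\<^esub> b" and ?k'b = "k' \<odot>\<^bsub>V\<^esub> b" and ?m = "(- k') \<odot>\<^bsub>V\<^esub> b"
    have c: "?kb \<in> carrier V" "?k'b \<in> carrier V" "?m \<in> carrier V" "w \<in> carrier V" "w' \<in> carrier V"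
      using bV w WV V.smult_closed by auto
    have "?d \<odot>\<^bsub>V\<^esub> b = ?kb \<oplus>\<^bsub>V\<^esub> ?m" using V.smult_l_distr[of k "- k'" b] bV by simp
    then have "?d \<odot>\<^bsub>V\<^esub> b \<oplus>\<^bsub>V\<^esub> w = ?m \<oplus>\<^bsub>V\<^esub> (?kb \<oplus>\<^bsub>V\<^esub> w)"
      using c V.M.add.m_ac by simp
    also have "\<dots> = (?m \<oplus>\<^bsub>V\<^esub> ?k'b) \<oplus>\<^bsub>V\<^esub> w'" using eq c V.M.add.m_ac by simp
    also have "?m \<oplus>\<^bsub>V\<^esub> ?k'b = \<zero>\<^bsub>V\<^esub>"
      using V.smult_l_distr[of "- k'" k' b] V.lmult_0[of b] bV by simp
    finally have "?d \<odot>\<^bsub>V\<^esub> b \<oplus>\<^bsub>V\<^esub> w = w'" using c by simp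
    then have "?d \<odot>\<^bsub>V\<^esub> b = w' \<ominus>\<^bsub>V\<^esub> w"
      using c bV V.smult_closed[of ?d b] V.M.add.inv_solve_right[of "?d \<odot>\<^bsub>V\<^esub> b" w' w]
      by (simp add: a_minus_def)
    moreover have "w' \<ominus>\<^bsub>V\<^esub> w = w' \<oplus>\<^bsub>V\<^esub> (- 1) \<odot>\<^bsub>V\<^esub> w"
      using V.smult_minus_1[of w] c by (simp add: a_minus_def class_ring_simps)
    ultimately have "?d \<odot>\<^bsub>V\<^esub> b \<in> ?W" using w W.m_closed W.smult_closed by simp
    then have "inverse ?d \<odot>\<^bsub>V\<^esub> (?d \<odot>\<^bsub>V\<^esub> b) \<in> ?W" using W.smult_closed by simp
    then show False
      using V.smult_assoc1[of "inverse ?d" ?d b] V.smult_one[of b] bV bW \<open>k \<noteq> k'\<close> by simp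
  qed
  have rep_zero: "w = 0 \<odot>\<^bsub>V\<^esub> b \<oplus>\<^bsub>V\<^esub> w" if "w \<in> ?W" for w
    using V.lmult_0[of b] bV WV[OF that] by simp
  have rep_add: "?rep (x \<oplus>\<^bsub>V\<^esub> y) (k + l)" if reps: "?rep x k" "?rep y l" for x y k l
  proof -
    obtain w v where w: "w \<in> ?W" "v \<in> ?W" and eq: "x = k \<odot>\<^bsub>V\<^esub> b \<oplus>\<^bsub>V\<^esub> w" "y = l \<odot>\<^bsub>V\<^esub> b \<oplus>\<^bsub>V\<^esub> v"
      using reps by auto
    have "k \<odot>\<^bsub>V\<^esub> b \<in> carrier V" "l \<odot>\<^bsub>V\<^esub> b \<in> carrier V" using bV V.smult_closed by auto
    then have "x \<oplus>\<^bsub>V\<^esub> y = (k + l) \<odot>\<^bsub>V\<^esub> b \<oplus>\<^bsub>V\<^esub> (w \<oplus>\<^bsub>V\<^esub> v)"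
      using V.smult_l_distr[of k l b] bV WV[OF w(1)] WV[OF w(2)] V.M.add.m_ac eq by simp
    then show ?thesis using w by auto
  qed
  have rep_smult: "?rep (c \<odot>\<^bsub>V\<^esub> x) (c * k)" if reps: "?rep x k" for c x k
  proof -
    obtain w where w: "w \<in> ?W" and eq: "x = k \<odot>\<^bsub>V\<^esub> b \<oplus>\<^bsub>V\<^esub> w" using reps by auto
    have "k \<odot>\<^bsub>V\<^esub> b \<in> carrier V" using bV V.smult_closed by auto
    then have "c \<odot>\<^bsub>V\<^esub> x = (c * k) \<odot>\<^bsub>V\<^esub> b \<oplus>\<^bsub>V\<^esub> c \<odot>\<^bsub>V\<^esub> w"
      using V.smult_r_distr[of c "k \<odot>\<^bsub>V\<^esub> b" w] V.smult_assoc1[of c k b] bV WV[OF w] eq by simp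
    then show ?thesis using W.smult_closed[of c w] w by auto
  qed
  have repb: "?rep b 1" using bV W.zero_closed V.smult_one[of b] by (intro bexI[of _ "\<zero>\<^bsub>V\<^esub>"]) auto
  have in_B: "\<exists>k. ?rep x k" if "x \<in> B" for x
  proof (cases "x = b")
    case False
    then have "x \<in> ?W" using that B V.in_own_span[of "B - {b}"] by auto
    then show ?thesis using rep_zero by blast
  qed (use repb in blast)
  have "submodule (class_ring :: 'k ring) {x \<in> carrier V. \<exists>k. ?rep x k} V"
  proof (intro submodule.intro V.module_axioms)
    show "\<zero>\<^bsub>V\<^esub> \<in> {x \<in> carrier V. \<exists>k. ?rep x k}"
      using rep_zero[of "\<zero>\<^bsub>V\<^esub>"] W.zero_closed by blast
  next
    fix v w assume "v \<in> {x \<in> carrier V. \<exists>k. ?rep x k}" "w \<in> {x \<in> carrier V. \<exists>k. ?rep x k}"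
    then show "v \<oplus>\<^bsub>V\<^esub> w \<in> {x \<in> carrier V. \<exists>k. ?rep x k}" 
      unfolding mem_Collect_eq using rep_add V.M.add.m_closed by meson
  next
    fix c :: 'k and v assume "v \<in> {x \<in> carrier V. \<exists>k. ?rep x k}"
    then show "c \<odot>\<^bsub>V\<^esub> v \<in> {x \<in> carrier V. \<exists>k. ?rep x k}" 
      unfolding mem_Collect_eq using rep_smult V.smult_closed by (metis UNIV_I partial_object.select_convs(1))
  qed auto
  then have "V.span B \<subseteq> {x \<in> carrier V. \<exists>k. ?rep x k}"
    using in_B B by (intro V.span_is_subset) auto
  then have ex: "\<exists>k. ?rep x k" if "x \<in> carrier V" for x using gen that by auto
  define \<psi> where "\<psi> x = (THE k. ?rep x k)" for x
  have psi: "\<psi> x = k" if "?rep x k" for x k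
    unfolding \<psi>_def using that uniq by (intro the_equality) blast+
  show ?thesis
  proof
    fix x y assume "x \<in> carrier V" "y \<in> carrier V"
    then obtain k l where "?rep x k" "?rep y l" using ex by meson
    then show "\<psi> (x \<oplus>\<^bsub>V\<^esub> y) = \<psi> x + \<psi> y" using psi rep_add by metis
  next
    fix c x assume "x \<in> carrier V"
    then obtain k where "?rep x k" using ex by meson
    then show "\<psi> (c \<odot>\<^bsub>V\<^esub> x) = c * \<psi> x" using psi rep_smult by metis
  next
    show "\<psi> b = 1" using psi repb by blast
  next
    fix b' assume "b' \<in> B" "b' \<noteq> b"
    then have "b' \<in> ?W" using B V.in_own_span[of "B - {b}"] by auto
    then have "?rep b' 0" using rep_zero by blast
    then show "\<psi> b' = 0" by (rule psi)
  qed
qed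


text \<open>A linear functional on one morphism space turns each relation in context into an
  equation between scalars. Taking it to be a coordinate of the standard basis later compares
  coefficients.\<close>

locale supercategory_functional = supercategory_generators C H A U \<pi>
  for C :: "('k::field, 'f) supercat" (structure) and H A U \<pi> +
  fixes P :: "'k params" and m n :: nat and \<psi> :: "'f \<Rightarrow> 'k"
  assumes sat: "satisfies C H A U (defining_relations P)"
    and psi_add: "\<lbrakk>x \<in> carrier (Hom C m n); y \<in> carrier (Hom C m n)\<rbrakk>
      \<Longrightarrow> \<psi> (x \<oplus>\<^bsub>Hom C m n\<^esub> y) = \<psi> x + \<psi> y"
    and psi_smult: "x \<in> carrier (Hom C m n) \<Longrightarrow> \<psi> (c \<odot>\<^bsub>Hom C m n\<^esub> x) = c * \<psi> x"
begin

sublocale B: brauer_presentation \<pi> P .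

definition val :: "letter list \<Rightarrow> 'k" where
  "val w = \<psi> (I (ev m w))"

lemma psi_comb: "vlds m n cs \<Longrightarrow> \<psi> (I (comb m n cs)) = (\<Sum>(c, w)\<leftarrow>cs. c * val w)"
proof (induction cs)
  case Nil
  have "\<psi> \<zero>\<^bsub>Hom C m n\<^esub> = 0"
    using psi_smult[of "\<zero>\<^bsub>Hom C m n\<^esub>" 0] V.lmult_0[of "\<zero>\<^bsub>Hom C m n\<^esub>" m n] by simp
  then show ?case by simp
next
  case (Cons cw cs)
  obtain c w where cw: "cw = (c, w)" by force
  have "I (ev m w) \<in> carrier (Hom C m n)" "I (comb m n cs) \<in> carrier (Hom C m n)"
    using Cons.prems by (auto simp: cw intro!: interp_in')
  then show ?case
    using Cons psi_add[of "c \<odot>\<^bsub>Hom C m n\<^esub> I (ev m w)" "I (comb m n cs)"]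
      psi_smult[of "I (ev m w)" c] V.smult_closed[of c "I (ev m w)" m n]
    by (simp add: cw val_def)
qed

lemma val_relation:
  assumes loc: "pres_eq \<pi> (defining_relations P) (ev m0 w0) (comb m0 n0 cs)"
    and v0: "vld m0 w0" "cd m0 w0 = n0" "vlds m0 n0 cs"
    and v: "vld m (x @ sh a w0 @ y)" "a + m0 \<le> cd m y" "cd m (x @ sh a w0 @ y) = n"
  shows "val (x @ sh a w0 @ y) = (\<Sum>(c, w)\<leftarrow>cs. c * val (x @ sh a w @ y))"
proof -
  let ?cs = "map (\<lambda>(c, w). (c, x @ sh a w @ y)) cs"
  have eq: "pres_eq \<pi> (defining_relations P) (ev m (x @ sh a w0 @ y)) (comb m n ?cs)"
    using B.lift_relation[OF loc v0 v(1,2)] v(3) by simp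
  obtain b where b: "cd m y = a + m0 + b" using v(2) le_iff_add by metis
  have "vlds m n ?cs"
    using v0 v b vld_sh[of m0 _ a b] by (auto simp: vlds_def)
  then show ?thesis
    using interp_sound[OF eq sat] psi_comb[of ?cs] by (simp add: val_def comp_def case_prod_unfold)
qed

lemma val_HU:
  assumes "vld m (x @ [LS a, LU a] @ y)" "cd m (x @ [LS a, LU a] @ y) = n"
  shows "val (x @ [LS a, LU a] @ y) = par_lam P * val (x @ [LU a] @ y)"
  using val_relation[OF B.rel_HU, of x a y] assms by simp

lemma val_AH:
  assumes "vld m (x @ [LA a, LS a] @ y)" "cd m (x @ [LA a, LS a] @ y) = n"
  shows "val (x @ [LA a, LS a] @ y) = par_lam' P * val (x @ [LA a] @ y)"
  using val_relation[OF B.rel_AH, of x a y] assms by simp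

lemma val_AU:
  assumes "vld m (x @ [LA a, LU a] @ y)" "cd m (x @ [LA a, LU a] @ y) = n"
  shows "val (x @ [LA a, LU a] @ y) = par_delta P * val (x @ y)"
  using val_relation[OF B.rel_AU, of x a y] assms by simp

lemma val_sig:
  assumes "vld m (x @ [LA a, LU (a + 1)] @ y)" "cd m (x @ [LA a, LU (a + 1)] @ y) = n"
  shows "val (x @ [LA a, LU (a + 1)] @ y) = par_sig P * val (x @ y)"
  using val_relation[OF B.rel_sig, of x a y] assms by simp

lemma val_sig':
  assumes "vld m (x @ [LA (a + 1), LU a] @ y)" "cd m (x @ [LA (a + 1), LU a] @ y) = n"
  shows "val (x @ [LA (a + 1), LU a] @ y) = par_sig' P * val (x @ y)"
  using val_relation[OF B.rel_sig', of x a y] assms by simp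

lemma val_rho:
  assumes "vld m (x @ [LA a, LS (a + 1), LU a] @ y)" "cd m (x @ [LA a, LS (a + 1), LU a] @ y) = n"
  shows "val (x @ [LA a, LS (a + 1), LU a] @ y) = par_rho P * val (x @ y)"
  using val_relation[OF B.rel_rho, of x a y] assms by simp

lemma val_HH:
  assumes "vld m (x @ [LS a, LS a] @ y)" "cd m (x @ [LS a, LS a] @ y) = n"
  shows "val (x @ [LS a, LS a] @ y) =
    par_a P * val (x @ y) + par_b P * val (x @ [LS a] @ y) + par_c P * val (x @ [LU a, LA a] @ y)"
  using val_relation[OF B.rel_HH, of x a y] assms by (simp add: add.assoc)

lemma val_HU_slide:
  assumes "vld m (x @ [LS a, LU (a + 1)] @ y)" "cd m (x @ [LS a, LU (a + 1)] @ y) = n"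
  shows "val (x @ [LS a, LU (a + 1)] @ y) =
    par_d P * val (x @ [LU a] @ y) + par_e P * val (x @ [LS (a + 1), LU a] @ y) +
    par_f P * val (x @ [LU (a + 1)] @ y)"
  using val_relation[OF B.rel_HU_slide, of x a y] assms by (simp add: add.assoc)

lemma val_HHU:
  assumes "vld m (x @ [LS a, LS (a + 1), LU a] @ y)" "cd m (x @ [LS a, LS (a + 1), LU a] @ y) = n"
  shows "val (x @ [LS a, LS (a + 1), LU a] @ y) =
    par_D P * val (x @ [LU a] @ y) + par_E P * val (x @ [LS (a + 1), LU a] @ y) +
    par_F P * val (x @ [LU (a + 1)] @ y)"
  using val_relation[OF B.rel_HHU, of x a y] assms by (simp add: add.assoc)

lemma val_AH_slide:
  assumes "vld m (x @ [LA (a + 1), LS a] @ y)" "cd m (x @ [LA (a + 1), LS a] @ y) = n"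
  shows "val (x @ [LA (a + 1), LS a] @ y) =
    par_d' P * val (x @ [LA a] @ y) + par_e' P * val (x @ [LA a, LS (a + 1)] @ y) +
    par_f' P * val (x @ [LA (a + 1)] @ y)"
proof -
  have "a + 3 \<le> cd m y" using assms(1) by auto
  then show ?thesis using val_relation[OF B.rel_AH_slide, of x a y] assms by (simp add: add.assoc)
qed

lemma val_AHH:
  assumes "vld m (x @ [LA a, LS (a + 1), LS a] @ y)" "cd m (x @ [LA a, LS (a + 1), LS a] @ y) = n"
  shows "val (x @ [LA a, LS (a + 1), LS a] @ y) =
    par_D' P * val (x @ [LA a] @ y) + par_E' P * val (x @ [LA a, LS (a + 1)] @ y) +
    par_F' P * val (x @ [LA (a + 1)] @ y)"
proof -
  have "a + 3 \<le> cd m y" using assms(1) by auto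
  then show ?thesis using val_relation[OF B.rel_AHH, of x a y] assms by (simp add: add.assoc)
qed

lemma val_braid:
  assumes "vld m (x @ [LS a, LS (a + 1), LS a] @ y)" "cd m (x @ [LS a, LS (a + 1), LS a] @ y) = n"
  shows "val (x @ [LS a, LS (a + 1), LS a] @ y) = val (x @ [LS (a + 1), LS a, LS (a + 1)] @ y)"
proof -
  have "a + 3 \<le> cd m y" using assms(1) by auto
  then show ?thesis using val_relation[OF B.rel_braid, of x a y] assms by simp
qed

lemma val_far:
  assumes "vld m (xs @ sh a [x, shl (ldom x + c) y] @ ys)" "cd m (xs @ sh a [x, shl (ldom x + c) y] @ ys) = n"
    and "lpos x = 0" "lpos y = 0"
  shows "val (xs @ sh a [x, shl (ldom x + c) y] @ ys) =
    koszul_sign (ldeg \<pi> y) (ldeg \<pi> x) * val (xs @ sh a [shl (lcod x + c) y, x] @ ys)"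
  using val_relation[OF B.word_far_commute'[OF assms(3,4), of c], of xs a ys] assms by auto

end

section \<open>Equations obtained by evaluating short words in two ways\<close>

context supercategory_functional
begin

text \<open>The values \<open>p\<close>, \<open>q\<close>, \<open>r\<close> belong to the three
  standard expressions of type (1,3). The first equation evaluates two crossings after
  \<open>I \<otimes> U\<close>; the other two evaluate both sides of the braid relation after
  \<open>U \<otimes> I\<close> and after \<open>I \<otimes> U\<close>.\<close>

lemma equations_1_3:
  assumes "m = 1" "n = 3" "par_d P = 0" "par_f P = 0"
  defines "p \<equiv> val [LU 0]" and "q \<equiv> val [LS 1, LU 0]" and "r \<equiv> val [LU 1]"
  shows "par_a P * r + par_b P * par_e P * q + par_c P * par_sig P * p =
      par_e P * (par_D P * p + par_E P * q + par_F P * r)" (is ?hh)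
    and "par_lam P * (par_D P * p + par_E P * q + par_F P * r) =
      par_D P * q + par_E P * (par_a P * p + par_b P * q + par_c P * par_sig' P * r) + par_F P * par_lam P * r"
      (is ?braid1)
    and "par_e P * (par_a P * par_lam P * p + par_b P * (par_D P * p + par_E P * q + par_F P * r) +
        par_c P * par_sig' P * par_e P * q) =
      par_lam P * par_e P * (par_a P * p + par_b P * q + par_c P * par_sig' P * r)" (is ?braid2)
proof -
  have s0u1: "val [LS 0, LU 1] = par_e P * q"
    using val_HU_slide[of "[]" 0 "[]"] assms by simp
  have s0s1u0: "val [LS 0, LS 1, LU 0] = par_D P * p + par_E P * q + par_F P * r"
    using val_HHU[of "[]" 0 "[]"] assms by simp
  have s1s1u0: "val [LS 1, LS 1, LU 0] = par_a P * p + par_b P * q + par_c P * par_sig' P * r"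
    using val_HH[of "[]" 1 "[LU 0]"] val_sig'[of "[LU 1]" 0 "[]"] assms by simp
  show ?hh
    using val_HH[of "[]" 0 "[LU 1]"] val_sig[of "[LU 0]" 0 "[]"] val_HU_slide[of "[LS 0]" 0 "[]"]
      s0u1 s0s1u0 assms by (simp add: mult.assoc)
  show ?braid1
    using val_braid[of "[]" 0 "[LU 0]"] val_HU[of "[LS 0, LS 1]" 0 "[]"] val_HHU[of "[LS 1]" 0 "[]"]
      val_HU[of "[]" 1 "[]"] s0s1u0 s1s1u0 assms by simp
  show ?braid2
    using val_braid[of "[]" 0 "[LU 1]"] val_HU_slide[of "[LS 0, LS 1]" 0 "[]"]
      val_HH[of "[LS 0]" 1 "[LU 0]"] val_HU[of "[]" 0 "[]"] val_sig'[of "[LS 0, LU 1]" 0 "[]"]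
      val_HU[of "[LS 1, LS 0]" 1 "[]"] val_HU_slide[of "[LS 1]" 0 "[]"]
      s0u1 s0s1u0 s1s1u0 assms by (simp add: mult.assoc)
qed

text \<open>The mirror image of the first equation above: two crossings followed by
  \<open>I \<otimes> A\<close>.\<close>

lemma equations_3_1:
  assumes "m = 3" "n = 1" "par_d' P = 0" "par_f' P = 0"
  defines "p \<equiv> val [LA 0]" and "q \<equiv> val [LA 0, LS 1]" and "r \<equiv> val [LA 1]"
  shows "par_a P * r + par_b P * par_e' P * q + par_c P * par_sig' P * p =
      par_e' P * (par_D' P * p + par_E' P * q + par_F' P * r)"
  using val_HH[of "[LA 1]" 0 "[]"] val_sig'[of "[]" 0 "[LA 0]"] val_AH_slide[of "[]" 0 "[LS 0]"]
    val_AH_slide[of "[]" 0 "[]"] val_AHH[of "[]" 0 "[]"] assms by (simp add: mult.assoc)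

text \<open>The word \<open>[LA 1, LS 0, LU 2]\<close> on two strands is a crossing with an
  unstraightened zigzag on its right strand. Moving the cup past the crossing straightens the zigzag
  and leaves \<open>\<sigma>\<close> times the crossing; sliding the cap over the crossing instead
  leads to the right hand side.\<close>

lemma equation_2_2:
  assumes "m = 2" "n = 2" "par_f P = 0" "par_f' P = 0"
  shows "par_sig P * val [LS 0] = par_d' P * koszul_sign \<pi> \<pi> * val [LU 0, LA 0] +
    par_e' P * (par_d P * par_sig P * val [] + par_e P * par_sig P * val [LS 0])"
proof -
  have u: "val [LA 0, LS 1, LU 2] = par_d P * par_sig P * val [] + par_e P * par_sig P * val [LS 0]"
    using val_HU_slide[of "[LA 0]" 1 "[]"] val_sig[of "[]" 0 "[]"] val_sig[of "[LS 0]" 0 "[]"]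
      val_far[of "[]" 0 "LA 0" 0 "LS 0" "[LU 1]"] assms by (simp add: numeral_2_eq_2 koszul_sign_def)
  have "val [LA 1, LS 0, LU 2] = par_sig P * val [LS 0]"
    using val_far[of "[LA 1]" 0 "LS 0" 0 "LU 0" "[]"] val_sig[of "[]" 1 "[LS 0]"] assms
    by (simp add: numeral_2_eq_2 koszul_sign_def)
  moreover have "val [LA 0, LU 2] = koszul_sign \<pi> \<pi> * val [LU 0, LA 0]"
    using val_far[of "[]" 0 "LA 0" 0 "LU 0" "[]"] assms by (simp add: numeral_2_eq_2)
  ultimately show ?thesis
    using val_AH_slide[of "[]" 0 "[LU 2]"] u assms by simp
qed

text \<open>A cap between two neighbouring cups can be straightened against either of them. The two
  readings differ by an exchange of the cups, which costs a Koszul sign and relates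
  \<open>par_sig'\<close> to \<open>par_sig\<close>. The second equation evaluates
  \<open>H H U\<close> by twisting twice and by the quadratic relation.\<close>

lemma equations_0_2:
  assumes "m = 0" "n = 2"
  shows "par_sig' P * val [LU 0] = koszul_sign \<pi> \<pi> * par_sig P * val [LU 0]"
    and "(par_lam P)\<^sup>2 * val [LU 0] = (par_a P + par_b P * par_lam P + par_c P * par_delta P) * val [LU 0]"
proof -
  show "par_sig' P * val [LU 0] = koszul_sign \<pi> \<pi> * par_sig P * val [LU 0]"
    using val_sig'[of "[]" 0 "[LU 0]"] val_far[of "[LA 1]" 0 "LU 0" 0 "LU 0" "[]"] val_sig[of "[]" 1 "[LU 0]"] assms
    by (simp add: numeral_2_eq_2)
  show "(par_lam P)\<^sup>2 * val [LU 0] = (par_a P + par_b P * par_lam P + par_c P * par_delta P) * val [LU 0]"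
    using val_HH[of "[]" 0 "[LU 0]"] val_HU[of "[LS 0]" 0 "[]"] val_HU[of "[]" 0 "[]"] val_AU[of "[LU 0]" 0 "[]"] assms
    by (simp add: power2_eq_square algebra_simps)
qed

text \<open>A zigzag with a crossing in it: the crossing is absorbed by the cap or the cup it
  touches, or it is slid to the other side, where the diagram becomes the one of
  \<open>par_rho\<close>.\<close>

lemma equations_1_1:
  assumes "m = 1" "n = 1" "par_f P = 0" "par_f' P = 0" "par_d P = 0" "par_d' P = 0"
  shows "par_lam' P * par_sig P * val [] = par_e P * par_rho P * val []"
    and "par_lam P * par_sig' P * val [] = par_e' P * par_rho P * val []"
proof -
  show "par_lam' P * par_sig P * val [] = par_e P * par_rho P * val []"
    using val_AH[of "[]" 0 "[LU 1]"] val_sig[of "[]" 0 "[]"] val_HU_slide[of "[LA 0]" 0 "[]"]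
      val_rho[of "[]" 0 "[]"] assms by simp
  show "par_lam P * par_sig' P * val [] = par_e' P * par_rho P * val []"
    using val_HU[of "[LA 1]" 0 "[]"] val_sig'[of "[]" 0 "[]"] val_AH_slide[of "[]" 0 "[LU 0]"]
      val_rho[of "[]" 0 "[]"] assms by simp
qed

end

lemma brauer_type_generators:
  "brauer_type W \<epsilon> C H A U \<Longrightarrow> supercategory_generators C H A U (parity \<epsilon>)"
  by (simp add: brauer_type_def supercategory_generators_def supercategory_generators_axioms_def)

lemma standard_functional:
  assumes "word_choice W" "brauer_type W \<epsilon> C H A U" "has_parameters C H A U P"
    and x: "x \<in> standard_expressions W m n"
  obtains \<psi> where "supercategory_functional C H A U (parity \<epsilon>) P m n \<psi>"
    "\<psi> (interp C H A U (ev m (stdword x))) = 1"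
    "\<And>y. y \<in> standard_expressions W m n \<Longrightarrow> y \<noteq> x \<Longrightarrow> \<psi> (interp C H A U (ev m (stdword y))) = 0"
proof -
  note gens = brauer_type_generators[OF assms(2)]
  interpret supercategory_generators C H A U "parity \<epsilon>" by (rule gens)
  have inj: "inj_on (eval_standard C H A U) (standard_expressions W m n)"
    and basis: "vectorspace.basis (class_ring :: 'a ring) (Hom C m n)
         (eval_standard C H A U ` standard_expressions W m n)"
    using assms(2) by (auto simp: brauer_type_def)
  have sat: "satisfies C H A U (defining_relations P)"
    using assms(2,3) by (auto simp: brauer_type_def has_parameters_def satisfies_def defining_relations_def)
  obtain \<psi> where psi: "\<And>x y. x \<in> carrier (Hom C m n) \<Longrightarrow> y \<in> carrier (Hom C m n) \<Longrightarrow>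
      \<psi> (x \<oplus>\<^bsub>Hom C m n\<^esub> y) = \<psi> x + \<psi> y"
    "\<And>c x. x \<in> carrier (Hom C m n) \<Longrightarrow> \<psi> (c \<odot>\<^bsub>Hom C m n\<^esub> x) = c * \<psi> x"
    "\<psi> (eval_standard C H A U x) = 1"
    "\<And>b'. b' \<in> eval_standard C H A U ` standard_expressions W m n \<Longrightarrow>
      b' \<noteq> eval_standard C H A U x \<Longrightarrow> \<psi> b' = 0"
    by (rule coordinate_functional[OF hom_space basis, of "eval_standard C H A U x"]) (use x in blast)+
  show ?thesis
  proof (rule that)
    show "supercategory_functional C H A U (parity \<epsilon>) P m n \<psi>"
      by unfold_locales (use sat psi in auto)
    show "\<psi> (interp C H A U (ev m (stdword x))) = 1"
      using psi(3) standard_expressions_evaluation(1)[OF assms(1) gens x] by simp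
    fix y assume y: "y \<in> standard_expressions W m n" "y \<noteq> x"
    then have "eval_standard C H A U y \<noteq> eval_standard C H A U x" using inj x by (auto dest: inj_onD)
    then show "\<psi> (interp C H A U (ev m (stdword y))) = 0"
      using psi(4) y standard_expressions_evaluation(1)[OF assms(1) gens y(1)] by (metis imageI)
  qed
qed

lemma parity_sign: "\<epsilon> = 1 \<or> \<epsilon> = - 1 \<Longrightarrow> koszul_sign (parity \<epsilon>) (parity \<epsilon>) = (\<epsilon> :: 'k::field)"
  by (auto simp: koszul_sign_def parity_def)

theorem brauer_type_parameters:
  fixes C :: "('k::field, 'f) supercat" (structure)
  assumes W: "word_choice W" and C: "brauer_type W \<epsilon> C H A U" and P: "has_parameters C H A U P"
    and f: "par_f P = 0" "par_f' P = 0" and lam: "par_lam' P = par_lam P" and sig: "par_sig P \<noteq> 0"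
  shows "(par_e P)\<^sup>2 = \<epsilon>" "par_a P = (par_lam P)\<^sup>2" "par_b P = 0" "par_c P = 0"
    "par_sig' P = \<epsilon> * par_sig P" "par_rho P = \<epsilon> * par_sig P * par_e P * par_lam P"
    "par_e' P = \<epsilon> * par_e P" "par_d P = 0" "par_d' P = 0"
    "par_D P = 0" "par_E P = 0" "par_D' P = 0" "par_E' P = 0"
    "par_F P = \<epsilon> * par_e P * (par_lam P)\<^sup>2" "par_F' P = par_e P * (par_lam P)\<^sup>2"
proof -
  note gens = brauer_type_generators[OF C]
  interpret supercategory_generators C H A U "parity \<epsilon>" by (rule gens)
  have eps: "\<epsilon> = 1 \<or> \<epsilon> = - 1" using C by (simp add: brauer_type_def)
  then have eps2: "\<epsilon> * \<epsilon> = 1" by auto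
  note nil = word_choice_Nil[OF W] and tr = word_choice_transposition[OF W, simplified]
  let ?S = "standard_expressions W"
  have S13: "(1, [(1, 0)], [], []) \<in> ?S 1 3" "(1, [(1, 1)], [], []) \<in> ?S 1 3" "(1, [(2, 0)], [], []) \<in> ?S 1 3"
    and S31: "(1, [], [], [(1, 0)]) \<in> ?S 3 1" "(1, [], [], [(1, 1)]) \<in> ?S 3 1" "(1, [], [], [(2, 0)]) \<in> ?S 3 1"
    and S22: "(2, [], [], []) \<in> ?S 2 2" "(2, [], [1], []) \<in> ?S 2 2" "(0, [(1, 0)], [], [(1, 0)]) \<in> ?S 2 2"
    and S02: "(0, [(1, 0)], [], []) \<in> ?S 0 2" and S11: "(1, [], [], []) \<in> ?S 1 1"
    using nil tr by (auto simp: standard_expressions_def)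
  note functional = standard_functional[OF W C P]

  obtain G where G: "G \<in> carrier (Hom C 2 2)" "G \<cdot> H = idm C 2"
    using C by (auto simp: brauer_type_def)
  have HC: "H \<in> carrier (Hom C 2 2)" and AC: "A \<in> carrier (Hom C 2 0)" and UC: "U \<in> carrier (Hom C 0 2)"
    using H_deg A_deg U_deg deg_carrier by auto
  have idC: "idm C k \<in> carrier (Hom C k k)" for k using id_even deg_carrier by blast

  obtain \<psi> where psi: "supercategory_functional C H A U (parity \<epsilon>) P 0 2 \<psi>"
    "\<psi> (interp C H A U (ev 0 (stdword (0, [(1, 0)], [], [])))) = 1"
    using functional[OF S02] by blast
  interpret F02: supercategory_functional C H A U "parity \<epsilon>" P 0 2 \<psi> by (rule psi(1))
  have U1: "F02.val [LU 0] = 1" using psi(2) by (simp add: F02.val_def)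
  have sig': "par_sig' P = \<epsilon> * par_sig P"
    using F02.equations_0_2(1) U1 parity_sign[OF eps] by simp
  have hhu: "(par_lam P)\<^sup>2 = par_a P + par_b P * par_lam P + par_c P * par_delta P"
    using F02.equations_0_2(2) U1 by simp
  have psiU: "\<psi> U = 1"
    using U1 interp_sound_empty[OF presentation.ev_one_gen[OF presentation.lev_gens(2)]] by (simp add: F02.val_def del: ev.simps(2))
  \<comment> \<open>\<open>H\<close> is invertible and \<open>U\<close> is a basis vector, so
    \<open>H U\<close> cannot vanish.\<close>
  have lam0: "par_lam P \<noteq> 0"
  proof
    assume "par_lam P = 0"
    moreover have "H \<cdot> U = par_lam P \<odot>\<^bsub>Hom C 0 2\<^esub> U"
      using P by (auto simp: has_parameters_def satisfies_def parameter_relations_def)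
    ultimately have "H \<cdot> U = \<zero>\<^bsub>Hom C 0 2\<^esub>" using V.lmult_0 UC by simp
    then have "U = G \<cdot> \<zero>\<^bsub>Hom C 0 2\<^esub>"
      using comp_assoc[OF G(1) HC UC] G(2) comp_id_left[OF UC] by simp
    also have "\<dots> = \<zero>\<^bsub>Hom C 0 2\<^esub>"
      using hom_smult(2)[OF G(1), of "\<zero>\<^bsub>Hom C 0 2\<^esub>" 0 0] V.lmult_0[of "\<zero>\<^bsub>Hom C 0 2\<^esub>" 0 2]
        V.lmult_0[of "G \<cdot> \<zero>\<^bsub>Hom C 0 2\<^esub>" 0 2] comp_in[OF G(1), of "\<zero>\<^bsub>Hom C 0 2\<^esub>" 0] by simp
    also have "\<dots> = 0 \<odot>\<^bsub>Hom C 0 2\<^esub> U" using V.lmult_0[OF UC] by simp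
    finally have "\<psi> U = 0" using F02.psi_smult[OF UC, of 0] by simp
    then show False using psiU by simp
  qed

  \<comment> \<open>\<open>k\<close> numbers the standard expressions \<open>1\<close>,
    \<open>H\<close>, \<open>U A\<close> of type (2,2). The functional is the corresponding
    coordinate, and the indicators let one statement give all three coefficient equations.\<close>
  have e22: "par_sig P * (if k = 1 then 1 else 0) = par_d' P * \<epsilon> * (if k = 2 then 1 else 0) +
      par_e' P * (par_d P * par_sig P * (if k = 0 then 1 else 0) + par_e P * par_sig P * (if k = 1 then 1 else 0))"
    if k: "k < 3" for k :: nat
  proof -
    let ?xs = "[(2, [], [], []), (2, [], [1], []), (0, [(1, 0)], [], [(1, 0)])]"
    have "?xs ! k \<in> ?S 2 2" using k S22 by (auto simp: less_Suc_eq numeral_3_eq_3)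
    then obtain \<phi> where phi: "supercategory_functional C H A U (parity \<epsilon>) P 2 2 \<phi>"
      "\<phi> (I (ev 2 (stdword (?xs ! k)))) = 1"
      "\<And>y. y \<in> ?S 2 2 \<Longrightarrow> y \<noteq> ?xs ! k \<Longrightarrow> \<phi> (I (ev 2 (stdword y))) = 0"
      using functional by metis
    interpret F: supercategory_functional C H A U "parity \<epsilon>" P 2 2 \<phi> by (rule phi(1))
    have "F.val [] = (if k = 0 then 1 else 0)" "F.val [LS 0] = (if k = 1 then 1 else 0)"
      "F.val [LU 0, LA 0] = (if k = 2 then 1 else 0)"
      unfolding F.val_def
      using k phi(2) phi(3)[OF S22(1)] phi(3)[OF S22(2)] phi(3)[OF S22(3)]
      by (auto simp: less_Suc_eq numeral_3_eq_3)
    then show ?thesis using F.equation_2_2 f parity_sign[OF eps] by simp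
  qed
  have "\<epsilon> \<noteq> 0" using eps by auto
  then have d': "par_d' P = 0" using e22[of 2] by simp
  have ee': "par_e' P * par_e P = 1" using e22[of 1] sig by (simp add: d')
  then have nz: "par_e P \<noteq> 0" "par_e' P \<noteq> 0" by auto
  have d: "par_d P = 0" using e22[of 0] sig nz by (simp add: d')

  obtain \<phi> where phi: "supercategory_functional C H A U (parity \<epsilon>) P 1 1 \<phi>"
    "\<phi> (I (ev 1 (stdword (1, [], [], [])))) = 1" using functional[OF S11] by blast
  interpret F11: supercategory_functional C H A U "parity \<epsilon>" P 1 1 \<phi> by (rule phi(1))
  have "F11.val [] = 1" unfolding F11.val_def using phi(2) by simp
  then have r1: "par_lam P * par_sig P = par_e P * par_rho P"
    and r2: "par_lam P * par_sig' P = par_e' P * par_rho P"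
    using F11.equations_1_1 f d d' lam by auto
  \<comment> \<open>Because \<open>e * e' = 1\<close>, the first equation determines
    \<open>\<rho>\<close>. Inserted into the second, with
    \<open>\<sigma>' = \<epsilon> \<sigma>\<close>, it gives the square of \<open>e'\<close> after
    cancelling \<open>\<lambda> \<sigma>\<close>.\<close>
  have "par_e' P * (par_lam P * par_sig P) = par_rho P"
    using ee' unfolding r1 by (simp add: mult.assoc[symmetric])
  then have "\<epsilon> * (par_lam P * par_sig P) = par_e' P * par_e' P * (par_lam P * par_sig P)"
    using r2 sig' by (simp add: algebra_simps)
  then have e'2: "par_e' P * par_e' P = \<epsilon>" using lam0 sig by simp
  then have "\<epsilon> * (par_e P * par_e P) = (par_e' P * par_e P) * (par_e' P * par_e P)" by (simp add: algebra_simps)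
  then have "\<epsilon> * (par_e P * par_e P) = 1" using ee' by simp
  then have "\<epsilon> * (\<epsilon> * (par_e P * par_e P)) = \<epsilon>" by simp
  then have e2: "par_e P * par_e P = \<epsilon>" using eps2 by (simp add: mult.assoc[symmetric])
  have e': "par_e' P = \<epsilon> * par_e P"
    using e2 ee' by (metis mult.assoc mult.commute mult.right_neutral e'2)

  \<comment> \<open>The indices 0, 1, 2 stand for \<open>U I\<close>, \<open>(I H)(U I)\<close> and
    \<open>I U\<close>, the standard expressions of type (1,3).\<close>
  have e13: "par_a P * (if k = 2 then 1 else 0) + par_b P * par_e P * (if k = 1 then 1 else 0) +
        par_c P * par_sig P * (if k = 0 then 1 else 0) =
      par_e P * (par_D P * (if k = 0 then 1 else 0) + par_E P * (if k = 1 then 1 else 0) + par_F P * (if k = 2 then 1 else 0)) \<and>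
      par_lam P * (par_D P * (if k = 0 then 1 else 0) + par_E P * (if k = 1 then 1 else 0) + par_F P * (if k = 2 then 1 else 0)) =
      par_D P * (if k = 1 then 1 else 0) + par_E P * (par_a P * (if k = 0 then 1 else 0) + par_b P * (if k = 1 then 1 else 0) +
        par_c P * par_sig' P * (if k = 2 then 1 else 0)) + par_F P * par_lam P * (if k = 2 then 1 else 0) \<and>
      par_e P * (par_a P * par_lam P * (if k = 0 then 1 else 0) + par_b P * (par_D P * (if k = 0 then 1 else 0) +
        par_E P * (if k = 1 then 1 else 0) + par_F P * (if k = 2 then 1 else 0)) +
        par_c P * par_sig' P * par_e P * (if k = 1 then 1 else 0)) =
      par_lam P * par_e P * (par_a P * (if k = 0 then 1 else 0) + par_b P * (if k = 1 then 1 else 0) +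
        par_c P * par_sig' P * (if k = 2 then 1 else 0))"
    if k: "k < 3" for k :: nat
  proof -
    let ?xs = "[(1, [(1, 0)], [], []), (1, [(1, 1)], [], []), (1, [(2, 0)], [], [])]"
    have "?xs ! k \<in> ?S 1 3" using k S13 by (auto simp: less_Suc_eq numeral_3_eq_3)
    moreover have k3: "k = 0 \<or> k = 1 \<or> k = 2" using k by auto
    ultimately obtain \<phi> where phi: "supercategory_functional C H A U (parity \<epsilon>) P 1 3 \<phi>"
      "\<phi> (I (ev 1 (stdword (?xs ! k)))) = 1"
      "\<And>y. y \<in> ?S 1 3 \<Longrightarrow> y \<noteq> ?xs ! k \<Longrightarrow> \<phi> (I (ev 1 (stdword y))) = 0"
      using functional by metis
    interpret F: supercategory_functional C H A U "parity \<epsilon>" P 1 3 \<phi> by (rule phi(1))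
    have "F.val [LU 0] = (if k = 0 then 1 else 0)" "F.val [LS 1, LU 0] = (if k = 1 then 1 else 0)"
      "F.val [LU 1] = (if k = 2 then 1 else 0)"
      unfolding F.val_def
      using k3 phi(2) phi(3)[OF S13(1)] phi(3)[OF S13(2)] phi(3)[OF S13(3)]
      by (elim disjE; simp)+
    then show ?thesis using F.equations_1_3 f d by simp
  qed
  have a: "par_a P = par_e P * par_F P" and E: "par_E P = par_b P" and cD: "par_c P * par_sig P = par_e P * par_D P"
    using e13[of 2] e13[of 1] e13[of 0] nz by (auto simp: mult.commute)
  have br1: "par_lam P * par_D P = par_b P * par_a P" "par_lam P * par_b P = par_D P + par_b P * par_b P"
    "par_b P * (par_c P * par_sig' P) = 0"
    using e13[of 2] e13[of 1] e13[of 0] E by (auto simp: mult.commute)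
  have br2: "par_b P * par_D P = 0"
    "par_b P * par_b P + par_c P * par_sig' P * par_e P = par_lam P * par_b P"
    "par_b P * par_F P = par_lam P * (par_c P * par_sig' P)"
    using e13[of 0] e13[of 1] e13[of 2] nz E by (auto simp: algebra_simps)

  have e31: "par_a P * (if k = 2 then 1 else 0) + par_b P * par_e' P * (if k = 1 then 1 else 0) +
        par_c P * par_sig' P * (if k = 0 then 1 else 0) =
      par_e' P * (par_D' P * (if k = 0 then 1 else 0) + par_E' P * (if k = 1 then 1 else 0) + par_F' P * (if k = 2 then 1 else 0))"
    if k: "k < 3" for k :: nat
  proof -
    let ?xs = "[(1, [], [], [(1, 0)]), (1, [], [], [(1, 1)]), (1, [], [], [(2, 0)])]"
    have "?xs ! k \<in> ?S 3 1" using k S31 by (auto simp: less_Suc_eq numeral_3_eq_3)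
    moreover have k3: "k = 0 \<or> k = 1 \<or> k = 2" using k by auto
    ultimately obtain \<phi> where phi: "supercategory_functional C H A U (parity \<epsilon>) P 3 1 \<phi>"
      "\<phi> (I (ev 3 (stdword (?xs ! k)))) = 1"
      "\<And>y. y \<in> ?S 3 1 \<Longrightarrow> y \<noteq> ?xs ! k \<Longrightarrow> \<phi> (I (ev 3 (stdword y))) = 0"
      using functional by metis
    interpret F: supercategory_functional C H A U "parity \<epsilon>" P 3 1 \<phi> by (rule phi(1))
    have "F.val [LA 0] = (if k = 0 then 1 else 0)" "F.val [LA 0, LS 1] = (if k = 1 then 1 else 0)"
      "F.val [LA 1] = (if k = 2 then 1 else 0)"
      unfolding F.val_def
      using k3 phi(2) phi(3)[OF S31(1)] phi(3)[OF S31(2)] phi(3)[OF S31(3)]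
      by (elim disjE; simp)+
    then show ?thesis using F.equations_3_1 f d' by simp
  qed
  have a': "par_a P = par_e' P * par_F' P" and E': "par_E' P = par_b P"
    and cD': "par_c P * par_sig' P = par_e' P * par_D' P"
    using e31[of 2] e31[of 1] e31[of 0] nz by (auto simp: mult.commute)

  have sig'0: "par_sig' P \<noteq> 0" using sig' sig \<open>\<epsilon> \<noteq> 0\<close> by simp
  \<comment> \<open>The braid relation gave \<open>b c \<sigma>' = 0\<close> and
    \<open>b^2 + c \<sigma>' e = \<lambda> b\<close>. A nonzero \<open>c\<close> would force
    \<open>b = 0\<close> by the former and then contradict the latter.\<close>
  have c: "par_c P = 0"
  proof (rule ccontr)
    assume "par_c P \<noteq> 0"
    then have "par_b P = 0" using br1(3) sig'0 by simp
    then show False using br2(2) \<open>par_c P \<noteq> 0\<close> sig'0 nz by simp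
  qed
  \<comment> \<open>A nonzero \<open>b\<close> forces \<open>F = 0\<close>, hence
    \<open>a = 0\<close> and \<open>H H = b H\<close>. Cancelling the invertible \<open>H\<close>
    makes it a multiple of the identity, although \<open>1\<close> and \<open>H\<close> are distinct
    basis vectors.\<close>
  have b: "par_b P = 0"
  proof (rule ccontr)
    assume b: "par_b P \<noteq> 0"
    then have "par_F P = 0" using br2(3) c by simp
    then have "par_a P = 0" using a by simp
    moreover have "H \<cdot> H = par_a P \<odot>\<^bsub>Hom C 2 2\<^esub> idm C 2 \<oplus>\<^bsub>Hom C 2 2\<^esub> par_b P \<odot>\<^bsub>Hom C 2 2\<^esub> H
        \<oplus>\<^bsub>Hom C 2 2\<^esub> par_c P \<odot>\<^bsub>Hom C 2 2\<^esub> (U \<cdot> A)"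
      using P by (auto simp: has_parameters_def satisfies_def parameter_relations_def)
    ultimately have "H \<cdot> H = par_b P \<odot>\<^bsub>Hom C 2 2\<^esub> H"
      using c V.lmult_0[of _ 2 2] HC idC[of 2] comp_in[OF UC AC] V.smult_closed[of "par_b P" H 2 2] by simp
    then have "H = par_b P \<odot>\<^bsub>Hom C 2 2\<^esub> idm C 2"
      using comp_assoc[OF G(1) HC HC] G comp_id_left[OF HC] hom_smult(2)[OF G(1) HC, of "par_b P"] by simp
    moreover obtain \<phi> where phi: "supercategory_functional C H A U (parity \<epsilon>) P 2 2 \<phi>"
      "\<phi> (I (ev 2 (stdword (2, [], [1], [])))) = 1" "\<phi> (I (ev 2 (stdword (2, [], [], [])))) = 0"
      using functional[OF S22(2)] S22(1) by (metis list.distinct(1) prod.inject)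
    ultimately show False
    proof -
      interpret F: supercategory_functional C H A U "parity \<epsilon>" P 2 2 \<phi> by (rule phi(1))
      have "I (ev 2 [LS 0]) = H"
        using interp_sound_empty[OF presentation.ev_one_gen[OF presentation.lev_gens(1)]] by simp
      then show False
        using phi(2,3) F.psi_smult[OF idC, of "par_b P"] \<open>H = par_b P \<odot>\<^bsub>Hom C 2 2\<^esub> idm C 2\<close>
        by (simp add: F.val_def del: ev.simps(2))
    qed
  qed
  have D: "par_D P = 0" using cD c nz by simp
  have D': "par_D' P = 0" using cD' c nz by simp
  have aval: "par_a P = (par_lam P)\<^sup>2" using hhu b c by simp
  have rho: "par_rho P = \<epsilon> * par_sig P * par_e P * par_lam P"
    using \<open>par_e' P * (par_lam P * par_sig P) = par_rho P\<close> e' by (simp add: algebra_simps)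
  have "\<epsilon> * par_e P * par_a P = \<epsilon> * (par_e P * par_e P) * par_F P" by (simp add: a algebra_simps)
  then have F: "par_F P = \<epsilon> * par_e P * (par_lam P)\<^sup>2" using e2 eps2 aval by simp
  have "par_e P * par_a P = (par_e' P * par_e P) * par_F' P" by (simp add: a' algebra_simps)
  then have F': "par_F' P = par_e P * (par_lam P)\<^sup>2" using ee' aval by simp
  show "(par_e P)\<^sup>2 = \<epsilon>" using e2 by (simp add: power2_eq_square)
  show "par_a P = (par_lam P)\<^sup>2" "par_b P = 0" "par_c P = 0" "par_sig' P = \<epsilon> * par_sig P"
    "par_rho P = \<epsilon> * par_sig P * par_e P * par_lam P" "par_e' P = \<epsilon> * par_e P" "par_d P = 0" "par_d' P = 0"
    "par_D P = 0" "par_E P = 0" "par_D' P = 0" "par_E' P = 0"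
    "par_F P = \<epsilon> * par_e P * (par_lam P)\<^sup>2" "par_F' P = par_e P * (par_lam P)\<^sup>2"
    by (fact aval b c sig' rho e' d d' D E[unfolded b] D' E'[unfolded b] F F')+
qed

section \<open>Rewriting products of arcs\<close>

text \<open>\<open>arc p q\<close> inserts a cup with end points \<open>p < q\<close>; \<open>up p q\<close> relabels the points below it.\<close>

definition arc :: "nat \<Rightarrow> nat \<Rightarrow> letter list" where
  "arc p q = arcw p (q - Suc p)"

definition up :: "nat \<Rightarrow> nat \<Rightarrow> nat \<Rightarrow> nat" where
  "up p q x = (if x < p then x else if Suc x < q then Suc x else Suc (Suc x))"

text \<open>The label of the point \<open>q\<close> once the end points \<open>P\<close> and
  \<open>Q\<close> of another arc are deleted; it is the counterpart of \<open>up\<close> when two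
  arcs change order.\<close>

definition dn :: "nat \<Rightarrow> nat \<Rightarrow> nat \<Rightarrow> nat" where
  "dn q P Q = q - (if P < q then 1 else 0) - (if Q < q then 1 else 0)"

definition arcs :: "(nat \<times> nat) list \<Rightarrow> letter list" where
  "arcs xs = concat (map (\<lambda>(p, q). arc p q) xs)"

lemma arcs_simps [simp]: "arcs [] = []" "arcs ((p, q) # xs) = arc p q @ arcs xs"
  by (simp_all add: arcs_def)

lemma arcw_arc: "arcw p s = arc p (Suc (p + s))"
  by (simp add: arc_def)

definition arcs_sorted :: "(nat \<times> nat) list \<Rightarrow> bool" where
  "arcs_sorted xs \<longleftrightarrow> sorted_wrt (\<lambda>x y. fst y < fst x) xs \<and> (\<forall>x\<in>set xs. fst x < snd x)"

text \<open>The preorder is abstract so that caps reuse the whole theory: cap words are reflected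
  cup words, and the reflected preorder satisfies the same axioms. Rules are directed, since the
  right side may make sense on fewer strands than the left.\<close>

locale arc_calculus =
  fixes le :: "letter list \<Rightarrow> letter list \<Rightarrow> bool" (infix "\<sqsubseteq>" 50)
  assumes le_refl: "w \<sqsubseteq> w"
    and le_trans [trans]: "u \<sqsubseteq> v \<Longrightarrow> v \<sqsubseteq> w \<Longrightarrow> u \<sqsubseteq> w"
    and le_context: "w \<sqsubseteq> w' \<Longrightarrow> x @ w @ y \<sqsubseteq> x @ w' @ y"
    and cancel: "[LS i, LS i] \<sqsubseteq> []"
    and braid: "[LS i, LS (Suc i), LS i] \<sqsubseteq> [LS (Suc i), LS i, LS (Suc i)]"
    and commute: "i + 2 \<le> j \<Longrightarrow> [LS i, LS j] \<sqsubseteq> [LS j, LS i]"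
    and commute': "i + 2 \<le> j \<Longrightarrow> [LS j, LS i] \<sqsubseteq> [LS i, LS j]"
    and twist: "[LS i, LU i] \<sqsubseteq> [LU i]"
    and slide: "[LS i, LU (Suc i)] \<sqsubseteq> [LS (Suc i), LU i]"
    and shift: "[LS i, LS (Suc i), LU i] \<sqsubseteq> [LU (Suc i)]"
    and left: "j + 2 \<le> i \<Longrightarrow> [LS j, LU i] \<sqsubseteq> [LU i, LS j]"
    and right: "i \<le> j \<Longrightarrow> [LS (j + 2), LU i] \<sqsubseteq> [LU i, LS j]"
    and right': "i \<le> j \<Longrightarrow> [LU i, LS j] \<sqsubseteq> [LS (j + 2), LU i]"
    and nest: "i \<le> j \<Longrightarrow> [LU i, LU j] \<sqsubseteq> [LU (j + 2), LU i]"
begin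

lemma le_Cons: "w \<sqsubseteq> w' \<Longrightarrow> z # w \<sqsubseteq> z # w'"
  using le_context[of w w' "[z]" "[]"] by simp

lemma le_append_left: "w \<sqsubseteq> w' \<Longrightarrow> x @ w \<sqsubseteq> x @ w'"
  using le_context[of w w' x "[]"] by simp

lemma le_append_right: "w \<sqsubseteq> w' \<Longrightarrow> w @ y \<sqsubseteq> w' @ y"
  using le_context[of w w' "[]" y] by simp

lemma commute_Cons: "i + 2 \<le> j \<or> j + 2 \<le> i \<Longrightarrow> LS i # LS j # w \<sqsubseteq> LS j # LS i # w"
  using le_append_right[OF commute[of i j], of w] le_append_right[OF commute'[of j i], of w] by auto

lemma arc_left: "i + 1 < p \<Longrightarrow> LS i # arcw p s \<sqsubseteq> arcw p s @ [LS i]"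
proof (induction s)
  case 0
  then show ?case using left[of i p] by simp
next
  case (Suc s)
  have "LS i # arcw p (Suc s) \<sqsubseteq> LS (Suc (p + s)) # LS i # arcw p s"
    using Suc.prems commute_Cons by simp
  also have "\<dots> \<sqsubseteq> LS (Suc (p + s)) # arcw p s @ [LS i]" using Suc by (intro le_Cons) auto
  finally show ?case by simp
qed

lemma arc_right: "p + s + 2 \<le> i \<Longrightarrow> LS i # arcw p s \<sqsubseteq> arcw p s @ [LS (i - 2)]"
proof (induction s)
  case 0
  then have "Suc (Suc (i - 2)) = i" by simp
  then show ?case using right[of p "i - 2"] 0 by simp
next
  case (Suc s)
  have "LS i # arcw p (Suc s) \<sqsubseteq> LS (Suc (p + s)) # LS i # arcw p s"
    using Suc.prems commute_Cons by simp
  also have "\<dots> \<sqsubseteq> LS (Suc (p + s)) # arcw p s @ [LS (i - 2)]" using Suc by (intro le_Cons) auto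
  finally show ?case by simp
qed

text \<open>The two strands being crossed both run under the arc. The crossing commutes with the
  outer crossings of the arc until it meets the two that involve these strands, where the braid
  relation carries it below; its index drops by one for the left end it has passed.\<close>

lemma arc_inside: "p < i \<Longrightarrow> i < p + s \<Longrightarrow> LS i # arcw p s \<sqsubseteq> arcw p s @ [LS (i - 1)]"
proof (induction s)
  case (Suc s)
  show ?case
  proof (cases "i = p + s")
    case True
    then obtain t where t: "s = Suc t" "i = Suc (p + t)" using Suc.prems by (cases s) auto
    have "LS i # arcw p (Suc s) \<sqsubseteq> LS (Suc i) # LS i # LS (Suc i) # arcw p t"
      using le_append_right[OF braid[of i], of "arcw p t"] t by simp
    also have "\<dots> \<sqsubseteq> LS (Suc i) # LS i # arcw p t @ [LS (i - 1)]"
      using arc_right[of p t "Suc i"] t by (intro le_Cons) simp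
    finally show ?thesis using t by simp
  next
    case False
    have "LS i # arcw p (Suc s) \<sqsubseteq> LS (Suc (p + s)) # LS i # arcw p s"
      using Suc.prems False commute_Cons by simp
    also have "\<dots> \<sqsubseteq> LS (Suc (p + s)) # arcw p s @ [LS (i - 1)]"
      using Suc False by (intro le_Cons) auto
    finally show ?thesis by simp
  qed
qed simp

lemma arc_extend_left: "LS i # arcw (Suc i) s \<sqsubseteq> arcw i (Suc s)"
proof (induction s)
  case 0
  then show ?case using slide[of i] by simp
next
  case (Suc s)
  have "LS i # arcw (Suc i) (Suc s) \<sqsubseteq> LS (Suc (Suc i + s)) # LS i # arcw (Suc i) s"
    using commute_Cons by simp
  also have "\<dots> \<sqsubseteq> LS (Suc (Suc i + s)) # arcw i (Suc s)" using Suc by (intro le_Cons) auto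
  finally show ?case by simp
qed

lemma arc_shrink_left: "LS p # arcw p (Suc s) \<sqsubseteq> arcw (Suc p) s"
proof (induction s)
  case 0
  then show ?case using shift[of p] by simp
next
  case (Suc s)
  have "LS p # arcw p (Suc (Suc s)) \<sqsubseteq> LS (Suc (p + Suc s)) # LS p # arcw p (Suc s)"
    using commute_Cons[of p "Suc (p + Suc s)"] by simp
  also have "\<dots> \<sqsubseteq> LS (Suc (p + Suc s)) # arcw (Suc p) s" using Suc by (intro le_Cons) auto
  finally show ?case by simp
qed

lemma arc_shrink_right: "LS (Suc (p + s)) # arcw p (Suc s) \<sqsubseteq> arcw p s"
  using le_append_right[OF cancel, of _ "arcw p s"] by simp

text \<open>A crossing that touches an end point of the arc is absorbed: it moves that end by one,
  or twists the cup when both ends are adjacent and touched. Any other crossing passes below, its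
  index lowered by the number of end points to its left.\<close>

lemma push_letter: "\<exists>p' s' v. LS i # arcw p s \<sqsubseteq> arcw p' s' @ map LS v"
proof -
  consider "i + 1 < p" | "Suc i = p" | "i = p" "s = 0" | t where "i = p" "s = Suc t"
    | "p < i" "i < p + s" | t where "s = Suc t" "i = Suc (p + t)" | "i = Suc (p + s)" | "p + s + 2 \<le> i"
    by (cases s) (force, force)
  then show ?thesis
  proof cases
    case 1
    then show ?thesis using arc_left by (intro exI[of _ p] exI[of _ s] exI[of _ "[i]"]) simp
  next
    case 2
    then show ?thesis using arc_extend_left by (intro exI[of _ i] exI[of _ "Suc s"] exI[of _ "[]"]) auto
  next
    case 3
    then show ?thesis using twist by (intro exI[of _ p] exI[of _ 0] exI[of _ "[]"]) simp
  next
    case 4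
    then show ?thesis using arc_shrink_left by (intro exI[of _ "Suc p"] exI[of _ t] exI[of _ "[]"]) auto
  next
    case 5
    then show ?thesis using arc_inside by (intro exI[of _ p] exI[of _ s] exI[of _ "[i - 1]"]) simp
  next
    case 6
    then show ?thesis using arc_shrink_right by (intro exI[of _ p] exI[of _ t] exI[of _ "[]"]) auto
  next
    case 7
    then show ?thesis using le_refl by (intro exI[of _ p] exI[of _ "Suc s"] exI[of _ "[]"]) simp
  next
    case 8
    then show ?thesis using arc_right by (intro exI[of _ p] exI[of _ s] exI[of _ "[i - 2]"]) simp
  qed
qed

lemma push_word: "\<exists>p' s' v'. map LS v @ arcw p s \<sqsubseteq> arcw p' s' @ map LS v'"
proof (induction v)
  case Nil
  show ?case using le_refl by (intro exI[of _ p] exI[of _ s] exI[of _ "[]"]) simp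
next
  case (Cons i v)
  then obtain p1 s1 v1 where 1: "map LS v @ arcw p s \<sqsubseteq> arcw p1 s1 @ map LS v1" by blast
  obtain p2 s2 v2 where 2: "LS i # arcw p1 s1 \<sqsubseteq> arcw p2 s2 @ map LS v2" using push_letter by blast
  have "map LS (i # v) @ arcw p s \<sqsubseteq> (LS i # arcw p1 s1) @ map LS v1"
    using le_Cons[OF 1] by simp
  also have "\<dots> \<sqsubseteq> (arcw p2 s2 @ map LS v2) @ map LS v1" by (rule le_append_right[OF 2])
  finally show ?case by (intro exI[of _ p2] exI[of _ s2] exI[of _ "v2 @ v1"]) simp
qed

text \<open>The number of arcs is unchanged, since crossings only deform arcs and never create or
  remove them.\<close>

lemma push_arcs:
  "\<forall>x\<in>set xs. fst x < snd x \<Longrightarrow>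
    \<exists>xs' v'. length xs' = length xs \<and> (\<forall>x\<in>set xs'. fst x < snd x) \<and> map LS v @ arcs xs \<sqsubseteq> arcs xs' @ map LS v'"
proof (induction xs arbitrary: v)
  case Nil
  show ?case using le_refl by (intro exI[of _ "[]"] exI[of _ v]) simp
next
  case (Cons x xs)
  obtain p q where x: "x = (p, q)" by force
  obtain p' s' v1 where 1: "map LS v @ arc p q \<sqsubseteq> arc p' (Suc (p' + s')) @ map LS v1"
    using push_word[of v p "q - Suc p"] by (auto simp: arc_def)
  obtain xs' v' where 2: "length xs' = length xs" "\<forall>x\<in>set xs'. fst x < snd x"
    "map LS v1 @ arcs xs \<sqsubseteq> arcs xs' @ map LS v'"
    using Cons.IH[of v1] Cons.prems by auto
  have "map LS v @ arcs (x # xs) \<sqsubseteq> arc p' (Suc (p' + s')) @ map LS v1 @ arcs xs"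
    using le_append_right[OF 1, of "arcs xs"] x by simp
  also have "\<dots> \<sqsubseteq> arc p' (Suc (p' + s')) @ arcs xs' @ map LS v'" by (rule le_append_left[OF 2(3)])
  finally show ?case using 2 by (intro exI[of _ "(p', Suc (p' + s')) # xs'"] exI[of _ v']) simp
qed

lemma cup_arc: "p \<le> p1 \<Longrightarrow> LU p # arcw p1 t \<sqsubseteq> arcw (p1 + 2) t @ [LU p]"
proof (induction t)
  case 0
  then show ?case using nest[of p p1] by simp
next
  case (Suc t)
  have "LU p # arcw p1 (Suc t) \<sqsubseteq> LS (Suc (p1 + t) + 2) # LU p # arcw p1 t"
    using le_append_right[OF right'[of p "Suc (p1 + t)"], of "arcw p1 t"] Suc.prems by simp
  also have "\<dots> \<sqsubseteq> LS (Suc (p1 + t) + 2) # arcw (p1 + 2) t @ [LU p]" using Suc by (intro le_Cons) auto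
  finally show ?case by simp
qed

text \<open>Induction on the length of the outer arc. Its last crossing \<open>LS q\<close> meets
  the relabelled second arc \<open>P\<close>, \<open>Q\<close>. If it touches an end point there, it
  shifts that end and the lower arc stays as it is; otherwise it passes through and lengthens the
  lower arc. The labels on the right record exactly this.\<close>

lemma swap_arcs:
  assumes "p \<le> p1" "p1 < q1"
  shows "arc p (Suc (p + s)) @ arc p1 q1 \<sqsubseteq>
    arc (up p (Suc (p + s)) p1) (up p (Suc (p + s)) q1) @
    arc p (dn (Suc (p + s)) (up p (Suc (p + s)) p1) (up p (Suc (p + s)) q1))"
proof (induction s)
  case 0
  then show ?case using cup_arc[of p p1 "q1 - Suc p1"] assms
    by (simp add: arc_def up_def dn_def)
next
  case (Suc s)
  define q where "q = Suc (p + s)"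
  define P where "P = up p q p1"
  define Q where "Q = up p q q1"
  have ne: "P \<noteq> q" "Q \<noteq> q" "P < Q" "p < P" and pq: "p < q"
    using assms by (auto simp: P_def Q_def q_def up_def)
  have step: "arc p (Suc q) @ arc p1 q1 \<sqsubseteq> LS q # arc P Q @ arc p (dn q P Q)"
    using le_Cons[OF Suc, of "LS q"] by (simp add: q_def P_def Q_def arc_def)
  consider "q + 1 < P" | "P = Suc q" | "P < q" "Suc q < Q" | "P < q" "Q = Suc q" | "Q < q"
    using ne by linarith
  then have "arc p (Suc q) @ arc p1 q1 \<sqsubseteq> arc (up p (Suc q) p1) (up p (Suc q) q1) @
    arc p (dn (Suc q) (up p (Suc q) p1) (up p (Suc q) q1))"
  proof cases
    case 1
    have "LS q # arc P Q @ arc p (dn q P Q) \<sqsubseteq> arc P Q @ LS q # arc p (dn q P Q)"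
      using le_append_right[OF arc_left[OF 1, of "Q - Suc P"], of "arc p (dn q P Q)"] by (simp add: arc_def)
    moreover have "up p (Suc q) p1 = P" "up p (Suc q) q1 = Q" "dn q P Q = q" "dn (Suc q) P Q = Suc q"
      using 1 assms ne by (auto simp: P_def Q_def up_def dn_def split: if_splits)
    moreover have "LS q # arc p q = arc p (Suc q)" using pq by (simp add: arc_def q_def)
    ultimately show ?thesis using le_trans[OF step] by simp
  next
    case 2
    have "LS q # arc P Q @ arc p (dn q P Q) \<sqsubseteq> arc q Q @ arc p (dn q P Q)"
      using le_append_right[OF arc_extend_left[of q "Q - Suc P"], of "arc p (dn q P Q)"] 2 ne
      by (simp add: arc_def Suc_diff_Suc)
    moreover have "up p (Suc q) p1 = q" "up p (Suc q) q1 = Q" "dn q P Q = q" "dn (Suc q) q Q = q"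
      using 2 assms ne pq by (auto simp: P_def Q_def up_def dn_def split: if_splits)
    ultimately show ?thesis using le_trans[OF step] by simp
  next
    case 3
    have "LS q # arc P Q @ arc p (dn q P Q) \<sqsubseteq> arc P Q @ LS (q - 1) # arc p (dn q P Q)"
      using le_append_right[OF arc_inside[of P q "Q - Suc P"], of "arc p (dn q P Q)"] 3 by (simp add: arc_def)
    moreover have "up p (Suc q) p1 = P" "up p (Suc q) q1 = Q" "dn q P Q = q - 1" "dn (Suc q) P Q = q"
      using 3 assms ne by (auto simp: P_def Q_def up_def dn_def split: if_splits)
    moreover have "q - Suc p = Suc (q - 1 - Suc p)" "q - 1 = Suc (p + (q - 1 - Suc p))" using 3 ne by auto
    then have "LS (q - 1) # arc p (q - 1) = arc p q" unfolding arc_def by (metis arcw.simps(2))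
    ultimately show ?thesis using le_trans[OF step] by simp
  next
    case 4
    have "LS q # arc P Q @ arc p (dn q P Q) \<sqsubseteq> arc P q @ arc p (dn q P Q)"
    proof -
      obtain t where "q = Suc (P + t)" using 4 less_iff_Suc_add[of P q] by auto
      then show ?thesis
        using le_append_right[OF arc_shrink_right[of P t], of "arc p (dn q P Q)"] 4 by (simp add: arc_def)
    qed
    moreover have "up p (Suc q) p1 = P" "up p (Suc q) q1 = q" "dn q P Q = q - 1" "dn (Suc q) P q = q - 1"
      using 4 assms ne by (auto simp: P_def Q_def up_def dn_def split: if_splits)
    ultimately show ?thesis using le_trans[OF step] by simp
  next
    case 5
    have "LS q # arc P Q @ arc p (dn q P Q) \<sqsubseteq> arc P Q @ LS (q - 2) # arc p (dn q P Q)"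
      using le_append_right[OF arc_right[of P "Q - Suc P" q], of "arc p (dn q P Q)"] 5 ne by (simp add: arc_def)
    moreover have "up p (Suc q) p1 = P" "up p (Suc q) q1 = Q" "dn q P Q = q - 2" "dn (Suc q) P Q = q - 1"
      using 5 assms ne by (auto simp: P_def Q_def up_def dn_def split: if_splits)
    moreover have "q - 1 - Suc p = Suc (q - 2 - Suc p)" "q - 2 = Suc (p + (q - 2 - Suc p))" using 5 ne by auto
    then have "LS (q - 2) # arc p (q - 2) = arc p (q - 1)" unfolding arc_def by (metis arcw.simps(2))
    ultimately show ?thesis using le_trans[OF step] by simp
  qed
  then show ?case by (simp add: q_def)
qed

text \<open>Insertion sort on left end points. Exchanging two arcs leaves the left end
  \<open>p\<close> of the inserted arc alone and changes its right end, hence the generalisation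
  over \<open>q\<close>. The final conjunct bounds the new left ends, which keeps the exchanged arc
  strictly in front of the recursive result.\<close>

lemma insert_arc:
  assumes "p < q" "arcs_sorted xs"
  shows "\<exists>xs'. length xs' = Suc (length xs) \<and> arcs_sorted xs' \<and> arc p q @ arcs xs \<sqsubseteq> arcs xs' \<and>
    (\<forall>x\<in>set xs'. fst x \<le> p \<or> (\<exists>y\<in>set xs. fst x \<le> up p q (fst y)))"
  using assms
proof (induction xs arbitrary: q)
  case Nil
  then show ?case using le_refl by (intro exI[of _ "[(p, q)]"]) (auto simp: arcs_sorted_def)
next
  case (Cons x xs)
  obtain p1 q1 where x: "x = (p1, q1)" by force
  have p1: "p1 < q1" and xs: "arcs_sorted xs" "\<forall>y\<in>set xs. fst y < p1"
    using Cons.prems x by (auto simp: arcs_sorted_def)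
  show ?case
  proof (cases "p1 < p")
    case True
    then have "arcs_sorted ((p, q) # x # xs)"
      using Cons.prems x xs by (auto simp: arcs_sorted_def)
    moreover have "\<forall>y\<in>set (x # xs). fst y \<le> p" using True xs x by fastforce
    ultimately show ?thesis using le_refl by (intro exI[of _ "(p, q) # x # xs"]) auto
  next
    case False
    then have "p \<le> p1" by simp
    obtain s where s: "q = Suc (p + s)" using Cons.prems less_iff_Suc_add[of p q] by auto
    define P where "P = up p q p1"
    define Q where "Q = up p q q1"
    define q' where "q' = dn q P Q"
    have PQ: "p < P" "P < Q" "p < q'"
      using \<open>p \<le> p1\<close> p1 Cons.prems by (auto simp: P_def Q_def q'_def up_def dn_def)
    \<comment> \<open>The two relabellings involve different right ends \<open>q'\<close> and
      \<open>q\<close>. The shift of \<open>p1\<close> in \<open>P\<close> still dominates the shift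
      of any smaller left end.\<close>
    have below: "up p q' y < P" if "y < p1" for y
      using that \<open>p \<le> p1\<close> p1 Cons.prems unfolding P_def Q_def q'_def up_def dn_def
      by (auto split: if_splits)
    obtain xs' where xs': "length xs' = Suc (length xs)" "arcs_sorted xs'" "arc p q' @ arcs xs \<sqsubseteq> arcs xs'"
      "\<forall>x\<in>set xs'. fst x \<le> p \<or> (\<exists>y\<in>set xs. fst x \<le> up p q' (fst y))"
      using Cons.IH[OF PQ(3) xs(1)] by blast
    have lt: "fst y < P" if "y \<in> set xs'" for y
      using xs'(4) that PQ(1) below xs(2) by (meson le_less_trans)
    have "arc p q @ arcs (x # xs) \<sqsubseteq> arc P Q @ arc p q' @ arcs xs"
      using le_append_right[OF swap_arcs[OF \<open>p \<le> p1\<close> p1, of s], of "arcs xs"]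
      by (simp add: x P_def Q_def q'_def s)
    also have "\<dots> \<sqsubseteq> arc P Q @ arcs xs'" by (rule le_append_left[OF xs'(3)])
    finally have "arc p q @ arcs (x # xs) \<sqsubseteq> arcs ((P, Q) # xs')" by simp
    moreover have "arcs_sorted ((P, Q) # xs')" using xs'(2) lt PQ by (auto simp: arcs_sorted_def)
    moreover have "\<forall>y\<in>set ((P, Q) # xs'). fst y \<le> up p q p1" using lt by (auto simp: P_def less_imp_le)
    ultimately show ?thesis
      using xs'(1) x by (intro exI[of _ "(P, Q) # xs'"]) auto
  qed
qed

lemma sort_arcs:
  "\<forall>x\<in>set xs. fst x < snd x \<Longrightarrow> \<exists>xs'. length xs' = length xs \<and> arcs_sorted xs' \<and> arcs xs \<sqsubseteq> arcs xs'"
proof (induction xs)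
  case Nil
  show ?case using le_refl by (auto simp: arcs_sorted_def)
next
  case (Cons x xs)
  obtain p q where x: "x = (p, q)" by force
  obtain xs1 where 1: "length xs1 = length xs" "arcs_sorted xs1" "arcs xs \<sqsubseteq> arcs xs1"
    using Cons by auto
  obtain xs2 where 2: "length xs2 = Suc (length xs1)" "arcs_sorted xs2" "arc p q @ arcs xs1 \<sqsubseteq> arcs xs2"
    using insert_arc[of p q xs1] 1 Cons.prems x by auto
  have "arcs (x # xs) \<sqsubseteq> arc p q @ arcs xs1" using le_append_left[OF 1(3)] x by simp
  then show ?case using le_trans 1 2 by (intro exI[of _ xs2]) auto
qed

end

section \<open>Spanning\<close>

locale brauer_family =
  fixes \<epsilon> l \<sigma> \<delta> e :: "'k::field"
  assumes sign: "\<epsilon> = 1 \<or> \<epsilon> = - 1" and l0: "l \<noteq> 0" and sigma0: "\<sigma> \<noteq> 0" and e2: "e\<^sup>2 = \<epsilon>"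
begin

lemma nonzero [simp]: "l \<noteq> 0" "\<sigma> \<noteq> 0" "\<epsilon> \<noteq> 0" "e \<noteq> 0"
  using sign l0 sigma0 e2 by auto

lemma eps_eps [simp]: "\<epsilon> * \<epsilon> = 1"
  using sign by auto

lemma e_e [simp]: "e * e = \<epsilon>"
  using e2 by (simp add: power2_eq_square)

abbreviation "params \<equiv> params_00 \<epsilon> l \<sigma> \<delta> e"

sublocale brauer_presentation "parity \<epsilon>" params .

lemma params_simps [simp]:
  "par_lam params = l" "par_lam' params = l" "par_delta params = \<delta>" "par_sig params = \<sigma>"
  "par_sig' params = \<epsilon> * \<sigma>" "par_rho params = \<epsilon> * \<sigma> * e * l" "par_a params = l\<^sup>2" "par_b params = 0"
  "par_c params = 0" "par_d params = 0" "par_e params = e" "par_f params = 0" "par_D params = 0"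
  "par_E params = 0" "par_F params = \<epsilon> * e * l\<^sup>2" "par_d' params = 0" "par_e' params = \<epsilon> * e"
  "par_f' params = 0" "par_D' params = 0" "par_E' params = 0" "par_F' params = e * l\<^sup>2"
  by (simp_all add: params_00_def)

abbreviation peq_00 (infix "\<simeq>" 50) where
  "t \<simeq> u \<equiv> pres_eq (parity \<epsilon>) (defining_relations params) t u"

text \<open>With \<open>b\<close>, \<open>c\<close>, \<open>d\<close>, \<open>f\<close>,
  \<open>D\<close>, \<open>E\<close> and their primed versions equal to zero, filtering leaves a
  single term in each relation with three terms.\<close>

lemma comb_filter: "vlds m n cs \<Longrightarrow> comb m n cs \<simeq> comb m n (filter (\<lambda>cw. fst cw \<noteq> 0) cs)"
proof (induction cs)
  case Nil
  show ?case by (simp add: pres_eq.refl)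
next
  case (Cons cw cs)
  have v: "vlds m n (filter (\<lambda>cw. fst cw \<noteq> 0) cs)" using Cons.prems by (auto simp: vlds_def)
  have IH: "comb m n cs \<simeq> comb m n (filter (\<lambda>cw. fst cw \<noteq> 0) cs)" using Cons by simp
  show ?case
  proof (cases "fst cw = 0")
    case True
    have "comb m n (cw # cs) \<simeq> EZero m n \<^bold>+ comb m n cs"
      using True Cons.prems zero_scale[of "ev m (snd cw)"]
      by (auto intro!: peq_sum_left simp: parallel_def)
    also have "\<dots> \<simeq> comb m n cs" using Cons.prems by (intro zero_sum) auto
    also have "\<dots> \<simeq> comb m n (filter (\<lambda>cw. fst cw \<noteq> 0) cs)" by (rule IH)
    finally show ?thesis using True by simp
  next
    case False
    then show ?thesis using peq_sum_right[OF IH, of "fst cw \<^bold>* ev m (snd cw)"] Cons.prems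
      by (simp add: parallel_def)
  qed
qed

lemma scale_inverse:
  assumes "t \<simeq> c \<^bold>* u" "c \<noteq> 0"
  shows "u \<simeq> inverse c \<^bold>* t"
proof -
  have u: "well_typed u" using peq_typed[OF assms(1)] by simp
  have "inverse c \<^bold>* t \<simeq> inverse c \<^bold>* c \<^bold>* u" by (rule pres_eq.cong_scale[OF assms(1)])
  also have "\<dots> \<simeq> (inverse c * c) \<^bold>* u" by (rule pres_eq.sym[OF pres_eq.scale_scale[OF u]])
  also have "(inverse c * c) \<^bold>* u \<simeq> u" using assms(2) pres_eq.scale_one[OF u] by simp
  finally show ?thesis by (rule pres_eq.sym)
qed

lemma scale_trans:
  assumes "t \<simeq> c \<^bold>* u" "u \<simeq> d \<^bold>* v"
  shows "t \<simeq> (c * d) \<^bold>* v"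
proof -
  have v: "well_typed v" using peq_typed[OF assms(2)] by simp
  have "t \<simeq> c \<^bold>* d \<^bold>* v" by (rule pres_eq.trans[OF assms(1) pres_eq.cong_scale[OF assms(2)]])
  also have "\<dots> \<simeq> (c * d) \<^bold>* v" by (rule pres_eq.sym[OF pres_eq.scale_scale[OF v]])
  finally show ?thesis .
qed

text \<open>The scalar is existential and may be zero, as for a closed loop with
  \<open>\<delta> = 0\<close>. Validity is only transferred from left to right:
  \<open>[LS i, LS i]\<close> needs \<open>i + 2\<close> strands and rewrites to the empty word,
  which needs none.\<close>

definition le_at :: "nat \<Rightarrow> letter list \<Rightarrow> letter list \<Rightarrow> bool" where
  "le_at m w w' \<longleftrightarrow> (vld m w \<longrightarrow> vld m w' \<and> cd m w' = cd m w \<and> (\<exists>c. ev m w \<simeq> c \<^bold>* ev m w'))"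

definition le :: "letter list \<Rightarrow> letter list \<Rightarrow> bool" (infix "\<sqsubseteq>" 50) where
  "w \<sqsubseteq> w' \<longleftrightarrow> (\<forall>m. le_at m w w')"

lemma le_at_refl: "le_at m w w"
  unfolding le_at_def
  using pres_eq.sym[OF pres_eq.scale_one[of "ev m w" "parity \<epsilon>" "defining_relations params"]] by auto

lemma le_at_trans: "le_at m u v \<Longrightarrow> le_at m v w \<Longrightarrow> le_at m u w"
  unfolding le_at_def using scale_trans by metis

lemma map_shl_0 [simp]: "sh 0 w = w"
  by (rule map_idI) simp

lemma le_at_context:
  assumes "le_at (cd m y) w w'"
  shows "le_at m (x @ w @ y) (x @ w' @ y)"
  unfolding le_at_def
proof
  assume v: "vld m (x @ w @ y)"
  then obtain c where w': "vld (cd m y) w'" "cd (cd m y) w' = cd (cd m y) w" "ev (cd m y) w \<simeq> c \<^bold>* ev (cd m y) w'"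
    using assms by (auto simp: le_at_def)
  have "ev (cd m y) w \<simeq> comb (cd m y) (cd (cd m y) w) [(c, w')]"
    by (rule pres_eq.trans[OF w'(3) pres_eq.sym[OF comb_single]]) (use w' in auto)
  from lift_relation[OF this, of m x 0 y]
  have "ev m (x @ w @ y) \<simeq> comb m (cd m (x @ w @ y)) [(c, x @ w' @ y)]"
    using v w' by simp
  also have "\<dots> \<simeq> c \<^bold>* ev m (x @ w' @ y)" using v w' by (intro comb_single) auto
  finally show "vld m (x @ w' @ y) \<and> cd m (x @ w' @ y) = cd m (x @ w @ y) \<and>
      (\<exists>c. ev m (x @ w @ y) \<simeq> c \<^bold>* ev m (x @ w' @ y))"
    using v w' by auto
qed

text \<open>A relation with exactly one nonzero coefficient is a rewriting rule. The condition
  \<open>dom\<close> says that the left word already demands all \<open>m0\<close> strands of the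
  relation, so that it can be padded wherever the word is valid.\<close>

lemma relation_le:
  assumes loc: "ev m0 w0 \<simeq> comb m0 n0 cs" and single: "filter (\<lambda>cw. fst cw \<noteq> 0) cs = [(c, w1)]"
    and v0: "vld m0 w0" "cd m0 w0 = n0" "vlds m0 n0 cs"
    and dom: "\<And>m. vld m (sh a w0) \<Longrightarrow> a + m0 \<le> m"
  shows "sh a w0 \<sqsubseteq> sh a w1"
  unfolding le_def le_at_def
proof (intro allI impI)
  fix m assume v: "vld m (sh a w0)"
  obtain b where b: "m = a + m0 + b" using dom[OF v] le_iff_add by metis
  have "(c, w1) \<in> set (filter (\<lambda>cw. fst cw \<noteq> 0) cs)" using single by simp
  then have "(c, w1) \<in> set cs" by simp
  then have w1: "vld m0 w1" "cd m0 w1 = n0" using v0(3) by (auto simp: vlds_def)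
  have "ev m0 w0 \<simeq> comb m0 n0 [(c, w1)]"
    using pres_eq.trans[OF loc comb_filter[OF v0(3)]] single by simp
  from lift_relation[OF this, of m "[]" a "[]"]
  have "ev m (sh a w0) \<simeq> comb m (cd m (sh a w0)) [(c, sh a w1)]"
    using v v0 w1 b by simp
  also have "\<dots> \<simeq> c \<^bold>* ev m (sh a w1)"
    using vld_sh[OF w1(1), of a b] vld_sh[OF v0(1), of a b] b v0 w1 by (intro comb_single) auto
  finally show "vld m (sh a w1) \<and> cd m (sh a w1) = cd m (sh a w0) \<and> (\<exists>c. ev m (sh a w0) \<simeq> c \<^bold>* ev m (sh a w1))"
    using vld_sh[OF w1(1), of a b] vld_sh[OF v0(1), of a b] b v0 w1 by auto
qed

lemma relation_inverse:
  assumes loc: "ev m0 w0 \<simeq> comb m0 n0 cs" and single: "filter (\<lambda>cw. fst cw \<noteq> 0) cs = [(c, w1)]"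
    and v0: "vld m0 w0" "cd m0 w0 = n0" "vlds m0 n0 cs"
  shows "ev m0 w1 \<simeq> comb m0 n0 [(inverse c, w0)]" "c \<noteq> 0" "vld m0 w1" "cd m0 w1 = n0"
proof -
  have mem: "(c, w1) \<in> set (filter (\<lambda>cw. fst cw \<noteq> 0) cs)" using single by simp
  then show "c \<noteq> 0" "vld m0 w1" "cd m0 w1 = n0" using v0(3) by (auto simp: vlds_def)
  then have "ev m0 w0 \<simeq> c \<^bold>* ev m0 w1"
    using pres_eq.trans[OF pres_eq.trans[OF loc comb_filter[OF v0(3)]], of "c \<^bold>* ev m0 w1"] single comb_single
    by simp
  then show "ev m0 w1 \<simeq> comb m0 n0 [(inverse c, w0)]"
    by (rule pres_eq.trans[OF scale_inverse pres_eq.sym[OF comb_single]]) (use \<open>c \<noteq> 0\<close> v0 in auto)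
qed

text \<open>A nonzero coefficient lets the rule be read backwards, provided that the former right
  hand side demands all \<open>m0\<close> strands as well.\<close>

lemma inverse_relation_le:
  assumes loc: "ev m0 w0 \<simeq> comb m0 n0 cs" and single: "filter (\<lambda>cw. fst cw \<noteq> 0) cs = [(c, w1)]"
    and v0: "vld m0 w0" "cd m0 w0 = n0" "vlds m0 n0 cs"
    and dom: "\<And>m. vld m (sh a w1) \<Longrightarrow> a + m0 \<le> m"
  shows "sh a w1 \<sqsubseteq> sh a w0"
  using relation_inverse[OF assms(1-5)] v0 dom
  by (intro relation_le[of m0 w1 n0 "[(inverse c, w0)]" "inverse c"]) auto

lemma far_le:
  assumes "lpos x = 0" "lpos y = 0"
  shows "[shl (a + (lcod x + c)) y, shl a x] \<sqsubseteq> [shl a x, shl (a + (ldom x + c)) y]"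
    and "[shl a x, shl (a + (ldom x + c)) y] \<sqsubseteq> [shl (a + (lcod x + c)) y, shl a x]"
proof -
  let ?k = "koszul_sign (ldeg (parity \<epsilon>) y) (ldeg (parity \<epsilon>) x) :: 'k"
  have k: "?k \<noteq> 0" by (simp add: koszul_sign_def)
  show "[shl (a + (lcod x + c)) y, shl a x] \<sqsubseteq> [shl a x, shl (a + (ldom x + c)) y]"
    using assms k by (intro relation_le[OF word_far_commute[OF assms, of c], of ?k "[x, shl (ldom x + c) y]" a, simplified]) auto
  show "[shl a x, shl (a + (ldom x + c)) y] \<sqsubseteq> [shl (a + (lcod x + c)) y, shl a x]"
    using assms k by (intro relation_le[OF word_far_commute'[OF assms, of c], of ?k "[shl (lcod x + c) y, x]" a, simplified]) auto
qed

lemma le_cancel: "[LS i, LS i] \<sqsubseteq> []"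
  using relation_le[OF rel_HH, of "l\<^sup>2" "[]" i] by simp

lemma le_braid: "[LS i, LS (Suc i), LS i] \<sqsubseteq> [LS (Suc i), LS i, LS (Suc i)]"
  by (rule relation_le[OF rel_braid, of 1 "[LS 1, LS 0, LS 1]" i, simplified]) auto

lemma le_braid': "[LS (Suc i), LS i, LS (Suc i)] \<sqsubseteq> [LS i, LS (Suc i), LS i]"
  by (rule inverse_relation_le[OF rel_braid, of 1 "[LS 1, LS 0, LS 1]" i, simplified])

lemma Suc_Suc_diff: "2 \<le> j \<Longrightarrow> Suc (Suc (j - 2)) = j"
  by simp

lemma le_commute: "i + 2 \<le> j \<Longrightarrow> [LS i, LS j] \<sqsubseteq> [LS j, LS i]"
  and le_commute': "i + 2 \<le> j \<Longrightarrow> [LS j, LS i] \<sqsubseteq> [LS i, LS j]"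
  using far_le[of "LS 0" "LS 0" i "j - (i + 2)"] by (simp_all add: Suc_Suc_diff)

lemma le_far_SU: "j + 2 \<le> i \<Longrightarrow> [LS j, LU i] \<sqsubseteq> [LU i, LS j]"
  using far_le[of "LS 0" "LU 0" j "i - (j + 2)"] by (simp add: Suc_Suc_diff)

lemma le_far_US: "i \<le> j \<Longrightarrow> [LS (j + 2), LU i] \<sqsubseteq> [LU i, LS j]"
  and le_far_US': "i \<le> j \<Longrightarrow> [LU i, LS j] \<sqsubseteq> [LS (j + 2), LU i]"
  using far_le[of "LU 0" "LS 0" i "j - i"] by simp_all

lemma le_far_UU: "i \<le> j \<Longrightarrow> [LU i, LU j] \<sqsubseteq> [LU (j + 2), LU i]"
  using far_le[of "LU 0" "LU 0" i "j - i"] by simp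

lemma le_far_AS: "j + 2 \<le> i \<Longrightarrow> [LA i, LS j] \<sqsubseteq> [LS j, LA i]"
  using far_le[of "LS 0" "LA 0" j "i - (j + 2)"] by (simp add: Suc_Suc_diff)

lemma le_far_SA: "i \<le> j \<Longrightarrow> [LA i, LS (j + 2)] \<sqsubseteq> [LS j, LA i]"
  and le_far_SA': "i \<le> j \<Longrightarrow> [LS j, LA i] \<sqsubseteq> [LA i, LS (j + 2)]"
  using far_le[of "LA 0" "LS 0" i "j - i"] by simp_all

lemma le_far_AA: "i \<le> j \<Longrightarrow> [LA j, LA i] \<sqsubseteq> [LA i, LA (j + 2)]"
  using far_le[of "LA 0" "LA 0" i "j - i"] by simp

lemma le_far_AU: "i \<le> j \<Longrightarrow> [LA i, LU (j + 2)] \<sqsubseteq> [LU j, LA i]"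
  using far_le[of "LA 0" "LU 0" i "j - i"] by simp

lemma le_HU: "[LS i, LU i] \<sqsubseteq> [LU i]"
  using relation_le[OF rel_HU, of l "[LU 0]" i] by simp

lemma le_HU_slide: "[LS i, LU (Suc i)] \<sqsubseteq> [LS (Suc i), LU i]"
  using relation_le[OF rel_HU_slide, of e "[LS 1, LU 0]" i] by simp

lemma le_HHU: "[LS i, LS (Suc i), LU i] \<sqsubseteq> [LU (Suc i)]"
  using relation_le[OF rel_HHU, of "\<epsilon> * e * l\<^sup>2" "[LU 1]" i] by simp

lemma le_AH: "[LA i, LS i] \<sqsubseteq> [LA i]"
  using relation_le[OF rel_AH, of l "[LA 0]" i] by simp

lemma le_AH_slide: "[LA (Suc i), LS i] \<sqsubseteq> [LA i, LS (Suc i)]"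
  by (rule relation_le[OF rel_AH_slide, of "\<epsilon> * e" "[LA 0, LS 1]" i, simplified]) auto

lemma le_AHH: "[LA i, LS (Suc i), LS i] \<sqsubseteq> [LA (Suc i)]"
  by (rule relation_le[OF rel_AHH, of "e * l\<^sup>2" "[LA 1]" i, simplified]) auto

lemma le_AHH': "[LA (Suc i)] \<sqsubseteq> [LA i, LS (Suc i), LS i]"
  by (rule inverse_relation_le[OF rel_AHH, of "e * l\<^sup>2" "[LA 1]" i, simplified])

text \<open>The variant for the relations that yield scalars: the coefficient
  \<open>\<delta>\<close> may vanish, and then no nonzero term would be left to select.\<close>

lemma relation_le_scalar:
  assumes loc: "ev m0 w0 \<simeq> comb m0 n0 [(c, w1)]"
    and v0: "vld m0 w0" "cd m0 w0 = n0" "vld m0 w1" "cd m0 w1 = n0"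
    and dom: "\<And>m. vld m (sh a w0) \<Longrightarrow> a + m0 \<le> m"
  shows "sh a w0 \<sqsubseteq> sh a w1"
  unfolding le_def le_at_def
proof (intro allI impI)
  fix m assume v: "vld m (sh a w0)"
  obtain b where b: "m = a + m0 + b" using dom[OF v] le_iff_add by metis
  from lift_relation[OF loc, of m "[]" a "[]"]
  have "ev m (sh a w0) \<simeq> comb m (cd m (sh a w0)) [(c, sh a w1)]"
    using v v0 b by simp
  also have "\<dots> \<simeq> c \<^bold>* ev m (sh a w1)"
    using vld_sh[OF v0(3), of a b] vld_sh[OF v0(1), of a b] b v0 by (intro comb_single) auto
  finally show "vld m (sh a w1) \<and> cd m (sh a w1) = cd m (sh a w0) \<and> (\<exists>c. ev m (sh a w0) \<simeq> c \<^bold>* ev m (sh a w1))"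
    using vld_sh[OF v0(3), of a b] vld_sh[OF v0(1), of a b] b v0 by auto
qed

lemma le_AU: "[LA i, LU i] \<sqsubseteq> []"
  using relation_le_scalar[OF rel_AU, of i] by simp

lemma le_AU_right: "[LA i, LU (Suc i)] \<sqsubseteq> []"
  using relation_le_scalar[OF rel_sig, of i] by simp

lemma le_AHU: "[LA i, LS (Suc i), LU i] \<sqsubseteq> []"
  using relation_le_scalar[OF rel_rho, of i] by simp

lemma le_refl: "w \<sqsubseteq> w"
  by (simp add: le_def le_at_refl)

lemma le_trans [trans]: "u \<sqsubseteq> v \<Longrightarrow> v \<sqsubseteq> w \<Longrightarrow> u \<sqsubseteq> w"
  unfolding le_def using le_at_trans by blast

lemma le_context: "w \<sqsubseteq> w' \<Longrightarrow> x @ w @ y \<sqsubseteq> x @ w' @ y"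
  unfolding le_def using le_at_context by blast

sublocale cups: arc_calculus "(\<sqsubseteq>)"
  by unfold_locales
    (auto intro: le_refl le_trans le_context le_cancel le_braid le_commute le_commute' le_HU le_HU_slide
      le_HHU le_far_SU le_far_US[simplified] le_far_US'[simplified] le_far_UU[simplified])

end

primrec swapl :: "letter \<Rightarrow> letter" where
  "swapl (LS i) = LS i" | "swapl (LU i) = LA i" | "swapl (LA i) = LU i"

text \<open>Reflection in a horizontal line. It changes the scalars of the relations, for instance
  \<open>e\<close> against \<open>\<epsilon> * e\<close>, but it respects the rewriting up to
  scalars.\<close>

definition flip :: "letter list \<Rightarrow> letter list" where
  "flip w = rev (map swapl w)"

lemma flip_simps [simp]:
  "flip [] = []" "flip (x # w) = flip w @ [swapl x]" "flip (v @ w) = flip w @ flip v" "flip (map LS u) = map LS (rev u)"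
  by (simp_all add: flip_def rev_map comp_def)

lemma arcs_append [simp]: "arcs (xs @ ys) = arcs xs @ arcs ys"
  by (simp add: arcs_def)

lemma flip_arcw: "flip (arcw p s) = coarcw p s"
  by (induction s) auto

section \<open>Moving caps below cups\<close>

context brauer_family
begin

sublocale caps: arc_calculus "\<lambda>w w'. flip w \<sqsubseteq> flip w'"
  by unfold_locales
    (auto intro: le_refl le_trans le_context[of _ _ "flip y" "flip x" for x y, simplified] le_cancel le_braid
      le_commute le_commute' le_AH le_AH_slide le_AHH le_far_AS le_far_SA[simplified] le_far_SA'[simplified] le_far_AA[simplified])

text \<open>Since \<open>F' = e * l^2\<close> is invertible, a cap at \<open>i + 1\<close> can be
  traded for a cap at \<open>i\<close> applied after two crossings. Only the leftmost cap then has
  to be moved past cups.\<close>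

lemma cap_letter: "\<exists>v. [LA i] \<sqsubseteq> LA 0 # map LS v"
proof (induction i)
  case 0
  show ?case using le_refl by (intro exI[of _ "[]"]) simp
next
  case (Suc i)
  then obtain v where "[LA i] \<sqsubseteq> LA 0 # map LS v" by blast
  then have "LA i # map LS [Suc i, i] \<sqsubseteq> (LA 0 # map LS v) @ map LS [Suc i, i]"
    using cups.le_append_right by fastforce
  then have "[LA (Suc i)] \<sqsubseteq> (LA 0 # map LS v) @ map LS [Suc i, i]"
    using le_trans[OF le_AHH'] by simp
  then show ?case by (intro exI[of _ "v @ [Suc i, i]"]) simp
qed

lemma cap_far_letter: "LA 0 # LS (Suc (Suc j)) # w \<sqsubseteq> LS j # LA 0 # w"
  using cups.le_append_right[OF le_far_SA[of 0 j], of w] by simp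

lemma cap_arc_far: "LA 0 # arcw (Suc (Suc p)) s \<sqsubseteq> arcw p s @ [LA 0]"
proof (induction s)
  case 0
  then show ?case using le_far_AU[of 0 p] by simp
next
  case (Suc s)
  have "LA 0 # arcw (Suc (Suc p)) (Suc s) \<sqsubseteq> LS (Suc (p + s)) # LA 0 # arcw (Suc (Suc p)) s"
    using cap_far_letter by simp
  also have "\<dots> \<sqsubseteq> LS (Suc (p + s)) # arcw p s @ [LA 0]" by (rule cups.le_Cons[OF Suc])
  finally show ?case by simp
qed

text \<open>The cap touches the arc only at its left end. The crossings that carry the right end
  pass the cap with index lowered by two, and the remaining zigzag straightens.\<close>

lemma cap_arc_near: "\<exists>v. LA 0 # arcw (Suc 0) s \<sqsubseteq> map LS v"
proof (induction s)
  case 0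
  then show ?case using le_AU_right[of 0] by (intro exI[of _ "[]"]) simp
next
  case (Suc s)
  then obtain v where v: "LA 0 # arcw (Suc 0) s \<sqsubseteq> map LS v" by blast
  have "LA 0 # arcw (Suc 0) (Suc s) \<sqsubseteq> LS s # LA 0 # arcw (Suc 0) s" using cap_far_letter by simp
  also have "\<dots> \<sqsubseteq> LS s # map LS v" by (rule cups.le_Cons[OF v])
  finally show ?case by (intro exI[of _ "s # v"]) simp
qed

text \<open>The cap touches the left end of the arc at 0. Crossings beyond the first one commute
  past the cap, so that the loop and the zigzag with one crossing are the only two base
  cases.\<close>

lemma cap_arc_meet: "\<exists>v. LA 0 # arcw 0 s \<sqsubseteq> map LS v"
proof (cases s)
  case 0
  then show ?thesis using le_AU[of 0] by (intro exI[of _ "[]"]) simp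
next
  case (Suc t)
  have "\<exists>v. LA 0 # arcw 0 (Suc t) \<sqsubseteq> map LS v"
  proof (induction t)
    case 0
    then show ?case using le_AHU[of 0] by (intro exI[of _ "[]"]) simp
  next
    case (Suc t)
    then obtain v where v: "LA 0 # arcw 0 (Suc t) \<sqsubseteq> map LS v" by blast
    have "LA 0 # arcw 0 (Suc (Suc t)) \<sqsubseteq> LS t # LA 0 # arcw 0 (Suc t)" using cap_far_letter[of t] by simp
    also have "\<dots> \<sqsubseteq> LS t # map LS v" by (rule cups.le_Cons[OF v])
    finally show ?case by (intro exI[of _ "t # v"]) simp
  qed
  then show ?thesis using Suc by simp
qed

text \<open>Going down the list, the cap passes every arc starting at 2 or later and is consumed by
  the first arc that starts at 0 or 1. The factor \<open>b\<close> tells whether the cap has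
  survived; once it is consumed, the leftover crossings are pushed below the remaining arcs.\<close>

lemma cap_arcs:
  "\<forall>x\<in>set xs. fst x < snd x \<Longrightarrow>
    \<exists>xs' v b. (\<forall>x\<in>set xs'. fst x < snd x) \<and> b \<in> {[], [LA 0]} \<and> LA 0 # arcs xs \<sqsubseteq> arcs xs' @ map LS v @ b"
proof (induction xs)
  case Nil
  show ?case using le_refl by (intro exI[of _ "[]"] exI[of _ "[LA 0]"]) simp
next
  case (Cons x xs)
  obtain p q where x: "x = (p, q)" by force
  define s where "s = q - Suc p"
  have a: "arc p q = arcw p s" by (simp add: arc_def s_def)
  show ?case
  proof (cases "2 \<le> p")
    case True
    then obtain p' where p': "p = Suc (Suc p')" by (metis add_2_eq_Suc le_Suc_ex)
    obtain xs' v b where IH: "\<forall>x\<in>set xs'. fst x < snd x" "b \<in> {[], [LA 0]}"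
      "LA 0 # arcs xs \<sqsubseteq> arcs xs' @ map LS v @ b"
      using Cons by auto
    have "LA 0 # arcs (x # xs) \<sqsubseteq> arcw p' s @ LA 0 # arcs xs"
      using cups.le_append_right[OF cap_arc_far[of p' s], of "arcs xs"] by (simp add: x a[unfolded p'] p')
    also have "\<dots> \<sqsubseteq> arcw p' s @ arcs xs' @ map LS v @ b" by (rule cups.le_append_left[OF IH(3)])
    finally show ?thesis
      using IH by (intro exI[of _ "(p', Suc (p' + s)) # xs'"] exI[of _ v] exI[of _ b]) (simp add: arcw_arc)
  next
    case False
    then obtain v where "LA 0 # arc p q \<sqsubseteq> map LS v"
      using cap_arc_near cap_arc_meet a by (metis One_nat_def Suc_1 Suc_leI less_Suc_eq linorder_not_le less_one)
    then have 1: "LA 0 # arcs (x # xs) \<sqsubseteq> map LS v @ arcs xs"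
      using cups.le_append_right x by fastforce
    obtain xs' v' where "\<forall>x\<in>set xs'. fst x < snd x" "map LS v @ arcs xs \<sqsubseteq> arcs xs' @ map LS v'"
      using cups.push_arcs[of xs v] Cons.prems by auto
    then show ?thesis using le_trans[OF 1] by (intro exI[of _ xs'] exI[of _ v'] exI[of _ "[]"]) simp
  qed
qed

text \<open>Induction on the word from its first applied letter. A new crossing or cup concerns only
  the cups on top, whereas a new cap has to travel through cups and crossings down to the
  caps.\<close>

lemma word_form:
  "\<exists>xs v ys. (\<forall>x\<in>set xs. fst x < snd x) \<and> (\<forall>x\<in>set ys. fst x < snd x) \<and> w \<sqsubseteq> arcs xs @ map LS v @ flip (arcs ys)"
proof (induction w)
  case Nil
  show ?case
    by (rule exI[of _ "[]"], rule exI[of _ "[]"], rule exI[of _ "[]"]) (simp add: le_refl)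
next
  case (Cons x w)
  then obtain xs v ys where IH: "\<forall>x\<in>set xs. fst x < snd x" "\<forall>x\<in>set ys. fst x < snd x"
    "w \<sqsubseteq> arcs xs @ map LS v @ flip (arcs ys)" by blast
  note w = cups.le_Cons[OF IH(3), of x]
  show ?case
  proof (cases x)
    case (LS i)
    obtain xs' v' where 1: "\<forall>x\<in>set xs'. fst x < snd x" "map LS [i] @ arcs xs \<sqsubseteq> arcs xs' @ map LS v'"
      using cups.push_arcs[OF IH(1), of "[i]"] by blast
    have "x # w \<sqsubseteq> arcs xs' @ map LS v' @ map LS v @ flip (arcs ys)"
      using le_trans[OF w] cups.le_append_right[OF 1(2), of "map LS v @ flip (arcs ys)"] LS by simp
    then show ?thesis using IH 1 by (intro exI[of _ xs'] exI[of _ "v' @ v"] exI[of _ ys]) simp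
  next
    case (LU i)
    have "arc i (Suc i) = [LU i]" by (simp add: arc_def)
    then show ?thesis using w IH LU by (intro exI[of _ "(i, Suc i) # xs"] exI[of _ v] exI[of _ ys]) simp
  next
    case (LA i)
    obtain u where u: "[LA i] \<sqsubseteq> LA 0 # map LS u" using cap_letter by blast
    obtain xs1 v1 where 1: "\<forall>x\<in>set xs1. fst x < snd x" "map LS u @ arcs xs \<sqsubseteq> arcs xs1 @ map LS v1"
      using cups.push_arcs[OF IH(1), of u] by blast
    obtain xs2 v2 b where 2: "\<forall>x\<in>set xs2. fst x < snd x" "b \<in> {[], [LA 0]}"
      "LA 0 # arcs xs1 \<sqsubseteq> arcs xs2 @ map LS v2 @ b"
      using cap_arcs[OF 1(1)] by blast
    have "x # w \<sqsubseteq> LA 0 # map LS u @ arcs xs @ map LS v @ flip (arcs ys)"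
      using le_trans[OF w] cups.le_append_right[OF u, of "arcs xs @ map LS v @ flip (arcs ys)"] LA by simp
    also have "\<dots> \<sqsubseteq> (LA 0 # arcs xs1) @ map LS v1 @ map LS v @ flip (arcs ys)"
      using cups.le_Cons[OF cups.le_append_right[OF 1(2), of "map LS v @ flip (arcs ys)"]] by simp
    also have "\<dots> \<sqsubseteq> (arcs xs2 @ map LS v2 @ b) @ map LS v1 @ map LS v @ flip (arcs ys)"
      by (rule cups.le_append_right[OF 2(3)])
    finally have 3: "x # w \<sqsubseteq> arcs xs2 @ map LS v2 @ b @ map LS (v1 @ v) @ flip (arcs ys)" by simp
    show ?thesis
    proof (cases "b = []")
      case True
      then show ?thesis using 3 2 IH by (intro exI[of _ xs2] exI[of _ "v2 @ v1 @ v"] exI[of _ ys]) simp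
    next
      case False
      then have b: "b = [LA 0]" using 2 by simp
      \<comment> \<open>The surviving cap stands above crossings. Upside down this is a crossing
        word above the single cup \<open>(0, 1)\<close>, so the reflected calculus moves the cap to
        the bottom.\<close>
      obtain ys1 v3 where 4: "\<forall>x\<in>set ys1. fst x < snd x"
        "flip (map LS (rev (v1 @ v)) @ arcs [(0, 1)]) \<sqsubseteq> flip (arcs ys1 @ map LS v3)"
        using caps.push_arcs[of "[(0, 1)]" "rev (v1 @ v)"] by auto
      have 5: "[LA 0] @ map LS (v1 @ v) \<sqsubseteq> map LS (rev v3) @ flip (arcs ys1)"
        using 4(2) by (simp add: arc_def)
      have "x # w \<sqsubseteq> arcs xs2 @ map LS v2 @ map LS (rev v3) @ flip (arcs ys1) @ flip (arcs ys)"
        using le_trans[OF 3] le_context[OF 5, of "arcs xs2 @ map LS v2" "flip (arcs ys)"] b by simp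
      then show ?thesis using 2 4 IH
        by (intro exI[of _ xs2] exI[of _ "v2 @ rev v3"] exI[of _ "ys @ ys1"]) auto
    qed
  qed
qed

end

subsection \<open>Words in the crossings\<close>

lemma word_perm_append: "word_perm (v @ w) = word_perm v \<circ> word_perm w"
  by (induction v) (auto simp: comp_assoc)

lemma word_perm_cancel: "word_perm (x @ [i, i] @ y) = word_perm (x @ y)"
  by (simp add: word_perm_append fun_eq_iff)

lemma word_perm_rev: "word_perm (w @ rev w) = id"
proof (induction w)
  case (Cons i w)
  have "word_perm ((i # w) @ rev (i # w)) = word_perm [i] \<circ> word_perm (w @ rev w) \<circ> word_perm [i]"
    by (simp add: word_perm_append fun_eq_iff)
  then show ?case using Cons by (simp add: fun_eq_iff)
qed simp

lemma word_perm_far: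
  "i + 2 \<le> j \<or> j + 2 \<le> i \<Longrightarrow> word_perm (x @ [i, j] @ y) = word_perm (x @ [j, i] @ y)"
  by (auto simp: word_perm_append fun_eq_iff Transposition.transpose_def)

lemma word_perm_braid: "word_perm (x @ [i, Suc i, i] @ y) = word_perm (x @ [Suc i, i, Suc i] @ y)"
  by (auto simp: word_perm_append fun_eq_iff Transposition.transpose_def)

text \<open>The index of a coset representative is recovered from the image of the last
  point.\<close>

lemma word_perm_upt: "j \<le> r \<Longrightarrow> word_perm [j..<r] r = j"
proof (induction "r - j" arbitrary: j)
  case (Suc n)
  then have "word_perm [Suc j..<r] r = Suc j" by simp
  then show ?case using Suc by (simp add: upt_rec[of j])
qed simp

context brauer_family
begin

text \<open>Equality of permutations is carried along, so that the normal form of a word can be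
  identified through its permutation.\<close>

definition lp :: "nat list \<Rightarrow> nat list \<Rightarrow> bool" (infix "\<preceq>" 50) where
  "v \<preceq> w \<longleftrightarrow> sword v \<sqsubseteq> sword w \<and> word_perm v = word_perm w"

lemma lp_refl: "v \<preceq> v"
  by (simp add: lp_def le_refl)

lemma lp_trans [trans]: "u \<preceq> v \<Longrightarrow> v \<preceq> w \<Longrightarrow> u \<preceq> w"
  unfolding lp_def using le_trans by metis

lemma lp_context: "v \<preceq> w \<Longrightarrow> x @ v @ y \<preceq> x @ w @ y"
  unfolding lp_def using le_context by (simp add: word_perm_append)

lemma lp_Cons: "v \<preceq> w \<Longrightarrow> i # v \<preceq> i # w"
  using lp_context[of v w "[i]" "[]"] by simp

lemma lp_append_left: "v \<preceq> w \<Longrightarrow> x @ v \<preceq> x @ w"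
  using lp_context[of v w x "[]"] by simp

lemma lp_cancel: "[i, i] \<preceq> []"
  using le_cancel[of "i - 1"] word_perm_cancel[of "[]" i "[]"] by (simp add: lp_def)

lemma lp_braid: "1 \<le> i \<Longrightarrow> [Suc i, i, Suc i] \<preceq> [i, Suc i, i]"
  using le_braid'[of "i - 1"] word_perm_braid[of "[]" i "[]"] by (simp add: lp_def)

lemma lp_far:
  assumes "1 \<le> i" "1 \<le> j" "i + 2 \<le> j \<or> j + 2 \<le> i"
  shows "[i, j] \<preceq> [j, i]"
proof -
  have "i - 1 + 2 \<le> j - 1 \<or> j - 1 + 2 \<le> i - 1" using assms by linarith
  then have "[LS (i - 1), LS (j - 1)] \<sqsubseteq> [LS (j - 1), LS (i - 1)]" using le_commute le_commute' by blast
  then show ?thesis using word_perm_far[OF assms(3), of "[]" "[]"] by (simp add: lp_def)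
qed

lemma lp_far_list:
  "1 \<le> i \<Longrightarrow> \<forall>k\<in>set u. 1 \<le> k \<and> (i + 2 \<le> k \<or> k + 2 \<le> i) \<Longrightarrow> i # u @ w \<preceq> u @ i # w"
proof (induction u)
  case Nil
  show ?case using lp_refl by simp
next
  case (Cons k u)
  have "i # (k # u) @ w \<preceq> k # i # u @ w" using lp_context[OF lp_far[of i k], of "[]" "u @ w"] Cons.prems by simp
  also have "\<dots> \<preceq> k # u @ i # w" by (rule lp_Cons[OF Cons.IH]) (use Cons.prems in auto)
  finally show ?case by simp
qed

text \<open>The words \<open>[j..<r]\<close> represent the left cosets of the symmetric group on
  \<open>r - 1\<close> points in that on \<open>r\<close> points. Multiplying a representative on
  the left by a generator changes \<open>j\<close> by one, or reproduces it with a generator of the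
  smaller group on the right.\<close>

lemma coset_form:
  "set w \<subseteq> {1..<r} \<Longrightarrow> 1 \<le> r \<Longrightarrow>
    \<exists>j w'. 1 \<le> j \<and> j \<le> r \<and> set w' \<subseteq> {1..<r - 1} \<and> w \<preceq> [j..<r] @ w'"
proof (induction w)
  case Nil
  then show ?case using lp_refl by (intro exI[of _ r] exI[of _ "[]"]) auto
next
  case (Cons i w)
  then obtain j w' where IH: "1 \<le> j" "j \<le> r" "set w' \<subseteq> {1..<r - 1}" "w \<preceq> [j..<r] @ w'" by auto
  have i: "1 \<le> i" "i < r" using Cons.prems by auto
  note 0 = lp_Cons[OF IH(4), of i]
  consider "i + 1 < j" | "Suc i = j" | "i = j" | "j < i" by linarith
  then show ?case
  proof cases
    case 1
    have "i # [j..<r] @ w' \<preceq> [j..<r] @ i # w'" using 1 i IH by (intro lp_far_list) auto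
    then show ?thesis using lp_trans[OF 0] IH i 1 by (intro exI[of _ j] exI[of _ "i # w'"]) auto
  next
    case 2
    then have eq: "i # [j..<r] @ w' = [i..<r] @ w'" using i by (simp add: upt_conv_Cons[of i])
    then show ?thesis using 0[unfolded eq] IH i by (intro exI[of _ i] exI[of _ w']) auto
  next
    case 3
    then have "i # [j..<r] @ w' = [] @ [i, i] @ [Suc i..<r] @ w'" using i by (simp add: upt_conv_Cons)
    then have "i # [j..<r] @ w' \<preceq> [Suc i..<r] @ w'" using lp_context[OF lp_cancel, of "[]" i] by simp
    then show ?thesis using lp_trans[OF 0] IH i by (intro exI[of _ "Suc i"] exI[of _ w']) auto
  next
    case 4
    then obtain k where k: "i = Suc k" "j \<le> k" by (cases i) auto
    have split: "[j..<r] = [j..<k] @ [k, Suc k] @ [Suc (Suc k)..<r]"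
    proof -
      have "[j..<r] = [j..<k] @ [k..<r]" using k i upt_add_eq_append[of j k "r - k"] by simp
      also have "[k..<r] = k # Suc k # [Suc (Suc k)..<r]"
        using k i by (simp add: upt_rec[of k] upt_rec[of "Suc k"])
      finally show ?thesis by simp
    qed
    \<comment> \<open>The letter \<open>Suc k\<close> travels through the run: it commutes up to the
      pair \<open>k, Suc k\<close>, becomes \<open>k\<close> by the braid relation, and commutes
      with the rest.\<close>
    have "i # [j..<r] @ w' \<preceq> [j..<k] @ [Suc k, k, Suc k] @ [Suc (Suc k)..<r] @ w'"
      unfolding split k(1) using lp_far_list[of "Suc k" "[j..<k]"] IH k by simp
    also have "\<dots> \<preceq> [j..<k] @ [k, Suc k, k] @ [Suc (Suc k)..<r] @ w'"
      using lp_braid[of k] IH k by (intro lp_context) auto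
    also have "\<dots> \<preceq> [j..<k] @ [k, Suc k] @ [Suc (Suc k)..<r] @ k # w'"
      using lp_far_list[of k "[Suc (Suc k)..<r]" w'] IH k lp_append_left[of _ _ "[j..<k] @ [k, Suc k]"] by simp
    also have "\<dots> = [j..<r] @ k # w'" unfolding split by simp
    finally show ?thesis using lp_trans[OF 0] IH i k by (intro exI[of _ j] exI[of _ "k # w'"]) auto
  qed
qed

text \<open>In coset form the last point is fixed by the smaller factor and sent to \<open>j\<close>
  by the run. For the identity this forces an empty run, and the induction continues with one point
  fewer.\<close>

lemma identity_word: "set w \<subseteq> {1..<r} \<Longrightarrow> word_perm w = id \<Longrightarrow> w \<preceq> []"
proof (induction r arbitrary: w)
  case 0
  then show ?case using lp_refl by simp
next
  case (Suc r)
  obtain j w' where j: "1 \<le> j" "j \<le> Suc r" and w': "set w' \<subseteq> {1..<r}" "w \<preceq> [j..<Suc r] @ w'"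
    using coset_form[OF Suc.prems(1)] by auto
  have "word_perm w' (Suc r) = Suc r"
    using permutes_not_in[OF word_perm_permutes[OF w'(1)], of "Suc r"] by simp
  then have "word_perm ([j..<Suc r] @ w') (Suc r) = j"
    using word_perm_upt[OF j(2)] by (simp add: word_perm_append del: upt_Suc)
  moreover have "word_perm ([j..<Suc r] @ w') = id"
    using w'(2) Suc.prems(2) unfolding lp_def by metis
  ultimately have "j = Suc r" by (simp del: upt_Suc)
  then have "w \<preceq> w'" using w'(2) by simp
  moreover from this have "w' \<preceq> []" using Suc.IH[OF w'(1)] Suc.prems(2) by (simp add: lp_def)
  ultimately show ?case by (rule lp_trans)
qed

text \<open>The cancellation rule backwards, by invertibility of \<open>a = l^2\<close>. It requires
  \<open>i + 2\<close> strands at that place and is therefore stated for a fixed source instead of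
  all sources.\<close>

lemma le_at_expand:
  assumes "i + 2 \<le> cd m y" "vld m y" "vld (cd m y) x"
  shows "le_at m (x @ y) (x @ [LS i, LS i] @ y)"
proof -
  have "ev 2 [] \<simeq> comb 2 2 [(inverse (l\<^sup>2), [LS 0, LS 0])]"
    by (rule relation_inverse(1)[OF rel_HH]) auto
  from lift_relation[OF this, of m x i y]
  have "ev m (x @ y) \<simeq> comb m (cd m (x @ y)) [(inverse (l\<^sup>2), x @ [LS i, LS i] @ y)]"
    using assms by simp
  also have "\<dots> \<simeq> inverse (l\<^sup>2) \<^bold>* ev m (x @ [LS i, LS i] @ y)"
    using assms by (intro comb_single) (auto simp: Suc_Suc_diff)
  finally show ?thesis using assms by (auto simp: le_at_def Suc_Suc_diff)
qed

lemma le_at_expand_word: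
  assumes "set u \<subseteq> {1..<r}" "set w \<subseteq> {1..<r}"
  shows "le_at r (sword w) (sword (w @ rev u @ u))"
  using assms(1)
proof (induction u)
  case Nil
  show ?case using le_at_refl by simp
next
  case (Cons i u)
  have u: "vld r (sword u) \<and> cd r (sword u) = r" using Cons.prems by (intro sword_valid) auto
  have w: "vld r (sword (w @ rev u))" using sword_valid[of "w @ rev u" r] Cons.prems assms(2) by simp
  have "le_at r (sword (w @ rev u) @ sword u) (sword (w @ rev u) @ [LS (i - 1), LS (i - 1)] @ sword u)"
    using u w Cons.prems by (intro le_at_expand) auto
  then have "le_at r (sword (w @ rev u @ u)) (sword (w @ rev (i # u) @ i # u))" by simp
  moreover have "le_at r (sword w) (sword (w @ rev u @ u))" using Cons by simp
  ultimately show ?case by (rule le_at_trans[rotated])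
qed

text \<open>Inserting cancelling pairs turns \<open>v\<close> into \<open>v @ rev w @ w\<close>, and
  \<open>v @ rev w\<close> has trivial permutation, hence disappears. The argument applies to
  arbitrary words, reduced or not.\<close>

lemma same_perm_le:
  assumes "set v \<subseteq> {1..<r}" "set w \<subseteq> {1..<r}" "word_perm v = word_perm w"
  shows "le_at r (sword v) (sword w)"
proof -
  have "word_perm (v @ rev w) = id"
    using word_perm_rev[of w] assms(3) by (simp add: word_perm_append)
  then have "v @ rev w \<preceq> []" using assms by (intro identity_word[of _ r]) auto
  then have "sword (v @ rev w @ w) \<sqsubseteq> sword w"
    using cups.le_append_right[of "sword (v @ rev w)" "[]" "sword w"] by (simp add: lp_def)
  then show ?thesis using le_at_trans[OF le_at_expand_word[OF assms(2,1)]] by (simp add: le_def)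
qed

subsection \<open>Standard form of a word\<close>

text \<open>From end points counted from zero to the pairs $(p_i, s_i)$ of standard expressions: the
  left end counted from one, and the number of points strictly between the ends.\<close>

definition conv :: "(nat \<times> nat) list \<Rightarrow> (nat \<times> nat) list" where
  "conv xs = map (\<lambda>(p, q). (Suc p, q - Suc p)) xs"

lemma conv_simps [simp]: "conv [] = []" "conv ((p, q) # xs) = (Suc p, q - Suc p) # conv xs" "length (conv xs) = length xs"
  by (simp_all add: conv_def)

lemma iword_conv: "iword (conv xs) = arcs xs"
  by (induction xs) (auto simp: arc_def)

lemma jword_conv: "jword (conv ys) = flip (arcs ys)"
  by (induction ys) (auto simp: arc_def flip_arcw)

lemma arcw_validD: "vld n (arcw p s) \<Longrightarrow> p + s \<le> n"
proof (induction s)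
  case (Suc s)
  then have "p + s \<le> n" by simp
  then show ?case using Suc arcw_valid[of p s n] by simp
qed simp

lemma coarcw_validD: "vld m (coarcw p s) \<Longrightarrow> p + s + 2 \<le> m"
  by (induction s arbitrary: m) auto

text \<open>The bound on \<open>p + s\<close> in \<open>arc_word\<close> is what validity of the arc
  word says, and sortedness gives the decreasing left ends.\<close>

lemma arc_word_cups: "vld r (arcs xs) \<Longrightarrow> arcs_sorted xs \<Longrightarrow> arc_word r (conv xs)"
proof (induction xs)
  case (Cons x xs)
  obtain p q where x: "x = (p, q)" by force
  have IH: "arc_word r (conv xs)" using Cons by (auto simp: x arcs_sorted_def)
  then have "cd r (arcs xs) = r + 2 * length xs" using iword_valid[OF IH] by (simp add: iword_conv)
  then have "p + (q - Suc p) \<le> r + 2 * length xs"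
    using Cons.prems arcw_validD[of "r + 2 * length xs" p "q - Suc p"] by (simp add: x arc_def)
  moreover have "\<forall>(p', s')\<in>set (conv xs). p' < Suc p"
    using Cons.prems by (auto simp: x arcs_sorted_def conv_def)
  ultimately show ?case using IH by (simp add: x)
qed simp

lemma arc_word_caps:
  "vld m (flip (arcs ys)) \<Longrightarrow> arcs_sorted ys \<Longrightarrow> \<exists>r. m = r + 2 * length ys \<and> arc_word r (conv ys)"
proof (induction ys arbitrary: m)
  case (Cons y ys)
  obtain p q where y: "y = (p, q)" by force
  define s where "s = q - Suc p"
  have v: "vld m (coarcw p s)" "vld (cd m (coarcw p s)) (flip (arcs ys))"
    using Cons.prems by (auto simp: y arc_def flip_arcw s_def)
  have ps: "p + s + 2 \<le> m" by (rule coarcw_validD[OF v(1)])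
  obtain n where n: "m = Suc (Suc n)" "p + s \<le> n" 
    by (rule that[of "m - 2"]) (use ps in auto)
  then have cdn: "cd m (coarcw p s) = n" using coarcw_valid by simp
  have sorted: "arcs_sorted ys" using Cons.prems by (simp add: y arcs_sorted_def)
  then obtain r where r: "n = r + 2 * length ys" "arc_word r (conv ys)"
    using Cons.IH[of n] v(2) sorted unfolding cdn by blast
  moreover have "\<forall>(p', s')\<in>set (conv ys). p' < Suc p"
    using Cons.prems by (auto simp: y arcs_sorted_def conv_def)
  ultimately show ?case using n by (intro exI[of _ r]) (simp add: y s_def)
qed simp

lemma crossings_valid: "vld r (map LS v) \<Longrightarrow> cd r (map LS v) = r \<and> set (map Suc v) \<subseteq> {1..<r}"
  by (induction v) auto

lemma sword_map_Suc: "sword (map Suc v) = map LS v"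
  by (simp add: sword_def)

text \<open>No rule produces a sum, so one standard expression suffices. Its middle size
  \<open>r\<close> is the number of strands left by the caps, and the crossings are exchanged for
  the chosen word with the same permutation.\<close>

theorem word_standard:
  assumes W: "word_choice W" and w: "vld m w"
  shows "\<exists>x\<in>standard_expressions W m (cd m w). \<exists>c. ev m w \<simeq> c \<^bold>* ev m (stdword x)"
proof -
  obtain xs v ys where 1: "\<forall>x\<in>set xs. fst x < snd x" "\<forall>x\<in>set ys. fst x < snd x"
    "w \<sqsubseteq> arcs xs @ map LS v @ flip (arcs ys)" using word_form[of w] by blast
  obtain xs' where xs': "arcs_sorted xs'" "arcs xs \<sqsubseteq> arcs xs'" using cups.sort_arcs[OF 1(1)] by blast
  obtain ys' where ys': "arcs_sorted ys'" "flip (arcs ys) \<sqsubseteq> flip (arcs ys')" using caps.sort_arcs[OF 1(2)] by blast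
  have "w \<sqsubseteq> arcs xs' @ map LS v @ flip (arcs ys)"
    using le_trans[OF 1(3) cups.le_append_right[OF xs'(2)]] by simp
  also have "\<dots> \<sqsubseteq> arcs xs' @ map LS v @ flip (arcs ys')"
    using cups.le_append_left[OF ys'(2), of "arcs xs' @ map LS v"] by simp
  finally have 2: "le_at m w (arcs xs' @ map LS v @ flip (arcs ys'))" by (simp add: le_def)
  then have v: "vld m (arcs xs' @ map LS v @ flip (arcs ys'))"
    and cdw: "cd m (arcs xs' @ map LS v @ flip (arcs ys')) = cd m w"
    using w by (auto simp: le_at_def)
  obtain r where r: "m = r + 2 * length ys'" "arc_word r (conv ys')"
    using arc_word_caps[OF _ ys'(1)] v by auto
  have cdr: "cd m (flip (arcs ys')) = r" using jword_valid[OF r(2)] r(1) by (simp add: jword_conv)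
  have vr: "cd r (map LS v) = r" "set (map Suc v) \<subseteq> {1..<r}"
    using crossings_valid[of r v] v cdr by auto
  have xr: "arc_word r (conv xs')" using arc_word_cups[OF _ xs'(1)] v cdr vr by simp
  then have n: "cd m w = r + 2 * length xs'"
    using iword_valid[OF xr] cdw cdr vr by (simp add: iword_conv)
  obtain u where u: "u \<in> W r" "word_perm u = word_perm (map Suc v)" "set u \<subseteq> {1..<r}"
    using word_choice_word[OF W word_perm_permutes[OF vr(2)]] by blast
  have "le_at r (map LS v) (sword u)"
    using same_perm_le[OF vr(2) u(3)] u(2) by (simp add: sword_map_Suc)
  then have "le_at m (arcs xs' @ map LS v @ flip (arcs ys')) (arcs xs' @ sword u @ flip (arcs ys'))"
    using le_at_context[of m "flip (arcs ys')"] cdr by simp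
  then have 3: "le_at m w (stdword (r, conv xs', u, conv ys'))"
    using le_at_trans[OF 2] by (simp add: iword_conv jword_conv)
  have "(r, conv xs', u, conv ys') \<in> standard_expressions W m (cd m w)"
    using xr r u n by (simp add: standard_expressions_def)
  then show ?thesis using 3 w unfolding le_at_def by blast
qed

subsection \<open>Standard expressions span\<close>

text \<open>The linear span of valid words, closed under the congruence. As a predicate on
  expressions it is stable under composition by a double induction.\<close>

inductive word_span :: "nat \<Rightarrow> nat \<Rightarrow> 'k expr \<Rightarrow> bool" where
  ws_word: "vld m w \<Longrightarrow> t \<simeq> ev m w \<Longrightarrow> word_span m (cd m w) t"
| ws_zero: "t \<simeq> EZero m n \<Longrightarrow> word_span m n t"
| ws_sum: "word_span m n t \<Longrightarrow> word_span m n u \<Longrightarrow> v \<simeq> t \<^bold>+ u \<Longrightarrow> word_span m n v"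
| ws_scale: "word_span m n t \<Longrightarrow> v \<simeq> c \<^bold>* t \<Longrightarrow> word_span m n v"

lemma word_span_typed: "word_span m n t \<Longrightarrow> well_typed t \<and> edom t = m \<and> ecod t = n"
  by (induction rule: word_span.induct) (auto dest: peq_typed)

lemma word_span_cong: "word_span m n t \<Longrightarrow> t' \<simeq> t \<Longrightarrow> word_span m n t'"
  using ws_scale[of m n t t' 1] scale_one_peq by blast

lemma word_span_comp:
  assumes "word_span n k t" "word_span m n u"
  shows "word_span m k (t \<^bold>\<cdot> u)"
  using assms
proof (induction arbitrary: u rule: word_span.induct)
  case (ws_word n w t)
  from ws_word(3) ws_word(1,2) show ?case
  proof (induction m n u rule: word_span.induct)
    case (ws_word m w' u)
    have "t \<^bold>\<cdot> u \<simeq> ev (cd m w') w \<^bold>\<cdot> ev m w'"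
      using ws_word peq_typed[OF ws_word(4)] peq_typed[OF ws_word(2)] by (intro pres_eq.cong_comp) auto
    also have "\<dots> \<simeq> ev m (w @ w')" using ws_word by (intro pres_eq.sym[OF ev_append]) auto
    finally show ?case using word_span.ws_word[of m "w @ w'"] ws_word by simp
  next
    case (ws_zero u m n)
    have "t \<^bold>\<cdot> u \<simeq> t \<^bold>\<cdot> EZero m n"
      using ws_zero peq_typed[OF ws_zero(3)] peq_typed[OF ws_zero(1)] by (intro peq_comp_right) auto
    also have "\<dots> \<simeq> EZero m (cd n w)"
      using comp_zero[of t n m] ws_zero peq_typed[OF ws_zero(3)] by auto
    finally show ?case by (rule word_span.ws_zero)
  next
    case (ws_sum m n u1 u2 u)
    note ty = word_span_typed[OF ws_sum(1)] word_span_typed[OF ws_sum(2)] peq_typed[OF ws_sum(7)]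
    have "t \<^bold>\<cdot> u \<simeq> t \<^bold>\<cdot> (u1 \<^bold>+ u2)"
      using ws_sum ty peq_typed[OF ws_sum(3)] by (intro peq_comp_right) auto
    also have "\<dots> \<simeq> t \<^bold>\<cdot> u1 \<^bold>+ t \<^bold>\<cdot> u2"
      using ws_sum ty by (intro pres_eq.comp_sum_right) (auto simp: parallel_def)
    finally show ?case using word_span.ws_sum ws_sum by blast
  next
    case (ws_scale m n u1 u c)
    note ty = word_span_typed[OF ws_scale(1)] peq_typed[OF ws_scale(5)]
    have "t \<^bold>\<cdot> u \<simeq> t \<^bold>\<cdot> (c \<^bold>* u1)"
      using ws_scale ty peq_typed[OF ws_scale(2)] by (intro peq_comp_right) auto
    also have "\<dots> \<simeq> c \<^bold>* (t \<^bold>\<cdot> u1)" using ws_scale ty by (intro pres_eq.comp_scale_right) auto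
    finally show ?case using word_span.ws_scale ws_scale by blast
  qed
next
  case (ws_zero t n k)
  have "t \<^bold>\<cdot> u \<simeq> EZero n k \<^bold>\<cdot> u"
    using ws_zero peq_typed[OF ws_zero(1)] word_span_typed[OF ws_zero(2)] by (intro peq_comp_left) auto
  also have "\<dots> \<simeq> EZero m k" using zero_comp[of u n k] word_span_typed[OF ws_zero(2)] by auto
  finally show ?case by (rule word_span.ws_zero)
next
  case (ws_sum n k t1 t2 t)
  note ty = word_span_typed[OF ws_sum(1)] word_span_typed[OF ws_sum(2)] peq_typed[OF ws_sum(3)] word_span_typed[OF ws_sum(6)]
  have "t \<^bold>\<cdot> u \<simeq> (t1 \<^bold>+ t2) \<^bold>\<cdot> u" using ws_sum ty by (intro peq_comp_left) auto
  also have "\<dots> \<simeq> t1 \<^bold>\<cdot> u \<^bold>+ t2 \<^bold>\<cdot> u"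
    using ws_sum ty by (intro pres_eq.comp_sum_left) (auto simp: parallel_def)
  finally show ?case using word_span.ws_sum ws_sum by blast
next
  case (ws_scale n k t1 t c)
  note ty = word_span_typed[OF ws_scale(1)] peq_typed[OF ws_scale(2)] word_span_typed[OF ws_scale(4)]
  have "t \<^bold>\<cdot> u \<simeq> (c \<^bold>* t1) \<^bold>\<cdot> u" using ws_scale ty by (intro peq_comp_left) auto
  also have "\<dots> \<simeq> c \<^bold>* (t1 \<^bold>\<cdot> u)" using ws_scale ty by (intro pres_eq.comp_scale_left) auto
  finally show ?case using word_span.ws_scale ws_scale by blast
qed

lemma pad_unit: "well_typed t \<Longrightarrow> pad 0 0 t \<simeq> t"
  unfolding pad_def using pres_eq.trans[OF pres_eq.tens_unit_right pres_eq.tens_unit_left] by simp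

lemma pad_tens:
  assumes "well_typed t" "well_typed u"
  shows "pad a b (t \<^bold>\<otimes> u) \<simeq> pad a (ecod u + b) t \<^bold>\<cdot> pad (a + edom t) b u"
proof -
  have 1: "t \<^bold>\<otimes> EId (ecod u) \<simeq> pad 0 (ecod u) t"
    unfolding pad_def using assms peq_tens_left[OF pres_eq.sym[OF pres_eq.tens_unit_left]] by simp
  have 2: "EId (edom t) \<^bold>\<otimes> u \<simeq> pad (edom t) 0 u"
    unfolding pad_def using assms by (intro pres_eq.sym[OF pres_eq.tens_unit_right]) simp
  have "pad a b (t \<^bold>\<otimes> u) \<simeq> pad a b ((t \<^bold>\<otimes> EId (ecod u)) \<^bold>\<cdot> (EId (edom t) \<^bold>\<otimes> u))"
    by (rule pad_cong[OF tens_as_comp[OF assms]])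
  also have "\<dots> \<simeq> pad a b (t \<^bold>\<otimes> EId (ecod u)) \<^bold>\<cdot> pad a b (EId (edom t) \<^bold>\<otimes> u)"
    using assms by (intro pad_comp) auto
  also have "\<dots> \<simeq> pad a (ecod u + b) t \<^bold>\<cdot> pad (a + edom t) b u"
    using assms pres_eq.trans[OF pad_cong[OF 1] pad_pad[OF assms(1)], of a b]
      pres_eq.trans[OF pad_cong[OF 2] pad_pad[OF assms(2)], of a b]
    by (intro pres_eq.cong_comp) auto
  finally show ?thesis .
qed

lemma word_span_letter: "lpos x = 0 \<Longrightarrow> word_span (a + ldom x + b) (a + lcod x + b) (pad a b (lgen x))"
proof -
  assume "lpos x = 0"
  then have "pad a b (lgen x) = lev (shl a x) (a + ldom x + b)" by (simp add: lev_pad)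
  then have "pad a b (lgen x) \<simeq> ev (a + ldom x + b) [shl a x]"
    using pres_eq.sym[OF ev_single[of "shl a x" "a + ldom x + b"]] \<open>lpos x = 0\<close> by simp
  moreover have "cd (a + ldom x + b) [shl a x] = a + lcod x + b" by simp
  ultimately show ?thesis
    using ws_word[of "a + ldom x + b" "[shl a x]"] \<open>lpos x = 0\<close> by (metis (no_types) cd.simps
      add.assoc le_add1 letter_simps(1,2) vld.simps add.right_neutral)
qed

text \<open>The padded statement is the one that passes the induction: a padded tensor product is
  the composite of its two factors with larger paddings.\<close>

lemma word_span_pad: "well_typed t \<Longrightarrow> word_span (a + edom t + b) (a + ecod t + b) (pad a b t)"
proof (induction t arbitrary: a b)
  case EH
  then show ?case using word_span_letter[of "LS 0"] by simp
next
  case EA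
  then show ?case using word_span_letter[of "LA 0"] by simp
next
  case EU
  then show ?case using word_span_letter[of "LU 0"] by simp
next
  case (EId n)
  then show ?case using ws_word[of "a + n + b" "[]"] pad_id by simp
next
  case (ECmp t u)
  then show ?case
    using word_span_cong[OF word_span_comp pad_comp, of "a + ecod u + b" "a + ecod t + b" a b t "a + edom u + b" u]
    by simp
next
  case (ETns t u)
  have "word_span (a + edom t + edom u + b) (a + ecod t + (ecod u + b)) (pad a (ecod u + b) t \<^bold>\<cdot> pad (a + edom t) b u)"
    using ETns.IH(1)[of a "ecod u + b"] ETns.IH(2)[of "a + edom t" b] ETns.prems
    by (intro word_span_comp) (auto simp: add.assoc)
  then show ?case using word_span_cong[OF _ pad_tens] ETns.prems by (simp add: add.assoc)
next
  case (EZero m n)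
  then show ?case using ws_zero pad_zero by simp
next
  case (ESum t u)
  then show ?case
    using ws_sum[of "a + edom t + b" "a + ecod t + b" "pad a b t" "pad a b u"] pad_sum[of t u a b]
    by (simp add: parallel_def)
next
  case (EScl c t)
  then show ?case using ws_scale[of "a + edom t + b" "a + ecod t + b" "pad a b t"] pad_scale[of t a b c] by simp
qed

lemma word_span_all: "well_typed t \<Longrightarrow> word_span (edom t) (ecod t) t"
  using word_span_cong[OF word_span_pad[of t 0 0] pres_eq.sym[OF pad_unit]] by simp

end

section \<open>Matchings of the integers\<close>

text \<open>A perfect matching as a fixed point free involution. The point \<open>x\<close> with
  \<open>x >= 0\<close> is the outgoing point number \<open>x\<close>, and \<open>- 1 - k\<close> is
  the incoming point number \<open>k\<close>; infinitely many points on both sides make sources and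
  targets invisible.\<close>

definition matching :: "(int \<Rightarrow> int) \<Rightarrow> bool" where
  "matching p \<longleftrightarrow> (\<forall>x. p (p x) = x \<and> p x \<noteq> x)"

definition ins :: "int \<Rightarrow> int \<Rightarrow> int" where
  "ins i x = (if x < i then x else x + 2)"

definition del :: "int \<Rightarrow> int \<Rightarrow> int" where
  "del i x = (if x < i then x else x - 2)"

definition tau :: "int \<Rightarrow> int \<Rightarrow> int" where
  "tau i x = (if x = i then i + 1 else if x = i + 1 then i else x)"

text \<open>Joins the partners of \<open>i\<close> and \<open>i + 1\<close>, while \<open>i\<close>
  and \<open>i + 1\<close> themselves are still present. The values at these two points are
  irrelevant, because \<open>aD\<close> evaluates only at \<open>ins i x\<close>.\<close>

definition cut :: "int \<Rightarrow> (int \<Rightarrow> int) \<Rightarrow> int \<Rightarrow> int" where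
  "cut i p x = (if p x = i then p (i + 1) else if p x = i + 1 then p i else p x)"

definition sD :: "int \<Rightarrow> (int \<Rightarrow> int) \<Rightarrow> int \<Rightarrow> int" where
  "sD i p x = tau i (p (tau i x))"

definition uD :: "int \<Rightarrow> (int \<Rightarrow> int) \<Rightarrow> int \<Rightarrow> int" where
  "uD i p x = (if x = i then i + 1 else if x = i + 1 then i else ins i (p (del i x)))"

definition aD :: "int \<Rightarrow> (int \<Rightarrow> int) \<Rightarrow> int \<Rightarrow> int" where
  "aD i p x = del i (cut i p (ins i x))"

lemma matchingD: "matching p \<Longrightarrow> p (p x) = x" "matching p \<Longrightarrow> p x \<noteq> x"
  by (auto simp: matching_def)

lemma matching_inj: "matching p \<Longrightarrow> p x = p y \<longleftrightarrow> x = y"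
  by (metis matchingD(1))

lemma tau_tau [simp]: "tau i (tau i x) = x"
  by (auto simp: tau_def)

lemma ins_del [simp]: "x \<noteq> i \<Longrightarrow> x \<noteq> i + 1 \<Longrightarrow> ins i (del i x) = x"
  by (auto simp: ins_def del_def)

lemma del_ins [simp]: "del i (ins i x) = x"
  by (auto simp: ins_def del_def)

lemma ins_neq [simp]: "ins i x \<noteq> i" "ins i x \<noteq> i + 1"
  by (auto simp: ins_def)

lemma ins_inj [simp]: "ins i x = ins i y \<longleftrightarrow> x = y"
  by (metis del_ins)

lemma matching_sD: "matching p \<Longrightarrow> matching (sD i p)"
  unfolding matching_def sD_def by (metis tau_tau)

lemma uD_ins: "uD i p (ins i x) = ins i (p x)" and uD_at: "uD i p i = i + 1" "uD i p (i + 1) = i"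
  by (auto simp: uD_def)

lemma ins_cases: obtains "x = i" | "x = i + 1" | y where "x = ins i y"
  by (metis ins_del)

lemma matching_uD:
  assumes "matching p"
  shows "matching (uD i p)"
  unfolding matching_def
proof
  fix x
  show "uD i p (uD i p x) = x \<and> uD i p x \<noteq> x"
    by (cases x i rule: ins_cases) (simp_all add: uD_at uD_ins matchingD[OF assms])
qed

lemma cut_neq:
  assumes "matching p" "x \<noteq> i" "x \<noteq> i + 1"
  shows "cut i p x \<noteq> i \<and> cut i p x \<noteq> i + 1"
  using matchingD[OF assms(1), of x] matchingD[OF assms(1), of i] matchingD[OF assms(1), of "i + 1"] assms(2,3)
  unfolding cut_def by smt

lemma cut_cut:
  assumes "matching p" "x \<noteq> i" "x \<noteq> i + 1"
  shows "cut i p (cut i p x) = x"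
  using matchingD[OF assms(1), of x] matchingD[OF assms(1), of i] matchingD[OF assms(1), of "i + 1"] assms(2,3)
  unfolding cut_def by smt

lemma cut_irrefl:
  assumes "matching p" "x \<noteq> i" "x \<noteq> i + 1"
  shows "cut i p x \<noteq> x"
  using matchingD[OF assms(1), of x] matchingD[OF assms(1), of i] matchingD[OF assms(1), of "i + 1"] assms(2,3)
  unfolding cut_def by smt

lemma matching_aD:
  assumes "matching p"
  shows "matching (aD i p)"
  unfolding matching_def aD_def
  using cut_neq[OF assms] cut_cut[OF assms] cut_irrefl[OF assms] by (metis ins_del del_ins ins_neq)

lemma ins_aD: "matching p \<Longrightarrow> ins i (aD i p x) = cut i p (ins i x)"
  unfolding aD_def using cut_neq ins_neq ins_del by blast

lemma fun_eq_insI: "(\<And>x. ins i (f x) = ins i (g x)) \<Longrightarrow> f = g"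
  by auto

lemma sD_sD [simp]: "sD i (sD i p) = p"
  by (auto simp: sD_def)

lemma tau_braid: "tau i (tau (i + 1) (tau i x)) = tau (i + 1) (tau i (tau (i + 1) x))"
  by (auto simp: tau_def)

lemma sD_braid: "sD i (sD (i + 1) (sD i p)) = sD (i + 1) (sD i (sD (i + 1) p))"
  by (rule ext) (simp add: sD_def tau_braid)

lemma sD_uD: "sD i (uD i p) = uD i p"
  by (rule ext) (auto simp: sD_def uD_def tau_def)

lemma tau_ins: "tau i (ins (i + 1) x) = tau (i + 1) (ins i x)"
  by (auto simp: tau_def ins_def)

lemma del_tau: "x \<noteq> i \<Longrightarrow> x \<noteq> i + 2 \<Longrightarrow> del (i + 1) (tau i x) = del i (tau (i + 1) x)"
  by (auto simp: tau_def del_def)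

lemma sD_uD_slide: "sD i (uD (i + 1) p) = sD (i + 1) (uD i p)"
proof
  fix x
  show "sD i (uD (i + 1) p) x = sD (i + 1) (uD i p) x"
  proof (cases "x = i \<or> x = i + 2")
    case True
    then show ?thesis by (auto simp: sD_def uD_def tau_def)
  next
    case False
    then have "tau i x \<noteq> i + 1" "tau i x \<noteq> i + 2" "tau (i + 1) x \<noteq> i" "tau (i + 1) x \<noteq> i + 1"
      by (auto simp: tau_def)
    then show ?thesis using False del_tau tau_ins by (simp add: sD_def uD_def add.assoc)
  qed
qed

lemma sD_sD_uD: "sD i (sD (i + 1) (uD i p)) = uD (i + 1) p"
  using sD_uD_slide[of i p] by (metis sD_sD)

lemma aD_eqI:
  assumes "\<And>x. cut i p (ins i x) = cut i q (ins i x)"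
  shows "aD i p = aD i q"
  using assms by (auto simp: aD_def)

lemma aD_sD:
  assumes "matching p"
  shows "aD i (sD i p) = aD i p"
proof (rule aD_eqI)
  fix x
  have "tau i (ins i x) = ins i x" by (simp add: tau_def)
  then show "cut i (sD i p) (ins i x) = cut i p (ins i x)"
    using matching_inj[OF assms, of "ins i x" i] matching_inj[OF assms, of "ins i x" "i + 1"]
      matchingD[OF assms, of i] matchingD[OF assms, of "i + 1"] ins_neq[of i x]
    unfolding cut_def sD_def by (auto simp: tau_def)
qed

text \<open>On both sides the points \<open>i\<close> and \<open>i + 2\<close> of \<open>p\<close>
  get capped, and the surviving point \<open>i + 1\<close> keeps its place.\<close>

lemma aD_sD_slide:
  assumes "matching p"
  shows "aD (i + 1) (sD i p) = aD i (sD (i + 1) p)"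
proof
  fix x
  define y where "y = tau (i + 1) (ins i x)"
  have y: "y \<noteq> i" "y \<noteq> i + 2" by (auto simp: y_def tau_def ins_def)
  have tx: "tau i (ins (i + 1) x) = y" unfolding y_def by (rule tau_ins)
  \<comment> \<open>The end of the path starting at \<open>y\<close> when \<open>i\<close> and
    \<open>i + 2\<close> are joined; both sides equal \<open>u\<close> up to relabelling.\<close>
  define u where "u = (if p y = i then p (i + 2) else if p y = i + 2 then p i else p y)"
  have u: "u \<noteq> i" "u \<noteq> i + 2"
    using y matchingD[OF assms, of y] matchingD[OF assms, of i] matchingD[OF assms, of "i + 2"]
    unfolding u_def by smt+
  have "cut (i + 1) (sD i p) (ins (i + 1) x) = tau i u"
    unfolding cut_def sD_def tx u_def by (auto simp: tau_def add.assoc)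
  moreover have "cut i (sD (i + 1) p) (ins i x) = tau (i + 1) u"
    unfolding cut_def sD_def y_def[symmetric] u_def by (auto simp: tau_def add.assoc)
  ultimately show "aD (i + 1) (sD i p) x = aD i (sD (i + 1) p) x"
    using del_tau[OF u] by (simp add: aD_def)
qed

lemma aD_sD_sD: "matching p \<Longrightarrow> aD i (sD (i + 1) (sD i p)) = aD (i + 1) p"
  using aD_sD_slide[OF matching_sD, of p i i] by simp

lemma aD_uD: "aD i (uD i p) = p"
  by (rule ext) (auto simp: aD_def uD_def cut_def)

lemma aD_uD_right:
  assumes "matching p"
  shows "aD i (uD (i + 1) p) = p"
proof (rule fun_eq_insI[of i])
  fix x
  let ?q = "uD (i + 1) p"
  have q: "?q i = ins (i + 1) (p i)" "?q (i + 1) = i + 2" "?q (i + 2) = i + 1"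
    using uD_ins[of "i + 1" p i] uD_at[of "i + 1" p] by (auto simp: ins_def add.assoc)
  have "cut i ?q (ins i x) = ins i (p x)"
  proof (cases "x = i")
    case True
    then show ?thesis using q matchingD(2)[OF assms, of i] by (auto simp: cut_def ins_def)
  next
    case False
    then have "ins i x = ins (i + 1) x" by (auto simp: ins_def)
    then show ?thesis using q uD_ins[of "i + 1" p x] by (auto simp: cut_def) (auto simp: ins_def split: if_splits)
  qed
  then show "ins i (aD i ?q x) = ins i (p x)" by (simp add: ins_aD[OF matching_uD[OF assms]])
qed

text \<open>Inserting an invisible twist at the cup and sliding the cap over it reduces this zigzag
  to the opposite one.\<close>

lemma aD_uD_left: "matching p \<Longrightarrow> aD (i + 1) (uD i p) = p"
  using aD_sD_slide[OF matching_uD, of p i i] aD_sD[OF matching_uD, of p i "i + 1"] aD_uD_right[of p i]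
  by (simp add: sD_uD sD_uD_slide[symmetric])

lemma aD_sD_uD: "matching p \<Longrightarrow> aD i (sD (i + 1) (uD i p)) = p"
  using aD_sD_slide[OF matching_uD, of p i i] by (simp add: sD_uD aD_uD_left)

lemma tau_far: "i + 2 \<le> j \<Longrightarrow> tau i (tau j x) = tau j (tau i x)"
  by (auto simp: tau_def)

lemma ins_ins: "i \<le> j \<Longrightarrow> ins i (ins j x) = ins (j + 2) (ins i x)"
  by (auto simp: ins_def)

lemma ins_tau: "i \<le> j \<Longrightarrow> ins i (tau j x) = tau (j + 2) (ins i x)"
  "j + 2 \<le> i \<Longrightarrow> ins i (tau j x) = tau j (ins i x)"
  by (auto simp: ins_def tau_def)

lemma sD_sD_far: "i + 2 \<le> j \<Longrightarrow> sD j (sD i p) = sD i (sD j p)"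
  by (rule ext) (simp add: sD_def tau_far[of i j])

lemma uD_eqI:
  assumes "q i = i + 1" "q (i + 1) = i" "\<And>x. q (ins i x) = ins i (p x)"
  shows "q = uD i p"
proof
  fix x
  show "q x = uD i p x"
    using assms(1,2) assms(3)[of "del i x"] by (cases "x = i \<or> x = i + 1") (auto simp: uD_def)
qed

lemma sD_uD_far: "i \<le> j \<Longrightarrow> sD (j + 2) (uD i p) = uD i (sD j p)"
  by (rule uD_eqI) (auto simp: sD_def ins_tau[symmetric] uD_ins, auto simp: tau_def uD_at)

lemma sD_uD_far_left: "j + 2 \<le> i \<Longrightarrow> sD j (uD i p) = uD i (sD j p)"
  by (rule uD_eqI) (auto simp: sD_def ins_tau[symmetric] uD_ins, auto simp: tau_def uD_at)

lemma uD_uD_far: "i \<le> j \<Longrightarrow> uD (j + 2) (uD i p) = uD i (uD j p)"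
proof (rule uD_eqI)
  assume "i \<le> j"
  show "uD (j + 2) (uD i p) i = i + 1" "uD (j + 2) (uD i p) (i + 1) = i"
    using \<open>i \<le> j\<close> by (auto simp: uD_def ins_def del_def)
  fix x
  show "uD (j + 2) (uD i p) (ins i x) = ins i (uD j p x)"
  proof (cases "x = j \<or> x = j + 1")
    case True
    then have "ins i x = x + 2" using \<open>i \<le> j\<close> by (auto simp: ins_def)
    then show ?thesis using True \<open>i \<le> j\<close> by (auto simp: uD_def ins_def)
  next
    case False
    then obtain y where y: "x = ins j y" by (metis ins_del)
    then show ?thesis using \<open>i \<le> j\<close> by (simp add: uD_ins ins_ins)
  qed
qed

lemma cut_sD:
  assumes "i + 2 \<le> j \<or> j + 2 \<le> i"
  shows "cut i (sD j p) x = tau j (cut i p (tau j x))"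
proof -
  have at: "tau j i = i" "tau j (i + 1) = i + 1" using assms by (auto simp: tau_def)
  have eq: "tau j z = i \<longleftrightarrow> z = i" "tau j z = i + 1 \<longleftrightarrow> z = i + 1" for z
    using assms by (auto simp: tau_def)
  show ?thesis unfolding cut_def sD_def at eq by simp
qed

lemma sD_aD_far:
  assumes "matching p" "i \<le> j"
  shows "sD j (aD i p) = aD i (sD (j + 2) p)"
proof (rule fun_eq_insI[of i])
  fix x
  show "ins i (sD j (aD i p) x) = ins i (aD i (sD (j + 2) p) x)"
    using assms(2) cut_sD[of i "j + 2" p "ins i x"]
    by (simp add: ins_aD[OF matching_sD[OF assms(1)]] sD_def[of j] ins_tau(1)[OF assms(2)] ins_aD[OF assms(1)])
qed

lemma sD_aD_far_left:
  assumes "matching p" "j + 2 \<le> i"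
  shows "sD j (aD i p) = aD i (sD j p)"
proof (rule fun_eq_insI[of i])
  fix x
  show "ins i (sD j (aD i p) x) = ins i (aD i (sD j p) x)"
    using assms(2) cut_sD[of i "j" p "ins i x"]
    by (simp add: ins_aD[OF matching_sD[OF assms(1)]] sD_def[of j] ins_tau(2)[OF assms(2)] ins_aD[OF assms(1)])
qed

lemma uD_aD_far:
  assumes "matching p" "i \<le> j"
  shows "aD i (uD (j + 2) p) = uD j (aD i p)"
proof (rule uD_eqI)
  note m = matching_uD[OF assms(1), of "j + 2"]
  have "ins i (aD i (uD (j + 2) p) j) = ins i (j + 1)" "ins i (aD i (uD (j + 2) p) (j + 1)) = ins i j"
    unfolding ins_aD[OF m] using assms(2) by (auto simp: cut_def uD_def ins_def)
  then show "aD i (uD (j + 2) p) j = j + 1" "aD i (uD (j + 2) p) (j + 1) = j" by simp_all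
  fix x
  have "ins i (aD i (uD (j + 2) p) (ins j x)) = cut i (uD (j + 2) p) (ins (j + 2) (ins i x))"
    using assms by (simp add: ins_aD[OF m] ins_ins)
  also have "\<dots> = ins (j + 2) (cut i p (ins i x))"
  proof -
    have "ins (j + 2) i = i" "ins (j + 2) (i + 1) = i + 1" using assms(2) by (auto simp: ins_def)
    then have "uD (j + 2) p i = ins (j + 2) (p i)" "uD (j + 2) p (i + 1) = ins (j + 2) (p (i + 1))"
      "ins (j + 2) y = i \<longleftrightarrow> y = i" "ins (j + 2) y = i + 1 \<longleftrightarrow> y = i + 1" for y
      using uD_ins[of "j + 2" p i] uD_ins[of "j + 2" p "i + 1"] ins_inj by metis+
    then show ?thesis by (simp add: cut_def uD_ins)
  qed
  also have "\<dots> = ins i (ins j (aD i p x))" using assms by (simp add: ins_aD[symmetric] ins_ins)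
  finally show "aD i (uD (j + 2) p) (ins j x) = ins j (aD i p x)" by simp
qed

lemma aD_uD_far:
  assumes "matching p" "i \<le> j"
  shows "aD (j + 2) (uD i p) = uD i (aD j p)"
proof (rule uD_eqI)
  note m = matching_uD[OF assms(1), of i]
  have "ins (j + 2) (aD (j + 2) (uD i p) i) = ins (j + 2) (i + 1)"
    "ins (j + 2) (aD (j + 2) (uD i p) (i + 1)) = ins (j + 2) i"
    unfolding ins_aD[OF m] using assms(2) by (auto simp: cut_def uD_def ins_def)
  then show "aD (j + 2) (uD i p) i = i + 1" "aD (j + 2) (uD i p) (i + 1) = i" by simp_all
  fix x
  have "ins (j + 2) (aD (j + 2) (uD i p) (ins i x)) = cut (j + 2) (uD i p) (ins i (ins j x))"
    using assms by (simp add: ins_aD[OF m] ins_ins)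
  also have "\<dots> = ins i (cut j p (ins j x))"
  proof -
    have "ins i j = j + 2" "ins i (j + 1) = j + 2 + 1" using assms(2) by (auto simp: ins_def)
    then have "uD i p (j + 2) = ins i (p j)" "uD i p (j + 2 + 1) = ins i (p (j + 1))"
      "ins i y = j + 2 \<longleftrightarrow> y = j" "ins i y = j + 2 + 1 \<longleftrightarrow> y = j + 1" for y
      using uD_ins[of i p j] uD_ins[of i p "j + 1"] ins_inj by metis+
    then show ?thesis by (simp add: cut_def uD_ins)
  qed
  also have "\<dots> = ins (j + 2) (ins i (aD j p x))" using assms by (simp add: ins_aD[symmetric] ins_ins[symmetric])
  finally show "aD (j + 2) (uD i p) (ins i x) = ins i (aD j p x)" by simp
qed

lemma cut_ins:
  assumes "matching p" "i \<le> j"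
  shows "ins i (cut j (aD i p) x) = cut (j + 2) (cut i p) (ins i x)"
proof -
  have "ins i j = j + 2" "ins i (j + 1) = j + 2 + 1" using assms(2) by (auto simp: ins_def)
  then have "aD i p y = j \<longleftrightarrow> cut i p (ins i y) = j + 2" "aD i p y = j + 1 \<longleftrightarrow> cut i p (ins i y) = j + 2 + 1"
    "ins i (aD i p j) = cut i p (j + 2)" "ins i (aD i p (j + 1)) = cut i p (j + 2 + 1)" for y
    using ins_aD[OF assms(1), of i] ins_inj by metis+
  then show ?thesis by (simp add: cut_def[of j] cut_def[of "j + 2"] ins_aD[OF assms(1)])
qed

lemma cut_ins':
  assumes "matching p" "i \<le> j"
  shows "ins (j + 2) (cut i (aD (j + 2) p) x) = cut i (cut (j + 2) p) (ins (j + 2) x)"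
proof -
  have "ins (j + 2) i = i" "ins (j + 2) (i + 1) = i + 1" using assms(2) by (auto simp: ins_def)
  then have "aD (j + 2) p y = i \<longleftrightarrow> cut (j + 2) p (ins (j + 2) y) = i"
    "aD (j + 2) p y = i + 1 \<longleftrightarrow> cut (j + 2) p (ins (j + 2) y) = i + 1"
    "ins (j + 2) (aD (j + 2) p i) = cut (j + 2) p i" "ins (j + 2) (aD (j + 2) p (i + 1)) = cut (j + 2) p (i + 1)" for y
    using ins_aD[OF assms(1), of "j + 2"] ins_inj by metis+
  then show ?thesis by (simp add: cut_def[of i] ins_aD[OF assms(1)])
qed

text \<open>A path may run through both caps; it ends at the same point whichever cap is performed
  first.\<close>

lemma cut_cut_far:
  assumes "matching p" "i + 2 \<le> j" "x \<noteq> i" "x \<noteq> i + 1" "x \<noteq> j" "x \<noteq> j + 1"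
  shows "cut j (cut i p) x = cut i (cut j p) x"
proof -
  define k where "k = j + 1"
  define h where "h = i + 1"
  have ne: "i \<noteq> j" "i \<noteq> k" "h \<noteq> j" "h \<noteq> k" "i \<noteq> h" "j \<noteq> k" using assms(2) by (auto simp: k_def h_def)
  have x: "x \<noteq> i" "x \<noteq> h" "x \<noteq> j" "x \<noteq> k" using assms by (auto simp: k_def h_def)
  note m = matchingD[OF assms(1), of i] matchingD[OF assms(1), of j] matchingD[OF assms(1), of h]
    matchingD[OF assms(1), of k] matchingD[OF assms(1), of x]
  show ?thesis
    unfolding cut_def k_def[symmetric] h_def[symmetric]
    using m ne x by (auto split: if_splits)
qed

lemma aD_aD_far:
  assumes "matching p" "i \<le> j"
  shows "aD j (aD i p) = aD i (aD (j + 2) p)"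
proof
  fix x
  have 1: "ins i (ins j (aD j (aD i p) x)) = cut (j + 2) (cut i p) (ins i (ins j x))"
    using assms by (simp add: ins_aD[OF matching_aD] cut_ins)
  have 2: "ins (j + 2) (ins i (aD i (aD (j + 2) p) x)) = cut i (cut (j + 2) p) (ins (j + 2) (ins i x))"
    using assms by (simp add: ins_aD[OF matching_aD] cut_ins')
  have "cut (j + 2) (cut i p) (ins i (ins j x)) = cut i (cut (j + 2) p) (ins (j + 2) (ins i x))"
    unfolding ins_ins[OF assms(2)] using assms(2) ins_neq[of "j + 2" "ins i x"] ins_neq[of i "ins j x"]
    by (intro cut_cut_far[OF assms(1)]) (auto simp: ins_ins)
  then show "aD j (aD i p) x = aD i (aD (j + 2) p) x"
    using 1 2 assms(2) by (metis ins_ins ins_inj)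
qed

lemma loop_aD_far:
  assumes "matching p" "i \<le> j"
  shows "aD i p j = j + 1 \<longleftrightarrow> cut i p (j + 2) = j + 3" "aD (j + 2) p i = i + 1 \<longleftrightarrow> cut (j + 2) p i = i + 1"
proof -
  have "ins i j = j + 2" "ins i (j + 1) = j + 3" using assms(2) by (auto simp: ins_def)
  then show "aD i p j = j + 1 \<longleftrightarrow> cut i p (j + 2) = j + 3" using ins_aD[OF assms(1), of i] ins_inj by metis
  have "ins (j + 2) i = i" "ins (j + 2) (i + 1) = i + 1" using assms(2) by (auto simp: ins_def)
  then show "aD (j + 2) p i = i + 1 \<longleftrightarrow> cut (j + 2) p i = i + 1" using ins_aD[OF assms(1), of "j + 2"] ins_inj by metis
qed

text \<open>The loops closed by two caps are counted independently of their order. The delicate case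
  is a pair of strands joining the end points of one cap to those of the other: together they close
  a single loop, which is charged to whichever cap acts second.\<close>

lemma loop_far:
  fixes d :: "'a::comm_ring_1"
  assumes "matching p" "i \<le> j"
  shows "(if p i = i + 1 then d else 1) * (if aD i p j = j + 1 then d else 1) =
    (if p (j + 2) = j + 3 then d else 1) * (if aD (j + 2) p i = i + 1 then d else 1)"
proof -
  define J where "J = j + 2"
  define K where "K = j + 3"
  define h where "h = i + 1"
  have ne: "i \<noteq> J" "i \<noteq> K" "h \<noteq> J" "h \<noteq> K" "i \<noteq> h" "J \<noteq> K" "J + 1 = K"
    using assms(2) by (auto simp: J_def K_def h_def)
  note m = matchingD[OF assms(1), of i] matchingD[OF assms(1), of h] matchingD[OF assms(1), of J]
    matchingD[OF assms(1), of K]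
  have 1: "cut i p J = K \<longleftrightarrow> p J = K \<or> (p J = i \<and> p h = K) \<or> (p J = h \<and> p i = K)"
    using ne unfolding cut_def h_def[symmetric] by auto
  have 2: "cut J p i = h \<longleftrightarrow> p i = h \<or> (p i = J \<and> p K = h) \<or> (p i = K \<and> p J = h)"
    using ne unfolding cut_def by auto
  have 3: "p i = J \<longleftrightarrow> p J = i" "p K = h \<longleftrightarrow> p h = K" using m by metis+
  have 4: "p J = h \<Longrightarrow> p i \<noteq> h" "p J = i \<Longrightarrow> p i \<noteq> h" "p i = K \<Longrightarrow> p J \<noteq> K" "p J = i \<Longrightarrow> p J \<noteq> K" "p J = h \<Longrightarrow> p J \<noteq> K"
    using m ne by metis+
  show ?thesis
    unfolding loop_aD_far[OF assms] unfolding h_def[symmetric] J_def[symmetric] K_def[symmetric] 1 2 3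
    using 4 by auto
qed

section \<open>A representation on matchings\<close>

lemma koszul_sign_add: "koszul_sign q (p + p') = koszul_sign q p * (koszul_sign q p' :: 'k::ring_1)"
  "koszul_sign (q + q') p = koszul_sign q p * (koszul_sign q' p :: 'k::ring_1)"
  by (cases q; cases p; cases p'; simp add: koszul_sign_def) (cases q; cases q'; cases p; simp add: koszul_sign_def)

context brauer_family
begin

text \<open>Functions on matchings carry a contravariant action of the expressions; \<open>act t a\<close> is the action
  of \<open>1\<^sub>a \<otimes> t\<close>. The powers of \<open>e\<close> twist the tensor product of the ordinary Brauer category, and
  \<open>e\<^sup>2 = \<epsilon>\<close> turns the interchange law into the one with signs.\<close>

definition kap :: 'k where "kap = \<sigma> * \<epsilon> * e"
definition loop :: 'k where "loop = \<delta> / kap"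

primrec act :: "'k expr \<Rightarrow> nat \<Rightarrow> ((int \<Rightarrow> int) \<Rightarrow> 'k) \<Rightarrow> (int \<Rightarrow> int) \<Rightarrow> 'k" where
  "act EH = (\<lambda>a \<phi> p. l * \<phi> (sD (int a) p))"
| "act EA = (\<lambda>a \<phi> p. kap * (\<epsilon> * e) ^ a * (if p (int a) = int a + 1 then loop else 1) * \<phi> (aD (int a) p))"
| "act EU = (\<lambda>a \<phi> p. e ^ a * \<phi> (uD (int a) p))"
| "act (EId n) = (\<lambda>a \<phi>. \<phi>)"
| "act (t \<^bold>\<cdot> u) = (\<lambda>a \<phi>. act u a (act t a \<phi>))"
| "act (t \<^bold>\<otimes> u) = (\<lambda>a \<phi>. act u (a + edom t) (act t a \<phi>))"
| "act (EZero m n) = (\<lambda>a \<phi> p. 0)"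
| "act (t \<^bold>+ u) = (\<lambda>a \<phi> p. act t a \<phi> p + act u a \<phi> p)"
| "act (c \<^bold>* t) = (\<lambda>a \<phi> p. c * act t a \<phi> p)"

text \<open>Functions take all maps of the integers as arguments, but several of the diagram
  identities hold only for matchings, so equality is tested there.\<close>

definition agree :: "((int \<Rightarrow> int) \<Rightarrow> 'k) \<Rightarrow> ((int \<Rightarrow> int) \<Rightarrow> 'k) \<Rightarrow> bool" (infix "\<doteq>" 50) where
  "\<phi> \<doteq> \<psi> \<longleftrightarrow> (\<forall>p. matching p \<longrightarrow> \<phi> p = \<psi> p)"

lemma agree_refl: "\<phi> \<doteq> \<phi>" and agree_sym: "\<phi> \<doteq> \<psi> \<Longrightarrow> \<psi> \<doteq> \<phi>"
  and agree_trans [trans]: "\<phi> \<doteq> \<psi> \<Longrightarrow> \<psi> \<doteq> \<chi> \<Longrightarrow> \<phi> \<doteq> \<chi>"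
  by (simp_all add: agree_def)

lemma agree_scale: "\<phi> \<doteq> \<psi> \<Longrightarrow> (\<lambda>p. c * \<phi> p) \<doteq> (\<lambda>p. c * \<psi> p)"
  by (simp add: agree_def)

lemma act_agree: "\<phi> \<doteq> \<psi> \<Longrightarrow> act t a \<phi> \<doteq> act t a \<psi>"
proof (induction t arbitrary: a \<phi> \<psi>)
  case (ESum t u)
  show ?case using ESum.IH(1)[OF ESum.prems] ESum.IH(2)[OF ESum.prems] by (simp add: agree_def)
next
  case (EScl c t)
  show ?case using EScl.IH[OF EScl.prems] by (simp add: agree_def)
qed (auto simp: agree_def matching_sD matching_uD matching_aD)

lemma act_add: "act t a (\<lambda>p. \<phi> p + \<psi> p) = (\<lambda>p. act t a \<phi> p + act t a \<psi> p)"
  by (induction t arbitrary: a \<phi> \<psi>) (auto simp: algebra_simps)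

lemma act_scale: "act t a (\<lambda>p. c * \<phi> p) = (\<lambda>p. c * act t a \<phi> p)"
  by (induction t arbitrary: a \<phi>) (auto simp: algebra_simps)

lemma act_zero: "act t a (\<lambda>p. 0) = (\<lambda>p. 0)"
  using act_scale[of t a 0 "\<lambda>p. 0"] by simp

lemma kap_nonzero [simp]: "kap \<noteq> 0"
  by (simp add: kap_def)

text \<open>The interchange law for the action, with \<open>u\<close> to the right of
  \<open>v\<close> and \<open>b - a\<close> strands between them. Gaps have to be allowed because
  the factors of a tensor product commute one at a time, the other factor then lying
  between.\<close>

definition comm :: "'k expr \<Rightarrow> bit \<Rightarrow> 'k expr \<Rightarrow> bit \<Rightarrow> bool" where
  "comm u q v p \<longleftrightarrow> (\<forall>a b \<phi>. a \<le> b \<longrightarrow>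
     act v a (act u (b + ecod v) \<phi>) \<doteq> (\<lambda>P. koszul_sign q p * act u (b + edom v) (act v a \<phi>) P))"

lemma commD: "comm u q v p \<Longrightarrow> a \<le> b \<Longrightarrow>
    act v a (act u (b + ecod v) \<phi>) \<doteq> (\<lambda>P. koszul_sign q p * act u (b + edom v) (act v a \<phi>) P)"
  by (simp add: comm_def)

lemma comm_id: "comm u q (EId n) 0" "comm (EId n) 0 v p"
  by (simp_all add: comm_def agree_def)

lemma comm_zero: "comm u q (EZero m n) p" "comm (EZero m n) q v p"
  by (simp_all add: comm_def agree_def act_zero)

lemma comm_sum: "comm u q t p \<Longrightarrow> comm u q v p \<Longrightarrow> parallel t v \<Longrightarrow> comm u q (t \<^bold>+ v) p"
  "comm t q u p \<Longrightarrow> comm v q u p \<Longrightarrow> comm (t \<^bold>+ v) q u p"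
  by (auto simp: comm_def agree_def act_add parallel_def algebra_simps)

lemma comm_scale: "comm u q t p \<Longrightarrow> comm u q (c \<^bold>* t) p" "comm t q u p \<Longrightarrow> comm (c \<^bold>* t) q u p"
  by (auto simp: comm_def agree_def act_scale algebra_simps)

lemma comm_comp_right:
  assumes "comm u q t p" "comm u q v p'" "edom t = ecod v"
  shows "comm u q (t \<^bold>\<cdot> v) (p + p')"
  unfolding comm_def
proof (intro allI impI)
  fix a b :: nat and \<phi> assume ab: "a \<le> b"
  have "act v a (act t a (act u (b + ecod t) \<phi>)) \<doteq>
      act v a (\<lambda>P. koszul_sign q p * act u (b + edom t) (act t a \<phi>) P)"
    by (rule act_agree[OF commD[OF assms(1) ab]])
  also have "\<dots> = (\<lambda>P. koszul_sign q p * act v a (act u (b + ecod v) (act t a \<phi>)) P)"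
    by (simp add: act_scale assms(3))
  also have "\<dots> \<doteq> (\<lambda>P. koszul_sign q p * (koszul_sign q p' * act u (b + edom v) (act v a (act t a \<phi>)) P))"
    by (rule agree_scale[OF commD[OF assms(2) ab]])
  finally show "act (t \<^bold>\<cdot> v) a (act u (b + ecod (t \<^bold>\<cdot> v)) \<phi>) \<doteq>
      (\<lambda>P. koszul_sign q (p + p') * act u (b + edom (t \<^bold>\<cdot> v)) (act (t \<^bold>\<cdot> v) a \<phi>) P)"
    by (simp only: koszul_sign_add mult.assoc act.simps edom.simps ecod.simps)
qed

lemma comm_tens_right:
  assumes "comm u q t p" "comm u q v p'"
  shows "comm u q (t \<^bold>\<otimes> v) (p + p')"
  unfolding comm_def
proof (intro allI impI)
  fix a b :: nat and \<phi> assume ab: "a \<le> b"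
  have "act v (a + edom t) (act t a (act u (b + ecod v + ecod t) \<phi>)) \<doteq>
      act v (a + edom t) (\<lambda>P. koszul_sign q p * act u (b + ecod v + edom t) (act t a \<phi>) P)"
    using ab by (intro act_agree commD[OF assms(1)]) simp
  also have "\<dots> = (\<lambda>P. koszul_sign q p * act v (a + edom t) (act u (b + edom t + ecod v) (act t a \<phi>)) P)"
    by (simp add: act_scale add_ac)
  also have "\<dots> \<doteq> (\<lambda>P. koszul_sign q p * (koszul_sign q p' *
      act u (b + edom t + edom v) (act v (a + edom t) (act t a \<phi>)) P))"
    using ab by (intro agree_scale commD[OF assms(2)]) simp
  finally show "act (t \<^bold>\<otimes> v) a (act u (b + ecod (t \<^bold>\<otimes> v)) \<phi>) \<doteq>
      (\<lambda>P. koszul_sign q (p + p') * act u (b + edom (t \<^bold>\<otimes> v)) (act (t \<^bold>\<otimes> v) a \<phi>) P)"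
    by (simp only: koszul_sign_add mult.assoc act.simps edom.simps ecod.simps add_ac)
qed

lemma comm_comp_left:
  assumes "comm t q v p" "comm u q' v p"
  shows "comm (t \<^bold>\<cdot> u) (q + q') v p"
  unfolding comm_def
proof (intro allI impI)
  fix a b :: nat and \<phi> assume ab: "a \<le> b"
  have "act v a (act u (b + ecod v) (act t (b + ecod v) \<phi>)) \<doteq>
      (\<lambda>P. koszul_sign q' p * act u (b + edom v) (act v a (act t (b + ecod v) \<phi>)) P)"
    by (rule commD[OF assms(2) ab])
  also have "\<dots> \<doteq> (\<lambda>P. koszul_sign q' p * act u (b + edom v)
      (\<lambda>P. koszul_sign q p * act t (b + edom v) (act v a \<phi>) P) P)"
    by (intro agree_scale act_agree commD[OF assms(1) ab])
  finally show "act v a (act (t \<^bold>\<cdot> u) (b + ecod v) \<phi>) \<doteq>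
      (\<lambda>P. koszul_sign (q + q') p * act (t \<^bold>\<cdot> u) (b + edom v) (act v a \<phi>) P)"
    by (simp only: koszul_sign_add act_scale mult_ac act.simps edom.simps ecod.simps)
qed

lemma comm_tens_left:
  assumes "comm t q v p" "comm u q' v p"
  shows "comm (t \<^bold>\<otimes> u) (q + q') v p"
  unfolding comm_def
proof (intro allI impI)
  fix a b :: nat and \<phi> assume ab: "a \<le> b"
  have "act v a (act u (b + edom t + ecod v) (act t (b + ecod v) \<phi>)) \<doteq>
      (\<lambda>P. koszul_sign q' p * act u (b + edom t + edom v) (act v a (act t (b + ecod v) \<phi>)) P)"
    using ab by (intro commD[OF assms(2)]) simp
  also have "\<dots> \<doteq> (\<lambda>P. koszul_sign q' p * act u (b + edom t + edom v)
      (\<lambda>P. koszul_sign q p * act t (b + edom v) (act v a \<phi>) P) P)"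
    by (intro agree_scale act_agree commD[OF assms(1) ab])
  finally show "act v a (act (t \<^bold>\<otimes> u) (b + ecod v) \<phi>) \<doteq>
      (\<lambda>P. koszul_sign (q + q') p * act (t \<^bold>\<otimes> u) (b + edom v) (act v a \<phi>) P)"
    by (simp only: koszul_sign_add act_scale mult_ac act.simps edom.simps ecod.simps add_ac)
qed

lemma koszul_parity: "koszul_sign (parity \<epsilon>) (parity \<epsilon>) = \<epsilon>"
  using sign by (auto simp: koszul_sign_def parity_def)

lemma eps_assoc [simp]: "\<epsilon> * (\<epsilon> * x) = x" "e * (e * x) = \<epsilon> * x"
  by (simp_all add: mult.assoc[symmetric])

lemma loop_sD: "i \<le> j \<Longrightarrow> sD (j + 2) P i = i + 1 \<longleftrightarrow> P i = i + 1"
  "i \<le> j \<Longrightarrow> sD i P (j + 2) = j + 3 \<longleftrightarrow> P (j + 2) = j + 3"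
  by (auto simp: sD_def tau_def)

lemma loop_uD: "i \<le> j \<Longrightarrow> uD i P (j + 2) = j + 3 \<longleftrightarrow> P j = j + 1"
  "i \<le> j \<Longrightarrow> uD (j + 2) P i = i + 1 \<longleftrightarrow> P i = i + 1"
  by (auto simp: uD_def ins_def del_def)

text \<open>The source of the sign: performing a cup or cap further left first moves the position of
  the right one by two and so multiplies its twist by \<open>\<epsilon>\<close>, which is the Koszul
  sign of the pair.\<close>

lemma pow_two: "e ^ (b + 2) = \<epsilon> * e ^ b" "(\<epsilon> * e) ^ (b + 2) = \<epsilon> * (\<epsilon> * e) ^ b"
  by (simp_all add: power_add power2_eq_square mult_ac)

text \<open>Each of the nine cases combines commutation of distant operations on matchings with the
  shift of the twist by two. For two caps the loop factors are compared as a product, since a single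
  loop may be closed by both.\<close>

lemma comm_generators:
  "comm EH 0 EH 0" "comm EU (parity \<epsilon>) EH 0" "comm EA (parity \<epsilon>) EH 0"
  "comm EH 0 EU (parity \<epsilon>)" "comm EU (parity \<epsilon>) EU (parity \<epsilon>)" "comm EA (parity \<epsilon>) EU (parity \<epsilon>)"
  "comm EH 0 EA (parity \<epsilon>)" "comm EU (parity \<epsilon>) EA (parity \<epsilon>)" "comm EA (parity \<epsilon>) EA (parity \<epsilon>)"
proof -
  have j3: "int b + 2 + 1 = int b + 3" for b by simp
  note rules = comm_def agree_def act.simps edom.simps ecod.simps add_0_right of_nat_add of_nat_numeral pow_two
    koszul_parity koszul_sign_zero mult_1_left j3
  show "comm EH 0 EH 0"
    unfolding rules by (simp add: sD_sD_far)
  show "comm EU (parity \<epsilon>) EH 0"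
    unfolding rules by (simp add: sD_uD_far_left)
  show "comm EA (parity \<epsilon>) EH 0"
    unfolding rules by (simp add: sD_aD_far_left loop_sD)
  show "comm EH 0 EU (parity \<epsilon>)"
    unfolding rules by (simp add: sD_uD_far)
  show "comm EU (parity \<epsilon>) EU (parity \<epsilon>)"
    unfolding rules by (simp add: uD_uD_far mult_ac)
  show "comm EA (parity \<epsilon>) EU (parity \<epsilon>)"
    unfolding rules by (simp add: aD_uD_far loop_uD mult_ac)
  show "comm EH 0 EA (parity \<epsilon>)"
    unfolding rules by (simp add: sD_aD_far loop_sD)
  show "comm EU (parity \<epsilon>) EA (parity \<epsilon>)"
    unfolding rules by (simp add: uD_aD_far loop_uD mult_ac)
  show "comm EA (parity \<epsilon>) EA (parity \<epsilon>)"
    unfolding rules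
  proof (intro allI impI)
    fix a b :: nat and \<phi> :: "(int \<Rightarrow> int) \<Rightarrow> 'k" and p assume ab: "a \<le> b" and p: "matching p"
    have ij: "int a \<le> int b" using ab by simp
    let ?z = "\<epsilon> * e"
    let ?L1 = "if p (int a) = int a + 1 then loop else 1"
    let ?L2 = "if aD (int a) p (int b) = int b + 1 then loop else 1"
    let ?L3 = "if p (int b + 2) = int b + 3 then loop else 1"
    let ?L4 = "if aD (int b + 2) p (int a) = int a + 1 then loop else 1"
    let ?f = "\<phi> (aD (int b) (aD (int a) p))"
    have "kap * ?z ^ a * ?L1 * (kap * ?z ^ b * ?L2 * ?f) = (kap * ?z ^ a * (kap * ?z ^ b)) * (?L1 * ?L2) * ?f"
      by (simp only: mult_ac)
    also have "?L1 * ?L2 = ?L3 * ?L4" by (rule loop_far[OF p ij])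
    also have "(kap * ?z ^ a * (kap * ?z ^ b)) * (?L3 * ?L4) * ?f =
        (\<epsilon> * \<epsilon>) * ((kap * ?z ^ a * (kap * ?z ^ b)) * (?L3 * ?L4) * ?f)" by simp
    also have "\<dots> = \<epsilon> * (kap * (\<epsilon> * ?z ^ b) * ?L3 * (kap * ?z ^ a * ?L4 * \<phi> (aD (int a) (aD (int b + 2) p))))"
      unfolding aD_aD_far[OF p ij] by (simp only: mult_ac)
    finally show "kap * ?z ^ a * ?L1 * (kap * ?z ^ b * ?L2 * ?f) =
        \<epsilon> * (kap * (\<epsilon> * ?z ^ b) * ?L3 * (kap * ?z ^ a * ?L4 * \<phi> (aD (int a) (aD (int b + 2) p))))" .
  qed
qed

lemma comm_left:
  assumes "homogeneous (parity \<epsilon>) u q" "well_typed u"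
    and "comm EH 0 v p" "comm EU (parity \<epsilon>) v p" "comm EA (parity \<epsilon>) v p"
  shows "comm u q v p"
  using assms(1,2)
proof (induction rule: homogeneous.induct)
  case (5 t p1 t' p2)
  then show ?case by (intro comm_comp_left) auto
next
  case (6 t p1 t' p2)
  then show ?case by (intro comm_tens_left) auto
next
  case (8 t p1 t')
  then show ?case by (intro comm_sum) auto
next
  case (9 t p1 c)
  then show ?case by (intro comm_scale) auto
qed (use assms(3-5) in \<open>simp_all add: comm_id comm_zero\<close>)

lemma comm_right:
  assumes "homogeneous (parity \<epsilon>) v p" "well_typed v"
    and "comm u q EH 0" "comm u q EU (parity \<epsilon>)" "comm u q EA (parity \<epsilon>)"
  shows "comm u q v p"
  using assms(1,2)
proof (induction rule: homogeneous.induct)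
  case (5 t p1 t' p2)
  then show ?case by (intro comm_comp_right) auto
next
  case (6 t p1 t' p2)
  then show ?case by (intro comm_tens_right) auto
next
  case (8 t p1 t')
  then show ?case by (intro comm_sum) auto
next
  case (9 t p1 c)
  then show ?case by (intro comm_scale) auto
qed (use assms(3-5) in \<open>simp_all add: comm_id comm_zero\<close>)

lemma comm_homogeneous:
  assumes "homogeneous (parity \<epsilon>) u q" "well_typed u" "homogeneous (parity \<epsilon>) v p" "well_typed v"
  shows "comm u q v p"
  by (rule comm_left[OF assms(1,2) comm_right[OF assms(3,4) comm_generators(1,4,7)]
    comm_right[OF assms(3,4) comm_generators(2,5,8)] comm_right[OF assms(3,4) comm_generators(3,6,9)]])

text \<open>These equations dictate the constants: a zigzag with cap at \<open>a\<close> and cup at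
  \<open>a + 1\<close> carries \<open>kap * (\<epsilon> * e) ^ a * e ^ (a + 1) = kap * e\<close>,
  and a closed loop carries \<open>kap * loop\<close>.\<close>

lemma kap_sigma: "e * kap = \<sigma>" "kap * e = \<sigma>" "kap * loop = \<delta>"
  by (simp_all add: kap_def loop_def mult_ac)

text \<open>When the cap of a relation closes a loop, before and after a crossing or cup. The
  zigzags never do, and a crossing only exchanges the two points concerned.\<close>

lemma loops:
  "sD i P i = i + 1 \<longleftrightarrow> P (i + 1) = i"
  "sD i P (i + 1) = i + 1 + 1 \<longleftrightarrow> P i = i + 2"
  "sD (i + 1) P i = i + 1 \<longleftrightarrow> P i = i + 2"
  "sD (i + 1) (sD i P) i = i + 1 \<longleftrightarrow> P (i + 1) = i + 1 + 1"
  "uD (i + 1) P i \<noteq> i + 1" "uD i P (i + 1) \<noteq> i + 1 + 1" "sD (i + 1) (uD i P) i \<noteq> i + 1"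
  "sD i P (i + 1) = 2 + i \<longleftrightarrow> P i = i + 2" "uD i P (i + 1) \<noteq> 2 + i" "uD i P i \<noteq> i + 2"
  "sD i P i = i + 2 \<longleftrightarrow> P (i + 1) = 2 + i"
  by (auto simp: sD_def tau_def uD_def ins_def)

lemma powers:
  "e ^ (a + 1) = e * e ^ a" "(\<epsilon> * e) ^ (a + 1) = \<epsilon> * e * (\<epsilon> * e) ^ a"
  "e ^ a * (\<epsilon> * e) ^ a = 1" "e ^ a * ((\<epsilon> * e) ^ a * x) = x"
  "e ^ a * (c * (\<epsilon> * e) ^ a) = c" "e ^ a * (c * ((\<epsilon> * e) ^ a * x)) = c * x"
proof -
  show *: "e ^ a * (\<epsilon> * e) ^ a = 1" by (simp add: power_mult_distrib[symmetric] mult_ac)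
  show **: "e ^ a * ((\<epsilon> * e) ^ a * x) = x" for x using * by (simp add: mult.assoc[symmetric])
  show "e ^ a * (c * (\<epsilon> * e) ^ a) = c" "e ^ a * (c * ((\<epsilon> * e) ^ a * x)) = c * x"
    using * ** by (simp_all only: mult.left_commute mult_1_right)
qed simp_all

text \<open>Each relation splits into an identity of diagrams on matchings and an identity of
  scalars. Both sides must also close a loop under the same condition, which accounts for
  \<open>loops\<close>.\<close>

lemma act_relation:
  assumes "(t, u) \<in> defining_relations params"
  shows "act t a \<phi> \<doteq> act u a \<phi>"
proof -
  note rules = agree_def act.simps edom.simps add_0_right params_simps of_nat_add of_nat_1 powers(1,2)
  have i1: "P (i + 1) = i \<longleftrightarrow> P i = i + 1" if "matching P" for P and i :: int using that by (metis matchingD(1))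
  have k: "kap * e = \<sigma>" "kap * (e * x) = \<sigma> * x" "e * (kap * x) = \<sigma> * x" "kap * (loop * x) = \<delta> * x" for x
    using kap_sigma by (simp_all add: mult.assoc[symmetric])
  have 1: "act (EH \<^bold>\<cdot> EU) a \<phi> \<doteq> act (par_lam params \<^bold>* EU) a \<phi>"
    unfolding rules by (simp add: sD_uD mult_ac)
  have 2: "act (EA \<^bold>\<cdot> EH) a \<phi> \<doteq> act (par_lam' params \<^bold>* EA) a \<phi>"
    unfolding rules by (simp add: aD_sD loops i1 mult_ac)
  have 3: "act (EA \<^bold>\<cdot> EU) a \<phi> \<doteq> act (par_delta params \<^bold>* EId 0) a \<phi>"
    unfolding rules by (simp add: aD_uD uD_at mult_ac powers(3-6)) (simp add: k kap_sigma mult_ac)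
  have 4: "act ((EA \<^bold>\<otimes> EI) \<^bold>\<cdot> (EI \<^bold>\<otimes> EU)) a \<phi> \<doteq> act (par_sig params \<^bold>* EI) a \<phi>"
    unfolding rules by (simp add: aD_uD_right loops mult_ac powers(3-6)) (simp add: k kap_sigma mult_ac)
  have 5: "act ((EI \<^bold>\<otimes> EA) \<^bold>\<cdot> (EU \<^bold>\<otimes> EI)) a \<phi> \<doteq> act (par_sig' params \<^bold>* EI) a \<phi>"
    unfolding rules by (simp add: aD_uD_left loops mult_ac powers(3-6)) (simp add: k kap_sigma mult_ac)
  have 6: "act ((EA \<^bold>\<otimes> EI) \<^bold>\<cdot> (EI \<^bold>\<otimes> EH) \<^bold>\<cdot> (EU \<^bold>\<otimes> EI)) a \<phi> \<doteq> act (par_rho params \<^bold>* EI) a \<phi>"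
    unfolding rules by (simp add: aD_sD_uD loops mult_ac powers(3-6)) (simp add: kap_def mult_ac)
  have 7: "act (EH \<^bold>\<cdot> EH) a \<phi> \<doteq>
      act (par_a params \<^bold>* EId 2 \<^bold>+ par_b params \<^bold>* EH \<^bold>+ par_c params \<^bold>* (EU \<^bold>\<cdot> EA)) a \<phi>"
    unfolding rules by (simp add: power2_eq_square mult_ac)
  have 8: "act ((EH \<^bold>\<otimes> EI) \<^bold>\<cdot> (EI \<^bold>\<otimes> EU)) a \<phi> \<doteq>
      act (par_d params \<^bold>* (EU \<^bold>\<otimes> EI) \<^bold>+ par_e params \<^bold>* ((EI \<^bold>\<otimes> EH) \<^bold>\<cdot> (EU \<^bold>\<otimes> EI)) \<^bold>+ par_f params \<^bold>* (EI \<^bold>\<otimes> EU)) a \<phi>"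
    unfolding rules by (simp add: sD_uD_slide mult_ac)
  \<comment> \<open>The cup moves from \<open>a\<close> to \<open>a + 1\<close> and gains a factor
    \<open>e\<close>, which the factor \<open>\<epsilon> * e\<close> in \<open>F\<close>
    compensates; the factor \<open>e\<close> in \<open>F'\<close> does the same for the cap.\<close>
  have 9: "act ((EH \<^bold>\<otimes> EI) \<^bold>\<cdot> (EI \<^bold>\<otimes> EH) \<^bold>\<cdot> (EU \<^bold>\<otimes> EI)) a \<phi> \<doteq>
      act (par_D params \<^bold>* (EU \<^bold>\<otimes> EI) \<^bold>+ par_E params \<^bold>* ((EI \<^bold>\<otimes> EH) \<^bold>\<cdot> (EU \<^bold>\<otimes> EI)) \<^bold>+ par_F params \<^bold>* (EI \<^bold>\<otimes> EU)) a \<phi>"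
    unfolding rules by (simp add: sD_sD_uD power2_eq_square mult_ac)
  have 10: "act ((EI \<^bold>\<otimes> EA) \<^bold>\<cdot> (EH \<^bold>\<otimes> EI)) a \<phi> \<doteq>
      act (par_d' params \<^bold>* (EA \<^bold>\<otimes> EI) \<^bold>+ par_e' params \<^bold>* ((EA \<^bold>\<otimes> EI) \<^bold>\<cdot> (EI \<^bold>\<otimes> EH)) \<^bold>+ par_f' params \<^bold>* (EI \<^bold>\<otimes> EA)) a \<phi>"
    unfolding rules by (simp add: aD_sD_slide loops mult_ac)
  have 11: "act ((EA \<^bold>\<otimes> EI) \<^bold>\<cdot> (EI \<^bold>\<otimes> EH) \<^bold>\<cdot> (EH \<^bold>\<otimes> EI)) a \<phi> \<doteq>
      act (par_D' params \<^bold>* (EA \<^bold>\<otimes> EI) \<^bold>+ par_E' params \<^bold>* ((EA \<^bold>\<otimes> EI) \<^bold>\<cdot> (EI \<^bold>\<otimes> EH)) \<^bold>+ par_F' params \<^bold>* (EI \<^bold>\<otimes> EA)) a \<phi>"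
    unfolding rules by (simp add: aD_sD_sD loops power2_eq_square mult_ac)
  have 12: "act ((EH \<^bold>\<otimes> EI) \<^bold>\<cdot> (EI \<^bold>\<otimes> EH) \<^bold>\<cdot> (EH \<^bold>\<otimes> EI)) a \<phi> \<doteq>
      act ((EI \<^bold>\<otimes> EH) \<^bold>\<cdot> (EH \<^bold>\<otimes> EI) \<^bold>\<cdot> (EI \<^bold>\<otimes> EH)) a \<phi>"
    unfolding rules by (simp add: sD_braid)
  have "\<forall>x \<in> defining_relations params. act (fst x) a \<phi> \<doteq> act (snd x) a \<phi>"
    unfolding defining_relations_def parameter_relations_def braid_relation_def ball_Un
    by (simp only: ball_simps fst_conv snd_conv 1 2 3 4 5 6 7 8 9 10 11 12 simp_thms)
  from bspec[OF this assms] show ?thesis by simp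
qed

text \<open>Besides the relations only interchange has content; it is commutation with gap zero. The
  bilinear, associative and unit laws are built into the recursion and the linearity of
  \<open>act\<close>.\<close>

lemma act_sound:
  "pres_eq (parity \<epsilon>) (defining_relations params) t u \<Longrightarrow> act t a \<phi> \<doteq> act u a \<phi>"
proof (induction arbitrary: a \<phi> rule: pres_eq.induct)
  case (rel t u)
  show ?case by (rule act_relation[OF rel.hyps(1)])
next
  case (refl t)
  show ?case by (rule agree_refl)
next
  case (sym t u)
  show ?case by (rule agree_sym[OF sym.IH])
next
  case (trans t u v)
  show ?case by (rule agree_trans[OF trans.IH])
next
  case (cong_comp t t' u u')
  have "act u a (act t a \<phi>) \<doteq> act u' a (act t a \<phi>)" by (rule cong_comp.IH)
  also have "\<dots> \<doteq> act u' a (act t' a \<phi>)" by (rule act_agree[OF cong_comp.IH(1)])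
  finally show ?case by simp
next
  case (cong_tens t t' u u')
  have "edom t = edom t'" using peq_typed[OF cong_tens.hyps(1)] by (simp add: parallel_def)
  moreover have "act u (a + edom t) (act t a \<phi>) \<doteq> act u' (a + edom t) (act t a \<phi>)" by (rule cong_tens.IH)
  moreover have "\<dots> \<doteq> act u' (a + edom t) (act t' a \<phi>)" by (rule act_agree[OF cong_tens.IH(1)])
  ultimately show ?case using agree_trans by simp
next
  case (cong_sum t t' u u')
  show ?case using cong_sum.IH(1)[of a \<phi>] cong_sum.IH(2)[of a \<phi>] by (simp add: agree_def)
next
  case (cong_scale t t' c)
  show ?case using cong_scale.IH[of a \<phi>] by (simp add: agree_def)
next
  case (interchange t v u w q p)
  then have eq: "edom t = ecod v" "edom u = ecod w" and wt: "well_typed u" "well_typed v" by auto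
  have "act v a (act u (a + ecod v) (act t a \<phi>)) \<doteq>
      (\<lambda>P. koszul_sign q p * act u (a + edom v) (act v a (act t a \<phi>)) P)"
    by (rule commD[OF comm_homogeneous[OF interchange(3) wt(1) interchange(4) wt(2)]]) simp
  from act_agree[OF this, of w "a + edom v"] show ?case
    by (simp add: eq act_scale)
next
  case sum_assoc
  show ?case by (simp add: agree_def act_add act_scale algebra_simps)
next
  case sum_comm
  show ?case by (simp add: agree_def act_add act_scale algebra_simps)
next
  case sum_zero
  show ?case by (simp add: agree_def act_add act_scale algebra_simps)
next
  case sum_neg
  show ?case by (simp add: agree_def act_add act_scale algebra_simps)
next
  case scale_sum
  show ?case by (simp add: agree_def act_add act_scale algebra_simps)
next
  case scale_add
  show ?case by (simp add: agree_def act_add act_scale algebra_simps)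
next
  case scale_scale
  show ?case by (simp add: agree_def act_add act_scale algebra_simps)
next
  case scale_one
  show ?case by (simp add: agree_def act_add act_scale algebra_simps)
next
  case comp_sum_left
  show ?case by (simp add: agree_def act_add act_scale algebra_simps)
next
  case comp_sum_right
  show ?case by (simp add: agree_def act_add act_scale algebra_simps)
next
  case comp_scale_left
  show ?case by (simp add: agree_def act_add act_scale algebra_simps)
next
  case comp_scale_right
  show ?case by (simp add: agree_def act_add act_scale algebra_simps)
next
  case comp_assoc
  show ?case by (simp add: agree_def act_add act_scale algebra_simps)
next
  case comp_id_left
  show ?case by (simp add: agree_def act_add act_scale algebra_simps)
next
  case comp_id_right
  show ?case by (simp add: agree_def act_add act_scale algebra_simps)
next
  case (tens_sum_left t u v)
  then have "edom u = edom t" by (simp add: parallel_def)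
  then have "act ((t \<^bold>+ u) \<^bold>\<otimes> v) a \<phi> = act (t \<^bold>\<otimes> v \<^bold>+ u \<^bold>\<otimes> v) a \<phi>"
    by (simp only: act.simps edom.simps act_add)
  then show ?case by (simp only: agree_refl)
next
  case tens_sum_right
  show ?case by (simp add: agree_def act_add act_scale algebra_simps)
next
  case tens_scale_left
  show ?case by (simp add: agree_def act_add act_scale algebra_simps)
next
  case tens_scale_right
  show ?case by (simp add: agree_def act_add act_scale algebra_simps)
next
  case tens_assoc
  show ?case by (simp add: agree_def act_add act_scale algebra_simps)
next
  case tens_unit_left
  show ?case by (simp add: agree_def act_add act_scale algebra_simps)
next
  case tens_unit_right
  show ?case by (simp add: agree_def act_add act_scale algebra_simps)
next
  case tens_id
  show ?case by (simp add: agree_def act_add act_scale algebra_simps)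
qed

end

section \<open>The diagrams of standard expressions\<close>

primrec diag_letter :: "letter \<Rightarrow> (int \<Rightarrow> int) \<Rightarrow> int \<Rightarrow> int" where
  "diag_letter (LS i) = sD (int i)" | "diag_letter (LU i) = uD (int i)" | "diag_letter (LA i) = aD (int i)"

primrec diag :: "letter list \<Rightarrow> (int \<Rightarrow> int) \<Rightarrow> int \<Rightarrow> int" where
  "diag [] p = p"
| "diag (x # w) p = diag_letter x (diag w p)"

lemma diag_append [simp]: "diag (x @ y) p = diag x (diag y p)"
  by (induction x) auto

lemma matching_diag: "matching p \<Longrightarrow> matching (diag w p)"
proof (induction w)
  case (Cons x w)
  then show ?case by (cases x) (auto simp: matching_sD matching_uD matching_aD)
qed simp

lemma inj_uD: "uD i p = uD i q \<longleftrightarrow> p = q"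
  by (metis aD_uD)

lemma diag_arcw_inj: "diag (arcw p s) P = diag (arcw p s) Q \<longleftrightarrow> P = Q"
proof (induction s)
  case 0
  show ?case by (simp add: inj_uD)
next
  case (Suc s)
  then show ?case by simp (metis sD_sD)
qed

text \<open>No arc joins two outgoing points. This is the shape of a standard word before its cups
  are applied.\<close>

definition through :: "(int \<Rightarrow> int) \<Rightarrow> bool" where
  "through p \<longleftrightarrow> (\<forall>x\<ge>0. p x < 0)"

text \<open>The condition \<open>P x < x\<close> on outgoing points says that \<open>x\<close> is
  not the left end of an arc. Inserting an arc at \<open>p\<close>, with no left end at
  \<open>p\<close> or beyond, therefore makes \<open>p\<close> the rightmost left end.\<close>

lemma diag_arcw:
  assumes "matching P" "\<forall>x\<ge>int p. P x < x"
  shows "diag (arcw p s) P (int p) = int p + int s + 1 \<and> (\<forall>x>int p. diag (arcw p s) P x < x)"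
proof (induction s)
  case 0
  have "uD (int p) P x < x" if "x > int p" for x
  proof (cases x "int p" rule: ins_cases)
    case (3 y)
    then have "y \<ge> int p" using that by (auto simp: ins_def split: if_splits)
    then have "P y < y" "ins (int p) y = y + 2" using assms(2) by (auto simp: ins_def)
    then show ?thesis using uD_ins[of "int p" P y] 3 by (auto simp: ins_def)
  qed (use that in \<open>auto simp: uD_at\<close>)
  then show ?case by (simp add: uD_at)
next
  case (Suc s)
  define Q where "Q = diag (arcw p s) P"
  define j where "j = int p + int s + 1"
  have Q: "matching Q" "Q (int p) = j" "\<And>x. x > int p \<Longrightarrow> Q x < x"
    using Suc matching_diag[OF assms(1)] by (auto simp: Q_def j_def)
  have Qj: "Q j = int p" using Q(1,2) matchingD(1) by metis
  have Qj1: "Q (j + 1) < j"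
  proof -
    have "Q (j + 1) \<noteq> j"
      using matchingD(1)[OF Q(1), of "j + 1"] Qj by (auto simp: j_def)
    then show ?thesis using Q(3)[of "j + 1"] by (simp add: j_def)
  qed
  have "sD j Q (int p) = j + 1" using Q(2) by (simp add: sD_def tau_def j_def)
  moreover have "sD j Q x < x" if x: "x > int p" for x
  proof -
    consider "x = j" | "x = j + 1" | "x \<noteq> j" "x \<noteq> j + 1" by blast
    then show ?thesis
    proof cases
      case 1
      then show ?thesis using Qj1 by (simp add: sD_def tau_def)
    next
      case 2
      then show ?thesis using Qj by (simp add: sD_def tau_def j_def)
    next
      case 3
      then have "tau j x = x" by (simp add: tau_def)
      then show ?thesis using Q(3)[OF x] 3 by (auto simp: sD_def tau_def)
    qed
  qed
  ultimately show ?case by (simp add: Q_def[symmetric] j_def add_ac)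
qed

lemma diag_iword:
  assumes "arc_word r xs" "matching P" "through P" "\<forall>(p, s)\<in>set xs. p \<le> k"
  shows "\<forall>x\<ge>int k. diag (iword xs) P x < x"
  using assms(1,4)
proof (induction xs arbitrary: k rule: iword.induct)
  case 1
  have "P x < x" if "x \<ge> int k" for x
  proof -
    have "x \<ge> 0" using that by simp
    moreover from this have "P x < 0" using assms(3) by (simp add: through_def)
    ultimately show ?thesis by simp
  qed
  then show ?case by simp
next
  case (2 p s xs)
  have "\<forall>(p', s')\<in>set xs. p' \<le> p - 1" using 2(2) by fastforce
  then have "\<forall>x\<ge>int (p - 1). diag (iword xs) P x < x" using 2 by auto
  from diag_arcw[OF matching_diag[OF assms(2)] this, of s] show ?case using 2(2,3) by auto
qed

text \<open>The first pair is read off from the rightmost left end and its partner; the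
  corresponding arc is then removed by injectivity, and the induction goes on.\<close>

lemma iword_decode:
  assumes "arc_word r xs" "arc_word r' ys" "matching P" "through P" "matching Q" "through Q"
    "diag (iword xs) P = diag (iword ys) Q"
  shows "xs = ys \<and> P = Q"
  using assms(1,2,7)
proof (induction xs arbitrary: ys rule: iword.induct)
  \<comment> \<open>In the numbering from zero the left end is \<open>p - 1\<close> and the right
    end is \<open>(p - 1) + s + 1\<close>.\<close>
  have head: "diag (iword ((p, s) # zs)) R (int (p - 1)) = int p + int s \<and> (\<forall>x\<ge>int p. diag (iword ((p, s) # zs)) R x < x)"
    if "arc_word r ((p, s) # zs)" "matching R" "through R" for p s zs R r
  proof -
    have "\<forall>(p', s')\<in>set zs. p' \<le> p - 1" using that(1) by fastforce
    then have "\<forall>x\<ge>int (p - 1). diag (iword zs) R x < x" using that by (intro diag_iword) auto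
    from diag_arcw[OF matching_diag[OF that(2)] this, of s] show ?thesis using that(1) by auto
  qed
  {
    case 1
    show ?case
    proof (cases ys)
      case Nil
      then show ?thesis using 1 by simp
    next
      case (Cons z zs)
      obtain p s where z: "z = (p, s)" by force
      have "P (int (p - 1)) = int p + int s"
        using head[OF 1(2)[unfolded Cons z] assms(5,6)] 1(3) by (simp add: Cons z)
      then show ?thesis using assms(4) unfolding through_def by (metis add_nonneg_nonneg not_less of_nat_0_le_iff)
    qed
  next
    case (2 p s xs)
    note h = head[OF 2(2) assms(3,4)]
    show ?case
    proof (cases ys)
      case Nil
      then have "Q (int (p - 1)) = int p + int s" using h 2(4) by simp
      then show ?thesis using assms(6) unfolding through_def by (metis add_nonneg_nonneg not_less of_nat_0_le_iff)
    next
      case (Cons z zs)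
      obtain q t where z: "z = (q, t)" by force
      note h' = head[OF 2(3)[unfolded Cons z] assms(5,6)]
      note eq = 2(4)[unfolded Cons z]
      have pq: "1 \<le> p" "1 \<le> q" using 2(2,3) by (auto simp: Cons z)
      \<comment> \<open>Otherwise \<open>q - 1\<close> is a left end on one side but lies beyond the
        last left end on the other.\<close>
      have "\<not> p < q"
      proof
        assume "p < q"
        then have "int p \<le> int (q - 1)" by simp
        then have "diag (iword ((p, s) # xs)) P (int (q - 1)) < int (q - 1)" using h by blast
        then show False using h' eq pq by auto
      qed
      moreover have "\<not> q < p"
      proof
        assume "q < p"
        then have "int q \<le> int (p - 1)" by simp
        then have "diag (iword ((q, t) # zs)) Q (int (p - 1)) < int (p - 1)" using h' by blast
        then show False using h eq pq by auto
      qed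
      ultimately have "p = q" by simp
      moreover from this have "s = t" using h h' eq by simp
      ultimately have "diag (iword xs) P = diag (iword zs) Q" using eq by (simp add: diag_arcw_inj)
      then have "xs = zs \<and> P = Q" using 2(1)[of zs] 2(2,3) by (simp add: Cons z)
      then show ?thesis using \<open>p = q\<close> \<open>s = t\<close> by (simp add: Cons z)
    qed
  }
qed

text \<open>On the nonnegative integers, the increasing enumeration of all points other than
  \<open>p\<close> and \<open>p + s + 1\<close>.\<close>

definition skip :: "nat \<Rightarrow> nat \<Rightarrow> int \<Rightarrow> int" where
  "skip p s x = (if x < int p then x else if x < int (p + s) then x + 1 else x + 2)"

lemma skip_cases:
  assumes "x \<ge> 0" "x \<noteq> int p" "x \<noteq> int p + int s + 1"
  obtains y where "y \<ge> 0" "x = skip p s y" "x > int p \<Longrightarrow> y \<ge> int p"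
proof -
  let ?y = "if x < int p then x else if x < int p + int s + 1 then x - 1 else x - 2"
  show thesis using assms by (intro that[of ?y]) (auto simp: skip_def)
qed

lemma sD_through:
  assumes "through P"
  shows "x \<ge> 0 \<Longrightarrow> sD (int j) P x = P (tau (int j) x)" "b < 0 \<Longrightarrow> sD (int j) P b = tau (int j) (P b)"
    "through (sD (int j) P)"
proof -
  have t: "tau (int j) x \<ge> 0 \<longleftrightarrow> x \<ge> 0" for x by (auto simp: tau_def)
  have n: "x < 0 \<Longrightarrow> tau (int j) x = x" for x by (auto simp: tau_def)
  show *: "x \<ge> 0 \<Longrightarrow> sD (int j) P x = P (tau (int j) x)" for x
    using assms t[of x] n by (auto simp: sD_def through_def)
  show "b < 0 \<Longrightarrow> sD (int j) P b = tau (int j) (P b)"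
    by (simp add: sD_def n)
  show "through (sD (int j) P)"
    using * t assms by (auto simp: through_def)
qed

text \<open>As all outgoing points lead to incoming ones, capping \<open>p\<close> and
  \<open>p + s + 1\<close> joins their two incoming partners, renumbers the other outgoing points,
  and leaves the incoming arcs already present intact.\<close>

lemma diag_coarcw:
  assumes "matching P" "through P"
  shows "(\<forall>y\<ge>0. diag (coarcw p s) P y = P (skip p s y)) \<and>
    diag (coarcw p s) P (P (int p)) = P (int p + int s + 1) \<and>
    (\<forall>b<0. P b < 0 \<longrightarrow> diag (coarcw p s) P b = P b)"
  using assms
proof (induction s arbitrary: P)
  case 0
  have neg: "P x < 0" if "x \<ge> 0" for x using that 0 by (simp add: through_def)
  have small: "x < 0 \<Longrightarrow> del (int p) x = x" "x < 0 \<Longrightarrow> ins (int p) x = x" for x by (auto simp: del_def ins_def)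
  have "aD (int p) P y = P (skip p 0 y)" if "y \<ge> 0" for y
  proof -
    have *: "P (ins (int p) y) < 0" by (rule neg) (use that in \<open>auto simp: ins_def\<close>)
    then show ?thesis using small that by (auto simp: aD_def cut_def skip_def ins_def)
  qed
  moreover have "aD (int p) P (P (int p)) = P (int p + 1)"
    using neg[of "int p"] neg[of "int p + 1"] small matchingD[OF 0(1)] by (simp add: aD_def cut_def)
  moreover have "aD (int p) P b = P b" if "b < 0" "P b < 0" for b
    using that small by (simp add: aD_def cut_def)
  ultimately show ?case by simp
next
  case (Suc s)
  define j where "j = Suc (p + s)"
  define Q where "Q = sD (int j) P"
  have Q: "matching Q" "through Q" using Suc.prems matching_sD sD_through(3) by (auto simp: Q_def)
  have top: "Q x = P (tau (int j) x)" if "x \<ge> 0" for x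
    using sD_through(1)[OF Suc.prems(2) that] by (simp add: Q_def)
  have bot: "Q b = tau (int j) (P b)" if "b < 0" for b
    using sD_through(2)[OF Suc.prems(2) that] by (simp add: Q_def)
  have eq: "diag (coarcw p (Suc s)) P = diag (coarcw p s) Q" by (simp add: Q_def j_def)
  note IH = Suc.IH[OF Q]
  have "diag (coarcw p s) Q y = P (skip p (Suc s) y)" if "y \<ge> 0" for y
  proof -
    have "skip p s y \<ge> 0" "tau (int j) (skip p s y) = skip p (Suc s) y"
      using that by (auto simp: skip_def tau_def j_def)
    then show ?thesis using IH top that by simp
  qed
  moreover have "diag (coarcw p s) Q (P (int p)) = P (int p + int (Suc s) + 1)"
  proof -
    have "Q (int p) = P (int p)" "Q (int p + int s + 1) = P (int p + int (Suc s) + 1)"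
      using top[of "int p"] top[of "int p + int s + 1"] by (simp_all add: tau_def j_def add_ac)
    then show ?thesis using IH by metis
  qed
  moreover have "diag (coarcw p s) Q b = P b" if "b < 0" "P b < 0" for b
  proof -
    have "Q b = P b" using bot[OF that(1)] that(2) by (simp add: tau_def)
    then show ?thesis using IH that by metis
  qed
  ultimately show ?case unfolding eq by blast
qed

text \<open>Through strands do not cross. Incoming points run to the left end of the integers as
  their number grows, so keeping the order of strands means reversing the order of integers.\<close>

definition descending :: "(int \<Rightarrow> int) \<Rightarrow> bool" where
  "descending P \<longleftrightarrow> (\<forall>x y. 0 \<le> x \<longrightarrow> x < y \<longrightarrow> P y < P x)"

lemma coarcw_through:
  assumes "matching P" "through P"
  shows "through (diag (coarcw p s) P)" "descending P \<Longrightarrow> descending (diag (coarcw p s) P)"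
proof -
  have s: "y \<ge> 0 \<Longrightarrow> skip p s y \<ge> 0" "x < y \<Longrightarrow> skip p s x < skip p s y" for x y by (auto simp: skip_def)
  note c = diag_coarcw[OF assms, of p s]
  show "through (diag (coarcw p s) P)"
    using c s assms(2) by (auto simp: through_def)
  show "descending (diag (coarcw p s) P)" if "descending P"
    unfolding descending_def
  proof (intro allI impI)
    fix x y :: int assume "0 \<le> x" "x < y"
    then show "diag (coarcw p s) P y < diag (coarcw p s) P x"
      using c s that unfolding descending_def by (metis less_imp_le order_trans)
  qed
qed

lemma jword_bottom:
  assumes "matching P" "through P"
  shows "through (diag (jword ys) P) \<and> (\<forall>b<0. P b < 0 \<longrightarrow> diag (jword ys) P b = P b)"
  using assms
proof (induction ys arbitrary: P rule: jword.induct)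
  case (2 p s ys)
  let ?Q = "diag (coarcw (p - 1) s) P"
  have "through ?Q" "matching ?Q" using coarcw_through(1) matching_diag 2 by auto
  then show ?case using 2(1)[of ?Q] diag_coarcw[OF 2(2,3), of "p - 1" s] by simp
qed simp

text \<open>For an incoming point, a partner that is larger as an integer lies to its left or is
  outgoing. So the points \<open>P x\<close> with \<open>x >= k\<close> are not left ends of
  incoming arcs, where \<open>k\<close> bounds the left ends, which are counted from one.\<close>

lemma diag_jword:
  assumes "arc_word r ys" "matching P" "through P" "descending P" "\<forall>(p, s)\<in>set ys. p \<le> k" "x \<ge> int k"
  shows "P x < diag (jword ys) P (P x)"
  using assms
proof (induction ys arbitrary: P k x rule: jword.induct)
  case 1
  then have "P x < 0" "P (P x) = x" by (auto simp: through_def matchingD(1))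
  then show ?case using 1 by simp
next
  case (2 p s ys)
  let ?Q = "diag (coarcw (p - 1) s) P"
  have p: "1 \<le> p" "p \<le> k" "\<forall>(p', s')\<in>set ys. p' \<le> p - 1" "arc_word r ys" using 2(2,6) by fastforce+
  have Q: "matching ?Q" "through ?Q" "descending ?Q" using coarcw_through matching_diag 2 by auto
  note c = diag_coarcw[OF 2(3,4), of "p - 1" s]
  have x0: "x \<ge> 0" using 2(7) by simp
  have Px: "P x < 0" using 2(4) x0 by (simp add: through_def)
  show ?case
  proof (cases "x = int (p - 1) + int s + 1")
    \<comment> \<open>\<open>P x\<close> is the right end of the arc made by the first cap; its
      partner comes from \<open>p - 1\<close> and lies to its left.\<close>
    case True
    have "?Q (P x) = P (int (p - 1))" using c matchingD(1)[OF Q(1)] True by metis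
    moreover have "P x < P (int (p - 1))" "P (int (p - 1)) < 0"
      using 2(4,5) True by (auto simp: descending_def through_def)
    ultimately have "diag (jword ys) ?Q (P x) = P (int (p - 1))" "P x < P (int (p - 1))"
      using jword_bottom[OF Q(1,2)] Px by auto
    then show ?thesis by simp
  next
    case False
    have xp: "x > int (p - 1)" using 2(7) p by linarith
    then obtain y where y: "y \<ge> 0" "x = skip (p - 1) s y" "y \<ge> int (p - 1)"
      using skip_cases[of x "p - 1" s] x0 False by (metis less_irrefl)
    have "?Q y < diag (jword ys) ?Q (?Q y)" by (rule 2(1)[OF p(4) Q p(3) y(3)])
    then show ?thesis using c y by simp
  qed
qed

text \<open>Only arcs between incoming points are compared, because crossings applied later still
  permute the outer ends of the through strands. These arcs alone determine the caps.\<close>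

lemma jword_decode:
  assumes "arc_word r xs" "arc_word r' ys" "matching P" "through P" "descending P"
    and "\<And>b. b < 0 \<Longrightarrow> diag (jword xs) P b < 0 \<or> diag (jword ys) P b < 0 \<Longrightarrow> diag (jword xs) P b = diag (jword ys) P b"
  shows "xs = ys"
  using assms
proof (induction xs arbitrary: ys P rule: jword.induct)
  \<comment> \<open>The leading pair is the cap applied first, hence its arc joins the incoming
    points below \<open>p - 1\<close> and \<open>p + s\<close>. No later left end exceeds it, as
    \<open>R\<close> preserves the order of strands.\<close>
  have head: "diag (jword ((p, s) # zs)) R (R (int (p - 1))) = R (int (p - 1) + int s + 1)"
      "\<And>x. x \<ge> int p \<Longrightarrow> R x < diag (jword ((p, s) # zs)) R (R x)" "1 \<le> p"
      "R (int (p - 1) + int s + 1) < R (int (p - 1))" "R (int (p - 1)) < 0"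
    if *: "arc_word r ((p, s) # zs)" "matching R" "through R" "descending R" for p s zs R r
  proof -
    let ?Q = "diag (coarcw (p - 1) s) R"
    show "1 \<le> p" using *(1) by auto
    show le: "R (int (p - 1) + int s + 1) < R (int (p - 1))" "R (int (p - 1)) < 0"
      using *(3,4) by (auto simp: descending_def through_def)
    have Q: "matching ?Q" "through ?Q" using coarcw_through matching_diag * by auto
    have "?Q (R (int (p - 1))) = R (int (p - 1) + int s + 1)" using diag_coarcw[OF *(2,3)] by blast
    then show "diag (jword ((p, s) # zs)) R (R (int (p - 1))) = R (int (p - 1) + int s + 1)"
      using jword_bottom[OF Q, of zs] le by simp
    show "R x < diag (jword ((p, s) # zs)) R (R x)" if "x \<ge> int p" for x
      by (rule diag_jword[OF * _ that]) (use *(1) in fastforce)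
  qed
  \<comment> \<open>If all left ends of \<open>us\<close> are smaller than \<open>p\<close>, the
    point below \<open>p - 1\<close> is a left end for one list and cannot be one for the
    other.\<close>
  have clash: False
    if *: "arc_word r ((p, s) # zs)" "arc_word r' us" "matching R" "through R" "descending R"
      and less: "\<forall>(q, t)\<in>set us. q < p"
      and agree: "\<And>b. b < 0 \<Longrightarrow> diag (jword ((p, s) # zs)) R b < 0 \<Longrightarrow> diag (jword us) R b = diag (jword ((p, s) # zs)) R b"
    for p s zs us R r r'
  proof -
    note h = head[OF *(1,3-5)]
    let ?b = "R (int (p - 1))"
    have "?b < diag (jword us) R ?b"
      by (rule diag_jword[OF *(2-5), of "p - 1"]) (use less in fastforce)+
    then show False using agree[of ?b] h by simp
  qed
  {
    case 1
    show ?case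
    proof (cases ys)
      case (Cons z zs)
      obtain p s where z: "z = (p, s)" by force
      note prems = 1[unfolded Cons z]
      have False
      proof (rule clash[OF prems(2,1,3-5)])
        fix b :: int assume "b < 0" "diag (jword ((p, s) # zs)) P b < 0"
        then show "diag (jword []) P b = diag (jword ((p, s) # zs)) P b" by (intro prems(6) disjI2)
      qed simp
      then show ?thesis ..
    qed simp
  next
    case (2 p s xs)
    show ?case
    proof (cases ys)
      case Nil
      note prems = 2(2-7)[unfolded Nil]
      have False
      proof (rule clash[OF prems(1-5)])
        fix b :: int assume "b < 0" "diag (jword ((p, s) # xs)) P b < 0"
        then show "diag (jword []) P b = diag (jword ((p, s) # xs)) P b"
          by (intro prems(6)[symmetric] disjI1)
      qed simp
      then show ?thesis ..
    next
      case (Cons z zs)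
      obtain q t where z: "z = (q, t)" by force
      note prems = 2(2-7)[unfolded Cons z]
      have less: "\<forall>(q', t')\<in>set zs. q' < q" "\<forall>(p', s')\<in>set xs. p' < p" using prems(1,2) by auto
      have "\<not> p < q"
      proof
        assume "p < q"
        then have lt: "\<forall>(q', t')\<in>set ((p, s) # xs). q' < q" using less(2) by fastforce
        show False
        proof (rule clash[OF prems(2,1,3-5) lt])
          fix b :: int assume "b < 0" "diag (jword ((q, t) # zs)) P b < 0"
          then show "diag (jword ((p, s) # xs)) P b = diag (jword ((q, t) # zs)) P b"
            by (intro prems(6) disjI2)
        qed
      qed
      moreover have "\<not> q < p"
      proof
        assume "q < p"
        then have lt: "\<forall>(p', s')\<in>set ((q, t) # zs). p' < p" using less(1) by fastforce
        show False
        proof (rule clash[OF prems(1-5) lt])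
          fix b :: int assume "b < 0" "diag (jword ((p, s) # xs)) P b < 0"
          then show "diag (jword ((q, t) # zs)) P b = diag (jword ((p, s) # xs)) P b"
            by (intro prems(6)[symmetric] disjI1)
        qed
      qed
      ultimately have pq: "p = q" by simp
      note h = head[OF prems(1,3-5)] and h' = head[OF prems(2-5)]
      have "P (int (p - 1) + int s + 1) = P (int (p - 1) + int t + 1)"
        using prems(6)[of "P (int (p - 1))"] h h' pq by simp
      then have st: "s = t" using matching_inj[OF prems(3)] by simp
      let ?Q = "diag (coarcw (p - 1) s) P"
      have "xs = zs"
        by (rule 2(1)[of zs ?Q]) (use prems pq st coarcw_through matching_diag in auto)
      then show ?thesis using pq st by (simp add: Cons z)
    qed
  }
qed

section \<open>Reading off the permutation and the whole standard expression\<close>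

primrec int_perm :: "nat list \<Rightarrow> int \<Rightarrow> int" where
  "int_perm [] x = x"
| "int_perm (i # w) x = tau (int (i - 1)) (int_perm w x)"

lemma int_perm_neg: "x < 0 \<Longrightarrow> int_perm w x = x"
  by (induction w) (auto simp: tau_def)

lemma int_perm_nonneg: "x \<ge> 0 \<Longrightarrow> int_perm w x \<ge> 0"
  by (induction w) (auto simp: tau_def)

lemma int_perm_word_perm:
  assumes "set w \<subseteq> {1..<r}" "1 \<le> n"
  shows "1 \<le> word_perm w n \<and> int_perm w (int n - 1) = int (word_perm w n) - 1"
  using assms(1)
proof (induction w)
  case (Cons i w)
  then show ?case by (auto simp: tau_def Transposition.transpose_def)
qed (use assms(2) in simp)

text \<open>Crossings relabel outgoing points only, so on incoming points the matching is merely
  followed by the permutation.\<close>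

lemma diag_sword:
  "through P \<Longrightarrow> through (diag (sword w) P) \<and> (\<forall>b<0. diag (sword w) P b = int_perm w (P b))"
proof (induction w)
  case (Cons i w)
  then have th: "through (diag (sword w) P)" by simp
  show ?case using sD_through(2,3)[OF th] Cons by simp
qed simp

text \<open>The diagram of the identity: outgoing point \<open>x\<close> is joined to incoming point
  number \<open>x\<close>.\<close>

definition straight :: "int \<Rightarrow> int" where
  "straight x = - 1 - x"

lemma straight: "matching straight" "through straight" "descending straight"
proof -
  have "- 1 - x \<noteq> x" for x :: int by presburger
  then show "matching straight" by (simp add: matching_def straight_def)
qed (auto simp: through_def descending_def straight_def)

text \<open>The cups come off from the outside; the incoming arcs give the caps; with equal caps the
  through strands differ only by the two permutations, which \<open>W\<close> represents
  uniquely.\<close>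

lemma standard_decode:
  assumes W: "word_choice W" and x: "x \<in> standard_expressions W m n" and y: "y \<in> standard_expressions W m n"
    and eq: "diag (stdword x) straight = diag (stdword y) straight"
  shows "x = y"
proof -
  obtain r xs w ys where x': "x = (r, xs, w, ys)" "arc_word r xs" "n = r + 2 * length xs" "w \<in> W r" "arc_word r ys"
    using x by (cases x) (auto simp: standard_expressions_def)
  obtain r' xs' w' ys' where y': "y = (r', xs', w', ys')" "arc_word r' xs'" "n = r' + 2 * length xs'" "w' \<in> W r'"
      "arc_word r' ys'"
    using y by (cases y) (auto simp: standard_expressions_def)
  let ?Q = "diag (jword ys) straight" and ?Q' = "diag (jword ys') straight"
  have Q: "matching ?Q" "through ?Q" "matching ?Q'" "through ?Q'"
    using matching_diag jword_bottom straight by auto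
  note S = diag_sword[OF Q(2), of w] and S' = diag_sword[OF Q(4), of w']
  have dec: "xs = xs' \<and> diag (sword w) ?Q = diag (sword w') ?Q'"
    by (rule iword_decode[OF x'(2) y'(2)]) (use Q S S' eq x' y' matching_diag in auto)
  then have xs: "xs = xs'" by simp
  have perm: "int_perm w (?Q b) = int_perm w' (?Q' b)" if "b < 0" for b
    using dec S S' that by metis
  have r: "r = r'" using x'(3) y'(3) xs by simp
  \<comment> \<open>The permutation fixes negative values and keeps nonnegative ones nonnegative, so
    incoming arcs are visible unchanged after the crossings and cannot be confused with through
    strands.\<close>
  have "ys = ys'"
  proof (rule jword_decode[OF x'(5) y'(5) straight])
    fix b :: int assume "b < 0" "?Q b < 0 \<or> ?Q' b < 0"
    then show "?Q b = ?Q' b" using perm[of b] int_perm_neg int_perm_nonneg by (metis not_less)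
  qed
  have "word_perm w k = word_perm w' k" for k
  proof (cases "k = 0")
    case True
    then show ?thesis
      using word_perm_permutes[OF word_choice_subset[OF W x'(4)]] word_perm_permutes[OF word_choice_subset[OF W y'(4)]]
      by (simp add: permutes_def)
  next
    case False
    \<comment> \<open>The incoming end of the through strand that reaches outgoing point
      \<open>k - 1\<close> before the crossings; its final position is the value of the permutation
      at \<open>k\<close>.\<close>
    define b where "b = ?Q (int k - 1)"
    have "b < 0" using Q(2) False by (simp add: b_def through_def)
    moreover have "?Q b = int k - 1" by (simp add: b_def matchingD(1)[OF Q(1)])
    ultimately have "int_perm w (int k - 1) = int_perm w' (int k - 1)" using perm \<open>ys = ys'\<close> by metis
    then show ?thesis
      using int_perm_word_perm[OF word_choice_subset[OF W x'(4)], of k]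
        int_perm_word_perm[OF word_choice_subset[OF W y'(4)], of k] False by simp
  qed
  then have "word_perm w = word_perm w'" by auto
  moreover have "word_perm w permutes {1..r}" using word_perm_permutes[OF word_choice_subset[OF W x'(4)]] .
  ultimately have "w = w'" using W x'(4) y'(4) r unfolding word_choice_def by metis
  then show ?thesis using x'(1) y'(1) r xs \<open>ys = ys'\<close> by simp
qed

text \<open>Guarantees that the factor \<open>loop\<close>, which vanishes for
  \<open>\<delta> = 0\<close>, never enters, so that the scalar of the word is nonzero.\<close>

primrec noloop :: "letter list \<Rightarrow> (int \<Rightarrow> int) \<Rightarrow> bool" where
  "noloop [] p = True"
| "noloop (x # w) p = (noloop w p \<and> (\<forall>i. x = LA i \<longrightarrow> diag w p (int i) \<noteq> int i + 1))"

lemma noloop_append: "noloop (x @ y) p \<longleftrightarrow> noloop y p \<and> noloop x (diag y p)"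
  by (induction x) auto

lemma noloop_arcw: "noloop (arcw p s) P"
  by (induction s) auto

lemma noloop_iword: "noloop (iword xs) P"
  by (induction xs rule: iword.induct) (auto simp: noloop_append noloop_arcw)

lemma noloop_sword: "noloop (sword w) P"
  by (induction w) auto

lemma noloop_coarcw: "through P \<Longrightarrow> noloop (coarcw p s) P"
proof (induction s arbitrary: P)
  case 0
  then have "P (int p) < 0" by (simp add: through_def)
  then show ?case by simp
next
  case (Suc s)
  show ?case
    using Suc.IH[OF sD_through(3)[OF Suc.prems, of "Suc (p + s)"]]
    by (simp add: noloop_append del: of_nat_Suc of_nat_add)
qed

lemma noloop_jword: "matching P \<Longrightarrow> through P \<Longrightarrow> noloop (jword ys) P"
proof (induction ys arbitrary: P rule: jword.induct)
  case (2 p s ys)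
  then show ?case using coarcw_through(1) matching_diag noloop_coarcw by (simp add: noloop_append)
qed simp

lemma noloop_stdword: "noloop (stdword x) straight"
  by (cases x) (simp add: noloop_append noloop_iword noloop_sword noloop_jword straight)

section \<open>Matrix coefficients, linear independence and the basis\<close>

context brauer_family
begin

lemma act_letter:
  assumes "\<And>i. x = LA i \<Longrightarrow> p (int i) \<noteq> int i + 1"
  shows "\<exists>c. c \<noteq> 0 \<and> (\<forall>\<phi>. act (lev x n) 0 \<phi> p = c * \<phi> (diag_letter x p))"
proof (cases x)
  case (LS i)
  then show ?thesis by (intro exI[of _ l]) (simp add: lev_def)
next
  case (LU i)
  then show ?thesis by (intro exI[of _ "e ^ i"]) (simp add: lev_def)
next
  case (LA i)
  then show ?thesis using assms by (intro exI[of _ "kap * (\<epsilon> * e) ^ i"]) (simp add: lev_def)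
qed

lemma act_word:
  "noloop w p \<Longrightarrow> \<exists>c. c \<noteq> 0 \<and> (\<forall>\<phi>. act (ev m w) 0 \<phi> p = c * \<phi> (diag w p))"
proof (induction w)
  case Nil
  show ?case by (intro exI[of _ 1]) simp
next
  case (Cons x w)
  then obtain c where c: "c \<noteq> 0" "\<And>\<phi>. act (ev m w) 0 \<phi> p = c * \<phi> (diag w p)" by auto
  obtain d where d: "d \<noteq> 0" "\<And>\<phi>. act (lev x (cd m w)) 0 \<phi> (diag w p) = d * \<phi> (diag_letter x (diag w p))"
    using act_letter[of x "diag w p" "cd m w"] Cons.prems by auto
  show ?case using c d by (intro exI[of _ "c * d"]) simp
qed

text \<open>The matrix coefficient from the straight diagram to \<open>D\<close>: the indicator
  function of \<open>D\<close> is pulled back and evaluated at \<open>straight\<close>. It is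
  defined on classes through a chosen representative; soundness of the action makes the choice
  harmless.\<close>

definition coord :: "(int \<Rightarrow> int) \<Rightarrow> 'k expr set \<Rightarrow> 'k" where
  "coord D X = act (SOME t. t \<in> X) 0 (\<lambda>p. if p = D then 1 else 0) straight"

lemma coord_cl: "well_typed t \<Longrightarrow> coord D (cl t) = act t 0 (\<lambda>p. if p = D then 1 else 0) straight"
proof -
  assume "well_typed t"
  then have "(SOME u. u \<in> cl t) \<in> cl t"
    by (intro someI[of "\<lambda>u. u \<in> cl t" t]) (simp add: mem_cl pres_eq.refl)
  then have "t \<simeq> (SOME u. u \<in> cl t)" by (simp add: mem_cl)
  from act_sound[OF this, of 0 "\<lambda>p. if p = D then 1 else 0"] show ?thesis
    using straight(1) by (simp add: coord_def agree_def)
qed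

lemma coord_add:
  assumes "X \<in> carrier (Hom PC m n)" "Y \<in> carrier (Hom PC m n)"
  shows "coord D (X \<oplus>\<^bsub>Hom PC m n\<^esub> Y) = coord D X + coord D Y"
proof -
  obtain t u where t: "X = cl t" "well_typed t" "edom t = m" "ecod t = n"
    and u: "Y = cl u" "well_typed u" "edom u = m" "ecod u = n"
    using assms by (auto elim!: carrier_PC_E)
  then show ?thesis by (simp add: add_PC coord_cl parallel_def)
qed

lemma coord_scale:
  assumes "X \<in> carrier (Hom PC m n)"
  shows "coord D (c \<odot>\<^bsub>Hom PC m n\<^esub> X) = c * coord D X"
  using assms by (auto elim!: carrier_PC_E simp: smult_PC coord_cl)

lemma eval_standard_PC:
  assumes "word_choice W" "x \<in> standard_expressions W m n"
  shows "eval_standard PC (cl EH) (cl EA) (cl EU) x = cl (ev m (stdword x))"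
    and "vld m (stdword x)" "cd m (stdword x) = n"
  using standard_expressions_evaluation[OF assms(1) generators_PC assms(2)] by (simp_all add: interp_PC)

text \<open>Each standard expression sends the straight diagram to a nonzero multiple of one
  diagram, and different expressions have different diagrams. The matrix of coefficients is
  therefore diagonal with nonzero diagonal, which gives injectivity and independence at
  once.\<close>

lemma coord_standard:
  assumes "word_choice W" "x \<in> standard_expressions W m n"
  shows "coord (diag (stdword x) straight) (eval_standard PC (cl EH) (cl EA) (cl EU) x) \<noteq> 0"
    and "\<lbrakk>y \<in> standard_expressions W m n; y \<noteq> x\<rbrakk> \<Longrightarrow>
      coord (diag (stdword x) straight) (eval_standard PC (cl EH) (cl EA) (cl EU) y) = 0"
proof -
  have *: "\<exists>c. c \<noteq> 0 \<and> coord D (eval_standard PC (cl EH) (cl EA) (cl EU) y) = (if diag (stdword y) straight = D then c else 0)"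
    if y: "y \<in> standard_expressions W m n" for y D
    using act_word[OF noloop_stdword, of m y] by (auto simp: eval_standard_PC[OF assms(1) y] coord_cl)
  show "coord (diag (stdword x) straight) (eval_standard PC (cl EH) (cl EA) (cl EU) x) \<noteq> 0"
    using *[OF assms(2), of "diag (stdword x) straight"] by auto
  show "coord (diag (stdword x) straight) (eval_standard PC (cl EH) (cl EA) (cl EU) y) = 0"
    if "y \<in> standard_expressions W m n" "y \<noteq> x"
    using *[OF that(1), of "diag (stdword x) straight"] standard_decode[OF assms(1) that(1) assms(2)] that(2) by auto
qed

lemma inj_standard:
  "word_choice W \<Longrightarrow> inj_on (eval_standard PC (cl EH) (cl EA) (cl EU)) (standard_expressions W m n)"
  using coord_standard by (intro inj_onI) metis

lemma standard_carrier:
  "word_choice W \<Longrightarrow> eval_standard PC (cl EH) (cl EA) (cl EU) ` standard_expressions W m n \<subseteq> carrier (Hom PC m n)"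
  using eval_standard_PC by (auto intro!: carrier_PC_I)

lemma indep_standard:
  assumes W: "word_choice W"
  shows "\<not> module.lin_dep (class_ring :: 'k ring) (Hom PC m n)
    (eval_standard PC (cl EH) (cl EA) (cl EU) ` standard_expressions W m n)"
proof
  interpret V: vectorspace "class_ring :: 'k ring" "Hom PC m n" by (rule vectorspace_PC)
  let ?E = "eval_standard PC (cl EH) (cl EA) (cl EU)" and ?S = "standard_expressions W m n"
  assume "V.lin_dep (?E ` ?S)"
  then obtain A a v where A: "finite A" "A \<subseteq> ?E ` ?S" "V.lincomb a A = \<zero>\<^bsub>Hom PC m n\<^esub>" "v \<in> A" "a v \<noteq> 0"
    unfolding V.lin_dep_def by (auto simp: class_ring_simps)
  obtain x where x: "x \<in> ?S" "v = ?E x" using A by auto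
  let ?c = "coord (diag (stdword x) straight)"
  have sub: "A \<subseteq> carrier (Hom PC m n)" using A(2) standard_carrier[OF W] by blast
  have zero: "?c \<zero>\<^bsub>Hom PC m n\<^esub> = 0" by (simp add: zero_PC coord_cl)
  have "V.lincomb a B \<in> carrier (Hom PC m n) \<and> ?c (V.lincomb a B) = (\<Sum>u\<in>B. a u * ?c u)" if "B \<subseteq> A" for B
    using finite_subset[OF that A(1)] that
  proof (induction B rule: finite_induct)
    case empty
    then show ?case using zero by (simp add: V.lincomb_def)
  next
    case (insert u B)
    have u: "u \<in> carrier (Hom PC m n)" "B \<subseteq> carrier (Hom PC m n)" using insert sub by auto
    then have "V.lincomb a (insert u B) = a u \<odot>\<^bsub>Hom PC m n\<^esub> u \<oplus>\<^bsub>Hom PC m n\<^esub> V.lincomb a B"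
      using insert by (intro V.lincomb_insert2) auto
    then show ?case using insert u by (simp add: coord_add coord_scale V.smult_closed)
  qed
  then have "(\<Sum>u\<in>A. a u * ?c u) = 0" using A(3) zero by (metis order_refl)
  moreover have "a u * ?c u = 0" if uA: "u \<in> A - {v}" for u
  proof -
    obtain y where "y \<in> ?S" "u = ?E y" using uA A(2) by blast
    then show ?thesis using coord_standard(2)[OF W x(1), of y] uA x(2) by auto
  qed
  ultimately have "a v * ?c v = 0"
    using sum.remove[OF A(1,4), of "\<lambda>u. a u * ?c u"] by simp
  then show False using A(5) coord_standard(1)[OF W x(1)] x(2) by simp
qed

lemma span_standard:
  assumes W: "word_choice W"
  shows "LinearCombinations.module.span (class_ring :: 'k ring) (Hom PC m n)
    (eval_standard PC (cl EH) (cl EA) (cl EU) ` standard_expressions W m n) = carrier (Hom PC m n)"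
proof -
  let ?B = "\<lambda>m n. eval_standard PC (cl EH) (cl EA) (cl EU) ` standard_expressions W m n"
  let ?S = "\<lambda>m n. LinearCombinations.module.span (class_ring :: 'k ring) (Hom PC m n) (?B m n)"
  have sub: "submodule (class_ring :: 'k ring) (?S m n) (Hom PC m n)" and own: "?B m n \<subseteq> ?S m n" for m n
  proof -
    interpret V: vectorspace "class_ring :: 'k ring" "Hom PC m n" by (rule vectorspace_PC)
    show "submodule (class_ring :: 'k ring) (?S m n) (Hom PC m n)"
      by (rule V.span_is_submodule[OF standard_carrier[OF W]])
    show "?B m n \<subseteq> ?S m n"
      by (rule V.in_own_span[OF standard_carrier[OF W]])
  qed
  note closed = submodule.m_closed[OF sub] submodule.smult_closed[OF sub] submodule.zero_closed[OF sub]
  have "cl t \<in> ?S m n" if "word_span m n t" for t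
    using that
  proof (induction rule: word_span.induct)
    case (ws_word m w t)
    then obtain x c where x: "x \<in> standard_expressions W m (cd m w)" "ev m w \<simeq> c \<^bold>* ev m (stdword x)"
      using word_standard[OF W] by metis
    have "cl t = c \<odot>\<^bsub>Hom PC m (cd m w)\<^esub> cl (ev m (stdword x))"
      using cl_cong[OF pres_eq.trans[OF ws_word(2) x(2)]] eval_standard_PC[OF W x(1)] by (simp add: smult_PC)
    moreover have "cl (ev m (stdword x)) \<in> ?S m (cd m w)"
      using subsetD[OF own[of m "cd m w"] imageI[OF x(1)]] unfolding eval_standard_PC(1)[OF W x(1)] .
    ultimately show ?case using closed(2) by simp
  next
    case (ws_zero t m n)
    then show ?case using closed(3) cl_cong by (simp only: zero_PC)
  next
    case (ws_sum m n t u v)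
    have "cl v = cl t \<oplus>\<^bsub>Hom PC m n\<^esub> cl u"
      using cl_cong[OF ws_sum.hyps(3)] word_span_typed[OF ws_sum.hyps(1)] word_span_typed[OF ws_sum.hyps(2)]
      by (simp add: add_PC parallel_def)
    then show ?case using ws_sum.IH closed(1) by simp
  next
    case (ws_scale m n t v c)
    have "cl v = c \<odot>\<^bsub>Hom PC m n\<^esub> cl t"
      using cl_cong[OF ws_scale.hyps(2)] word_span_typed[OF ws_scale.hyps(1)] by (simp add: smult_PC)
    then show ?case using ws_scale.IH closed(2) by simp
  qed
  then have "carrier (Hom PC m n) \<subseteq> ?S m n"
    using word_span_all by (auto elim!: carrier_PC_E)
  then show ?thesis using submodule.subset[OF sub] by blast
qed

lemma basis_standard:
  assumes W: "word_choice W"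
  shows "vectorspace.basis (class_ring :: 'k ring) (Hom PC m n)
    (eval_standard PC (cl EH) (cl EA) (cl EU) ` standard_expressions W m n)"
proof -
  interpret V: vectorspace "class_ring :: 'k ring" "Hom PC m n" by (rule vectorspace_PC)
  show ?thesis
    unfolding V.basis_def using indep_standard[OF W] span_standard[OF W] standard_carrier[OF W] by blast
qed

lemma satisfies_PC: "R \<subseteq> defining_relations params \<Longrightarrow> satisfies PC (cl EH) (cl EA) (cl EU) R"
  unfolding satisfies_def
proof clarify
  fix t u assume "R \<subseteq> defining_relations params" "(t, u) \<in> R"
  then have tu: "(t, u) \<in> defining_relations params" by blast
  note typed = defining_relations_typed[OF tu]
  have "cl t = cl u" using pres_eq.rel[OF tu] typed cl_cong by blast
  then show "interp PC (cl EH) (cl EA) (cl EU) t = interp PC (cl EH) (cl EA) (cl EU) u"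
    using typed by (simp add: interp_PC)
qed

text \<open>With \<open>b = c = 0\<close> the quadratic relation reads \<open>H H = l^2\<close>, so
  \<open>H\<close> divided by \<open>l^2\<close> is a two-sided inverse of \<open>H\<close>.\<close>

lemma EH_inverse: "inverse (l\<^sup>2) \<^bold>* (EH \<^bold>\<cdot> EH) \<simeq> EId 2"
proof -
  have "(EH \<^bold>\<cdot> EH, par_a params \<^bold>* EId 2 \<^bold>+ par_b params \<^bold>* EH \<^bold>+ par_c params \<^bold>* (EU \<^bold>\<cdot> EA)) \<in> defining_relations params"
    by (simp add: defining_relations_def parameter_relations_def)
  then have "EH \<^bold>\<cdot> EH \<simeq> l\<^sup>2 \<^bold>* EId 2 \<^bold>+ 0 \<^bold>* EH \<^bold>+ 0 \<^bold>* (EU \<^bold>\<cdot> EA)"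
    using pres_eq.rel by (fastforce simp: parallel_def)
  also have "\<dots> \<simeq> l\<^sup>2 \<^bold>* EId 2 \<^bold>+ 0 \<^bold>* EH \<^bold>+ EZero 2 2"
    using zero_scale[of "EU \<^bold>\<cdot> EA"] by (intro peq_sum_right) (auto simp: parallel_def)
  also have "\<dots> \<simeq> l\<^sup>2 \<^bold>* EId 2 \<^bold>+ 0 \<^bold>* EH"
    using pres_eq.sum_zero[of "l\<^sup>2 \<^bold>* EId 2 \<^bold>+ 0 \<^bold>* EH"] by (simp add: parallel_def)
  also have "\<dots> \<simeq> l\<^sup>2 \<^bold>* EId 2 \<^bold>+ EZero 2 2"
    using zero_scale[of EH] by (intro peq_sum_right) (auto simp: parallel_def)
  also have "\<dots> \<simeq> l\<^sup>2 \<^bold>* EId 2"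
    using pres_eq.sum_zero[of "l\<^sup>2 \<^bold>* EId 2"] by simp
  finally show ?thesis
    by (intro pres_eq.sym[OF scale_inverse]) auto
qed

theorem brauer_type_presented:
  assumes W: "word_choice W"
  shows "brauer_type W \<epsilon> PC (cl EH) (cl EA) (cl EU)" "has_parameters PC (cl EH) (cl EA) (cl EU) params"
proof -
  have inv: "cl (inverse (l\<^sup>2) \<^bold>* EH) \<cdot>\<^bsub>PC\<^esub> cl EH = idm PC 2" "cl EH \<cdot>\<^bsub>PC\<^esub> cl (inverse (l\<^sup>2) \<^bold>* EH) = idm PC 2"
    using cl_cong[OF pres_eq.trans[OF pres_eq.comp_scale_left EH_inverse]]
      cl_cong[OF pres_eq.trans[OF pres_eq.comp_scale_right EH_inverse]]
    by (simp_all add: cmp_PC id_PC)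
  show "brauer_type W \<epsilon> PC (cl EH) (cl EA) (cl EU)"
    unfolding brauer_type_def
  proof (intro conjI allI ballI)
    show "cl EH \<in> Hdeg PC 0 2 2" "cl EA \<in> Hdeg PC (parity \<epsilon>) 2 0" "cl EU \<in> Hdeg PC (parity \<epsilon>) 0 2"
      by (auto intro!: Hdeg_PC_I homogeneous.intros)
    show "generated PC (cl EH) (cl EA) (cl EU) m n f" if "f \<in> carrier (Hom PC m n)" for m n f
      using that generated_cl by (auto elim!: carrier_PC_E)
    show "\<exists>G\<in>carrier (Hom PC 2 2). G \<cdot>\<^bsub>PC\<^esub> cl EH = idm PC 2 \<and> cl EH \<cdot>\<^bsub>PC\<^esub> G = idm PC 2"
      using inv by (intro bexI[of _ "cl (inverse (l\<^sup>2) \<^bold>* EH)"]) (auto intro!: carrier_PC_I)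
    show "satisfies PC (cl EH) (cl EA) (cl EU) braid_relation"
      by (rule satisfies_PC) (simp add: defining_relations_def)
  qed (use supercategory_PC sign inj_standard[OF W] basis_standard[OF W] in simp_all)
  show "has_parameters PC (cl EH) (cl EA) (cl EU) params"
    unfolding has_parameters_def by (rule satisfies_PC) (simp add: defining_relations_def)
qed

end

theorem proposition7p1:
  fixes W :: "nat \<Rightarrow> nat list set" and \<epsilon> :: "'k::field"
  assumes char: "CHAR('k) \<noteq> 2"
    and sign: "\<epsilon> = 1 \<or> \<epsilon> = - 1"
    and words: "word_choice W"
  shows
    "(\<forall>(C :: ('k, 'f) supercat) H A U P.
        brauer_type W \<epsilon> C H A U \<and> has_parameters C H A U P \<and>
        par_f P = 0 \<and> par_f' P = 0 \<and> par_lam' P = par_lam P \<and> par_sig P \<noteq> 0 \<longrightarrow>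
        (par_e P)\<^sup>2 = \<epsilon> \<and>
        par_lam' P = par_lam P \<and>
        par_a P = (par_lam P)\<^sup>2 \<and> par_b P = 0 \<and> par_c P = 0 \<and>
        par_sig' P = \<epsilon> * par_sig P \<and>
        par_rho P = \<epsilon> * par_sig P * par_e P * par_lam P \<and>
        par_e' P = \<epsilon> * par_e P \<and>
        par_d P = 0 \<and> par_d' P = 0 \<and> par_f P = 0 \<and> par_f' P = 0 \<and>
        par_D P = 0 \<and> par_E P = 0 \<and> par_D' P = 0 \<and> par_E' P = 0 \<and>
        par_F P = \<epsilon> * par_e P * (par_lam P)\<^sup>2 \<and>
        par_F' P = par_e P * (par_lam P)\<^sup>2) \<and>
     (\<forall>(l::'k) (\<sigma>::'k) (\<delta>::'k) (e::'k).
        l \<noteq> 0 \<and> \<sigma> \<noteq> 0 \<and> e\<^sup>2 = \<epsilon> \<longrightarrow>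
        (let P = params_00 \<epsilon> l \<sigma> \<delta> e;
             R = defining_relations P;
             C = presented (parity \<epsilon>) R;
             H = pres_class (parity \<epsilon>) R EH;
             A = pres_class (parity \<epsilon>) R EA;
             U = pres_class (parity \<epsilon>) R EU
         in brauer_type W \<epsilon> C H A U \<and> has_parameters C H A U P))"
proof (intro conjI[OF allI[OF allI[OF allI[OF allI[OF allI]]]]] impI allI)
  fix C :: "('k, 'f) supercat" and H A U P
  assume "brauer_type W \<epsilon> C H A U \<and> has_parameters C H A U P \<and>
    par_f P = 0 \<and> par_f' P = 0 \<and> par_lam' P = par_lam P \<and> par_sig P \<noteq> 0"
  then have h: "brauer_type W \<epsilon> C H A U" "has_parameters C H A U P" "par_f P = 0" "par_f' P = 0"
    "par_lam' P = par_lam P" "par_sig P \<noteq> 0" by auto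
  note r = brauer_type_parameters[OF words h]
  show "(par_e P)\<^sup>2 = \<epsilon> \<and>
        par_lam' P = par_lam P \<and>
        par_a P = (par_lam P)\<^sup>2 \<and> par_b P = 0 \<and> par_c P = 0 \<and>
        par_sig' P = \<epsilon> * par_sig P \<and>
        par_rho P = \<epsilon> * par_sig P * par_e P * par_lam P \<and>
        par_e' P = \<epsilon> * par_e P \<and>
        par_d P = 0 \<and> par_d' P = 0 \<and> par_f P = 0 \<and> par_f' P = 0 \<and>
        par_D P = 0 \<and> par_E P = 0 \<and> par_D' P = 0 \<and> par_E' P = 0 \<and>
        par_F P = \<epsilon> * par_e P * (par_lam P)\<^sup>2 \<and>
        par_F' P = par_e P * (par_lam P)\<^sup>2"
    by (intro conjI r h(3-5))
next
  fix l \<sigma> \<delta> e :: 'k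
  assume "l \<noteq> 0 \<and> \<sigma> \<noteq> 0 \<and> e\<^sup>2 = \<epsilon>"
  then interpret brauer_family \<epsilon> l \<sigma> \<delta> e using sign by unfold_locales auto
  show "let P = params_00 \<epsilon> l \<sigma> \<delta> e;
             R = defining_relations P;
             C = presented (parity \<epsilon>) R;
             H = pres_class (parity \<epsilon>) R EH;
             A = pres_class (parity \<epsilon>) R EA;
             U = pres_class (parity \<epsilon>) R EU
         in brauer_type W \<epsilon> C H A U \<and> has_parameters C H A U P"
    unfolding Let_def using brauer_type_presented[OF words] by blast
qed

end
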